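(* Let $T$ be a complete, model complete, o-minimal $\mathcal L$-theory extending the theory of real closed ordered fields, and suppose $T$ is power bounded. Let $K=(K,\mathcal O,\partial)$ be a $T$-convex $T$-differential field with nontrivial derivation and nontrivial valuation, and suppose $S(\partial)=\{0\}$. Then $K$ has a spherically complete immediate strict $T^{\mathcal O,\partial}$-extension.
   Context: $\mathcal L\supseteq\{0,1,+,-,\cdot,<\}$. For $K\models T$, a $T$-convex valuation ring of $K$ is a nonempty convex subset $\mathcal O\subseteq K$ with $F(\mathcal O)\subseteq\mathcal O$ for every $\mathcal L(\emptyset)$-definable continuous $F\colon K\to K$; it is a valuation ring with maximal ideal $\mathfrak o$, valuation $v\colon K^\times\to\Gamma$, residue field $\mathrm{res}(K)$. A $T$-derivation on $K$ is a map $\partial\colon K\to K$ such that for every $\mathcal L(\emptyset)$-definable $\mathcal C^1$ function $F\colon U\to K$, $U\subseteq K^n$ open, and every $u\in U$, $\partial(F(u))=\mathbf J_F(u)\,\partial u$. A $T$-convex $T$-differential field is $(K,\mathcal O,\partial)$ with $\mathcal O$ $T$-convex and $\partial$ a $T$-derivation continuous for the valuation topology; $T^{\mathcal O,\partial}$ is their theory. A $T^{\mathcal O,\partial}$-extension $M$ of $K$ is a model of $T^{\mathcal O,\partial}$ containing $K$ as a substructure; immediate: $\Gamma_M=\Gamma$, $\mathrm{res}(M)=\mathrm{res}(K)$; strict: for all $\phi\in K^\times$, $\partial\mathfrak o\subseteq\phi\mathfrak o\Rightarrow\partial_M\mathfrak o_M\subseteq\phi\mathfrak o_M$ and $\partial\mathcal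 O\subseteq\phi\mathfrak o\Rightarrow\partial_M\mathcal O_M\subseteq\phi\mathfrak o_M$. Spherically complete: every family of closed $v$-balls $\{y:v(y-a)\ge\gamma\}$ with pairwise nonempty intersections has nonempty intersection. $\Gamma(\partial):=\{v\phi:\phi\in K^\times,\ \partial\mathfrak o\subseteq\phi\mathfrak o\}$, $S(\partial):=\{\gamma\in\Gamma:\Gamma(\partial)+\gamma=\Gamma(\partial)\}$. $T$ is power bounded if for every model $K$, every $\mathcal L(K)$-definable $F\colon K\to K$ satisfies $|F(x)|<x^\lambda$ for all large $x$ for some $\mathcal L(K)$-definable endomorphism $x\mapsto x^\lambda$ of $(K^{>0},\cdot)$. *)

theory Defs
  imports Main
begin

record ('f,'r) lang =
  fun_ar :: "'f \<Rightarrow> nat"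
  rel_ar :: "'r \<Rightarrow> nat"
  sym_zero :: 'f
  sym_one :: 'f
  sym_add :: 'f
  sym_neg :: 'f
  sym_mul :: 'f
  sym_less :: 'r

definition lang_ok :: "('f,'r) lang \<Rightarrow> bool" where
  "lang_ok L \<longleftrightarrow> fun_ar L (sym_zero L) = 0 \<and> fun_ar L (sym_one L) = 0 \<and>
     fun_ar L (sym_add L) = 2 \<and> fun_ar L (sym_neg L) = 1 \<and> fun_ar L (sym_mul L) = 2 \<and>
     rel_ar L (sym_less L) = 2 \<and>
     distinct [sym_zero L, sym_one L, sym_add L, sym_neg L, sym_mul L]"

record ('a,'f,'r) struc =
  univ :: "'a set"
  fint :: "'f \<Rightarrow> 'a list \<Rightarrow> 'a"
  rint :: "'r \<Rightarrow> 'a list \<Rightarrow> bool"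

datatype 'f trm = Var nat | Fn 'f "'f trm list"

datatype ('f,'r) fm = Eq "'f trm" "'f trm" | Rl 'r "'f trm list" | Neg "('f,'r) fm"
  | Conj "('f,'r) fm" "('f,'r) fm" | Ex nat "('f,'r) fm"

fun wf_trm :: "('f,'r) lang \<Rightarrow> 'f trm \<Rightarrow> bool" where
  "wf_trm L (Var n) = True"
| "wf_trm L (Fn f ts) = (length ts = fun_ar L f \<and> list_all (wf_trm L) ts)"

fun fv_trm :: "'f trm \<Rightarrow> nat set" where
  "fv_trm (Var n) = {n}"
| "fv_trm (Fn f ts) = \<Union> (set (map fv_trm ts))"

fun eval_trm :: "('a,'f,'r) struc \<Rightarrow> (nat \<Rightarrow> 'a) \<Rightarrow> 'f trm \<Rightarrow> 'a" where
  "eval_trm M \<beta> (Var n) = \<beta> n"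
| "eval_trm M \<beta> (Fn f ts) = fint M f (map (eval_trm M \<beta>) ts)"

fun wf_fm :: "('f,'r) lang \<Rightarrow> ('f,'r) fm \<Rightarrow> bool" where
  "wf_fm L (Eq s t) = (wf_trm L s \<and> wf_trm L t)"
| "wf_fm L (Rl r ts) = (length ts = rel_ar L r \<and> list_all (wf_trm L) ts)"
| "wf_fm L (Neg \<phi>) = wf_fm L \<phi>"
| "wf_fm L (Conj \<phi> \<psi>) = (wf_fm L \<phi> \<and> wf_fm L \<psi>)"
| "wf_fm L (Ex x \<phi>) = wf_fm L \<phi>"

fun fv :: "('f,'r) fm \<Rightarrow> nat set" where
  "fv (Eq s t) = fv_trm s \<union> fv_trm t"
| "fv (Rl r ts) = \<Union> (set (map fv_trm ts))"
| "fv (Neg \<phi>) = fv \<phi>"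
| "fv (Conj \<phi> \<psi>) = fv \<phi> \<union> fv \<psi>"
| "fv (Ex x \<phi>) = fv \<phi> - {x}"

fun sat :: "('a,'f,'r) struc \<Rightarrow> (nat \<Rightarrow> 'a) \<Rightarrow> ('f,'r) fm \<Rightarrow> bool" where
  "sat M \<beta> (Eq s t) = (eval_trm M \<beta> s = eval_trm M \<beta> t)"
| "sat M \<beta> (Rl r ts) = rint M r (map (eval_trm M \<beta>) ts)"
| "sat M \<beta> (Neg \<phi>) = (\<not> sat M \<beta> \<phi>)"
| "sat M \<beta> (Conj \<phi> \<psi>) = (sat M \<beta> \<phi> \<and> sat M \<beta> \<psi>)"
| "sat M \<beta> (Ex x \<phi>) = (\<exists>a\<in>univ M. sat M (\<beta>(x := a)) \<phi>)"

definition sentence :: "('f,'r) lang \<Rightarrow> ('f,'r) fm \<Rightarrow> bool" where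
  "sentence L \<phi> \<longleftrightarrow> wf_fm L \<phi> \<and> fv \<phi> = {}"

definition struc_ok :: "('f,'r) lang \<Rightarrow> ('a,'f,'r) struc \<Rightarrow> bool" where
  "struc_ok L M \<longleftrightarrow> univ M \<noteq> {} \<and>
     (\<forall>f xs. length xs = fun_ar L f \<and> set xs \<subseteq> univ M \<longrightarrow> fint M f xs \<in> univ M)"

definition satall :: "('a,'f,'r) struc \<Rightarrow> ('f,'r) fm \<Rightarrow> bool" where
  "satall M \<phi> \<longleftrightarrow> (\<forall>\<beta>. (\<forall>i. \<beta> i \<in> univ M) \<longrightarrow> sat M \<beta> \<phi>)"

definition is_model :: "('f,'r) lang \<Rightarrow> ('f,'r) fm set \<Rightarrow> ('a,'f,'r) struc \<Rightarrow> bool" where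
  "is_model L T M \<longleftrightarrow> struc_ok L M \<and> (\<forall>\<phi>\<in>T. satall M \<phi>)"

definition emb :: "('f,'r) lang \<Rightarrow> ('a,'f,'r) struc \<Rightarrow> ('b,'f,'r) struc \<Rightarrow> ('a \<Rightarrow> 'b) \<Rightarrow> bool" where
  "emb L K M e \<longleftrightarrow> inj_on e (univ K) \<and> e ` univ K \<subseteq> univ M \<and>
     (\<forall>f xs. length xs = fun_ar L f \<and> set xs \<subseteq> univ K \<longrightarrow> e (fint K f xs) = fint M f (map e xs)) \<and>
     (\<forall>r xs. length xs = rel_ar L r \<and> set xs \<subseteq> univ K \<longrightarrow> (rint M r (map e xs) \<longleftrightarrow> rint K r xs))"

definition elementary :: "('f,'r) lang \<Rightarrow> ('a,'f,'r) struc \<Rightarrow> ('b,'f,'r) struc \<Rightarrow> ('a \<Rightarrow> 'b) \<Rightarrow> bool" where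
  "elementary L K M e \<longleftrightarrow> (\<forall>\<phi> \<beta>. wf_fm L \<phi> \<and> (\<forall>i. \<beta> i \<in> univ K) \<longrightarrow>
       (sat K \<beta> \<phi> \<longleftrightarrow> sat M (e \<circ> \<beta>) \<phi>))"

definition zr :: "('f,'r) lang \<Rightarrow> ('a,'f,'r) struc \<Rightarrow> 'a" where "zr L M = fint M (sym_zero L) []"
definition on :: "('f,'r) lang \<Rightarrow> ('a,'f,'r) struc \<Rightarrow> 'a" where "on L M = fint M (sym_one L) []"
definition ad :: "('f,'r) lang \<Rightarrow> ('a,'f,'r) struc \<Rightarrow> 'a \<Rightarrow> 'a \<Rightarrow> 'a" where
  "ad L M x y = fint M (sym_add L) [x, y]"
definition ng :: "('f,'r) lang \<Rightarrow> ('a,'f,'r) struc \<Rightarrow> 'a \<Rightarrow> 'a" where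
  "ng L M x = fint M (sym_neg L) [x]"
definition ml :: "('f,'r) lang \<Rightarrow> ('a,'f,'r) struc \<Rightarrow> 'a \<Rightarrow> 'a \<Rightarrow> 'a" where
  "ml L M x y = fint M (sym_mul L) [x, y]"
definition ls :: "('f,'r) lang \<Rightarrow> ('a,'f,'r) struc \<Rightarrow> 'a \<Rightarrow> 'a \<Rightarrow> bool" where
  "ls L M x y = rint M (sym_less L) [x, y]"
definition le :: "('f,'r) lang \<Rightarrow> ('a,'f,'r) struc \<Rightarrow> 'a \<Rightarrow> 'a \<Rightarrow> bool" where
  "le L M x y \<longleftrightarrow> ls L M x y \<or> x = y"
definition sb :: "('f,'r) lang \<Rightarrow> ('a,'f,'r) struc \<Rightarrow> 'a \<Rightarrow> 'a \<Rightarrow> 'a" where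
  "sb L M x y = ad L M x (ng L M y)"
definition ab :: "('f,'r) lang \<Rightarrow> ('a,'f,'r) struc \<Rightarrow> 'a \<Rightarrow> 'a" where
  "ab L M x = (if ls L M x (zr L M) then ng L M x else x)"
definition iv :: "('f,'r) lang \<Rightarrow> ('a,'f,'r) struc \<Rightarrow> 'a \<Rightarrow> 'a" where
  "iv L M x = (THE y. y \<in> univ M \<and> ml L M x y = on L M)"
definition dv :: "('f,'r) lang \<Rightarrow> ('a,'f,'r) struc \<Rightarrow> 'a \<Rightarrow> 'a \<Rightarrow> 'a" where
  "dv L M x y = ml L M x (iv L M y)"

definition lsum :: "('f,'r) lang \<Rightarrow> ('a,'f,'r) struc \<Rightarrow> 'a list \<Rightarrow> 'a" where
  "lsum L M xs = foldr (ad L M) xs (zr L M)"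

fun peval :: "('f,'r) lang \<Rightarrow> ('a,'f,'r) struc \<Rightarrow> 'a list \<Rightarrow> 'a \<Rightarrow> 'a" where
  "peval L M [] x = zr L M"
| "peval L M (c # cs) x = ad L M c (ml L M x (peval L M cs x))"

definition is_rcf :: "('f,'r) lang \<Rightarrow> ('a,'f,'r) struc \<Rightarrow> bool" where
  "is_rcf L M \<longleftrightarrow> (let U = univ M; z = zr L M; u1 = on L M; a = ad L M; n = ng L M;
        m = ml L M; l = ls L M in
     z \<in> U \<and> u1 \<in> U \<and> z \<noteq> u1 \<and>
     (\<forall>x\<in>U. \<forall>y\<in>U. a x y \<in> U \<and> m x y \<in> U) \<and> (\<forall>x\<in>U. n x \<in> U) \<and>
     (\<forall>x\<in>U. \<forall>y\<in>U. \<forall>w\<in>U. a (a x y) w = a x (a y w) \<and> m (m x y) w = m x (m y w) \<and>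
         m x (a y w) = a (m x y) (m x w)) \<and>
     (\<forall>x\<in>U. \<forall>y\<in>U. a x y = a y x \<and> m x y = m y x) \<and>
     (\<forall>x\<in>U. a x z = x \<and> m x u1 = x \<and> a x (n x) = z) \<and>
     (\<forall>x\<in>U. x \<noteq> z \<longrightarrow> (\<exists>y\<in>U. m x y = u1)) \<and>
     (\<forall>x\<in>U. \<not> l x x) \<and>
     (\<forall>x\<in>U. \<forall>y\<in>U. \<forall>w\<in>U. l x y \<and> l y w \<longrightarrow> l x w) \<and>
     (\<forall>x\<in>U. \<forall>y\<in>U. l x y \<or> x = y \<or> l y x) \<and>
     (\<forall>x\<in>U. \<forall>y\<in>U. \<forall>w\<in>U. l x y \<longrightarrow> l (a x w) (a y w)) \<and>
     (\<forall>x\<in>U. \<forall>y\<in>U. l z x \<and> l z y \<longrightarrow> l z (m x y)) \<and>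
     (\<forall>x\<in>U. l z x \<longrightarrow> (\<exists>y\<in>U. m y y = x)) \<and>
     (\<forall>cs. set cs \<subseteq> U \<and> odd (length cs) \<longrightarrow> (\<exists>x\<in>U. peval L M (cs @ [u1]) x = z)))"

definition asg :: "'a list \<Rightarrow> (nat \<Rightarrow> 'a) \<Rightarrow> nat \<Rightarrow> 'a" where
  "asg xs \<beta> i = (if i < length xs then xs ! i else \<beta> i)"

definition tuples :: "('a,'f,'r) struc \<Rightarrow> nat \<Rightarrow> 'a list set" where
  "tuples M n = {xs. length xs = n \<and> set xs \<subseteq> univ M}"

text \<open>S \<subseteq> M^n is L(A)-definable: defined by a formula whose free variables 0..n-1
  are the coordinates and whose other free variables are assigned parameters from A.\<close>

definition def_set :: "('f,'r) lang \<Rightarrow> ('a,'f,'r) struc \<Rightarrow> 'a set \<Rightarrow> nat \<Rightarrow> 'a list set \<Rightarrow> bool" where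
  "def_set L M A n S \<longleftrightarrow> (\<exists>\<phi> \<beta>. wf_fm L \<phi> \<and> (\<forall>i\<in>fv \<phi>. n \<le> i \<longrightarrow> \<beta> i \<in> A) \<and>
      S = {xs \<in> tuples M n. sat M (asg xs \<beta>) \<phi>})"

definition def_fun :: "('f,'r) lang \<Rightarrow> ('a,'f,'r) struc \<Rightarrow> 'a set \<Rightarrow> nat \<Rightarrow> 'a list set
    \<Rightarrow> ('a list \<Rightarrow> 'a) \<Rightarrow> bool" where
  "def_fun L M A n U F \<longleftrightarrow> U \<subseteq> tuples M n \<and> (\<forall>xs\<in>U. F xs \<in> univ M) \<and>
      def_set L M A (Suc n) {xs @ [F xs] | xs. xs \<in> U}"

definition def_fun1 :: "('f,'r) lang \<Rightarrow> ('a,'f,'r) struc \<Rightarrow> 'a set \<Rightarrow> ('a \<Rightarrow> 'a) \<Rightarrow> bool" where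
  "def_fun1 L M A F \<longleftrightarrow> (\<forall>x\<in>univ M. F x \<in> univ M) \<and> def_set L M A 2 {[x, F x] | x. x \<in> univ M}"

definition pos :: "('f,'r) lang \<Rightarrow> ('a,'f,'r) struc \<Rightarrow> 'a \<Rightarrow> bool" where
  "pos L M x \<longleftrightarrow> x \<in> univ M \<and> ls L M (zr L M) x"

definition cont_at :: "('f,'r) lang \<Rightarrow> ('a,'f,'r) struc \<Rightarrow> ('a \<Rightarrow> 'a) \<Rightarrow> 'a \<Rightarrow> bool" where
  "cont_at L M F x \<longleftrightarrow> (\<forall>\<epsilon>. pos L M \<epsilon> \<longrightarrow> (\<exists>\<delta>. pos L M \<delta> \<and> (\<forall>y\<in>univ M.
      ls L M (ab L M (sb L M y x)) \<delta> \<longrightarrow> ls L M (ab L M (sb L M (F y) (F x))) \<epsilon>)))"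

definition near :: "('f,'r) lang \<Rightarrow> ('a,'f,'r) struc \<Rightarrow> 'a \<Rightarrow> 'a list \<Rightarrow> 'a list \<Rightarrow> bool" where
  "near L M \<delta> y u \<longleftrightarrow> (\<forall>i<length u. ls L M (ab L M (sb L M (y ! i) (u ! i))) \<delta>)"

definition open_tup :: "('f,'r) lang \<Rightarrow> ('a,'f,'r) struc \<Rightarrow> nat \<Rightarrow> 'a list set \<Rightarrow> bool" where
  "open_tup L M n U \<longleftrightarrow> U \<subseteq> tuples M n \<and>
     (\<forall>u\<in>U. \<exists>\<delta>. pos L M \<delta> \<and> (\<forall>y\<in>tuples M n. near L M \<delta> y u \<longrightarrow> y \<in> U))"

text \<open>(Frechet) derivative of F at u with gradient D, w.r.t. the l1-norm
  (equivalent to any other norm on M^n).\<close>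

definition has_grad :: "('f,'r) lang \<Rightarrow> ('a,'f,'r) struc \<Rightarrow> 'a list set \<Rightarrow> ('a list \<Rightarrow> 'a)
    \<Rightarrow> 'a list \<Rightarrow> 'a list \<Rightarrow> bool" where
  "has_grad L M U F D u \<longleftrightarrow> length D = length u \<and> set D \<subseteq> univ M \<and>
     (\<forall>\<epsilon>. pos L M \<epsilon> \<longrightarrow> (\<exists>\<delta>. pos L M \<delta> \<and> (\<forall>y\<in>U. near L M \<delta> y u \<longrightarrow>
        le L M (ab L M (sb L M (sb L M (F y) (F u))
                   (lsum L M (map (\<lambda>i. ml L M (D ! i) (sb L M (y ! i) (u ! i))) [0..<length u]))))
             (ml L M \<epsilon> (lsum L M (map (\<lambda>i. ab L M (sb L M (y ! i) (u ! i))) [0..<length u]))))))"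

definition C1_with :: "('f,'r) lang \<Rightarrow> ('a,'f,'r) struc \<Rightarrow> nat \<Rightarrow> 'a list set \<Rightarrow> ('a list \<Rightarrow> 'a)
    \<Rightarrow> ('a list \<Rightarrow> 'a list) \<Rightarrow> bool" where
  "C1_with L M n U F DF \<longleftrightarrow> (\<forall>u\<in>U. has_grad L M U F (DF u) u) \<and>
     (\<forall>u\<in>U. \<forall>i<n. \<forall>\<epsilon>. pos L M \<epsilon> \<longrightarrow> (\<exists>\<delta>. pos L M \<delta> \<and> (\<forall>y\<in>U. near L M \<delta> y u \<longrightarrow>
         ls L M (ab L M (sb L M (DF y ! i) (DF u ! i))) \<epsilon>)))"

definition tconvex :: "('f,'r) lang \<Rightarrow> ('a,'f,'r) struc \<Rightarrow> 'a set \<Rightarrow> bool" where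
  "tconvex L M Ov \<longleftrightarrow> Ov \<subseteq> univ M \<and> Ov \<noteq> {} \<and>
     (\<forall>x\<in>Ov. \<forall>z\<in>Ov. \<forall>y\<in>univ M. le L M x y \<and> le L M y z \<longrightarrow> y \<in> Ov) \<and>
     (\<forall>F. def_fun1 L M {} F \<and> (\<forall>x\<in>univ M. cont_at L M F x) \<longrightarrow> F ` Ov \<subseteq> Ov)"

definition mideal :: "('f,'r) lang \<Rightarrow> ('a,'f,'r) struc \<Rightarrow> 'a set \<Rightarrow> 'a set" where
  "mideal L M Ov = {x\<in>Ov. x = zr L M \<or> iv L M x \<notin> Ov}"

definition nonzero :: "('f,'r) lang \<Rightarrow> ('a,'f,'r) struc \<Rightarrow> 'a set" where
  "nonzero L M = univ M - {zr L M}"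

definition units :: "('f,'r) lang \<Rightarrow> ('a,'f,'r) struc \<Rightarrow> 'a set \<Rightarrow> 'a set" where
  "units L M Ov = Ov - mideal L M Ov"

definition scl :: "('f,'r) lang \<Rightarrow> ('a,'f,'r) struc \<Rightarrow> 'a \<Rightarrow> 'a set \<Rightarrow> 'a set" where
  "scl L M \<phi> S = ml L M \<phi> ` S"

text \<open>The valuation v : M^x \<rightarrow> \<Gamma> = M^x / Ov^x, values being the cosets.\<close>
definition val :: "('f,'r) lang \<Rightarrow> ('a,'f,'r) struc \<Rightarrow> 'a set \<Rightarrow> 'a \<Rightarrow> 'a set" where
  "val L M Ov x = {y\<in>nonzero L M. dv L M x y \<in> units L M Ov}"

definition vgroup :: "('f,'r) lang \<Rightarrow> ('a,'f,'r) struc \<Rightarrow> 'a set \<Rightarrow> 'a set set" where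
  "vgroup L M Ov = val L M Ov ` nonzero L M"

definition vadd :: "('f,'r) lang \<Rightarrow> ('a,'f,'r) struc \<Rightarrow> 'a set \<Rightarrow> 'a set \<Rightarrow> 'a set \<Rightarrow> 'a set" where
  "vadd L M Ov g h = val L M Ov (ml L M (SOME x. x \<in> g) (SOME y. y \<in> h))"

definition Gamma_der :: "('f,'r) lang \<Rightarrow> ('a,'f,'r) struc \<Rightarrow> 'a set \<Rightarrow> ('a \<Rightarrow> 'a) \<Rightarrow> 'a set set" where
  "Gamma_der L M Ov d = {val L M Ov \<phi> | \<phi>. \<phi> \<in> nonzero L M \<and>
       d ` mideal L M Ov \<subseteq> scl L M \<phi> (mideal L M Ov)}"

definition S_der :: "('f,'r) lang \<Rightarrow> ('a,'f,'r) struc \<Rightarrow> 'a set \<Rightarrow> ('a \<Rightarrow> 'a) \<Rightarrow> 'a set set" where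
  "S_der L M Ov d = {\<gamma>\<in>vgroup L M Ov. (\<lambda>\<delta>. vadd L M Ov \<delta> \<gamma>) ` Gamma_der L M Ov d = Gamma_der L M Ov d}"

definition tderiv :: "('f,'r) lang \<Rightarrow> ('a,'f,'r) struc \<Rightarrow> ('a \<Rightarrow> 'a) \<Rightarrow> bool" where
  "tderiv L M d \<longleftrightarrow> d ` univ M \<subseteq> univ M \<and>
     (\<forall>n U F DF. open_tup L M n U \<and> def_fun L M {} n U F \<and> C1_with L M n U F DF \<longrightarrow>
        (\<forall>u\<in>U. d (F u) = lsum L M (map (\<lambda>i. ml L M (DF u ! i) (d (u ! i))) [0..<n])))"

text \<open>continuity in the valuation topology: v(y-a) > v(c) iff (y-a)/c \<in> maximal ideal\<close>
definition vcont :: "('f,'r) lang \<Rightarrow> ('a,'f,'r) struc \<Rightarrow> 'a set \<Rightarrow> ('a \<Rightarrow> 'a) \<Rightarrow> bool" where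
  "vcont L M Ov d \<longleftrightarrow> (\<forall>a\<in>univ M. \<forall>e\<in>nonzero L M. \<exists>c\<in>nonzero L M. \<forall>y\<in>univ M.
      dv L M (sb L M y a) c \<in> mideal L M Ov \<longrightarrow> dv L M (sb L M (d y) (d a)) e \<in> mideal L M Ov)"

definition tdiff :: "('f,'r) lang \<Rightarrow> ('f,'r) fm set \<Rightarrow> ('a,'f,'r) struc \<Rightarrow> 'a set \<Rightarrow> ('a \<Rightarrow> 'a) \<Rightarrow> bool" where
  "tdiff L T M Ov d \<longleftrightarrow> is_model L T M \<and> tconvex L M Ov \<and> tderiv L M d \<and> vcont L M Ov d"

definition complete_th :: "'u itself \<Rightarrow> ('f,'r) lang \<Rightarrow> ('f,'r) fm set \<Rightarrow> bool" where
  "complete_th (_::'u itself) L T \<longleftrightarrow> (\<forall>\<phi>. sentence L \<phi> \<longrightarrow>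
     (\<forall>M::('u,'f,'r) struc. is_model L T M \<longrightarrow> satall M \<phi>) \<or>
     (\<forall>M::('u,'f,'r) struc. is_model L T M \<longrightarrow> satall M (Neg \<phi>)))"

definition model_complete :: "'u itself \<Rightarrow> ('f,'r) lang \<Rightarrow> ('f,'r) fm set \<Rightarrow> bool" where
  "model_complete (_::'u itself) L T \<longleftrightarrow> (\<forall>(M::('u,'f,'r) struc) (N::('u,'f,'r) struc) e.
     is_model L T M \<and> is_model L T N \<and> emb L M N e \<longrightarrow> elementary L M N e)"

definition oint :: "('f,'r) lang \<Rightarrow> ('a,'f,'r) struc \<Rightarrow> 'a option \<Rightarrow> 'a option \<Rightarrow> 'a set" where
  "oint L M a b = {x\<in>univ M. (case a of None \<Rightarrow> True | Some a' \<Rightarrow> ls L M a' x) \<and>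
                              (case b of None \<Rightarrow> True | Some b' \<Rightarrow> ls L M x b')}"

definition ominimal_struc :: "('f,'r) lang \<Rightarrow> ('a,'f,'r) struc \<Rightarrow> bool" where
  "ominimal_struc L M \<longleftrightarrow> (\<forall>S. def_set L M (univ M) 1 S \<longrightarrow>
     (\<exists>P I. finite P \<and> P \<subseteq> univ M \<and> finite I \<and>
        (\<forall>(a, b)\<in>I. set_option a \<subseteq> univ M \<and> set_option b \<subseteq> univ M) \<and>
        {x. [x] \<in> S} = P \<union> (\<Union>(a, b)\<in>I. oint L M a b)))"

definition ominimal_th :: "'u itself \<Rightarrow> ('f,'r) lang \<Rightarrow> ('f,'r) fm set \<Rightarrow> bool" where
  "ominimal_th (_::'u itself) L T \<longleftrightarrow>
     (\<forall>M::('u,'f,'r) struc. is_model L T M \<longrightarrow> ominimal_struc L M)"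

definition extends_rcf :: "'u itself \<Rightarrow> ('f,'r) lang \<Rightarrow> ('f,'r) fm set \<Rightarrow> bool" where
  "extends_rcf (_::'u itself) L T \<longleftrightarrow> (\<forall>M::('u,'f,'r) struc. is_model L T M \<longrightarrow> is_rcf L M)"

definition power_bounded :: "'u itself \<Rightarrow> ('f,'r) lang \<Rightarrow> ('f,'r) fm set \<Rightarrow> bool" where
  "power_bounded (_::'u itself) L T \<longleftrightarrow> (\<forall>M::('u,'f,'r) struc. is_model L T M \<longrightarrow>
     (\<forall>F. def_fun1 L M (univ M) F \<longrightarrow>
        (\<exists>f. def_set L M (univ M) 2 {[x, f x] | x. pos L M x} \<and>
             (\<forall>x. pos L M x \<longrightarrow> pos L M (f x)) \<and>
             (\<forall>x y. pos L M x \<and> pos L M y \<longrightarrow> f (ml L M x y) = ml L M (f x) (f y)) \<and>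
             (\<exists>c\<in>univ M. \<forall>x\<in>univ M. ls L M c x \<longrightarrow> ls L M (ab L M (F x)) (f x)))))"

definition ext_via :: "('f,'r) lang \<Rightarrow> ('a,'f,'r) struc \<Rightarrow> 'a set \<Rightarrow> ('a \<Rightarrow> 'a)
    \<Rightarrow> ('b,'f,'r) struc \<Rightarrow> 'b set \<Rightarrow> ('b \<Rightarrow> 'b) \<Rightarrow> ('a \<Rightarrow> 'b) \<Rightarrow> bool" where
  "ext_via L K Ov d M OvM dM e \<longleftrightarrow> emb L K M e \<and>
     (\<forall>x\<in>univ K. x \<in> Ov \<longleftrightarrow> e x \<in> OvM) \<and> (\<forall>x\<in>univ K. dM (e x) = e (d x))"

text \<open>Immediate: the induced maps on value groups and residue fields are onto.\<close>
definition immediate :: "('f,'r) lang \<Rightarrow> ('a,'f,'r) struc \<Rightarrow> 'a set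
    \<Rightarrow> ('b,'f,'r) struc \<Rightarrow> 'b set \<Rightarrow> ('a \<Rightarrow> 'b) \<Rightarrow> bool" where
  "immediate L K Ov M OvM e \<longleftrightarrow>
     (\<forall>y\<in>nonzero L M. \<exists>x\<in>nonzero L K. val L M OvM (e x) = val L M OvM y) \<and>
     (\<forall>y\<in>OvM. \<exists>x\<in>Ov. sb L M y (e x) \<in> mideal L M OvM)"

definition strict :: "('f,'r) lang \<Rightarrow> ('a,'f,'r) struc \<Rightarrow> 'a set \<Rightarrow> ('a \<Rightarrow> 'a)
    \<Rightarrow> ('b,'f,'r) struc \<Rightarrow> 'b set \<Rightarrow> ('b \<Rightarrow> 'b) \<Rightarrow> ('a \<Rightarrow> 'b) \<Rightarrow> bool" where
  "strict L K Ov d M OvM dM e \<longleftrightarrow> (\<forall>\<phi>\<in>nonzero L K.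
     (d ` mideal L K Ov \<subseteq> scl L K \<phi> (mideal L K Ov) \<longrightarrow>
        dM ` mideal L M OvM \<subseteq> scl L M (e \<phi>) (mideal L M OvM)) \<and>
     (d ` Ov \<subseteq> scl L K \<phi> (mideal L K Ov) \<longrightarrow>
        dM ` OvM \<subseteq> scl L M (e \<phi>) (mideal L M OvM)))"

text \<open>closed ball {y. v(y - a) \<ge> v(g)}, g \<noteq> 0\<close>
definition cball_v :: "('f,'r) lang \<Rightarrow> ('a,'f,'r) struc \<Rightarrow> 'a set \<Rightarrow> 'a \<Rightarrow> 'a \<Rightarrow> 'a set" where
  "cball_v L M Ov a g = {y\<in>univ M. dv L M (sb L M y a) g \<in> Ov}"

definition sph_complete :: "('f,'r) lang \<Rightarrow> ('a,'f,'r) struc \<Rightarrow> 'a set \<Rightarrow> bool" where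
  "sph_complete L M Ov \<longleftrightarrow> (\<forall>B. B \<subseteq> univ M \<times> nonzero L M \<longrightarrow>
     (\<forall>(a, g)\<in>B. \<forall>(b, h)\<in>B. cball_v L M Ov a g \<inter> cball_v L M Ov b h \<noteq> {}) \<longrightarrow>
     (\<exists>y\<in>univ M. \<forall>(a, g)\<in>B. y \<in> cball_v L M Ov a g))"

end

theory Submission
 imports Defs "HOL.Rat"
begin

text \<open>An immediate extension of K embeds into the functions from K to K, so Zorn's lemma in an ambient type of
sufficient size gives a maximal immediate elementary T-convex extension. By power boundedness a definable function
has eventually constant leading term along a nest of balls without common point; the germs along such a nest form
a proper immediate extension, so a maximal one is spherically complete. The derivation is extended one generator
at a time, again by Zorn. The admissible values for the derivative of a new element form balls that meet pairwise,
because a linear form in derivatives can be compared with its values at nearby elements of the smaller field;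
spherical completeness then supplies a value.\<close>

text \<open>The hypotheses on \<open>T\<close> speak only of models whose carrier lies in the type
  \<open>('a + 'f + 'r + nat) set\<close>, whereas germs and their classes live on other types.
  O-minimality and power boundedness of an extension are therefore available only once it has been
  injected into that type, and the injection has to be found from the ordered field and the ring of
  \<open>K\<close> alone. Power boundedness enters through the logarithmic derivative. If F'/F is
  much larger than the reciprocal of the radius of a ball, then F, rescaled to [0,1], expands at a
  rate beyond every constant definable without parameters. Definable choice turns this into a
  definable family with arbitrary rates t. Its doubling ratios in t would grow by the factor 3/2
  between any two points of [0,1], which no definable function can do. Continuity of the derivation
  and both clauses of strictness have one shape: a set of small elements is mapped into \<phi> times
  the maximal ideal. All such conditions valid on \<open>K\<close> are imposed at once. Two of the
  resulting conditions on a new derivative are compatible because putting it at the centre of the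
  smaller ball makes one derivative vanish.\<close>

abbreviation (input) iff_ascii :: "bool => bool => bool" (infixr "<->" 25) where "A <-> B == A = B"


section \<open>Coincidence lemmas and capture-free substitution\<close>

lemma eval_trm_cong:
 "(!!i. i : fv_trm t ==> bt i = gm i) ==> eval_trm M bt t = eval_trm M gm t"
proof (induction t)
 case (Fn f ts)
 have "map (eval_trm M bt) ts = map (eval_trm M gm) ts"
  using Fn by (auto intro!: Fn.IH)
 then show ?case by (simp del: map_eq_conv)
qed simp

lemma sat_cong:
 "(!!i. i : fv ph ==> bt i = gm i) ==> sat M bt ph = sat M gm ph"
proof (induction ph arbitrary: bt gm)
 case (Eq s t)
 then show ?case using eval_trm_cong[of s bt gm M] eval_trm_cong[of t bt gm M] by auto
next
 case (Rl r ts)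
 have "map (eval_trm M bt) ts = map (eval_trm M gm) ts"
  using Rl by (auto intro!: eval_trm_cong)
 then show ?case by (simp del: map_eq_conv)
next
 case (Neg ph)
 have "sat M bt ph = sat M gm ph" by (rule Neg.IH) (simp add: Neg.prems)
 then show ?case by simp
next
 case (Conj ph1 ph2)
 have "sat M bt ph1 = sat M gm ph1" by (rule Conj.IH) (simp add: Conj.prems)
 moreover have "sat M bt ph2 = sat M gm ph2" by (rule Conj.IH) (simp add: Conj.prems)
 ultimately show ?case by simp
next
 case (Ex x ph)
 have "sat M (bt(x := a)) ph = sat M (gm(x := a)) ph" for a
  by (rule Ex.IH) (simp add: Ex.prems)
 then show ?case by simp
qed

lemma finite_fv_trm [simp]: "finite (fv_trm t)"
 by (induction t) auto

lemma finite_fv [simp]: "finite (fv ph)"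
 by (induction ph) auto

lemma sat_support: "EX n. ALL bt gm. (ALL i<n. bt i = gm i) --> sat M bt ph = sat M gm ph"
proof -
 obtain n where "ALL i:fv ph. i < n" using finite_nat_set_iff_bounded[of "fv ph"] by auto
 then have "ALL bt gm. (ALL i<n. bt i = gm i) --> sat M bt ph = sat M gm ph"
  by (auto intro!: sat_cong)
 then show ?thesis ..
qed

fun tsub :: "(nat => 'f trm) => 'f trm => 'f trm" where
 "tsub ta (Var n) = ta n"
| "tsub ta (Fn f ts) = Fn f (map (tsub ta) ts)"

lemma eval_tsub: "eval_trm M bt (tsub ta t) = eval_trm M (%i. eval_trm M bt (ta i)) t"
proof (induction t)
 case (Fn f ts)
 then have "map (eval_trm M bt \<circ> tsub ta) ts = map (eval_trm M (%i. eval_trm M bt (ta i))) ts"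
  by auto
 then show ?case by (metis eval_trm.simps(2) list.map_comp tsub.simps(2))
qed simp

lemma wf_tsub: "wf_trm L t ==> (!!i. wf_trm L (ta i)) ==> wf_trm L (tsub ta t)"
 by (induction t) (auto simp: list_all_iff)

text \<open>The bound variable is renamed to a number above every variable of the terms put for the
  free variables of the body, so nothing is captured. The maximum exists because
  \<open>fv ph\<close> is finite, although \<open>ta\<close> assigns terms to infinitely many
  variables.\<close>

fun fsub :: "(nat => 'f trm) => ('f,'r) fm => ('f,'r) fm" where
 "fsub ta (Eq s t) = Eq (tsub ta s) (tsub ta t)"
| "fsub ta (Rl r ts) = Rl r (map (tsub ta) ts)"
| "fsub ta (Neg ph) = Neg (fsub ta ph)"
| "fsub ta (Conj ph \<psi>) = Conj (fsub ta ph) (fsub ta \<psi>)"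
| "fsub ta (Ex x ph) = (let y = Suc (Max (insert 0 (\<Union>i\<in>fv ph. fv_trm (ta i))))
   in Ex y (fsub (ta(x := Var y)) ph))"

lemma sat_fsub: "sat M bt (fsub ta ph) = sat M (%i. eval_trm M bt (ta i)) ph"
proof (induction ph arbitrary: bt ta)
 case (Rl r ts)
 have "map (eval_trm M bt \<circ> tsub ta) ts = map (eval_trm M (%i. eval_trm M bt (ta i))) ts"
  by (auto simp: eval_tsub)
 then show ?case by (metis sat.simps(2) list.map_comp fsub.simps(2))
next
 case (Ex x ph)
 define S where "S = insert 0 (\<Union>i\<in>fv ph. fv_trm (ta i))"
 define y where "y = Suc (Max S)"
 have fin: "finite S" by (simp add: S_def)
 have fresh: "y ~: fv_trm (ta i)" if "i : fv ph" for i
 proof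
  assume "y : fv_trm (ta i)"
  then have "y : S" using that by (auto simp: S_def)
  then show False using Max_ge[OF fin, of y] by (simp add: y_def)
 qed
 have "sat M (bt(y := a)) (fsub (ta(x := Var y)) ph) = sat M ((%i. eval_trm M bt (ta i))(x := a)) ph" for a
  unfolding Ex.IH
  by (rule sat_cong) (auto intro!: eval_trm_cong simp: fresh dest: fresh)
 then show ?case by (simp add: Let_def S_def[symmetric] y_def[symmetric])
qed (auto simp: eval_tsub)

lemma wf_fsub: "wf_fm L ph ==> (!!i. wf_trm L (ta i)) ==> wf_fm L (fsub ta ph)"
proof (induction ph arbitrary: ta)
 case (Ex x ph)
 have "wf_fm L (fsub (ta(x := Var y)) ph)" for y
  by (rule Ex.IH) (use Ex.prems in simp_all)
 then show ?case by (simp add: Let_def)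
next
 case (Neg ph)
 then have "wf_fm L (fsub ta ph)" by (intro Neg.IH) simp_all
 then show ?case by simp
next
 case (Conj ph1 ph2)
 then have "wf_fm L (fsub ta ph1)" "wf_fm L (fsub ta ph2)"
  by (intro Conj.IH; simp)+
 then show ?case by simp
qed (simp_all add: wf_tsub list_all_iff)

lemma fv_tsub: "fv_trm (tsub ta t) <= (\<Union>i\<in>fv_trm t. fv_trm (ta i))"
proof (induction t)
 case (Fn f ts)
 have "fv_trm (tsub ta (Fn f ts)) = (\<Union>t\<in>set ts. fv_trm (tsub ta t))" by simp
 also have "\<dots> <= (\<Union>t\<in>set ts. \<Union>i\<in>fv_trm t. fv_trm (ta i))" using Fn by (intro UN_mono) auto
 also have "\<dots> = (\<Union>i\<in>fv_trm (Fn f ts). fv_trm (ta i))" by simp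
 finally show ?case .
qed simp

lemma fv_fsub: "fv (fsub ta ph) <= (\<Union>i\<in>fv ph. fv_trm (ta i))"
proof (induction ph arbitrary: ta)
 case (Eq s t)
 then show ?case using fv_tsub[of ta s] fv_tsub[of ta t] by auto
next
 case (Rl r ts)
 have "fv (fsub ta (Rl r ts)) = (\<Union>t\<in>set ts. fv_trm (tsub ta t))" by simp
 also have "\<dots> <= (\<Union>t\<in>set ts. \<Union>i\<in>fv_trm t. fv_trm (ta i))" by (intro UN_mono fv_tsub order_refl)
 also have "\<dots> = (\<Union>i\<in>fv (Rl r ts). fv_trm (ta i))" by simp
 finally show ?case .
next
 case (Ex x ph)
 define y where "y = Suc (Max (insert 0 (\<Union>i\<in>fv ph. fv_trm (ta i))))"
 have "fv (fsub ta (Ex x ph)) = fv (fsub (ta(x := Var y)) ph) - {y}"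
  by (simp add: Let_def y_def)
 also have "\<dots> <= (\<Union>i\<in>fv ph. fv_trm ((ta(x := Var y)) i)) - {y}"
  using Ex.IH by blast
 also have "\<dots> <= (\<Union>i\<in>fv (Ex x ph). fv_trm (ta i))"
  by (auto split: if_splits)
 finally show ?case .
next
 case (Neg ph)
 then show ?case by simp
next
 case (Conj ph1 ph2)
 show ?case using Conj.IH(1)[of ta] Conj.IH(2)[of ta] by auto
qed

section \<open>Definable predicates and functions, treated semantically\<close>

definition mix :: "(nat => 'k) => (nat => 'k) => nat => 'k" where
 "mix bt br i = (if even i then bt (i div 2) else br (i div 2))"

lemma mix_even [simp]: "mix bt br (2 * i) = bt i"
 and mix_odd [simp]: "mix bt br (Suc (2 * i)) = br i"
 by (auto simp: mix_def)

lemma mix_mix1: "mix bt (mix br bs) (Suc (4 * i)) = br i"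
proof -
 have "Suc (4 * i) div 2 = 2 * i" "odd (Suc (4 * i))" by simp_all
 then show ?thesis unfolding mix_def by simp
qed

lemma mix_mix2: "mix bt (mix br bs) (Suc (Suc (Suc (4 * i)))) = bs i"
proof -
 have "Suc (Suc (Suc (4 * i))) div 2 = Suc (2 * i)" "odd (Suc (Suc (Suc (4 * i))))" by simp_all
 then show ?thesis unfolding mix_def by simp
qed

lemma mix_eqI:
 assumes "!!i. f (2 * i) = bt i" "!!i. f (Suc (2 * i)) = br i" shows "f = mix bt br"
proof
 fix i show "f i = mix bt br i"
  by (cases "even i") (auto simp: assms elim!: evenE oddE)
qed

text \<open>The carrier is a whole type of class \<open>linordered_field\<close> and the symbols
  denote the class operations, so that field arithmetic is available to the simplifier. Structures
  with other carriers are brought to this shape by transport.\<close>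

locale omf =
 fixes L :: "('f,'r) lang" and N :: "('k::linordered_field,'f,'r) struc"
 assumes ok: "lang_ok L" and UN [simp]: "univ N = UNIV"
  and zrN [simp]: "zr L N = 0" and onN [simp]: "on L N = 1"
  and adN [simp]: "ad L N x y = x + y" and ngN [simp]: "ng L N x = - x"
  and mlN [simp]: "ml L N x y = x * y" and lsN [simp]: "ls L N x y <-> x < y"
  and om: "ominimal_struc L N"
begin

text \<open>Definability without parameters as a property of predicates on valuations. Closure rules
  for such predicates replace the building of formulas; a quantifier pushes the bound value into
  slot 0 and shifts the others, as in de Bruijn notation.\<close>

definition D0 :: "((nat => 'k) => bool) => bool" where
 "D0 P <-> (EX ph. wf_fm L ph & (ALL bt. P bt = sat N bt ph))"

lemma D0_not: "D0 P ==> D0 (%bt. ~ P bt)"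
 unfolding D0_def by (metis sat.simps(3) wf_fm.simps(3))

lemma D0_conj: "D0 P ==> D0 Q ==> D0 (%bt. P bt & Q bt)"
 unfolding D0_def by (metis sat.simps(4) wf_fm.simps(4))

lemma D0_term:
 assumes "D0 P" "!!i. wf_trm L (ta i)" shows "D0 (%bt. P (%i. eval_trm N bt (ta i)))"
 using assms unfolding D0_def by (metis sat_fsub wf_fsub)

lemma D0_ren: "D0 P ==> D0 (%bt. P (%i. bt (r i)))"
 using D0_term[of P "%i. Var (r i)"] by simp

lemma wf_zero: "wf_trm L (Fn (sym_zero L) [])"
 using ok by (simp add: lang_ok_def)

lemma D0_support: "D0 P ==> EX n. ALL bt gm. (ALL i<n. bt i = gm i) --> P bt = P gm"
 unfolding D0_def using sat_support[of N] by metis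

lemma D0_ex: assumes "D0 P" shows "D0 (%bt. EX y. P (case_nat y bt))"
proof -
 obtain ph where wf: "wf_fm L ph" and P: "!!bt. P bt = sat N bt ph"
  using assms unfolding D0_def by blast
 obtain m where m: "ALL i:fv ph. i < m" using finite_nat_set_iff_bounded[of "fv ph"] by auto
 define \<psi> where "\<psi> = Ex m (fsub (%i. case i of 0 => Var m | Suc j => Var j) ph)"
 have "wf_fm L \<psi>" unfolding \<psi>_def by (auto intro!: wf_fsub wf split: nat.split)
 moreover have "sat N (%i. eval_trm N (bt(m := y)) (case i of 0 => Var m | Suc j => Var j)) ph =
   sat N (case_nat y bt) ph" for bt y
  by (rule sat_cong) (use m in \<open>auto split: nat.split\<close>)
 then have "(EX y. P (case_nat y bt)) = sat N bt \<psi>" for bt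
  by (simp add: \<psi>_def P sat_fsub)
 ultimately show ?thesis unfolding D0_def by blast
qed

lemma D0_eq: "D0 (%bt. bt i = bt j)"
 unfolding D0_def by (rule exI[of _ "Eq (Var i) (Var j)"]) auto

lemma D0_less: "D0 (%bt. bt i < bt j)"
 unfolding D0_def by (rule exI[of _ "Rl (sym_less L) [Var i, Var j]"])
  (use ok lsN in \<open>auto simp: lang_ok_def ls_def\<close>)

lemma D0_add: "D0 (%bt. bt i = bt j + bt k)"
 unfolding D0_def by (rule exI[of _ "Eq (Var i) (Fn (sym_add L) [Var j, Var k])"])
  (use ok adN in \<open>auto simp: lang_ok_def ad_def\<close>)

lemma D0_mult: "D0 (%bt. bt i = bt j * bt k)"
 unfolding D0_def by (rule exI[of _ "Eq (Var i) (Fn (sym_mul L) [Var j, Var k])"])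
  (use ok mlN in \<open>auto simp: lang_ok_def ml_def\<close>)

lemma D0_one: "D0 (%bt. bt i = 1)"
 unfolding D0_def by (rule exI[of _ "Eq (Var i) (Fn (sym_one L) [])"])
  (use ok onN in \<open>auto simp: lang_ok_def on_def\<close>)

definition D :: "'k set => ((nat => 'k) => bool) => bool" where
 "D A P <-> (EX P0 br. D0 P0 & (ALL i. br i : insert 0 A) & (ALL bt. P bt = P0 (mix bt br)))"

definition DF :: "'k set => ((nat => 'k) => 'k) => bool" where
 "DF A f <-> D A (%bt. bt 0 = f (%i. bt (Suc i)))"

lemma D_mono: "D A P ==> A <= A' ==> D A' P"
 unfolding D_def by (metis insert_mono subsetD)

lemma D0_D: "D0 P ==> D A P"
proof -
 assume "D0 P"
 then have "D0 (%bt. P (%i. bt (2 * i)))" by (rule D0_ren)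
 then show ?thesis unfolding D_def
  by (intro exI[of _ "%bt. P (%i. bt (2 * i))"] exI[of _ "%_. 0"]) auto
qed

lemma D_support: "D A P ==> EX n. ALL bt gm. (ALL i<n. bt i = gm i) --> P bt = P gm"
proof -
 assume "D A P"
 then obtain P0 br where P: "D0 P0" "!!bt. P bt = P0 (mix bt br)" unfolding D_def by blast
 obtain n where n: "!!bt gm. (ALL i<n. bt i = gm i) ==> P0 bt = P0 gm" using D0_support[OF P(1)] by blast
 have "P bt = P gm" if "ALL i<n. bt i = gm i" for bt gm
  unfolding P(2) by (rule n) (use that in \<open>auto simp: mix_def\<close>)
 then show ?thesis by blast
qed

lemma D_not: "D A P ==> D A (%bt. ~ P bt)"
proof -
 assume "D A P"
 then obtain P0 br where P: "D0 P0" "ALL i. br i : insert 0 A" "!!bt. P bt = P0 (mix bt br)"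
  unfolding D_def by blast
 then show ?thesis unfolding D_def
  by (intro exI[of _ "%bt. ~ P0 bt"] exI[of _ br]) (simp add: D0_not)
qed

lemma D_conj: assumes "D A P" "D A Q" shows "D A (%bt. P bt & Q bt)"
proof -
 obtain P0 br where P: "D0 P0" "!!i. br i : insert 0 A" "!!bt. P bt = P0 (mix bt br)"
  using assms(1) unfolding D_def by blast
 obtain Q0 bs where Q: "D0 Q0" "!!i. bs i : insert 0 A" "!!bt. Q bt = Q0 (mix bt bs)"
  using assms(2) unfolding D_def by blast
 \<comment> \<open>The two parameter sequences are interleaved once more: parameter i of
   \<open>P\<close> then sits in slot 2(2i) + 1 = 4i + 1, that of \<open>Q\<close> in slot 2(2i + 1)
   + 1 = 4i + 3.\<close>
 let ?r1 = "%j::nat. if even j then j else Suc (4 * (j div 2))"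
 let ?r2 = "%j::nat. if even j then j else Suc (Suc (Suc (4 * (j div 2))))"
 have "D0 (%bt. P0 (%i. bt (?r1 i)) & Q0 (%i. bt (?r2 i)))"
  by (rule D0_conj[OF D0_ren[OF P(1)] D0_ren[OF Q(1)]])
 moreover have "(%i. mix bt (mix br bs) (?r1 i)) = mix bt br" for bt
  by (rule mix_eqI) (simp_all add: mix_mix1 mix_mix2)
 moreover have "(%i. mix bt (mix br bs) (?r2 i)) = mix bt bs" for bt
  by (rule mix_eqI) (simp_all add: mix_mix1 mix_mix2)
 moreover have "mix br bs i : insert 0 A" for i unfolding mix_def using P(2) Q(2) by (cases "even i") simp_all
 ultimately show ?thesis unfolding D_def
  by (intro exI[of _ "%bt. P0 (%i. bt (?r1 i)) & Q0 (%i. bt (?r2 i))"] exI[of _ "mix br bs"] conjI allI)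
   (simp_all only: P(3) Q(3))
qed

lemma D_disj: assumes "D A P" "D A Q" shows "D A (%bt. P bt | Q bt)"
proof -
 have "D A (%bt. ~ (~ P bt & ~ Q bt))"
  by (rule D_not[OF D_conj[OF D_not[OF assms(1)] D_not[OF assms(2)]]])
 then show ?thesis by (simp only: de_Morgan_conj not_not)
qed

lemma D_imp: assumes "D A P" "D A Q" shows "D A (%bt. P bt --> Q bt)"
 using D_disj[OF D_not[OF assms(1)] assms(2)] by (simp only: imp_conv_disj)

lemma D_iff: assumes "D A P" "D A Q" shows "D A (%bt. P bt <-> Q bt)"
 using D_conj[OF D_imp[OF assms] D_imp[OF assms(2,1)]] by (simp only: iff_conv_conj_imp)

lemma D_ren: assumes "D A P" shows "D A (%bt. P (%i. bt (r i)))"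
proof -
 obtain P0 br where P: "D0 P0" "!!i. br i : insert 0 A" "!!bt. P bt = P0 (mix bt br)"
  using assms(1) unfolding D_def by blast
 let ?r = "%j::nat. if even j then 2 * r (j div 2) else j"
 have "D0 (%bt. P0 (%i. bt (?r i)))" by (rule D0_ren[OF P(1)])
 moreover have "(%i. mix bt br (?r i)) = mix (%i. bt (r i)) br" for bt
  by (auto simp: mix_def fun_eq_iff)
 ultimately show ?thesis unfolding D_def
  by (intro exI[of _ "%bt. P0 (%i. bt (?r i))"] exI[of _ br]) (use P(2) in \<open>simp add: P(3)\<close>)
qed

lemma D_ex_nat: assumes "D A P" shows "D A (%bt. EX y. P (case_nat y bt))"
proof -
 obtain P0 br where P: "D0 P0" "!!i. br i : insert 0 A" "!!bt. P bt = P0 (mix bt br)"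
  using assms(1) unfolding D_def by blast
 \<comment> \<open>The new value becomes variable 0, so slot j of the variables reads slot j - 2 of
   the old valuation, while the parameters in odd slots stay; the outer \<open>Suc\<close> accounts
   for the value pushed in front.\<close>
 let ?r = "%j::nat. if j = 0 then 0 else if even j then Suc (j - 2) else Suc j"
 have "D0 (%bt. P0 (%i. bt (?r i)))" by (rule D0_ren[OF P(1)])
 then have "D0 (%bt. EX y. P0 (%i. (case_nat y bt) (?r i)))" by (rule D0_ex)
 moreover have "(%i. (case_nat y (mix bt br)) (?r i)) = mix (case_nat y bt) br" for y bt
 proof (rule mix_eqI)
  fix i show "case_nat y (mix bt br) (?r (2 * i)) = case_nat y bt i"
   by (cases i) simp_all
 qed simp
 ultimately show ?thesis unfolding D_def
  by (intro exI[of _ "%bt. EX y. P0 (%i. (case_nat y bt) (?r i))"] exI[of _ br]) (use P(2) in \<open>simp add: P(3)\<close>)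
qed

lemma D_ex: assumes "D A (%bt. Q (bt 0) (%i. bt (Suc i)))" shows "D A (%bt. EX y. Q y bt)"
 using D_ex_nat[OF assms] by (simp only: nat.case)

lemma D_all: assumes "D A (%bt. Q (bt 0) (%i. bt (Suc i)))" shows "D A (%bt. ALL y. Q y bt)"
 using D_not[OF D_ex[of A "%y bt. ~ Q y bt", OF D_not[OF assms]]] by (simp only: not_ex not_not)

lemma D_True: "D A (%bt. True)"
 using D0_D[OF D0_eq[of 0 0]] by simp

lemma DF_ren: "DF A f ==> DF A (%bt. f (%i. bt (r i)))"
 unfolding DF_def by (drule D_ren[of A _ "case_nat 0 (%i. Suc (r i))"]) (simp only: nat.case)

lemma DF_mono: "DF A f ==> A <= A' ==> DF A' f"
 unfolding DF_def by (rule D_mono)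

lemma D_sub1: assumes "D A P" "DF A g" shows "D A (%bt. P (case_nat (g bt) bt))"
proof -
 have eta: "case_nat (bt 0) (%i. bt (Suc i)) = bt" for bt :: "nat => 'k"
  by (rule ext) (simp split: nat.split)
 have "D A (%bt. bt 0 = g (%i. bt (Suc i)) & P bt)"
  by (rule D_conj) (use assms in \<open>simp_all add: DF_def\<close>)
 then have "D A (%bt. EX y. y = g bt & P (case_nat y bt))"
  by (intro D_ex[where Q = "%y bt. y = g bt & P (case_nat y bt)"]) (simp only: eta)
 then show ?thesis by simp
qed

end

context omf
begin

lemma D_sub1': assumes "D A (%bt. R (bt 0) (%i. bt (Suc i)))" "DF A g" shows "D A (%bt. R (g bt) bt)"
 using D_sub1[OF assms] by (simp only: nat.case)

lemma DF_sub1: assumes "DF A (%bt. F (bt 0) (%i. bt (Suc i)))" "DF A g" shows "DF A (%bt. F (g bt) bt)"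
proof -
 have 1: "D A (%bt. bt 1 = F (bt 0) (%i. bt (Suc (Suc i))))"
  using D_ren[OF assms(1)[unfolded DF_def], of "%i. case i of 0 => 1 | Suc 0 => 0 | Suc (Suc j) => Suc (Suc j)"]
  by (simp only: nat.case)
 have 2: "DF A (%bt. g (%i. bt (Suc i)))" by (rule DF_ren[OF assms(2)])
 show ?thesis unfolding DF_def
  by (rule D_sub1'[where R = "%y bt. bt 0 = F y (%i. bt (Suc i))" and g = "%bt. g (%i. bt (Suc i))", OF _ 2])
   (use 1 in simp)
qed

lemma DF_var [intro]: "DF A (%bt. bt i)"
 unfolding DF_def by (rule D0_D[OF D0_eq])

lemma D_const_eq: assumes "c : insert 0 A" shows "D A (%bt. bt 0 = c)"
proof -
 have "D0 (%bt. bt 0 = bt 1)" by (rule D0_eq)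
 then show ?thesis unfolding D_def
  by (intro exI[of _ "%bt. bt 0 = bt 1"] exI[of _ "%_. c"]) (use assms in \<open>auto simp: mix_def\<close>)
qed

lemma DF_const: "c : A ==> DF A (%bt. c)"
 unfolding DF_def by (rule D_const_eq) simp

lemma DF_0: "DF A (%bt. 0)"
 unfolding DF_def by (rule D_const_eq) simp

lemma DF_1: "DF A (%bt. 1)"
 unfolding DF_def by (rule D0_D[OF D0_one])

lemma D_app2:
 assumes R: "D A (%bt. R (bt 0) (bt 1))" and f: "DF A f" and g: "DF A g"
 shows "D A (%bt. R (f bt) (g bt))"
proof -
 have "D A (%bt. R (bt 1) (bt 0))"
  using D_ren[OF R, of "%i. if i = 0 then 1 else 0"] by simp
 then have "D A (%bt. R (bt 1) (g (%i. bt (Suc i))))"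
  using D_sub1'[of A "%y bt. R (bt 0) y" g]
  by (intro D_sub1'[where R = "%y bt. R (bt 1) y"] DF_ren[OF g])
    (use D_ren[OF R, of "%i. if i = 0 then 2 else 0"] in \<open>simp add: numeral_2_eq_2\<close>)
 then have "D A (%bt. R (bt 0) (g (%i. bt (Suc i))))"
  by (intro D_sub1'[where R = "%y bt. R (bt 0) y"] DF_ren[OF g])
    (use D_ren[OF R, of "%i. if i = 0 then 1 else 0"] in simp)
 then show ?thesis
  by (intro D_sub1'[where R = "%y bt. R y (g bt)"] f)
qed

lemma D_eq: "DF A f ==> DF A g ==> D A (%bt. f bt = g bt)"
 by (rule D_app2[of A "(=)" f g, OF D0_D[OF D0_eq]])

lemma D_less: "DF A f ==> DF A g ==> D A (%bt. f bt < g bt)"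
 by (rule D_app2[of A "(<)" f g, OF D0_D[OF D0_less]])

lemma D_le: assumes "DF A f" "DF A g" shows "D A (%bt. f bt <= g bt)"
 using D_not[OF D_less[OF assms(2,1)]] by (simp only: not_less)

lemma DF_I:
 assumes "D A (%bt. R (bt 0) (%i. bt (Suc i)))" "!!bt y. y = f bt <-> R y bt"
 shows "DF A f"
 unfolding DF_def using assms(1) by (simp only: assms(2))

lemma DF_app2:
 assumes F: "DF A (%bt. F (bt 0) (bt 1))" and f: "DF A f" and g: "DF A g"
 shows "DF A (%bt. F (f bt) (g bt))"
proof -
 have "DF A (%bt. F (bt 0) (g (%i. bt (Suc i))))"
  by (intro DF_sub1[where F = "%y bt. F (bt 0) y"] DF_ren[OF g])
    (use DF_ren[OF F, of "%i. if i = 0 then 1 else 0"] in simp)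
 then show ?thesis
  by (intro DF_sub1[where F = "%y bt. F y (g bt)"] f)
qed

lemma DF_app1: assumes F: "DF A (%bt. F (bt 0))" and f: "DF A f" shows "DF A (%bt. F (f bt))"
 by (rule DF_app2[of A "%x y. F x", OF F f f])

lemma D_app1: assumes F: "D A (%bt. P (bt 0))" and f: "DF A f" shows "D A (%bt. P (f bt))"
 by (rule D_app2[of A "%x y. P x", OF F f f])

lemma DF_add: assumes "DF A f" "DF A g" shows "DF A (%bt. f bt + g bt)"
 by (rule DF_app2[OF _ assms]) (unfold DF_def, rule D0_D[OF D0_add])

lemma DF_mult: assumes "DF A f" "DF A g" shows "DF A (%bt. f bt * g bt)"
 by (rule DF_app2[OF _ assms]) (unfold DF_def, rule D0_D[OF D0_mult])

lemma DF_diff: assumes "DF A f" "DF A g" shows "DF A (%bt. f bt - g bt)"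
proof (rule DF_app2[OF _ assms])
 show "DF A (%bt. bt 0 - bt 1)"
  by (rule DF_I[where R = "%y bt. y + bt 1 = bt 0"]) (auto intro!: D_eq DF_add DF_var simp: algebra_simps)
qed

lemma DF_minus: assumes "DF A f" shows "DF A (%bt. - f bt)"
 using DF_diff[OF DF_0 assms] by simp

lemma DF_divide: assumes "DF A f" "DF A g" shows "DF A (%bt. f bt / g bt)"
proof (rule DF_app2[OF _ assms])
 show "DF A (%bt. bt 0 / bt 1)"
  \<comment> \<open>A zero denominator must give 0, as division in the type class does.\<close>
  by (rule DF_I[where R = "%y bt. (bt 1 = 0 & y = 0) | (bt 1 ~= 0 & y * bt 1 = bt 0)"])
   (intro D_eq D_disj D_conj D_not DF_mult DF_var DF_0, auto simp: eq_divide_eq)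
qed

lemma DF_if: assumes "D A P" "DF A f" "DF A g" shows "DF A (%bt. if P bt then f bt else g bt)"
proof (rule DF_I[where R = "%y bt. (P bt & y = f bt) | (~ P bt & y = g bt)"])
 show "D A (%bt. (P (%i. bt (Suc i)) & bt 0 = f (%i. bt (Suc i))) | (~ P (%i. bt (Suc i)) & bt 0 = g (%i. bt (Suc i))))"
  using D_ren[OF assms(1), of Suc] assms(2,3)
  by (intro D_disj D_conj D_not) (simp_all only: DF_def)
qed auto

lemma DF_abs: assumes "DF A f" shows "DF A (%bt. \<bar>f bt\<bar>)"
proof -
 have "DF A (%bt. if f bt < 0 then - f bt else f bt)"
  by (intro DF_if D_less DF_minus assms DF_0)
 then show ?thesis by (simp only: abs_if)
qed

lemma DF_numeral: "DF A (%bt. numeral n)"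
proof (induction n)
 case One then show ?case using DF_1 by simp
next
 case (Bit0 n)
 then show ?case using DF_add[OF Bit0 Bit0] by (simp only: numeral_Bit0)
next
 case (Bit1 n)
 then show ?case using DF_add[OF DF_add[OF Bit1 Bit1] DF_1] by (simp only: numeral_Bit1)
qed

text \<open>Together these two collections form a calculus of definability: applied repeatedly, they
  follow the shape of a predicate written with quantifiers and field operations and leave only the
  functions occurring in it.\<close>

lemmas D_base = D_conj D_disj D_imp D_iff D_not D_eq D_less D_le D_ex D_all
lemmas DF_base = DF_var DF_0 DF_1 DF_numeral DF_add DF_mult DF_diff DF_minus DF_divide DF_abs

definition dcl :: "'k set => 'k set" where "dcl A = {c. DF A (%bt. c)}"

lemma DF_dcl: "c : dcl A ==> DF A (%bt. c)" by (simp add: dcl_def)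

lemma dclI: "D A (%bt. bt 0 = c) ==> c : dcl A" by (simp add: dcl_def DF_def)

text \<open>Arguments are substituted one at a time; the even variables keep the original valuation
  while the odd ones still wait to be substituted.\<close>

lemma D_subst: assumes "D A P" "!!i. DF A (ta i)" shows "D A (%bt. P (%i. ta i bt))"
proof -
 define Q where "Q n bt = P (%i. if i < n then ta i (%j. bt (2 * j)) else bt (Suc (2 * (i - n))))" for n bt
 have "D A (Q n)" for n
 proof (induction n)
  case 0
  show ?case using D_ren[OF assms(1), of "%i. Suc (2 * i)"] by (simp add: Q_def[abs_def])
 next
  case (Suc n)
  define r :: "nat => nat" where "r i = (if even i then Suc i else if i = 1 then 0 else Suc (i - 2))" for i
  have "D A (%bt. Q n (%i. bt (r i)))" by (rule D_ren[OF Suc])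
  then have "D A (%bt. Q n (%i. case_nat (ta n (%j. bt (2 * j))) bt (r i)))"
   by (rule D_sub1) (rule DF_ren[OF assms(2)])
  moreover have "Q n (%i. case_nat (ta n (%j. bt (2 * j))) bt (r i)) = Q (Suc n) bt" for bt
  proof -
   have eq: "(%i. if i < n then ta i (%j. case_nat (ta n (%j. bt (2 * j))) bt (r (2 * j)))
       else case_nat (ta n (%j. bt (2 * j))) bt (r (Suc (2 * (i - n)))))
     = (%i. if i < Suc n then ta i (%j. bt (2 * j)) else bt (Suc (2 * (i - Suc n))))" (is "?l = ?r")
   proof
    fix i
    show "?l i = ?r i"
    proof (cases "i < n | i = n")
     case True then show ?thesis by (auto simp: r_def)
    next
     case False
     then obtain k where "i = Suc (n + k)" by (metis add_Suc_right less_iff_Suc_add linorder_neqE_nat)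
     then show ?thesis by (simp add: r_def)
    qed
   qed
   then show ?thesis unfolding Q_def by (rule arg_cong[where f = P])
  qed
  ultimately show ?case by (simp only:)
 qed
 moreover obtain n where n: "!!bt gm. (ALL i<n. bt i = gm i) ==> P bt = P gm" using D_support[OF assms(1)] by blast
 ultimately have "D A (%bt. Q n (%i. bt (i div 2)))" by (rule_tac D_ren)
 moreover have "Q n (%i. bt (i div 2)) = P (%i. ta i bt)" for bt
  unfolding Q_def by (rule n) simp
 ultimately show ?thesis by (simp only:)
qed

lemma DF_subst: assumes "DF A f" "!!i. DF A (ta i)" shows "DF A (%bt. f (%i. ta i bt))"
proof -
 have 1: "DF A (%bt. case i of 0 => bt 0 | Suc j => ta j (%i. bt (Suc i)))" for i
  by (cases i) (simp_all add: DF_var DF_ren[OF assms(2)])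
 show ?thesis unfolding DF_def
  using D_subst[OF assms(1)[unfolded DF_def], of "%i bt. case i of 0 => bt 0 | Suc j => ta j (%i. bt (Suc i))", OF 1]
  by (simp only: nat.case)
qed

lemma D_dcl: assumes "D (dcl A) P" shows "D A P"
proof -
 obtain P0 br where P: "D0 P0" "!!i. br i : insert 0 (dcl A)" "!!bt. P bt = P0 (mix bt br)"
  using assms unfolding D_def by blast
 have "DF A (%bt. mix bt br i)" for i
 proof (cases "even i")
  case True then show ?thesis by (simp add: mix_def DF_var)
 next
  case False
  then show ?thesis using P(2)[of "i div 2"] DF_0[of A] by (auto simp: mix_def dcl_def)
 qed
 from D_subst[OF D0_D[OF P(1)], where ta = "%i bt. mix bt br i", OF this]
 have "D A (%bt. P0 (mix bt br))" .
 moreover have "P = (%bt. P0 (mix bt br))" using P(3) by (rule ext)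
 ultimately show ?thesis by (simp only:)
qed

lemma DF_dcl': "DF (dcl A) f ==> DF A f"
 unfolding DF_def by (rule D_dcl)

lemma subset_dcl: "A <= dcl A" by (auto simp: dcl_def DF_const)

lemma dcl_dcl [simp]: "dcl (dcl A) = dcl A"
 using subset_dcl[of "dcl A"] by (auto simp: dcl_def intro: DF_dcl'[unfolded dcl_def])

lemma dcl_mono: "A <= B ==> dcl A <= dcl B"
 by (auto simp: dcl_def intro: DF_mono)

lemma dcl_app: "DF A f ==> (!!i. bt i : dcl A) ==> f bt : dcl A"
 using DF_subst[of A f "%i _. bt i"] by (auto simp: dcl_def)

text \<open>A slot holding a parameter outside \<open>insert 0 A\<close> can only hold
  \<open>b\<close>; all these slots are redirected to the new variable 0.\<close>

lemma D_param: assumes "D (insert b A) P" shows "EX Q. D A Q & (ALL bt. P bt = Q (case_nat b bt))"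
proof -
 obtain P0 br where P: "D0 P0" "!!i. br i : insert 0 (insert b A)" "!!bt. P bt = P0 (mix bt br)"
  using assms unfolding D_def by blast
 define Q where "Q bt = P0 (%i. if even i then bt (Suc (i div 2)) else if br (i div 2) : insert 0 A then br (i div 2) else bt 0)" for bt
 have "D A Q" unfolding Q_def[abs_def]
 proof (rule D_subst[OF D0_D[OF P(1)], where ta = "%i bt. if even i then bt (Suc (i div 2)) else if br (i div 2) : insert 0 A then br (i div 2) else bt 0"])
  show "DF A (%bt. if even i then bt (Suc (i div 2)) else if br (i div 2) : insert 0 A then br (i div 2) else bt 0)" for i
   by (cases "even i"; cases "br (i div 2) : insert 0 A")
    (use DF_0[of A] DF_const[of "br (i div 2)" A] in \<open>auto intro: DF_var\<close>)
 qed
 moreover have "P bt = Q (case_nat b bt)" for bt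
 proof -
  have "mix bt br = (%i. if even i then case_nat b bt (Suc (i div 2)) else if br (i div 2) : insert 0 A then br (i div 2) else case_nat b bt 0)"
   by (rule ext) (use P(2) in \<open>auto simp: mix_def\<close>)
  then show ?thesis by (simp only: P(3) Q_def)
 qed
 ultimately show ?thesis by blast
qed

end

section \<open>Consequences of o-minimality on the line\<close>

context omf
begin

text \<open>Link to the formal notion of definable set. That notion admits parameters from
  \<open>A\<close> only, so a filler 0 among the parameters is replaced by the term for zero, and
  likewise every variable from n on.\<close>

lemma def_set_of_D:
 assumes "D A P" and supp: "!!bt gm. (!!i. i < n ==> bt i = gm i) ==> P bt = P gm"
 shows "def_set L N A n {xs. length xs = n & P (%i. if i < n then xs ! i else 0)}"
proof -
 obtain P0 br where P: "D0 P0" "!!i. br i : insert 0 A" "!!bt. P bt = P0 (mix bt br)"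
  using assms(1) unfolding D_def by blast
 obtain ph where ph: "wf_fm L ph" "!!bt. P0 bt = sat N bt ph" using P(1) unfolding D0_def by blast
 let ?z = "Fn (sym_zero L) []"
 define ta where "ta j = (if even j then (if j div 2 < n then Var (j div 2) else ?z)
   else if br (j div 2) : A then Var (n + j div 2) else ?z)" for j
 define \<psi> where "\<psi> = fsub ta ph"
 have wfta: "wf_trm L (ta j)" for j by (auto simp: ta_def wf_zero simp del: wf_trm.simps(2))
 have "wf_fm L \<psi>" unfolding \<psi>_def by (rule wf_fsub[OF ph(1) wfta])
 moreover have "ALL i:fv \<psi>. n <= i --> br (i - n) : A"
 proof (intro ballI impI)
  fix i assume i: "i : fv \<psi>" "n <= i"
  then obtain j where "i : fv_trm (ta j)" using fv_fsub[of ta ph] unfolding \<psi>_def by auto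
  with i show "br (i - n) : A" by (auto simp: ta_def split: if_splits)
 qed
 moreover have "{xs. length xs = n & P (%i. if i < n then xs ! i else 0)}
   = {xs : tuples N n. sat N (asg xs (%i. br (i - n))) \<psi>}"
 proof -
  have "P (%i. if i < n then xs ! i else 0) = sat N (asg xs (%i. br (i - n))) \<psi>" if "length xs = n" for xs
  proof -
   have z: "eval_trm N bt ?z = 0" for bt using zrN by (simp add: zr_def)
   have "mix (%i. if i < n then xs ! i else 0) br = (%j. eval_trm N (asg xs (%i. br (i - n))) (ta j))"
   proof
    fix j show "mix (%i. if i < n then xs ! i else 0) br j = eval_trm N (asg xs (%i. br (i - n))) (ta j)"
     using P(2)[of "j div 2"] z that by (auto simp: mix_def ta_def asg_def simp del: eval_trm.simps(2))
   qed
   then show ?thesis unfolding P(3) \<psi>_def sat_fsub ph(2) by simp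
  qed
  then show ?thesis by (auto simp: tuples_def)
 qed
 ultimately show ?thesis unfolding def_set_def by (intro exI[of _ \<psi>] exI[of _ "%i. br (i - n)"] conjI)
qed

lemma D_of_def_set:
 assumes "def_set L N A n S" shows "D A (%bt. map bt [0..<n] : S)"
proof -
 obtain ph gm where ph: "wf_fm L ph" "!!i. i : fv ph ==> n <= i ==> gm i : A"
  and S: "S = {xs : tuples N n. sat N (asg xs gm) ph}"
  using assms unfolding def_set_def by blast
 have 1: "D A (%bt. sat N bt ph)" by (rule D0_D) (use ph(1) in \<open>auto simp: D0_def\<close>)
 have "D A (%bt. sat N (%i. if i < n then bt i else if i : fv ph then gm i else 0) ph)"
  by (rule D_subst[OF 1, where ta = "%i bt. if i < n then bt i else if i : fv ph then gm i else 0"])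
   (rename_tac i, case_tac "i < n"; case_tac "i : fv ph"; simp add: DF_var DF_0 DF_const ph(2))
 moreover have "sat N (%i. if i < n then bt i else if i : fv ph then gm i else 0) ph = (map bt [0..<n] : S)" for bt
 proof -
  have "(map bt [0..<n] : S) = sat N (asg (map bt [0..<n]) gm) ph" by (simp add: S tuples_def)
  also have "\<dots> = sat N (%i. if i < n then bt i else if i : fv ph then gm i else 0) ph"
   by (rule sat_cong) (auto simp: asg_def)
  finally show ?thesis ..
 qed
 ultimately show ?thesis by (simp only:)
qed

lemma D_UNIV: "D A P ==> D UNIV P" by (erule D_mono) simp
lemma DF_UNIV: "DF A f ==> DF UNIV f" by (erule DF_mono) simp

text \<open>The exceptional set \<open>C\<close> consists of the isolated points and the endpoints
  of the intervals supplied by o-minimality; truth can change only there. This is the form in which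
  o-minimality is used from here on.\<close>

lemma OMfin:
 assumes "D A (%bt. S (bt 0))"
 obtains C where "finite C" "!!x y. x <= y ==> (!!c. c : C ==> ~ (x <= c & c <= y)) ==> S x = S y"
proof -
 have "def_set L N UNIV 1 {xs. length xs = 1 & S (if (0::nat) < 1 then xs ! 0 else 0)}"
  by (rule def_set_of_D[OF D_UNIV[OF assms], of 1]) auto
 then obtain P I where PI: "finite P" "finite I"
  and eq: "{x. [x] : {xs. length xs = 1 & S (if (0::nat) < 1 then xs ! 0 else 0)}} = P Un (\<Union>(a, b)\<in>I. oint L N a b)"
  using om[unfolded ominimal_struc_def UN, rule_format, of "{xs. length xs = 1 & S (if (0::nat) < 1 then xs ! 0 else 0)}"]
  by blast
 have S: "S x <-> x : P | (EX (a, b):I. x : oint L N a b)" for x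
  using eqset_imp_iff[OF eq, of x] by auto
 define C where "C = P Un (\<Union>(a, b)\<in>I. set_option a Un set_option b)"
 have "finite C" using PI by (auto simp: C_def)
 moreover have "S x = S y" if xy: "x <= y" "!!c. c : C ==> ~ (x <= c & c <= y)" for x y
 proof -
  have "x ~: P" "y ~: P" using xy(1) xy(2)[of x] xy(2)[of y] by (auto simp: C_def)
  moreover have "x : oint L N a b <-> y : oint L N a b" if "(a, b) : I" for a b
  proof -
   have "a = Some a' ==> a' < x <-> a' < y" "b = Some b' ==> x < b' <-> y < b'" for a' b'
    using xy(2)[of a'] xy(2)[of b'] xy(1) that by (force simp: C_def)+
   then show ?thesis by (auto simp: oint_def split: option.split)
  qed
  ultimately show ?thesis unfolding S by fast
 qed
 ultimately show ?thesis by (rule that)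
qed

lemma ev_right:
 assumes "D A (%bt. S (bt 0))" obtains d where "d > 0" "!!x y. a < x ==> x < a + d ==> a < y ==> y < a + d ==> S x = S y"
proof -
 obtain C where C: "finite C" "!!x y. x <= y ==> (!!c. c : C ==> ~ (x <= c & c <= y)) ==> S x = S y"
  by (rule OMfin[OF assms]) blast
 define d where "d = Min (insert 1 ((%c. c - a) ` {c:C. c > a}))"
 have "d > 0" using C(1) by (auto simp: d_def)
 have d: "d <= c - a" if "c : C" "c > a" for c
  unfolding d_def using C(1) that by (intro Min_le) auto
 have "S x = S y" if "a < x" "x < a + d" "a < y" "y < a + d" "x <= y" for x y
  by (rule C(2)) (use that d in \<open>force+\<close>)
 then have "S x = S y" if "a < x" "x < a + d" "a < y" "y < a + d" for x y
  using that by (metis linear)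
 with \<open>d > 0\<close> show ?thesis by (rule that)
qed

lemma D_reflect: assumes "D A (%bt. S (bt 0))" shows "D A (%bt. S (- bt 0))"
 by (rule D_app1[OF assms DF_minus[OF DF_var]])

lemma ev_top:
 assumes "D A (%bt. S (bt 0))" obtains t where "!!x y. t < x ==> t < y ==> S x = S y"
proof -
 obtain C where C: "finite C" "!!x y. x <= y ==> (!!c. c : C ==> ~ (x <= c & c <= y)) ==> S x = S y"
  by (rule OMfin[OF assms]) blast
 have t: "c <= Max (insert 0 C)" if "c : C" for c using C(1) that by simp
 have "S x = S y" if "Max (insert 0 C) < x" "x <= y" for x y
  by (rule C(2)) (use that t in \<open>force+\<close>)
 then have "S x = S y" if "Max (insert 0 C) < x" "Max (insert 0 C) < y" for x y
  using that by (metis linear)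
 then show ?thesis by (rule that)
qed

definition is_sup :: "('k => bool) => 'k => bool" where
 "is_sup S s <-> (ALL x. S x --> x <= s) & (ALL b. (ALL x. S x --> x <= b) --> s <= b)"

lemma is_sup_unique: "is_sup S s ==> is_sup S t ==> s = t"
 unfolding is_sup_def by (meson order_antisym)

lemma is_sup_less: "is_sup S s ==> t < s ==> EX x. S x & t < x"
 unfolding is_sup_def by (meson not_le)

text \<open>Definability replaces completeness. The set \<open>U\<close> of upper bounds is constant
  off a finite set \<open>C\<close>. If \<open>U\<close> has no least element, take \<open>v\<close>
  in \<open>U\<close> below all points of \<open>C\<close> in \<open>U\<close>; then
  \<open>U\<close> reaches from \<open>v\<close> down to the largest point \<open>c0\<close> of
  \<open>C\<close> outside \<open>U\<close> (or \<open>x0\<close>), and \<open>c0\<close> turns out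
  to be an upper bound itself.\<close>

lemma sup_exists:
 assumes S: "D A (%bt. S (bt 0))" and ne: "S x0" and bd: "!!x. S x ==> x <= b"
 obtains s where "is_sup S s"
proof -
 define U where "U u <-> (ALL x. S x --> x <= u)" for u
 have "D A (%bt. U (bt 0))" unfolding U_def
  by (intro D_base DF_base D_app1[OF S])
 then obtain C where C: "finite C" "!!x y. x <= y ==> (!!c. c : C ==> ~ (x <= c & c <= y)) ==> U x = U y"
  by (rule OMfin) blast
 have up: "U u ==> u <= v ==> U v" for u v unfolding U_def by force
 have Ub: "U b" using bd by (auto simp: U_def)
 define c1 where "c1 = Min (insert b {c:C. U c})"
 define c0 where "c0 = Max (insert x0 {c:C. ~ U c})"
 have c1U: "U c1" unfolding c1_def using C(1) Ub Min_in[of "insert b {c:C. U c}"] by auto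
 show ?thesis
 proof (cases "EX s. U s & (ALL v. U v --> s <= v)")
  case True
  then show ?thesis using that unfolding is_sup_def U_def by blast
 next
  case False
  then have F: "U u ==> EX v. U v & v < u" for u by (meson not_le)
  have x0: "~ U v" if "v < x0" for v using ne that unfolding U_def by force
  from F[OF c1U] obtain v where v: "U v" "v < c1" by blast
  have c0v: "c < v" if "~ U c" for c using up v(1) that by (meson not_le)
  have Ule: "c1 <= c" if "c : C" "U c" for c unfolding c1_def using C(1) that by simp
  let ?s = "c0"
  have c0C: "c <= c0" if "c : C" "~ U c" for c unfolding c0_def using C(1) that by simp
  have "is_sup S c0"
  proof -
   have key: "U w" if w: "c0 < w" "w <= v" for w
   proof -
    have "U w = U v"
     by (rule C(2)) (use w v Ule c0C in \<open>force+\<close>)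
    then show ?thesis using v by simp
   qed
   have "x <= c0" if "S x" for x
   proof (rule ccontr)
    assume "~ x <= c0"
    then have c: "c0 < x" by simp
    have cv: "c0 < v"
    proof -
     have "x <= v" using v(1) that by (auto simp: U_def)
     then show ?thesis using c by simp
    qed
    define w where "w = (c0 + min x v) / 2"
    have "c0 < w" "w < x" "w <= v" using c cv by (auto simp: w_def min_def field_simps)
    then have "U w" by (intro key)
    then show False using that \<open>w < x\<close> by (auto simp: U_def)
   qed
   then have "U c0" by (simp add: U_def)
   then have "c0 = x0" unfolding c0_def using C(1) Max_in[of "insert x0 {c:C. ~ U c}"] by auto
   then show ?thesis using \<open>U c0\<close> ne unfolding is_sup_def U_def by auto
  qed
  then show ?thesis by (rule that)
 qed
qed

text \<open>A total supremum with default 0. By \<open>DF_supd\<close> it is definable uniformly in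
  parameters, which is how the mere existence of a radius is turned into a definable radius
  function.\<close>

definition supd :: "('k => bool) => 'k" where
 "supd S = (if EX s. is_sup S s then THE s. is_sup S s else 0)"

lemma supd_eq: "is_sup S s ==> supd S = s"
 unfolding supd_def using is_sup_unique by (metis the_equality)

lemma DF_supd:
 assumes "D A (%bt. R (bt 0) (%i. bt (Suc i)))" shows "DF A (%bt. supd (%y. R y bt))"
proof (rule DF_I[where R = "%s bt. is_sup (%y. R y bt) s | (s = 0 & ~ (EX s. is_sup (%y. R y bt) s))"])
 have 1: "D A (%bt. R (bt 0) (%i. bt (Suc (Suc i))))"
  using D_ren[OF assms, of "%i. case i of 0 => 0 | Suc j => Suc (Suc j)"] by (simp only: nat.case)
 have 2: "D A (%bt. R (bt 0) (%i. bt (Suc (Suc (Suc i)))))"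
  using D_ren[OF assms, of "%i. case i of 0 => 0 | Suc j => Suc (Suc (Suc j))"] by (simp only: nat.case)
 have 3: "D A (%bt. R (bt 0) (%i. bt (Suc (Suc (Suc (Suc i))))))"
  using D_ren[OF assms, of "%i. case i of 0 => 0 | Suc j => Suc (Suc (Suc (Suc j)))"] by (simp only: nat.case)
 show "D A (%bt. is_sup (%y. R y (%i. bt (Suc i))) (bt 0) |
      (bt 0 = 0 & ~ (EX s. is_sup (%y. R y (%i. bt (Suc i))) s)))"
  unfolding is_sup_def by (intro D_base DF_base 1 2 3)
 show "y = supd (%y. R y bt) <-> is_sup (%y. R y bt) y | (y = 0 & ~ (EX s. is_sup (%y. R y bt) s))" for bt y
  by (metis supd_eq supd_def)
qed

lemma inf_exists:
 assumes S: "D A (%bt. S (bt 0))" and ne: "S x0" and bd: "!!x. S x ==> b <= x"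
 obtains s where "!!x. S x ==> s <= x" "!!t. s < t ==> EX x. S x & x < t"
proof -
 obtain s where s: "is_sup (%x. S (- x)) s"
  by (rule sup_exists[OF D_reflect[OF S], of "- x0" "- b"]) (use ne bd in force)+
 show ?thesis
 proof (rule that[of "- s"])
  show "- s <= x" if "S x" for x using s that unfolding is_sup_def by (metis minus_le_iff minus_minus)
  show "EX x. S x & x < t" if "- s < t" for t
   using is_sup_less[OF s, of "- t"] that by (metis minus_less_iff)
 qed
qed

text \<open>At a point off the exceptional set the truth value agrees with that of all points
  slightly to the right, so a member there would bring a whole interval with it.\<close>

lemma finite_if_no_interval:
 assumes S: "D A (%bt. S (bt 0))" and no: "!!a b. a < b ==> EX x. a < x & x < b & ~ S x"
 shows "finite {x. S x}"
proof -
 obtain C where C: "finite C" "!!x y. x <= y ==> (!!c. c : C ==> ~ (x <= c & c <= y)) ==> S x = S y"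
  by (rule OMfin[OF S]) blast
 have "x : C" if "S x" for x
 proof (rule ccontr)
  assume x: "x ~: C"
  define d where "d = Min (insert 1 ((%c. c - x) ` {c:C. c > x}))"
  have "d > 0" using C(1) by (auto simp: d_def)
  have d: "d <= c - x" if "c : C" "c > x" for c
   unfolding d_def using C(1) that by (intro Min_le) auto
  obtain y where y: "x < y" "y < x + d" "~ S y" using no[of x "x + d"] \<open>d > 0\<close> by auto
  have "S x = S y" by (rule C(2)) (use y d x in \<open>force+\<close>)
  then show False using y that by simp
 qed
 then show ?thesis using C(1) by (metis finite_subset mem_Collect_eq subsetI)
qed

definition bdp :: "('k => bool) => 'k => bool" where
 "bdp S c <-> (ALL d>0. EX x. \<bar>x - c\<bar> < d & S x ~= S c)"

lemma D_bdp: assumes "D A (%bt. S (bt 0))" shows "D A (%bt. bdp S (bt 0))"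
 unfolding bdp_def by (intro D_base DF_base D_app1[OF assms])

lemma finite_bdp: assumes S: "D A (%bt. S (bt 0))" shows "finite {c. bdp S c}"
proof (rule finite_if_no_interval[OF D_bdp[OF S]])
 fix a b :: 'k assume "a < b"
 obtain d where d: "d > 0" "!!x y. a < x ==> x < a + d ==> a < y ==> y < a + d ==> S x = S y"
  by (rule ev_right[OF S, of a]) blast
 define e where "e = min d (b - a) / 2"
 have e: "e > 0" "e < d" "e < b - a" "e <= d - e" using d(1) \<open>a < b\<close> by (auto simp: e_def min_def field_simps)
 have "~ bdp S (a + e)"
 proof
  assume "bdp S (a + e)"
  then obtain x where "\<bar>x - (a + e)\<bar> < e" "S x ~= S (a + e)" using e(1) unfolding bdp_def by blast
  moreover have "S x = S (a + e)" by (rule d(2)) (use calculation(1) e in \<open>auto simp: abs_less_iff\<close>)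
  ultimately show False by simp
 qed
 then show "EX x. a < x & x < b & ~ bdp S x" using e by (intro exI[of _ "a + e"]) auto
qed

text \<open>The least element of a finite definable set is definable; it is removed and the
  cardinality drops.\<close>

lemma finite_subset_dcl:
 assumes "D A (%bt. S (bt 0))" "finite {x. S x}" shows "{x. S x} <= dcl A"
 using assms
proof (induction "card {x. S x}" arbitrary: S)
 case 0 then show ?case by simp
next
 case (Suc n)
 note S = Suc.prems(1)
 have ne: "{x. S x} ~= {}" using Suc.hyps(2) by (metis card.empty nat.distinct(1))
 define m where "m = Min {x. S x}"
 have m: "S m" "!!x. S x ==> m <= x" using Min_in[OF Suc.prems(2) ne] Suc.prems(2) by (auto simp: m_def)
 have "D A (%bt. S (bt 0) & (ALL x. S x --> bt 0 <= x))"
  by (intro D_base DF_base D_app1[OF S])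
 moreover have "(S y & (ALL x. S x --> y <= x)) = (y = m)" for y using m by (meson order_antisym)
 ultimately have md: "m : dcl A" by (intro dclI) (simp only:)
 define S' where "S' x <-> S x & x ~= m" for x
 have "D (dcl A) (%bt. S' (bt 0))" unfolding S'_def
  by (intro D_base DF_base DF_const md D_mono[OF D_app1[OF S] subset_dcl])
 then have D': "D A (%bt. S' (bt 0))" by (rule D_dcl)
 have eq: "{x. S' x} = {x. S x} - {m}" by (auto simp: S'_def)
 have "card {x. S' x} = n" unfolding eq using m Suc.hyps(2) Suc.prems(2) by simp
 then have "{x. S' x} <= dcl A" using Suc.hyps(1)[of S'] D' Suc.prems(2) eq by simp
 then show ?case using md eq by auto
qed

lemma bdp_dcl: "D A (%bt. S (bt 0)) ==> bdp S c ==> c : dcl A"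
 using finite_subset_dcl[OF D_bdp finite_bdp] by blast

text \<open>The points where \<open>S\<close> fails to be locally constant form a finite
  \<open>A\<close>-definable set, hence lie in \<open>dcl A\<close>. So a point outside
  \<open>dcl A\<close> is generic: an \<open>A\<close>-definable property holding there holds
  nearby. Openness, continuity and differentiability at independent tuples all rest on this.\<close>

lemma not_dcl_nbhd:
 assumes "D A (%bt. S (bt 0))" "c ~: dcl A"
 obtains d where "d > 0" "!!x. \<bar>x - c\<bar> < d ==> S x = S c"
 using bdp_dcl[OF assms(1)] assms(2) unfolding bdp_def by blast

end

section \<open>Continuity and derivatives over an ordered field\<close>

definition has_d :: "('k::linordered_field => 'k) => 'k => 'k => bool" where
 "has_d f x c <-> (ALL e>0. EX d>0. ALL h. \<bar>h\<bar> < d --> \<bar>f (x + h) - f x - c * h\<bar> <= e * \<bar>h\<bar>)"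

definition contat :: "('k::linordered_field => 'k) => 'k => bool" where
 "contat f x <-> (ALL e>0. EX d>0. ALL y. \<bar>y - x\<bar> < d --> \<bar>f y - f x\<bar> < e)"

definition evr :: "('k::linordered_field => bool) => bool" where
 "evr P <-> (EX d>0. ALL h. 0 < h & h < d --> P h)"

definition derivk :: "('k::linordered_field => 'k) => 'k => 'k" where
 "derivk f x = (if EX c. has_d f x c then THE c. has_d f x c else 0)"

lemma has_d_unique: assumes "has_d f x a" "has_d f x b" shows "a = b"
proof (rule ccontr)
 assume ne: "a ~= b"
 define e where "e = \<bar>a - b\<bar> / 3"
 have e: "e > 0" using ne by (simp add: e_def)
 obtain d1 where d1: "d1 > 0" "!!h. \<bar>h\<bar> < d1 ==> \<bar>f (x + h) - f x - a * h\<bar> <= e * \<bar>h\<bar>"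
  using assms(1) e unfolding has_d_def by blast
 obtain d2 where d2: "d2 > 0" "!!h. \<bar>h\<bar> < d2 ==> \<bar>f (x + h) - f x - b * h\<bar> <= e * \<bar>h\<bar>"
  using assms(2) e unfolding has_d_def by blast
 define h where "h = min d1 d2 / 2"
 have h: "h > 0" "h < d1" "h < d2" using d1(1) d2(1) by (auto simp: h_def min_def field_simps)
 have "\<bar>(a - b) * h\<bar> <= e * h + e * h"
  using d1(2)[of h] d2(2)[of h] h by (simp add: algebra_simps abs_le_iff)
 moreover have "\<bar>h\<bar> = h" using h(1) by simp
 ultimately have "\<bar>a - b\<bar> * h <= (2 * e) * h" by (simp only: abs_mult mult_2 distrib_right)
 then have "\<bar>a - b\<bar> <= 2 * e" by (rule mult_right_le_imp_le[OF _ h(1)])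
 then show False using e by (simp add: e_def)
qed

lemma derivk_eq: "has_d f x c ==> derivk f x = c"
 unfolding derivk_def using has_d_unique by (metis the_equality)

lemma has_d_cont: assumes "has_d f x c" shows "contat f x"
 unfolding contat_def
proof (intro allI impI)
 fix e :: 'a assume e: "e > 0"
 obtain d where d: "d > 0" "!!h. \<bar>h\<bar> < d ==> \<bar>f (x + h) - f x - c * h\<bar> <= 1 * \<bar>h\<bar>"
  using assms unfolding has_d_def by (metis zero_less_one)
 define m where "m = \<bar>c\<bar> + 1"
 have m: "m > 0" by (simp add: m_def add_nonneg_pos)
 show "EX d>0. ALL y. \<bar>y - x\<bar> < d --> \<bar>f y - f x\<bar> < e"
 proof (intro exI[of _ "min d (e / m)"] conjI allI impI)
  show "0 < min d (e / m)" using d(1) e m by simp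
  fix y assume y: "\<bar>y - x\<bar> < min d (e / m)"
  have "\<bar>f (x + (y - x)) - f x - c * (y - x)\<bar> <= 1 * \<bar>y - x\<bar>" by (rule d(2)) (use y in simp)
  then have "\<bar>f y - f x\<bar> <= \<bar>y - x\<bar> + \<bar>c * (y - x)\<bar>" by (simp add: abs_le_iff abs_if split: if_splits)
  also have "\<dots> = m * \<bar>y - x\<bar>" by (simp only: m_def abs_mult) (simp add: distrib_right)
  also have "\<dots> < e" using y m by (simp add: field_simps)
  finally show "\<bar>f y - f x\<bar> < e" .
 qed
qed

lemma evr_mono: "evr P ==> (!!h. 0 < h ==> P h ==> Q h) ==> evr Q"
 unfolding evr_def by meson

lemma contat_uminus: "contat f x ==> contat (%x. - f x) x"
 unfolding contat_def by (metis abs_minus_commute add.commute diff_minus_eq_add uminus_add_conv_diff)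

lemma contat_diff_lin:
 assumes "contat f x" shows "contat (%x. f x - c * x) x"
 unfolding contat_def
proof (intro allI impI)
 fix e :: 'a assume e: "e > 0"
 then obtain d where d: "d > 0" "!!y. \<bar>y - x\<bar> < d ==> \<bar>f y - f x\<bar> < e / 2"
  using assms unfolding contat_def by (metis half_gt_zero)
 define m where "m = 2 * (\<bar>c\<bar> + 1)"
 have m: "m > 0" by (simp add: m_def add_nonneg_pos)
 show "EX d>0. ALL y. \<bar>y - x\<bar> < d --> \<bar>f y - c * y - (f x - c * x)\<bar> < e"
 proof (intro exI[of _ "min d (e / m)"] conjI allI impI)
  show "0 < min d (e / m)" using d(1) e m by simp
  fix y assume y: "\<bar>y - x\<bar> < min d (e / m)"
  have m2: "m / 2 = \<bar>c\<bar> + 1" by (simp add: m_def)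
  have "\<bar>c * (y - x)\<bar> <= (m / 2) * \<bar>y - x\<bar>" unfolding m2 abs_mult by (rule mult_right_mono) auto
  also have "\<dots> < e / 2" using y m by (simp add: field_simps)
  finally have "\<bar>c * (y - x)\<bar> < e / 2" .
  moreover have "\<bar>f y - f x\<bar> < e / 2" using d(2) y by simp
  moreover have eq: "f y - c * y - (f x - c * x) = (f y - f x) - c * (y - x)" by (simp add: algebra_simps)
  ultimately show "\<bar>f y - c * y - (f x - c * x)\<bar> < e"
   unfolding eq using abs_triangle_ineq4[of "f y - f x" "c * (y - x)"] by linarith
 qed
qed

section \<open>Definable choice\<close>

context omf
begin

text \<open>A canonical member of a definable set with a nonnegative element: the infimum m of its
  nonnegative part if this is a member, otherwise the midpoint of an initial interval to the right
  of m, whose length is taken maximal but at most 1 so that the supremum exists.\<close>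

definition pickp :: "('k => bool) => 'k" where
 "pickp S = (let m = - supd (%x. S (- x) & 0 <= - x) in
   if S m & 0 <= m then m
   else m + supd (%e. e <= 1 & (ALL x. m < x & x < m + e --> S x)) / 2)"

lemma pickp:
 assumes S: "D A (%bt. S (bt 0))" and t: "S t" "0 <= t" shows "S (pickp S)"
proof -
 obtain s where s: "is_sup (%x. S (- x) & 0 <= - x) s"
  by (rule sup_exists[of A "%x. S (- x) & 0 <= - x" "- t" 0])
   (intro D_base DF_base D_app1[OF S], use t in auto)
 define m where "m = - s"
 have m: "- supd (%x. S (- x) & 0 <= - x) = m" using supd_eq[OF s] by (simp add: m_def)
 show ?thesis
 proof (cases "S m & 0 <= m")
  case True
  then show ?thesis unfolding pickp_def Let_def m by simp
 next
  case False
  have lo: "m <= x" if "S x" "0 <= x" for x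
   using s that unfolding is_sup_def m_def by (metis minus_le_iff minus_minus)
  obtain d where d: "d > 0" "!!x y. m < x ==> x < m + d ==> m < y ==> y < m + d ==> S x = S y"
   by (rule ev_right[OF S, of m]) blast
  obtain x where x: "S x" "0 <= x" "x < m + d"
   using is_sup_less[OF s, of "s - d"] d(1) by (auto simp: m_def)
  have mx: "m < x" using lo[OF x(1,2)] False x by (metis order_le_less)
  let ?E = "%e. e <= 1 & (ALL x. m < x & x < m + e --> S x)"
  have "S y" if "m < y" "y < m + min d 1" for y
   using d(2)[OF mx x(3), of y] that x(1) by simp
  then have Ed: "?E (min d 1)" by simp
  obtain e where e: "is_sup ?E e"
   by (rule sup_exists[of UNIV ?E "min d 1" 1])
    (intro D_base DF_base DF_const UNIV_I D_app1[OF D_UNIV[OF S]], use Ed in auto)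
  have "e \<ge> min d 1" using e Ed unfolding is_sup_def by blast
  then have e0: "e > 0" using d(1) by (meson less_le_trans min_less_iff_conj zero_less_one)
  obtain e' where "?E e'" "e / 2 < e'" using is_sup_less[OF e, of "e / 2"] e0 by auto
  then have "S (m + e / 2)" using e0 by auto
  moreover have "pickp S = m + e / 2"
   unfolding pickp_def m Let_def supd_eq[OF e] if_not_P[OF False] by (rule refl)
  ultimately show ?thesis by simp
 qed
qed

lemma DF_pickp:
 assumes "D A (%bt. R (bt 0) (%i. bt (Suc i)))" shows "DF A (%bt. pickp (%y. R y bt))"
proof -
 have R: "D A (%bt. R (g bt) bt)" if "DF A g" for g using D_sub1'[OF assms that] .
 have Rs: "D A (%bt. R (g bt) (%i. bt (Suc i)))" if "DF A g" for g
 proof -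
  have "D A (%bt. R (bt 0) (%i. bt (Suc (Suc i))))"
   using D_ren[OF assms, of "%i. case i of 0 => 0 | Suc j => Suc (Suc j)"] by (simp only: nat.case)
  then show ?thesis by (rule D_sub1'[where R = "%y bt. R y (%i. bt (Suc i))", OF _ that])
 qed
 have Rss: "D A (%bt. R (bt 0) (%i. bt (Suc (Suc i))))"
  using D_ren[OF assms, of "%i. case i of 0 => 0 | Suc j => Suc (Suc j)"] by (simp only: nat.case)
 have 1: "DF A (%bt. - supd (%x. R (- x) bt & 0 <= - x))"
  by (rule DF_minus, rule DF_supd[where R = "%x bt. R (- x) bt & 0 <= - x"])
   (intro D_base DF_base Rs)
 define M where "M bt = - supd (%x. R (- x) bt & 0 <= - x)" for bt
 have M: "DF A M" using 1 by (simp only: M_def[abs_def])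
 have M1: "DF A (%bt. M (%i. bt (Suc i)))" "DF A (%bt. M (%i. bt (Suc (Suc i))))"
  by (rule DF_ren[OF M])+
 have "DF A (%bt. if R (M bt) bt & 0 <= M bt then M bt else M bt + supd (%e. e <= 1 & (ALL x. M bt < x & x < M bt + e --> R x bt)) / 2)"
  by (intro DF_if D_base DF_base R M DF_supd[where R = "%e bt. e <= 1 & (ALL x. M bt < x & x < M bt + e --> R x bt)"] M1 Rss)
 then show ?thesis by (simp only: pickp_def M_def Let_def)
qed

lemma choice1:
 assumes "D A (%bt. R (bt 0) (%i. bt (Suc i)))"
 obtains s where "DF A s" "!!bt y. R y bt ==> R (s bt) bt"
proof -
 define s where "s bt = (if EX y. R y bt & 0 <= y then pickp (%y. R y bt) else - pickp (%y. R (- y) bt))" for bt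
 have R: "D A (%bt. R (g bt) (%i. bt (Suc i)))" if "DF A g" for g
 proof -
  have "D A (%bt. R (bt 0) (%i. bt (Suc (Suc i))))"
   using D_ren[OF assms, of "%i. case i of 0 => 0 | Suc j => Suc (Suc j)"] by (simp only: nat.case)
  then show ?thesis by (rule D_sub1'[where R = "%y bt. R y (%i. bt (Suc i))", OF _ that])
 qed
 have "DF A s" unfolding s_def[abs_def]
  by (intro DF_if D_base DF_base assms DF_pickp[where R = R] DF_pickp[where R = "%y. R (- y)"] R)
 moreover have "R (s bt) bt" if "R y bt" for bt y
 proof -
  have "DF UNIV (%gm. case i of 0 => gm 0 | Suc j => bt j)" for i
   by (cases i) (simp_all add: DF_var DF_const)
  then have "D UNIV (%gm. R (gm 0) bt)"
   using D_subst[OF D_UNIV[OF assms], of "%i gm. case i of 0 => gm 0 | Suc j => bt j"]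
   by simp
  then have S: "D UNIV (%gm. (%y. R y bt) (gm 0))" "D UNIV (%gm. (%y. R (- y) bt) (gm 0))"
   using D_reflect[of UNIV "%y. R y bt"] by auto
  show ?thesis
  proof (cases "EX y. R y bt & 0 <= y")
   case True then show ?thesis using pickp[OF S(1)] by (auto simp: s_def)
  next
   case False
   then have "R (- (- y)) bt" "0 <= - y" using that by auto
   then show ?thesis using pickp[OF S(2), of "- y"] False by (auto simp: s_def)
  qed
 qed
 ultimately show ?thesis by (rule that)
qed

text \<open>Only finitely many of the odd variables matter, by \<open>D_support\<close>, and these
  are chosen by induction on their number: the first n as functions of the last one and of
  \<open>bt\<close>, then the last one as a function of \<open>bt\<close>, which is finally
  substituted into the others.\<close>

lemma Skolem:
 assumes "D A P"
 obtains s :: "nat => (nat => 'k) => 'k" where "!!i. DF A (s i)" "!!bt bs. P (mix bt bs) ==> P (mix bt (%i. s i bt))"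
proof -
 let ?pre = "%n bs bt i::nat. if i < n then bs i else bt (i - n)"
 have *: "ALL P. D A P --> (EX s :: nat => (nat => 'k) => 'k. (ALL i. DF A (s i)) & (ALL bt bs. P (?pre n bs bt) --> P (?pre n (%i. s i bt) bt)))" for n
 proof (induction n)
  case 0
  show ?case by (auto intro!: exI[of _ "%i bt. 0"] DF_0)
 next
  case (Suc n)
  show ?case
  proof (intro allI impI)
   fix P :: "(nat => 'k) => bool" assume P: "D A P"
   obtain s :: "nat => (nat => 'k) => 'k" where s: "!!i. DF A (s i)"
    "!!bt bs. P (?pre n bs bt) ==> P (?pre n (%i. s i bt) bt)"
    using Suc P by blast
   define P' where "P' gm = P (?pre n (%i. s i gm) gm)" for gm
   have "D A P'" unfolding P'_def[abs_def]
    by (rule D_subst[OF P, where ta = "%i gm. if i < n then s i gm else gm (i - n)"])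
     (rename_tac i, case_tac "i < n", simp_all add: s(1) DF_var)
   then have "D A (%bt. P' (case_nat (bt 0) (%i. bt (Suc i))))"
   proof -
    assume P': "D A P'"
    have eta: "case_nat (bt 0) (%i. bt (Suc i)) = bt" for bt :: "nat => 'k"
     by (rule ext) (simp split: nat.split)
    show ?thesis unfolding eta by (rule P')
   qed
   then obtain t where t: "DF A t" "!!bt y. P' (case_nat y bt) ==> P' (case_nat (t bt) bt)"
    by (rule choice1[where R = "%y bt. P' (case_nat y bt)"]) blast
   define s' where "s' i bt = (if i < n then s i (case_nat (t bt) bt) else t bt)" for i bt
   have "DF A (s' i)" for i
   proof (cases "i < n")
    case True
    have "DF A (%bt. s i (%j. case j of 0 => t bt | Suc k => bt k))"
     by (rule DF_subst[OF s(1), where ta = "%j bt. case j of 0 => t bt | Suc k => bt k"])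
      (rename_tac j, case_tac j, simp_all add: t(1) DF_var)
    then show ?thesis using True by (simp add: s'_def[abs_def])
   qed (simp add: s'_def[abs_def] t(1))
   moreover have "P (?pre (Suc n) (%i. s' i bt) bt)" if "P (?pre (Suc n) bs bt)" for bt bs
   proof -
    have e: "?pre (Suc n) bs bt = ?pre n bs (case_nat (bs n) bt)" for bs
     by (rule ext) (auto simp: less_Suc_eq Suc_diff_le not_less split: nat.split, metis Suc_diff_le diff_Suc_Suc le_neq_implies_less less_Suc_eq_le nat.inject not_less_eq_eq)
    have "P' (case_nat (bs n) bt)" unfolding P'_def by (rule s(2)[of bs]) (use that in \<open>simp only: e\<close>)
    then have "P' (case_nat (t bt) bt)" by (rule t(2))
    moreover have "?pre n (%i. s i (case_nat (t bt) bt)) (case_nat (t bt) bt) = ?pre n (%i. s' i bt) (case_nat (s' n bt) bt)"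
     by (rule ext) (simp add: s'_def split: nat.split)
    ultimately show ?thesis unfolding e P'_def by simp
   qed
   ultimately show "EX s :: nat => (nat => 'k) => 'k. (ALL i. DF A (s i)) & (ALL bt bs. P (?pre (Suc n) bs bt) --> P (?pre (Suc n) (%i. s i bt) bt))"
    by blast
  qed
 qed
 obtain n where n: "!!bt gm. (ALL i<n. bt i = gm i) ==> P bt = P gm" using D_support[OF assms] by blast
 have "D A (%bt. P (%i. bt (if even i then n + i div 2 else i div 2)))" by (rule D_ren[OF assms])
 then obtain s :: "nat => (nat => 'k) => 'k" where s: "!!i. DF A (s i)"
  "!!bt bs. P (%i. ?pre n bs bt (if even i then n + i div 2 else i div 2)) ==> P (%i. ?pre n (%i. s i bt) bt (if even i then n + i div 2 else i div 2))"
  using *[rule_format, of "%bt. P (%i. bt (if even i then n + i div 2 else i div 2))" n] by blast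
 have e: "P (%i. ?pre n bs bt (if even i then n + i div 2 else i div 2)) = P (mix bt bs)" for bt bs
  by (rule n) (auto simp: mix_def)
 show ?thesis
 proof (rule that[of s, OF s(1)])
  show "P (mix bt (%i. s i bt))" if "P (mix bt bs)" for bt bs
   using s(2)[of bs bt] e[of bs bt] e[of "%i. s i bt" bt] that by simp
 qed
qed

end

section \<open>Monotonicity and differentiability on subintervals\<close>

context omf
begin

abbreviation df :: "('k => 'k) => bool" where "df f \<equiv> DF UNIV (%bt. f (bt 0))"
abbreviation ds :: "('k => bool) => bool" where "ds S \<equiv> D UNIV (%bt. S (bt 0))"

lemmas DFU = DF_const[of _ UNIV, OF UNIV_I]

lemma sub_const:
 assumes "ds S" "a < b"
 obtains a' b' where "a <= a'" "a' < b'" "b' <= b" "!!x y. a' < x ==> x < b' ==> a' < y ==> y < b' ==> S x = S y"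
proof -
 obtain d where d: "d > 0" "!!x y. a < x ==> x < a + d ==> a < y ==> y < a + d ==> S x = S y"
  by (rule ev_right[OF assms(1), of a]) blast
 show ?thesis
 proof (rule that[of a "min b (a + d)"])
  show "S x = S y" if "a < x" "x < min b (a + d)" "a < y" "y < min b (a + d)" for x y
   using d(2)[of x y] that by simp
 qed (use d(1) assms(2) in simp_all)
qed

text \<open>Otherwise each set where \<open>dt\<close> is at least d > 0 contains no interval and is
  finite. A finite image has a positive minimum, which is absurd on an infinite interval. An
  infinite image contains an interval, and infinitely many values above its midpoint would be taken
  on a finite set.\<close>

lemma bdd_below_sub:
 assumes f: "df dt" and ab: "a < b" and pos: "!!x. a < x ==> x < b ==> dt x > 0"
 obtains a' b' d where "a <= a'" "a' < b'" "b' <= b" "d > 0" "!!x. a' < x ==> x < b' ==> d <= dt x"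
proof -
 have "EX a' b' d. a <= a' & a' < b' & b' <= b & d > 0 & (ALL x. a' < x & x < b' --> d <= dt x)"
 proof (rule ccontr)
  assume no: "~ ?thesis"
  have fin: "finite {x. a < x & x < b & d <= dt x}" if d: "d > 0" for d
  proof (rule finite_if_no_interval[of UNIV])
   show "ds (%x. a < x & x < b & d <= dt x)"
    by (intro D_base DF_base DFU DF_app1[where F = dt, OF f])
   fix u v :: 'k assume uv: "u < v"
   show "EX x. u < x & x < v & ~ (a < x & x < b & d <= dt x)"
   proof (rule ccontr)
    assume "~ ?thesis"
    then have *: "a < x & x < b & d <= dt x" if "u < x" "x < v" for x using that by blast
    have "a <= u" using * dense[OF uv] by (meson dense leI less_trans not_less_iff_gr_or_eq uv)
    moreover have "v <= b" using * dense[OF uv] by (meson dense leI less_trans not_less_iff_gr_or_eq uv)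
    ultimately show False using no uv d * by blast
   qed
  qed
  let ?I = "%y. EX x. a < x & x < b & dt x = y"
  have I: "ds ?I" by (intro D_base DF_base DFU DF_app1[where F = dt, OF f])
  show False
  proof (cases "finite {y. ?I y}")
   case True
   define m where "m = Min (insert 1 {y. ?I y})"
   have "m > 0" using True pos by (auto simp: m_def)
   have "{a<..<b} <= {x. a < x & x < b & m <= dt x}" using True by (auto simp: m_def intro!: Min_le)
   then show False using fin[OF \<open>m > 0\<close>] infinite_Ioo[OF ab] finite_subset by blast
  next
   case False
   then obtain p q where pq: "p < q" "!!y. p < y ==> y < q ==> ?I y"
    using finite_if_no_interval[OF I] by blast
   define m where "m = (p + q) / 2"
   have m: "p < m" "m < q" using pq(1) by (auto simp: m_def)
   then have "m > 0" using pq(2)[of m] pos by auto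
   have "{m<..<q} <= dt ` {x. a < x & x < b & m <= dt x}"
   proof
    fix y assume y: "y : {m<..<q}"
    then have "p < y" "y < q" using m by auto
    from pq(2)[OF this] y show "y : dt ` {x. a < x & x < b & m <= dt x}" by force
   qed
   then show False using finite_surj[OF fin[OF \<open>m > 0\<close>]] infinite_Ioo[OF m(2)] by blast
  qed
 qed
 then show ?thesis using that by blast
qed

text \<open>The radius up to which \<open>R x\<close> holds to the right of x, capped at 1, is a
  definable positive function of x. Where it is bounded below by d, the statement becomes uniform on
  a piece of length d.\<close>

lemma unif_sub:
 assumes R: "D UNIV (%bt. R (bt 0) (bt 1))" and ab: "a < b"
  and ev: "!!x. a < x ==> x < b ==> evr (%h. R x (x + h))"
 obtains a' b' where "a <= a'" "a' < b'" "b' <= b" "!!x y. a' < x ==> x < y ==> y < b' ==> R x y"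
proof -
 let ?E = "%x d. d <= 1 & (ALL h. 0 < h & h < d --> R x (x + h))"
 define dt where "dt x = supd (?E x)" for x
 have R': "D UNIV (%bt. R (f bt) (g bt))" if "DF UNIV f" "DF UNIV g" for f g
  by (rule D_app2[OF R that])
 have df: "df dt" unfolding dt_def
  by (rule DF_supd[where R = "%d bt. ?E (bt 0) d"]) (intro D_base DF_base R')
 have sup: "is_sup (?E x) (dt x) & dt x > 0" if x: "a < x" "x < b" for x
 proof -
  obtain d where d: "d > 0" "ALL h. 0 < h & h < d --> R x (x + h)" using ev[OF x] unfolding evr_def by blast
  have E: "?E x (min d 1)" using d by auto
  obtain s where s: "is_sup (?E x) s"
   by (rule sup_exists[of UNIV "?E x" "min d 1" 1]) (intro D_base DF_base DFU R', use E in auto)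
  have "min d 1 <= s" using s E unfolding is_sup_def by blast
  moreover have "min d 1 > 0" using d(1) by simp
  ultimately have "s > 0" by linarith
  then show ?thesis using s supd_eq[OF s] by (simp add: dt_def)
 qed
 obtain a' b' d where *: "a <= a'" "a' < b'" "b' <= b" "d > 0" "!!x. a' < x ==> x < b' ==> d <= dt x"
  by (rule bdd_below_sub[OF df ab]) (use sup in blast)+
 have r: "R x y" if "a' < x" "x < y" "y < min b' (a' + d)" for x y
 proof -
  have x: "a < x" "x < b" using that * by auto
  have "y - x < dt x" using *(5)[of x] that by auto
  then obtain e where "?E x e" "y - x < e" using sup[OF x] is_sup_less by blast
  then have "R x (x + (y - x))" using that by force
  then show ?thesis by simp
 qed
 show ?thesis by (rule that[of a' "min b' (a' + d)"]) (use *(1-4) r in simp_all)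
qed

lemma evr_dec: assumes "ds S" shows "evr (%h. S (x + h)) | evr (%h. ~ S (x + h))"
proof -
 obtain d where d: "d > 0" "!!u v. x < u ==> u < x + d ==> x < v ==> v < x + d ==> S u = S v"
  by (rule ev_right[OF assms, of x]) blast
 show ?thesis
 proof (cases "S (x + d / 2)")
  case True
  have "S (x + h)" if "0 < h" "h < d" for h using d(2)[of "x + h" "x + d / 2"] that d(1) True by simp
  then show ?thesis using d(1) unfolding evr_def by blast
 next
  case False
  have "~ S (x + h)" if "0 < h" "h < d" for h using d(2)[of "x + h" "x + d / 2"] that d(1) False by simp
  then show ?thesis using d(1) unfolding evr_def by blast
 qed
qed

text \<open>To the right of each point \<open>f\<close> is eventually larger, equal or smaller.
  Which case occurs is a definable property of the point, hence constant on a subinterval, where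
  \<open>unif_sub\<close> makes it uniform.\<close>

lemma mono_sub:
 assumes f: "df f" and ab: "a < b"
 obtains a' b' where "a <= a'" "a' < b'" "b' <= b"
  "(ALL x y. a' < x & x < y & y < b' --> f x < f y) | (ALL x y. a' < x & x < y & y < b' --> f x = f y)
   | (ALL x y. a' < x & x < y & y < b' --> f y < f x)"
proof -
 note f' = DF_app1[where F = f, OF f]
 have R1: "D UNIV (%bt. f (bt 0) < f (bt 1))" and R2: "D UNIV (%bt. f (bt 0) = f (bt 1))"
  and R3: "D UNIV (%bt. f (bt 1) < f (bt 0))"
  by (intro D_base DF_base f')+
 let ?G = "%x. evr (%h. f x < f (x + h))" and ?E = "%x. evr (%h. f x = f (x + h))"
 have G: "ds ?G" unfolding evr_def by (intro D_base DF_base f')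
 have E: "ds ?E" unfolding evr_def by (intro D_base DF_base f')
 obtain a1 b1 where 1: "a <= a1" "a1 < b1" "b1 <= b" "!!x y. a1 < x ==> x < b1 ==> a1 < y ==> y < b1 ==> ?G x = ?G y"
  by (rule sub_const[OF G ab]) blast
 obtain a2 b2 where 2: "a1 <= a2" "a2 < b2" "b2 <= b1" "!!x y. a2 < x ==> x < b2 ==> a2 < y ==> y < b2 ==> ?E x = ?E y"
  by (rule sub_const[OF E 1(2)]) blast
 obtain m where m: "a2 < m" "m < b2" using dense[OF 2(2)] by blast
 have le: "a <= a2" "b2 <= b" using 1 2 by auto
 show ?thesis
 proof (cases "?G m")
  case True
  moreover have "?G x = ?G m" if "a2 < x" "x < b2" for x by (rule 1(4)) (use that m 2 in auto)
  ultimately have "?G x" if "a2 < x" "x < b2" for x using that by blast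
  then obtain a' b' where "a2 <= a'" "a' < b'" "b' <= b2" "!!x y. a' < x ==> x < y ==> y < b' ==> f x < f y"
   using unif_sub[where R = "%x y. f x < f y", OF _ 2(2)] R1 by (metis (no_types, lifting))
  then show ?thesis using that[of a' b'] le by auto
 next
  case nG: False
  show ?thesis
  proof (cases "?E m")
   case True
   moreover have "?E x = ?E m" if "a2 < x" "x < b2" for x by (rule 2(4)) (use that m in auto)
   ultimately have "?E x" if "a2 < x" "x < b2" for x using that by blast
   then obtain a' b' where "a2 <= a'" "a' < b'" "b' <= b2" "!!x y. a' < x ==> x < y ==> y < b' ==> f x = f y"
    using unif_sub[where R = "%x y. f x = f y", OF _ 2(2)] R2 by (metis (no_types, lifting))
   then show ?thesis using that[of a' b'] le by auto
  next
   case False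
   have "evr (%h. f (x + h) < f x)" if x: "a2 < x" "x < b2" for x
   proof -
    have "?G x = ?G m" by (rule 1(4)) (use x m 2 in auto)
    moreover have "?E x = ?E m" by (rule 2(4)) (use x m in auto)
    ultimately have "~ ?G x" "~ ?E x" using nG False by blast+
    moreover have "?G x | evr (%h. ~ f x < f (x + h))"
     by (rule evr_dec[where S = "%y. f x < f y"]) (intro D_base DF_base DFU f')
    moreover have "?E x | evr (%h. ~ f x = f (x + h))"
     by (rule evr_dec[where S = "%y. f x = f y"]) (intro D_base DF_base DFU f')
    ultimately have "evr (%h. ~ f x < f (x + h))" "evr (%h. ~ f x = f (x + h))"
     by blast+
    then obtain d d' where d: "d > 0" "d' > 0" "ALL h. 0 < h & h < d --> ~ f x < f (x + h)" "ALL h. 0 < h & h < d' --> ~ f x = f (x + h)"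
     unfolding evr_def by blast
    then have "f (x + h) < f x" if "0 < h" "h < min d d'" for h
     using that by (metis linorder_neqE min_less_iff_conj)
    then show ?thesis unfolding evr_def using d(1,2) by (intro exI[of _ "min d d'"]) simp
   qed
   then obtain a' b' where "a2 <= a'" "a' < b'" "b' <= b2" "!!x y. a' < x ==> x < y ==> y < b' ==> f y < f x"
    using unif_sub[where R = "%x y. f y < f x", OF _ 2(2)] R3 by (metis (no_types, lifting))
   then show ?thesis using that[of a' b'] le by auto
  qed
 qed
qed

text \<open>A strictly increasing function has infinite image, so its image contains an interval.
  Between two points mapped into that interval, every intermediate value is attained, and
  monotonicity turns this into continuity.\<close>

lemma cont_incr:
 assumes f: "df f" and ab: "a < b" and inc: "!!x y. a < x ==> x < y ==> y < b ==> f x < f y"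
 obtains a' b' where "a <= a'" "a' < b'" "b' <= b" "!!x. a' < x ==> x < b' ==> contat f x"
proof -
 let ?I = "%y. EX x. a < x & x < b & f x = y"
 have I: "ds ?I" by (intro D_base DF_base DFU DF_app1[where F = f, OF f])
 have "infinite {y. ?I y}"
 proof
  assume "finite {y. ?I y}"
  moreover have "f ` {a<..<b} <= {y. ?I y}" by auto
  ultimately have "finite (f ` {a<..<b})" by (rule finite_subset[rotated])
  moreover have "inj_on f {a<..<b}" by (rule linorder_inj_onI') (use inc in force)
  ultimately show False using finite_imageD infinite_Ioo[OF ab] by blast
 qed
 then obtain p q where pq: "p < q" "!!y. p < y ==> y < q ==> ?I y"
  using finite_if_no_interval[OF I] by blast
 obtain r where r: "p < r" "r < q" using dense[OF pq(1)] by blast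
 obtain r' where r': "r < r'" "r' < q" using dense[OF r(2)] by blast
 obtain u where u: "a < u" "u < b" "f u = r" using pq(2)[of r] r by auto
 obtain v where v: "a < v" "v < b" "f v = r'" using pq(2)[of r'] r r' by auto
 have uv: "u < v" using inc[of v u] u v r' by (metis less_asym linorder_neqE not_less_iff_gr_or_eq)
 have "contat f x" if x: "u < x" "x < v" for x unfolding contat_def
 proof (intro allI impI)
  fix e :: 'k assume e: "e > 0"
  have fx: "r < f x" "f x < r'" using inc[of u x] inc[of x v] u v x by auto
  have "p < max r (f x - e / 2)" "max r (f x - e / 2) < q" "p < min r' (f x + e / 2)" "min r' (f x + e / 2) < q"
   using fx r r' e by (auto simp: max_def min_def)
  with pq(2) obtain x1 x2 where x1: "a < x1" "x1 < b" "f x1 = max r (f x - e / 2)"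
   and x2: "a < x2" "x2 < b" "f x2 = min r' (f x + e / 2)" by blast
  have "f x1 < f x" "f x < f x2" using x1 x2 fx e by auto
  then have lt: "x1 < x" "x < x2" using inc[of x x1] inc[of x2 x] x u v x1 x2
   by (smt (verit, best) linorder_neqE order_less_asym order_less_trans)+
  show "EX d>0. ALL y. \<bar>y - x\<bar> < d --> \<bar>f y - f x\<bar> < e"
  proof (intro exI[of _ "min (x - x1) (x2 - x)"] conjI allI impI)
   show "0 < min (x - x1) (x2 - x)" using lt by simp
   fix y assume "\<bar>y - x\<bar> < min (x - x1) (x2 - x)"
   then have y: "x1 < y" "y < x2" by (auto simp: abs_less_iff)
   have "f x1 < f y" "f y < f x2" using inc[of x1 y] inc[of y x2] y x1 x2 by auto
   then show "\<bar>f y - f x\<bar> < e" using x1(3) x2(3) e fx by (auto simp: abs_less_iff)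
  qed
 qed
 then show ?thesis using that[of u v] u v uv by auto
qed

lemma cont_sub:
 assumes f: "df f" and ab: "a < b"
 obtains a' b' where "a <= a'" "a' < b'" "b' <= b" "!!x. a' < x ==> x < b' ==> contat f x"
proof -
 obtain a1 b1 where 1: "a <= a1" "a1 < b1" "b1 <= b" and c:
  "(ALL x y. a1 < x & x < y & y < b1 --> f x < f y) | (ALL x y. a1 < x & x < y & y < b1 --> f x = f y)
   | (ALL x y. a1 < x & x < y & y < b1 --> f y < f x)"
  by (rule mono_sub[OF f ab]) blast
 from c show ?thesis
 proof (elim disjE)
  assume i: "ALL x y. a1 < x & x < y & y < b1 --> f x < f y"
  obtain a2 b2 where "a1 <= a2" "a2 < b2" "b2 <= b1" "!!x. a2 < x ==> x < b2 ==> contat f x"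
   by (rule cont_incr[OF f 1(2)]) (use i in blast)+
  then show ?thesis using that[of a2 b2] 1 by auto
 next
  assume i: "ALL x y. a1 < x & x < y & y < b1 --> f y < f x"
  have f': "df (%x. - f x)" by (rule DF_minus[OF f])
  obtain a2 b2 where 2: "a1 <= a2" "a2 < b2" "b2 <= b1" "!!x. a2 < x ==> x < b2 ==> contat (%x. - f x) x"
   by (rule cont_incr[OF f' 1(2)]) (use i in auto)
  show ?thesis using that[of a2 b2] 1 2 contat_uminus[of "%x. - f x"] by auto
 next
  assume i: "ALL x y. a1 < x & x < y & y < b1 --> f x = f y"
  have "contat f x" if x: "a1 < x" "x < b1" for x unfolding contat_def
  proof (intro allI impI exI[of _ "min (x - a1) (b1 - x)"] conjI)
   fix e y :: 'k assume e: "e > 0" "\<bar>y - x\<bar> < min (x - a1) (b1 - x)"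
   then have "a1 < y" "y < b1" by (auto simp: abs_less_iff)
   then have "f y = f x" using i x by (metis linorder_neqE)
   then show "\<bar>f y - f x\<bar> < e" using e by simp
  qed (use x in auto)
  then show ?thesis using that[of a1 b1] 1 by auto
 qed
qed

text \<open>Continuous induction, with definability providing the supremum of the initial segment on
  which \<open>f a\<close> is a lower bound. Continuity carries the bound to the supremum, and
  growth to the right carries it further unless the supremum is \<open>b\<close>.\<close>

lemma RT_weak:
 assumes f: "df f" and ab: "a <= b" and c: "!!x. a <= x ==> x <= b ==> contat f x"
  and r: "!!x. a <= x ==> x < b ==> evr (%h. f x < f (x + h))"
 shows "f a <= f b"
proof -
 define X where "X s <-> a <= s & s <= b & (ALL y. a <= y & y <= s --> f a <= f y)" for s
 have X: "ds X" unfolding X_def by (intro D_base DF_base DFU DF_app1[where F = f, OF f])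
 have Xa: "X a" using ab by (auto simp: X_def)
 have Xb: "X x ==> x <= b" for x by (simp add: X_def)
 obtain s where s: "is_sup X s"
  by (rule sup_exists[OF X Xa Xb])
 with Xb have sab: "a <= s" "s <= b" using Xa unfolding is_sup_def by blast+
 have lt: "f a <= f y" if y: "a <= y" "y < s" for y
 proof -
  obtain t where "X t" "y < t" using is_sup_less[OF s y(2)] by blast
  then show ?thesis using y by (auto simp: X_def)
 qed
 have fs: "f a <= f s"
 proof (rule ccontr)
  assume n: "~ f a <= f s"
  then have "f a - f s > 0" by simp
  then obtain d where d: "d > 0" "!!y. \<bar>y - s\<bar> < d ==> \<bar>f y - f s\<bar> < f a - f s"
   using c[OF sab] unfolding contat_def by blast
  have "a < s" using n sab by (cases "a = s") auto
  define y where "y = max a (s - d / 2)"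
  have "a <= y" "y < s" "\<bar>y - s\<bar> < d" using \<open>a < s\<close> d(1) by (auto simp: y_def max_def abs_less_iff)
  then show False using lt[of y] d(2)[of y] by auto
 qed
 have Xs: "X s" unfolding X_def using sab lt fs by (metis order_le_less)
 have "s = b"
 proof (rule ccontr)
  assume "s ~= b"
  then have sb: "s < b" using sab by simp
  obtain d where d: "d > 0" "!!h. 0 < h ==> h < d ==> f s < f (s + h)"
   using r[OF sab(1) sb] unfolding evr_def by blast
  define t where "t = min b (s + d / 2)"
  have t: "s < t" "t <= b" "t < s + d" using sb d(1) by (auto simp: t_def min_def)
  have "f a <= f y" if "s < y" "y <= t" for y
   using d(2)[of "y - s"] that t fs by auto
  then have "X t" unfolding X_def using Xs t sab unfolding X_def by (metis le_less_linear less_imp_le order_trans)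
  then show False using s t(1) unfolding is_sup_def by force
 qed
 then show ?thesis using fs by simp
qed

lemma RT:
 assumes f: "df f" and ab: "a < b" and c: "!!x. a <= x ==> x <= b ==> contat f x"
  and r: "!!x. a <= x ==> x < b ==> evr (%h. f x < f (x + h))"
 shows "f a < f b"
proof -
 obtain d where d: "d > 0" "!!h. 0 < h ==> h < d ==> f a < f (a + h)"
  using r[of a] ab unfolding evr_def by blast
 define t where "t = min b (a + d / 2)"
 have t: "a < t" "t <= b" "t < a + d" using ab d(1) by (auto simp: t_def min_def)
 have "f a < f t" using d(2)[of "t - a"] t by simp
 also have "f t <= f b" by (rule RT_weak[OF f t(2)]) (use c r t in auto)
 finally show ?thesis .
qed

end

context omf
begin

text \<open>Slopes to the right of x are eventually above c. The supremum of such c plays the part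
  of a right derivative, and no limit has to exist beforehand.\<close>

definition qd :: "('k => 'k) => 'k => 'k => bool" where
 "qd f x c <-> evr (%h. c * h < f (x + h) - f x)"

lemma df_lin: "df f ==> df (%x. f x - c * x)"
 by (rule DF_diff[where f = "%bt. f (bt 0)"], assumption) (intro DF_base DFU)

lemma qd_lin: "qd f x c <-> evr (%h. f x - c * x < f (x + h) - c * (x + h))"
 unfolding qd_def by (simp add: algebra_simps)

lemma qd_RT:
 assumes f: "df f" and ab: "a < b" and c: "!!x. a <= x ==> x <= b ==> contat f x"
  and r: "!!x. a <= x ==> x < b ==> qd f x c"
 shows "c * (b - a) < f b - f a"
proof -
 have "f a - c * a < f b - c * b"
  by (rule RT[OF df_lin[OF f] ab]) (use c r in \<open>auto simp: qd_lin intro: contat_diff_lin\<close>)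
 then show ?thesis by (simp add: algebra_simps)
qed

lemma qd_mono: "qd f x c ==> c' <= c ==> qd f x c'"
 unfolding qd_def by (erule evr_mono) (meson le_less_trans mult_right_mono order_less_imp_le)

lemma D_qd: assumes f: "df f" shows "D UNIV (%bt. qd f (bt i) (bt j))"
 unfolding qd_def evr_def by (intro D_base DF_base DF_app1[where F = f, OF f])

lemma not_qd: assumes f: "df f" and n: "~ qd f x c" shows "evr (%h. f (x + h) - f x <= c * h)"
proof -
 have "evr (%h. c * ((x + h) - x) < f (x + h) - f x) | evr (%h. ~ c * ((x + h) - x) < f (x + h) - f x)"
  by (rule evr_dec[where S = "%y. c * (y - x) < f y - f x"]) (intro D_base DF_base DFU DF_app1[where F = f, OF f])
 then show ?thesis using n unfolding qd_def by (simp add: not_less)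
qed

text \<open>Infinite right slope at every point would, by \<open>qd_RT\<close> with c the slope of a
  secant, make that secant steeper than itself.\<close>

lemma evr_unbounded_slope:
 assumes f: "df f" and ab: "a < b" shows "EX x. a < x & x < b & ~ (ALL c. qd f x c)"
proof (rule ccontr)
 assume n: "~ ?thesis"
 obtain a1 b1 where 1: "a <= a1" "a1 < b1" "b1 <= b" "!!x. a1 < x ==> x < b1 ==> contat f x"
  by (rule cont_sub[OF f ab]) blast
 obtain u where u: "a1 < u" "u < b1" using dense[OF 1(2)] by blast
 obtain v where v: "u < v" "v < b1" using dense[OF u(2)] by blast
 have "(f v - f u) / (v - u) * (v - u) < f v - f u"
  by (rule qd_RT[OF f v(1)]) (use 1 u v n in auto)
 then show False using v(1) by simp
qed

text \<open>On a subinterval the right slopes of \<open>f\<close> and of - f are not infinite, so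
  the right derivative \<open>Dp\<close> is a genuine definable function. Where it is continuous,
  \<open>qd_RT\<close> squeezes all nearby secants between \<open>Dp x - e\<close> and
  \<open>Dp x + e\<close>, on both sides of x.\<close>

lemma exists_deriv:
 assumes f: "df f" and ab: "a < b" shows "EX x. a < x & x < b & (EX c. has_d f x c)"
proof -
 have f': "df (%x. - f x)" by (rule DF_minus[OF f])
 let ?S1 = "%x. ALL c. qd f x c" and ?S2 = "%x. ALL c. qd (%x. - f x) x c"
 have S1: "ds ?S1" by (intro D_base D_qd[OF f])
 have S2: "ds ?S2" by (intro D_base D_qd[OF f'])
 obtain a1 b1 where 1: "a <= a1" "a1 < b1" "b1 <= b" "!!x y. a1 < x ==> x < b1 ==> a1 < y ==> y < b1 ==> ?S1 x = ?S1 y"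
  by (rule sub_const[OF S1 ab]) blast
 have n1: "~ ?S1 x" if "a1 < x" "x < b1" for x
  using evr_unbounded_slope[OF f 1(2)] 1(4) that by blast
 obtain a2 b2 where 2: "a1 <= a2" "a2 < b2" "b2 <= b1" "!!x y. a2 < x ==> x < b2 ==> a2 < y ==> y < b2 ==> ?S2 x = ?S2 y"
  by (rule sub_const[OF S2 1(2)]) blast
 have n2: "~ ?S2 x" if "a2 < x" "x < b2" for x
  using evr_unbounded_slope[OF f' 2(2)] 2(4) that by blast
 define Dp where "Dp x = supd (qd f x)" for x
 have Dp: "df Dp" unfolding Dp_def by (rule DF_supd[where R = "%c bt. qd f (bt 0) c"]) (rule D_qd[OF f])
 have sup: "is_sup (qd f x) (Dp x)" if x: "a2 < x" "x < b2" for x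
 proof -
  obtain c where c: "~ qd f x c" using n1[of x] x 2 by auto
  obtain c' where c': "~ qd (%x. - f x) x c'" using n2[of x] x by auto
  have "qd f x (- c' - 1)" unfolding qd_def
   by (rule evr_mono[OF not_qd[OF f' c']]) (simp add: algebra_simps)
  moreover have "ds (qd f x)" by (rule D_app2[where R = "qd f", OF D_qd[OF f] DFU DF_var])
  moreover have "t <= c" if "qd f x t" for t using c qd_mono[OF that, of c] by (meson linear)
  ultimately obtain s where "is_sup (qd f x) s" using sup_exists[of UNIV "qd f x"] by blast
  then show ?thesis using supd_eq by (simp add: Dp_def)
 qed
 obtain a3 b3 where 3: "a2 <= a3" "a3 < b3" "b3 <= b2" "!!x. a3 < x ==> x < b3 ==> contat f x"
  by (rule cont_sub[OF f 2(2)]) blast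
 obtain a4 b4 where 4: "a3 <= a4" "a4 < b4" "b4 <= b3" "!!x. a4 < x ==> x < b4 ==> contat Dp x"
  by (rule cont_sub[OF Dp 3(2)]) blast
 obtain x where x: "a4 < x" "x < b4" using dense[OF 4(2)] by blast
 have "has_d f x (Dp x)" unfolding has_d_def
 proof (intro allI impI)
  fix e :: 'k assume e: "e > 0"
  obtain d0 where d0: "d0 > 0" "!!y. \<bar>y - x\<bar> < d0 ==> \<bar>Dp y - Dp x\<bar> < e / 2"
   using 4(4)[OF x] e unfolding contat_def by (metis half_gt_zero)
  define d where "d = min d0 (min (x - a4) (b4 - x))"
  have d: "d > 0" using d0 x by (auto simp: d_def)
  have y: "a4 < y" "y < b4" "\<bar>Dp y - Dp x\<bar> < e / 2" if "\<bar>y - x\<bar> < d" for y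
   using that d0(2)[of y] by (auto simp: d_def abs_less_iff)
  have sl: "(Dp x - e) * (v - u) < f v - f u & f v - f u < (Dp x + e) * (v - u)"
   if uv: "u < v" "\<bar>u - x\<bar> < d" "\<bar>v - x\<bar> < d" for u v
  proof -
   have w: "\<bar>w - x\<bar> < d" if "u <= w" "w <= v" for w using uv that by (auto simp: abs_less_iff)
   have ct: "contat f w" if "u <= w" "w <= v" for w using y[OF w[OF that]] 3 4 by auto
   have sw: "is_sup (qd f w) (Dp w)" "\<bar>Dp w - Dp x\<bar> < e / 2" if "u <= w" "w <= v" for w
    using y[OF w[OF that]] 2 3 4 sup by auto
   have "qd f w (Dp x - e)" if "u <= w" "w < v" for w
   proof -
    have "\<bar>Dp w - Dp x\<bar> < e / 2" by (rule sw(2)) (use that in auto)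
    then have "Dp x - e < Dp w" unfolding abs_less_iff using e by linarith
    then show ?thesis using is_sup_less[OF sw(1)] that qd_mono[of f w] by (metis less_imp_le)
   qed
   then have lo: "(Dp x - e) * (v - u) < f v - f u" by (intro qd_RT[OF f uv(1) ct])
   have "qd (%x. - f x) w (- (Dp x + e))" if "u <= w" "w < v" for w
   proof -
    have "\<bar>Dp w - Dp x\<bar> < e / 2" by (rule sw(2)) (use that in auto)
    then have "Dp w < Dp x + e / 2" unfolding abs_less_iff using e by linarith
    then have "~ qd f w (Dp x + e / 2)" using sw(1)[of w] that unfolding is_sup_def by force
    then have "evr (%h. f (w + h) - f w <= (Dp x + e / 2) * h)" by (rule not_qd[OF f])
    then show ?thesis unfolding qd_def
    proof (rule evr_mono)
     fix h assume h: "0 < h" "f (w + h) - f w <= (Dp x + e / 2) * h"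
     have "(Dp x + e / 2) * h < (Dp x + e) * h" using h(1) e by (intro mult_strict_right_mono) auto
     then show "- (Dp x + e) * h < - f (w + h) - - f w" using h(2) by (simp add: algebra_simps)
    qed
   qed
   then have "- (Dp x + e) * (v - u) < - f v - - f u"
    by (intro qd_RT[OF f' uv(1)]) (use ct contat_uminus in auto)
   then show ?thesis using lo by (simp add: algebra_simps)
  qed
  show "EX d>0. ALL h. \<bar>h\<bar> < d --> \<bar>f (x + h) - f x - Dp x * h\<bar> <= e * \<bar>h\<bar>"
  proof (intro exI[of _ d] conjI allI impI d)
   fix h assume h: "\<bar>h\<bar> < d"
   consider "h > 0" | "h = 0" | "h < 0" by linarith
   then show "\<bar>f (x + h) - f x - Dp x * h\<bar> <= e * \<bar>h\<bar>"
   proof cases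
    case 1 then show ?thesis using sl[of x "x + h"] h d by (simp add: algebra_simps abs_le_iff)
   next
    case 3 then show ?thesis using sl[of "x + h" x] h d by (simp add: algebra_simps abs_le_iff)
   qed simp
  qed
 qed
 then show ?thesis using x 1 2 3 4 by (intro exI[of _ x]) auto
qed

lemma finite_nondiff: assumes f: "df f" shows "finite {x. ~ (EX c. has_d f x c)}"
proof (rule finite_if_no_interval[of UNIV])
 show "ds (%x. ~ (EX c. has_d f x c))" unfolding has_d_def
  by (intro D_base DF_base DF_app1[where F = f, OF f])
qed (use exists_deriv[OF f] in blast)

lemma D_has_d:
 assumes "DF A (%bt. F (bt 0) (%i. bt (Suc i)))" "DF A g" "DF A c"
 shows "D A (%bt. has_d (%x. F x bt) (g bt) (c bt))"
proof -
 have F: "DF A (%bt. F (h bt) (%i. bt (r i)))" if "DF A h" for h r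
 proof -
  have "DF A (%bt. F (bt 0) (%i. bt (Suc (r i))))"
   using DF_ren[OF assms(1), of "case_nat 0 (%i. Suc (r i))"] by (simp only: nat.case)
  then show ?thesis by (rule DF_sub1[where F = "%y bt. F y (%i. bt (r i))", OF _ that])
 qed
 show ?thesis unfolding has_d_def
  by (intro D_base DF_base F DF_ren[OF assms(2)] DF_ren[OF assms(3)])
qed

lemma DF_derivk:
 assumes F: "DF A (%bt. F (bt 0) (%i. bt (Suc i)))" and g: "DF A g"
 shows "DF A (%bt. derivk (%x. F x bt) (g bt))"
proof (rule DF_I[where R = "%y bt. has_d (%x. F x bt) (g bt) y | (y = 0 & ~ (EX c. has_d (%x. F x bt) (g bt) c))"])
 have F': "DF A (%bt. F (bt 0) (%i. bt (Suc (r i))))" for r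
  using DF_ren[OF F, of "case_nat 0 (%i. Suc (r i))"] by (simp only: nat.case)
 show "D A (%bt. has_d (%x. F x (%i. bt (Suc i))) (g (%i. bt (Suc i))) (bt 0) |
   bt 0 = 0 & ~ (EX c. has_d (%x. F x (%i. bt (Suc i))) (g (%i. bt (Suc i))) c))"
  by (intro D_base DF_base D_has_d[where F = "%x bt. F x (%i. bt (Suc i))"]
    D_has_d[where F = "%x bt. F x (%i. bt (Suc (Suc i)))"] F' DF_ren[OF g])
 show "y = derivk (%x. F x bt) (g bt) <-> has_d (%x. F x bt) (g bt) y | (y = 0 & ~ (EX c. has_d (%x. F x bt) (g bt) c))" for y bt
  by (metis derivk_eq derivk_def)
qed

lemma df_derivk: "DF A (%bt. f (bt 0)) ==> DF A (%bt. derivk f (bt 0))"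
 by (rule DF_derivk[where F = "%x bt. f x"]) (auto intro: DF_var)

lemma has_d_qd: assumes "has_d f x c" "c' < c" shows "qd f x c'"
proof -
 have "(c - c') / 2 > 0" using assms(2) by simp
 then obtain d where d: "d > 0" "!!h. \<bar>h\<bar> < d ==> \<bar>f (x + h) - f x - c * h\<bar> <= (c - c') / 2 * \<bar>h\<bar>"
  using assms(1) unfolding has_d_def by blast
 have "c' * h < f (x + h) - f x" if "0 < h" "h < d" for h
 proof -
  have "\<bar>f (x + h) - f x - c * h\<bar> <= (c - c') / 2 * h" using d(2)[of h] that by simp
  then have "- (f (x + h) - f x - c * h) <= (c - c') / 2 * h" by (rule abs_le_D2)
  then have "f (x + h) - f x \<ge> (c - (c - c') / 2) * h" unfolding left_diff_distrib[of c] by linarith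
  moreover have "(c - (c - c') / 2) * h > c' * h" using that assms(2) by (intro mult_strict_right_mono) (auto simp: field_simps)
  ultimately show ?thesis by linarith
 qed
 then show ?thesis unfolding qd_def evr_def using d(1) by blast
qed

text \<open>Replaces the mean value theorem. The slope c is lowered by t = e/(b - a), which makes
  the slopes strict as \<open>qd_RT\<close> requires and costs exactly e over the interval.\<close>

lemma mvi:
 assumes f: "df f" and ab: "a <= b" and d: "!!x. a <= x ==> x <= b ==> has_d f x (f' x)" and c: "!!x. a <= x ==> x <= b ==> c <= f' x"
 shows "c * (b - a) <= f b - f a"
proof (cases "a = b")
 case False
 then have lt: "a < b" using ab by simp
 have "c * (b - a) <= f b - f a + e" if e: "e > 0" for e
 proof -
  define t where "t = e / (b - a)"
  have t: "t > 0" using e lt by (simp add: t_def)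
  have "(c - t) * (b - a) < f b - f a"
  proof (rule qd_RT[OF f lt])
   show "contat f x" if "a <= x" "x <= b" for x by (rule has_d_cont[OF d[OF that]])
   show "qd f x (c - t)" if "a <= x" "x < b" for x
    by (rule has_d_qd[OF d[of x]]) (use that c[of x] t in simp_all)
  qed
  moreover have "t * (b - a) = e" using lt by (simp add: t_def)
  ultimately show ?thesis by (simp add: algebra_simps)
 qed
 then show ?thesis by (rule field_le_epsilon)
qed simp

lemma has_d_uminus: "has_d f x c ==> has_d (%x. - f x) x (- c)"
proof -
 have "\<bar>- f (x + h) - - f x - - c * h\<bar> = \<bar>f (x + h) - f x - c * h\<bar>" for h
  by (subst abs_minus_cancel[symmetric]) (simp add: algebra_simps)
 then show "has_d f x c ==> ?thesis" unfolding has_d_def by simp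
qed

lemma mvi_le:
 assumes f: "df f" and ab: "a <= b" and d: "!!x. a <= x ==> x <= b ==> has_d f x (f' x)" and c: "!!x. a <= x ==> x <= b ==> f' x <= c"
 shows "f b - f a <= c * (b - a)"
proof -
 have "- c * (b - a) <= - f b - - f a"
  by (rule mvi[OF DF_minus[OF f] ab, of "%x. - f' x"]) (use d c has_d_uminus[of f] in auto)
 then show ?thesis by (simp add: algebra_simps)
qed

text \<open>If \<open>f\<close> is constant near \<open>b\<close>, its value there is one of the finitely many values taken on
  some interval; otherwise \<open>b\<close> is an isolated point of a fibre.\<close>

lemma exchange_fun:
 assumes f: "DF A (%bt. f (bt 0))" and b: "b ~: dcl A" and fb: "f b ~: dcl A"
 shows "b : dcl (insert (f b) A)"
proof (rule ccontr)
 assume nb: "b ~: dcl (insert (f b) A)"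
 note fU = DF_UNIV[OF f]
 have "D (insert (f b) A) (%bt. f (bt 0) = f b)"
  by (intro D_base DF_const DF_mono[OF f]) auto
 from not_dcl_nbhd[where S = "%x. f x = f b", OF this nb]
 obtain d where d: "d > 0" "!!x. \<bar>x - b\<bar> < d ==> f x = f b" by metis
 define Y where "Y y <-> (EX x. EX d>0. ALL z. \<bar>z - x\<bar> < d --> f z = y)" for y
 have Y: "D A (%bt. Y (bt 0))" unfolding Y_def by (intro D_base DF_base DF_app1[where F = f, OF f])
 have "finite {y. Y y}"
 proof (rule finite_if_no_interval[OF Y], rule ccontr)
  fix p q :: 'k assume pq: "p < q" "\<nexists>y. p < y & y < q & ~ Y y"
  \<comment> \<open>If the values taken on intervals filled an interval themselves, a definable
    choice \<open>g y\<close> of a point near which \<open>f\<close> is constantly y would be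
    continuous somewhere. Near such a y, \<open>g z\<close> falls into the region where
    \<open>f\<close> equals y, although \<open>f (g z) = z\<close>.\<close>
  have "D UNIV (%bt. EX d>0. ALL z. \<bar>z - bt 0\<bar> < d --> f z = bt (Suc 0))"
   by (intro D_base DF_base DF_app1[where F = f, OF fU])
  from choice1[where R = "%y bt. EX d>0. ALL z. \<bar>z - y\<bar> < d --> f z = bt 0", OF this]
  obtain s where s: "DF UNIV s" "!!bt y. EX d>0. ALL z. \<bar>z - y\<bar> < d --> f z = bt 0 ==> EX d>0. ALL z. \<bar>z - s bt\<bar> < d --> f z = bt 0"
   by blast
  define g where "g y = s (%_. y)" for y
  have g: "df g" unfolding g_def by (rule DF_ren[OF s(1)])
  have gy: "EX d>0. ALL z. \<bar>z - g y\<bar> < d --> f z = y" if "p < y" "y < q" for y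
   using s(2)[of _ "%_. y"] pq(2) that unfolding g_def Y_def by blast
  obtain a' b' where ab: "p <= a'" "a' < b'" "b' <= q" "!!x. a' < x ==> x < b' ==> contat g x"
   by (rule cont_sub[OF g pq(1)]) blast
  obtain y where y: "a' < y" "y < b'" using dense[OF ab(2)] by blast
  then have pyq: "p < y" "y < q" using ab by auto
  from gy[OF pyq] obtain d where d: "d > 0" "!!z. \<bar>z - g y\<bar> < d ==> f z = y" by blast
  obtain e where e: "e > 0" "!!z. \<bar>z - y\<bar> < e ==> \<bar>g z - g y\<bar> < d"
   using ab(4)[OF y] d(1) unfolding contat_def by blast
  define z where "z = min (y + e / 2) ((y + q) / 2)"
  have z: "y < z" "z < q" "\<bar>z - y\<bar> < e" using e(1) pyq by (auto simp: z_def min_def abs_less_iff field_simps)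
  have "f (g z) = y" using e(2)[OF z(3)] d(2) by blast
  moreover have "f (g z) = z" using gy[of z] z pyq by fastforce
  ultimately show False using z(1) by simp
 qed
 then have "{y. Y y} <= dcl A" by (rule finite_subset_dcl[OF Y])
 moreover have "Y (f b)" using d unfolding Y_def by blast
 ultimately show False using fb by blast
qed

text \<open>The condition defining \<open>a\<close> from \<open>b\<close> need not be functional at
  other points; there the value 0 is taken, which makes \<open>f\<close> total and still
  definable.\<close>

lemma dcl_insert_fun:
 assumes "a : dcl (insert b A)" obtains f where "DF A (%bt. f (bt 0))" "a = f b"
proof -
 have "D (insert b A) (%bt. bt 0 = a)" using assms by (simp add: dcl_def DF_def)
 then obtain Q where Q: "D A Q" "!!bt. (bt 0 = a) = Q (case_nat b bt)" using D_param by blast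
 define R where "R x y = Q (case_nat x (%_. y))" for x y
 have R: "D A (%bt. R (bt 0) (bt 1))" unfolding R_def
  using D_ren[OF Q(1), of "case_nat 0 (%_. 1)"]
  by (rule back_subst[where P = "D A"]) (rule ext, rule arg_cong[where f = Q], rule ext, simp split: nat.split)
 have Rb: "R b y <-> y = a" for y unfolding R_def using Q(2)[of "%_. y"] by simp
 define f where "f x = (if EX! y. R x y then THE y. R x y else 0)" for x
 have "DF A (%bt. f (bt 0))"
 proof (rule DF_I[where R = "%y bt. (R (bt 0) y & (ALL z. R (bt 0) z --> z = y)) | (y = 0 & ~ (EX y. R (bt 0) y & (ALL z. R (bt 0) z --> z = y)))"])
  show "D A (%bt. (R (bt (Suc 0)) (bt 0) & (ALL z. R (bt (Suc 0)) z --> z = bt 0)) | (bt 0 = 0 & ~ (EX y. R (bt (Suc 0)) y & (ALL z. R (bt (Suc 0)) z --> z = y))))"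
   by (intro D_base DF_base D_app2[where R = R, OF R])
  show "y = f (bt 0) <-> (R (bt 0) y & (ALL z. R (bt 0) z --> z = y)) | (y = 0 & ~ (EX y. R (bt 0) y & (ALL z. R (bt 0) z --> z = y)))" for y bt
  proof (cases "EX! y. R (bt 0) y")
   case True
   then obtain y0 where y0: "R (bt 0) y0" "!!z. R (bt 0) z ==> z = y0" by blast
   have "f (bt 0) = y0" unfolding f_def if_P[OF True] by (rule the1_equality[OF True y0(1)])
   then show ?thesis using y0 by metis
  next
   case False
   then have "f (bt 0) = 0" by (simp add: f_def)
   then show ?thesis using False by metis
  qed
 qed
 moreover have "a = f b" unfolding f_def Rb by simp
 ultimately show ?thesis by (rule that)
qed

lemma exchange: "a : dcl (insert b A) ==> a ~: dcl A ==> b : dcl (insert a A)"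
proof -
 assume a: "a : dcl (insert b A)" "a ~: dcl A"
 obtain f where f: "DF A (%bt. f (bt 0))" "a = f b" by (rule dcl_insert_fun[OF a(1)])
 show ?thesis
 proof (cases "b : dcl A")
  case True
  then show ?thesis using dcl_mono[of A "insert a A"] by blast
 next
  case False
  then show ?thesis using exchange_fun[OF f(1) False] a(2) f(2) by simp
 qed
qed

end

section \<open>Power boundedness and rates of growth\<close>

context omf
begin

lemma def_fun1_of_DF: assumes "DF A (%bt. f (bt 0))" shows "def_fun1 L N A f"
proof -
 have "D A (%bt. bt 1 = f (bt 0))" by (intro D_base DF_base assms)
 then have "def_set L N A 2 {xs. length xs = 2 & (%bt. bt 1 = f (bt 0)) (%i. if i < 2 then xs ! i else 0)}"
  by (rule def_set_of_D) simp
 moreover have "{xs. length xs = 2 & (%bt. bt 1 = f (bt 0)) (%i. if i < 2 then xs ! i else 0)} = {[x, f x] |x. x : univ N}"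
  by (auto simp: length_Suc_conv numeral_2_eq_2)
 ultimately show ?thesis by (simp add: def_fun1_def)
qed

lemma abN [simp]: "ab L N x = \<bar>x\<bar>" by (simp add: ab_def abs_if)
lemma sbN [simp]: "sb L N x y = x - y" by (simp add: sb_def)
lemma posN [simp]: "pos L N x <-> 0 < x" by (simp add: pos_def)
lemma leN [simp]: "le L N x y <-> x <= y" by (auto simp: le_def)
lemma ivN: "x ~= 0 ==> iv L N x = inverse x"
 unfolding iv_def by (rule the_equality) (auto simp: field_simps)
lemma dvN: "y ~= 0 ==> dv L N x y = x / y" by (simp add: dv_def ivN divide_inverse)
lemma cont_atN: "cont_at L N F x <-> contat F x"
 by (simp add: cont_at_def contat_def)

definition evt :: "('k => bool) => bool" where "evt P <-> (EX t0. ALL t>t0. P t)"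

lemma evt_dec: assumes "ds S" shows "evt S | evt (%t. ~ S t)"
proof -
 obtain t where t: "!!x y. t < x ==> t < y ==> S x = S y" by (rule ev_top[OF assms]) blast
 show ?thesis
 proof (cases "S (t + 1)")
  case True then have "S x" if "t < x" for x using t[of x "t + 1"] that by simp
  then show ?thesis unfolding evt_def by blast
 next
  case False then have "~ S x" if "t < x" for x using t[of x "t + 1"] that by simp
  then show ?thesis unfolding evt_def by blast
 qed
qed

end

locale pb = omf L N for L :: "('f,'r) lang" and N :: "('k::linordered_field,'f,'r) struc" +
 assumes pbN: "!!F. def_fun1 L N UNIV F ==>
    EX f. def_set L N UNIV 2 {[x, f x] | x. pos L N x} &
       (ALL x. pos L N x --> pos L N (f x)) &
       (ALL x y. pos L N x & pos L N y --> f (ml L N x y) = ml L N (f x) (f y)) &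
       (EX c:UNIV. ALL x:UNIV. ls L N c x --> ls L N (ab L N (F x)) (f x))"
begin

text \<open>Let the power function \<open>p\<close> dominate \<open>R\<close>. If the ratio
  R(2t)/R(t) eventually exceeded 2 p(2), then R/p would more than double from t to 2t by
  multiplicativity of \<open>p\<close>. But R/p is at most 1 for large t, so its values have a
  supremum s, and a value above s/2 would lead beyond s.\<close>

lemma growth_doubling:
 assumes R: "df R" and pos: "!!t. 0 < t ==> 0 < R t"
 shows "EX m. evt (%t. R (2 * t) / R t <= m)"
proof (rule ccontr)
 assume no: "~ ?thesis"
 note R' = DF_app1[where F = R, OF R]
 have big: "evt (%t. m < R (2 * t) / R t)" for m
 proof -
  have "evt (%t. m < R (2 * t) / R t) | evt (%t. ~ m < R (2 * t) / R t)"
   by (rule evt_dec) (intro D_base DF_base DFU R')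
  then show ?thesis using no by (auto simp: not_less)
 qed
 obtain p c where pD: "def_set L N UNIV 2 {[x, p x] | x. 0 < x}" and p0: "!!x. 0 < x ==> 0 < p x"
  and pm: "!!x y. 0 < x ==> 0 < y ==> p (x * y) = p x * p y" and pc: "!!x. c < x ==> \<bar>R x\<bar> < p x"
 proof -
  from pbN[OF def_fun1_of_DF[OF R], unfolded posN mlN lsN abN] obtain p where p:
   "def_set L N UNIV 2 {[x, p x] | x. 0 < x}" "ALL x. 0 < x --> 0 < p x"
   "ALL x y. 0 < x & 0 < y --> p (x * y) = p x * p y" "EX c:UNIV. ALL x:UNIV. c < x --> \<bar>R x\<bar> < p x"
   by (elim exE conjE)
  from p(4) obtain c where "ALL x:UNIV. c < x --> \<bar>R x\<bar> < p x" by (elim bexE)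
  then show ?thesis by (intro that[of p c]) (use p(1-3) in blast)+
 qed
 have "D UNIV (%bt. map bt [0..<2] : {[x, p x] | x. 0 < x})" by (rule D_of_def_set[OF pD])
 moreover have "(map bt [0..<2] : {[x, p x] | x. 0 < x}) = (0 < bt 0 & bt 1 = p (bt 0))" for bt
  by (auto simp: numeral_2_eq_2)
 ultimately have P: "D UNIV (%bt. (%x y. 0 < x & y = p x) (bt 0) (bt 1))" by (simp only:)
 note P' = D_app2[where R = "%x y. 0 < x & y = p x", OF P]
 obtain T0 where T0: "!!t. T0 < t ==> 2 * p 2 < R (2 * t) / R t" using big[of "2 * p 2"] unfolding evt_def by blast
 define T where "T = max T0 (max c 0)"
 have T: "T0 <= T" "c <= T" "0 <= T" by (auto simp: T_def)
 define S where "S v <-> (EX t. T < t & (EX q. (0 < t & q = p t) & v = R t / q))" for v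
 have S: "ds S" unfolding S_def by (intro D_base(9) D_base(1) D_less D_eq DF_base DFU R' P')
 have Sk: "S (R t / p t)" if "T < t" for t using that T unfolding S_def by (intro exI[of _ t]) auto
 have Sb: "v <= 1" if "S v" for v
 proof -
  obtain t where t: "T < t" "v = R t / p t" using \<open>S v\<close> unfolding S_def by auto
  have "R t < p t" using pc[of t] t T by auto
  then show ?thesis using t p0[of t] T by (simp add: divide_le_eq)
 qed
 have "S (R (T + 1) / p (T + 1))" by (rule Sk) simp
 then obtain s where s: "is_sup S s" using sup_exists[OF S _ Sb] by blast
 have "R (T + 1) / p (T + 1) <= s" using s Sk[of "T + 1"] unfolding is_sup_def by auto
 moreover have "0 < R (T + 1) / p (T + 1)" using pos[of "T + 1"] p0[of "T + 1"] T by simp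
 ultimately have s0: "s > 0" by simp
 then obtain v where v: "S v" "s / 2 < v" using is_sup_less[OF s, of "s / 2"] by auto
 then obtain t where t: "T < t" "v = R t / p t" unfolding S_def by auto
 have t0: "0 < t" "T0 < t" using t T by auto
 have "2 * p 2 * R t < R (2 * t)" using T0[OF t0(2)] pos[OF t0(1)] by (simp add: field_simps)
 then have "2 * (R t / p t) < R (2 * t) / p (2 * t)"
  using pm[of 2 t] p0[of 2] p0[of t] t0(1) by (simp add: field_simps)
 moreover have "R (2 * t) / p (2 * t) <= s"
  using s Sk[of "2 * t"] t t0 unfolding is_sup_def by auto
 ultimately show False using v(2) t(2) by simp
qed

text \<open>For each x the doubling ratio \<open>u x t\<close>, the growth of
  \<open>f t x / f t 0\<close> from t to 2t, stays bounded by \<open>growth_doubling\<close>.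
  Expansion forces \<open>u y t\<close> above 3/2 times \<open>u x t\<close> eventually whenever x <
  y. The limit \<open>l x\<close> in t would then jump by the factor 3/2 between any two points,
  against its continuity on some subinterval.\<close>

lemma no_expanding_family:
 assumes f: "DF UNIV (%bt. f (bt 0) (bt 1))"
  and pos: "!!t x. 0 < t ==> 0 <= x ==> x <= 1 ==> 0 < f t x"
  and ex: "!!t x y. 0 < t ==> 0 <= x ==> x < y ==> y <= 1 ==> f t x * (1 + t * (y - x)) <= f t y"
 shows False
proof -
 note f' = DF_app2[where F = f, OF f]
 define u where "u x t = (f (2 * t) x / f (2 * t) 0) / (f t x / f t 0)" for x t
 have u': "DF UNIV (%bt. u (g bt) (h bt))" if "DF UNIV g" "DF UNIV h" for g h
  unfolding u_def by (intro DF_base f' that)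
 have u0: "0 < u x t" if "0 < t" "0 <= x" "x <= 1" for x t
  unfolding u_def using that by (intro divide_pos_pos pos) auto
 have bdd: "EX m. evt (%t. u x t <= m)" if x: "0 <= x" "x <= 1" for x
  unfolding u_def by (rule growth_doubling[of "%t. f t x / f t 0"])
   (intro DF_base DFU f', use x in \<open>auto intro!: divide_pos_pos pos\<close>)
 have dbl: "evt (%t. 3 / 2 * u x t < u y t)" if xy: "0 <= x" "x < y" "y <= 1" for x y
 proof (rule ccontr)
  assume n: "~ ?thesis"
  have "evt (%t. 3 / 2 * u x t < u y t) | evt (%t. ~ 3 / 2 * u x t < u y t)"
   by (rule evt_dec) (intro D_base DF_base DFU u')
  then have "evt (%t. ~ 3 / 2 * u x t < u y t)" using n by blast
  then obtain T0 where T0: "!!t. T0 < t ==> u y t <= 3 / 2 * u x t" unfolding evt_def not_less by blast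
  define T where "T = max T0 0"
  have T: "T0 <= T" "0 <= T" by (auto simp: T_def)
  \<comment> \<open>Here \<open>u y t / u x t = 2 * k (2 * t) / k t\<close>, so failure of the claim
    gives \<open>k (2 * t) <= 3 / 4 * k t\<close>, while expansion gives
    \<open>y - x <= k t\<close>. A value of \<open>k\<close> within (y - x)/3 of its infimum is then
    impossible.\<close>
  define k where "k t = f t y / f t x / t" for t
  have k: "DF UNIV (%bt. k (bt i))" for i unfolding k_def by (intro DF_base DFU f')
  have klo: "y - x <= k t" if t: "0 < t" for t
  proof -
   have fx: "0 < f t x" using pos t xy by auto
   have "t * (y - x) * f t x <= f t y" using ex[OF t xy] fx by (simp add: algebra_simps)
   then show ?thesis using fx t by (simp add: k_def field_simps)
  qed
  have kd: "k (2 * t) <= 3 / 4 * k t" if t: "T < t" for t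
  proof -
   have t0: "0 < t" "T0 < t" using t T by auto
   have p: "0 < f t x" "0 < f t y" "0 < f (2*t) x" "0 < f (2*t) y" "0 < f t 0" "0 < f (2*t) 0" using pos t0 xy by auto
   have "u y t = (k (2 * t) / k t) * (2 * u x t)" using p t0 by (simp add: u_def k_def)
   then have "(k (2 * t) / k t) * (2 * u x t) <= 3 / 4 * (2 * u x t)" using T0[OF t0(2)] by simp
   moreover have "0 < 2 * u x t" using u0[OF t0(1), of x] xy by simp
   ultimately have "k (2 * t) / k t <= 3 / 4" by (rule mult_right_le_imp_le)
   moreover have "0 < k t" using p t0 by (simp add: k_def)
   ultimately show ?thesis by (simp add: divide_le_eq)
  qed
  define V where "V v <-> (EX t. T < t & v = k t)" for v
  have V1: "ds V" unfolding V_def by (intro D_base DF_base DFU k)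
  have V2: "V (k (T + 1))" unfolding V_def by (intro exI[of _ "T + 1"]) simp
  have V3: "y - x <= v" if "V v" for v using that klo T unfolding V_def by auto
  obtain s where s0: "!!v. V v ==> s <= v" "!!b. s < b ==> EX v. V v & v < b"
   using inf_exists[where S = V, OF V1 V2 V3] by metis
  note s = s0[unfolded V_def]
  obtain v where "(EX t. T < t & v = k t) & v < s + (y - x) / 3" using s(2)[of "s + (y - x) / 3"] xy by auto
  then obtain t where t: "T < t" "k t < s + (y - x) / 3" by blast
  have sk: "y - x <= s"
  proof (rule ccontr)
   assume "~ y - x <= s"
   then obtain t where "T < t" "k t < y - x" using s(2)[of "y - x"] by auto
   then show False using klo[of t] T by simp
  qed
  have "s <= k (2 * t)" using t T by (intro s(1) exI[of _ "2 * t"]) auto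
  moreover have "4 * k (2 * t) <= 3 * k t" using kd[OF t(1)] by simp
  moreover have "3 * k t < 3 * s + (y - x)" using t(2) by (simp add: field_simps)
  ultimately show False using sk by linarith
 qed
 \<comment> \<open>The limit of \<open>u x t\<close> for large t, taken as the supremum of eventual
   lower bounds; it is finite since the doubling ratios are bounded.\<close>
 define l where "l x = supd (%c. evt (%t. c < u x t))" for x
 have l: "df l" unfolding l_def evt_def
  by (rule DF_supd[where R = "%c bt. EX t0. ALL t>t0. c < u (bt 0) t"]) (intro D_base DF_base u')
 have ls: "is_sup (%c. evt (%t. c < u x t)) (l x)" if x: "0 <= x" "x <= 1" for x
 proof -
  obtain m where m: "evt (%t. u x t <= m)" using bdd[OF x] by blast
  have "ds (%c. evt (%t. c < u x t))" unfolding evt_def by (intro D_base DF_base DFU u')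
  moreover have "evt (%t. 0 < u x t)" unfolding evt_def using u0 x by blast
  moreover have "c <= m" if c: "evt (%t. c < u x t)" for c
  proof -
   obtain t1 t2 where t12: "ALL t>t1. u x t <= m" "ALL t>t2. c < u x t" using m c unfolding evt_def by blast
   define t where "t = max t1 t2 + 1"
   have "t > t1" "t > t2" by (simp_all add: t_def add_strict_increasing2 max_def)
   then show ?thesis using t12 by force
  qed
  ultimately obtain s where "is_sup (%c. evt (%t. c < u x t)) s" using sup_exists[of UNIV "%c. evt (%t. c < u x t)"] by blast
  then show ?thesis using supd_eq by (simp add: l_def)
 qed
 have l0: "0 <= l x" if x: "0 <= x" "x <= 1" for x
  using ls[OF x] u0[OF _ x] unfolding is_sup_def evt_def by blast
 have ll: "3 / 2 * l x <= l y" if xy: "0 <= x" "x < y" "y <= 1" for x y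
 proof -
  have "c <= 2 / 3 * l y" if c: "evt (%t. c < u x t)" for c
  proof -
   obtain t1 t2 where t12: "ALL t>t1. 3 / 2 * u x t < u y t" "ALL t>t2. c < u x t" using dbl[OF xy] c unfolding evt_def by blast
   have "3 / 2 * c < u y t" if "t > max t1 t2" for t
   proof -
    have "t > t1" "t > t2" using that by auto
    then have "3 / 2 * u x t < u y t" "c < u x t" using t12 by auto
    then show ?thesis by linarith
   qed
   then have "evt (%t. 3 / 2 * c < u y t)" unfolding evt_def by blast
   moreover have "is_sup (%c. evt (%t. c < u y t)) (l y)" by (rule ls) (use xy in auto)
   ultimately have "3 / 2 * c <= l y" unfolding is_sup_def by blast
   then show ?thesis by simp
  qed
  moreover have "is_sup (%c. evt (%t. c < u x t)) (l x)" by (rule ls) (use xy in auto)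
  ultimately have "l x <= 2 / 3 * l y" unfolding is_sup_def by blast
  then show ?thesis by simp
 qed
 have "evt (%t. 1 / 2 < u 0 t)"
 proof -
  have "1 / 2 < u 0 t" if "0 < t" for t using pos[of t 0] pos[of "2 * t" 0] that by (simp add: u_def)
  then show ?thesis unfolding evt_def by blast
 qed
 moreover have "is_sup (%c. evt (%t. c < u 0 t)) (l 0)" by (rule ls) auto
 ultimately have "1 / 2 <= l 0" unfolding is_sup_def by blast
 then have l1: "0 < l 0" by (rule less_le_trans[rotated]) simp
 obtain a b where ab: "0 <= a" "a < b" "b <= 1" "!!x. a < x ==> x < b ==> contat l x"
  by (rule cont_sub[OF l zero_less_one]) blast
 obtain x where x: "a < x" "x < b" using dense[OF ab(2)] by blast
 have "3 / 2 * l 0 <= l x" using ll[of 0 x] x ab by auto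
 then have lx: "0 < l x" by (rule less_le_trans[rotated]) (use l1 in simp)
 then obtain d where d: "d > 0" "!!y. \<bar>y - x\<bar> < d ==> \<bar>l y - l x\<bar> < l x / 4"
  using ab(4)[OF x] unfolding contat_def by (metis zero_less_divide_iff zero_less_numeral)
 define y where "y = x + min (d / 2) (b - x) "
 have y: "x < y" "y <= b" "\<bar>y - x\<bar> < d" using d(1) x by (auto simp: y_def min_def)
 have "3 / 2 * l x <= l y" by (rule ll) (use y x ab in auto)
 then have "6 * l x <= 4 * l y" by simp
 moreover have "l y - l x < l x / 4" using d(2)[OF y(3)] by (rule abs_less_iff[THEN iffD1, THEN conjunct1])
 then have "4 * l y - 4 * l x < l x" by (simp add: field_simps)
 ultimately show False using lx by linarith
qed

text \<open>The parameters of \<open>F\<close>, \<alpha> and \<ll> become variables, and definable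
  choice picks them as functions of the rate. The set of attained rates is thus definable without
  parameters. If bounded, its supremum lies in \<open>dcl {}\<close>; if unbounded, every rate is
  attained and the choices form the family excluded by \<open>no_expanding_family\<close>.\<close>

lemma expansion_rate_bounded:
 assumes F: "df F" and lp: "0 < \<ll>"
  and pos: "!!x. 0 <= x ==> x <= 1 ==> 0 < F (\<alpha> + \<ll> * x)"
  and ex: "!!x y. 0 <= x ==> x < y ==> y <= 1 ==> F (\<alpha> + \<ll> * x) * (1 + q * (y - x)) <= F (\<alpha> + \<ll> * y)"
 shows "EX c:dcl {}. q <= c"
proof -
 have "D UNIV (%bt. bt 0 = F (bt 1))" using F[unfolded DF_def] by simp
 then obtain P0 br where P0: "D0 P0" "!!bt. (bt 0 = F (bt 1)) = P0 (mix bt br)" unfolding D_def by blast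
 \<comment> \<open>The graph of \<open>F\<close> with its parameters released: at
   \<open>bs = br\<close> it says y = F x, elsewhere it need not be a function at all, so
   \<open>good\<close> quantifies over all its values.\<close>
 define G where "G y x bs = P0 (%i. if even i then (if i = 0 then y else x) else bs (i div 2))" for y x bs
 have GF: "G y x br <-> y = F x" for y x
 proof -
  have e: "(%i. if even i then (if i = 0 then y else x) else br (i div 2)) = mix (%i. if i = 0 then y else x) br"
   by (rule ext) (auto simp: mix_def elim!: evenE)
  show ?thesis unfolding G_def e using P0(2)[of "%i. if i = 0 then y else x"] by simp
 qed
 have G: "D {} (%bt. G (g bt) (h bt) (%i. s i bt))" if "DF {} g" "DF {} h" "!!i. DF {} (s i)" for g h s
  unfolding G_def
  by (rule D_subst[OF D0_D[OF P0(1)], where ta = "%i bt. if even i then (if i = 0 then g bt else h bt) else s (i div 2) bt"])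
   (rename_tac i, case_tac "even i"; case_tac "i = 0"; simp add: that)
 define good where "good q bs <-> (ALL x. 0 <= x & x <= 1 --> (EX X. G X (bs 0 + bs 1 * x) (%i. bs (Suc (Suc i))))) &
   (ALL x. 0 <= x & x <= 1 --> (ALL X. G X (bs 0 + bs 1 * x) (%i. bs (Suc (Suc i))) --> 0 < X)) &
   (ALL x. 0 <= x --> (ALL y. x < y & y <= 1 --> (ALL X. G X (bs 0 + bs 1 * x) (%i. bs (Suc (Suc i))) -->
    (ALL Y. G Y (bs 0 + bs 1 * y) (%i. bs (Suc (Suc i))) --> X * (1 + q * (y - x)) <= Y))))" for q bs
 have good: "D {} (%bt. good (g bt) (%i. s i bt))" if "DF {} g" "!!i. DF {} (s i)" for g s
  unfolding good_def by (intro D_base DF_base G DF_ren[OF that(1)] DF_ren[OF that(2)])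
 have good_mono: "good q' bs" if "good q'' bs" "q' <= q''" for q' q'' bs
 proof -
  have "X * (1 + q' * (y - x)) <= X * (1 + q'' * (y - x))" if "0 < X" "x < y" for X x y
   using that \<open>q' <= q''\<close> by (intro mult_left_mono add_left_mono mult_right_mono) auto
  then show ?thesis using that(1) unfolding good_def
   by (smt (verit, ccfv_threshold) order_trans less_imp_le order_less_le_trans)
 qed
 have gq: "good q (%i. case i of 0 => \<alpha> | Suc 0 => \<ll> | Suc (Suc j) => br j)"
  unfolding good_def using pos ex by (simp add: GF)
 have "D {} (%bt. good (bt 0) (%i. bt (Suc (2 * i))))" by (rule good) (auto intro: DF_var)
 from Skolem[where P = "%bt. good (bt 0) (%i. bt (Suc (2 * i)))", OF this]
 obtain s where s: "!!i. DF {} (s i)" "!!bt bs. good (mix bt bs 0) (%i. mix bt bs (Suc (2 * i))) ==>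
   good (mix bt (%i. s i bt) 0) (%i. mix bt (%i. s i bt) (Suc (2 * i)))" by blast
 have m0: "mix bt bs 0 = bt 0" for bt bs :: "nat => 'k" by (simp add: mix_def)
 note s = s(1) s(2)[unfolded mix_odd m0]
 define E where "E q <-> good q (%i. s i (%_. q))" for q
 have E: "D {} (%bt. E (bt 0))" unfolding E_def
  by (rule good[where s = "%i bt. s i (%_. bt 0)"]) (auto intro: DF_var DF_ren[OF s(1)])
 have Eg: "good q' bs ==> E q'" for q' bs unfolding E_def using s(2)[of "%_. q'"] by simp
 have Eq: "E q" using Eg[OF gq] .
 show ?thesis
 proof (cases "EX b. ALL t. E t --> t <= b")
  case True
  then obtain c where c: "is_sup E c" using sup_exists[OF E Eq] by blast
  have "DF {} (%bt. supd E)" by (rule DF_supd[where R = "%c bt. E c"]) (rule E)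
  then have "c : dcl {}" by (simp add: dcl_def supd_eq[OF c])
  moreover have "q <= c" using c Eq unfolding is_sup_def by blast
  ultimately show ?thesis by blast
 next
  case False
  have all: "good t (%i. s i (%_. t))" for t
  proof -
   obtain t' where "E t'" "t <= t'" using False by (meson linear)
   then show ?thesis using Eg good_mono unfolding E_def by blast
  qed
  have "D {} (%bt. G (bt 0) (s 0 (%_. bt 1) + s 1 (%_. bt 1) * bt 2) (%i. s (Suc (Suc i)) (%_. bt 1)))"
   by (rule G) (intro DF_base DF_ren[OF s(1)])+
  then have "D {} (%bt. G (bt 0) (s 0 (%_. bt (Suc 0)) + s 1 (%_. bt (Suc 0)) * bt (Suc 1)) (%i. s (Suc (Suc i)) (%_. bt (Suc 0))))"
   by (simp add: numeral_2_eq_2)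
  from choice1[where R = "%X bt. G X (s 0 (%_. bt 0) + s 1 (%_. bt 0) * bt 1) (%i. s (Suc (Suc i)) (%_. bt 0))", OF this]
  obtain h where h: "DF {} h" "!!bt X. G X (s 0 (%_. bt 0) + s 1 (%_. bt 0) * bt 1) (%i. s (Suc (Suc i)) (%_. bt 0))
    ==> G (h bt) (s 0 (%_. bt 0) + s 1 (%_. bt 0) * bt 1) (%i. s (Suc (Suc i)) (%_. bt 0))" by blast
  define f where "f t x = h (%i. if i = 0 then t else x)" for t x
  have fG: "G (f t x) (s 0 (%_. t) + s 1 (%_. t) * x) (%i. s (Suc (Suc i)) (%_. t))" if "0 <= x" "x <= 1" for t x
   using all[of t] that h(2)[of _ "%i. if i = 0 then t else x"] unfolding good_def f_def by auto
  have "DF {} (%bt. if i = 0 then bt 0 else bt 1)" for i :: nat by (cases "i = 0") (simp_all add: DF_var)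
  from DF_subst[OF h(1), where ta = "%i bt. if i = 0 then bt 0 else bt 1", OF this]
  have "DF {} (%bt. f (bt 0) (bt 1))" unfolding f_def .
  then have fD: "DF UNIV (%bt. f (bt 0) (bt 1))" by (rule DF_UNIV)
  have False
  proof (rule no_expanding_family[OF fD])
   show "0 < f t x" if "0 <= x" "x <= 1" for t x
    using all[of t] fG[OF that] that unfolding good_def by blast
   show "f t x * (1 + t * (y - x)) <= f t y" if "0 <= x" "x < y" "y <= 1" for t x y
   proof -
    have "x <= 1" "0 <= y" using that by auto
    then show ?thesis using all[of t, unfolded good_def, THEN conjunct2, THEN conjunct2] fG[of x t] fG[of y t] that by blast
   qed
  qed
  then show ?thesis ..
 qed
qed

end

section \<open>The valuation ring and the dominance relations\<close>

locale tcv = omf L N for L :: "('f,'r) lang" and N :: "('k::linordered_field,'f,'r) struc" +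
 fixes Ov :: "'k set"
 assumes tc: "tconvex L N Ov"
begin

lemma Ov_cont:
 assumes "DF {} (%bt. F (bt 0))" "!!x. contat F x" "x : Ov" shows "F x : Ov"
proof -
 have "F ` Ov <= Ov"
  using tc def_fun1_of_DF[OF assms(1)] assms(2) unfolding tconvex_def cont_atN by blast
 then show ?thesis using assms(3) by blast
qed

lemma Ov_between: "x : Ov ==> z : Ov ==> x <= y ==> y <= z ==> y : Ov"
 using tc unfolding tconvex_def leN UN by blast

lemma Ov_ne: "Ov ~= {}" using tc unfolding tconvex_def by blast

text \<open>Constant functions are continuous and must map the ring to itself. This is where a bound
  definable without parameters becomes a bound in the valuation.\<close>

lemma dcl_empty_Ov: "dcl {} <= Ov"
proof
 fix c assume "c : dcl {}"
 then have "DF {} (%bt. (%x. c) (bt 0))" by (simp add: dcl_def)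
 moreover have "contat (%x. c) x" for x unfolding contat_def by (auto intro: zero_less_one)
 moreover obtain x where "x : Ov" using Ov_ne by blast
 ultimately show "c : Ov" using Ov_cont[of "%x. c" x] by simp
qed

lemma Ov_0 [simp]: "0 : Ov" and Ov_1 [simp]: "1 : Ov"
 using dcl_empty_Ov DF_0 DF_1 by (auto simp: dcl_def)

lemma contat_lin: "contat (%x. c * x) (x::'k)"
 by (rule has_d_cont[of _ _ c]) (auto simp: has_d_def algebra_simps intro: zero_less_one)

lemma Ov_uminus: "x : Ov ==> - x : Ov"
 by (rule Ov_cont[of "%x. - x"]) (use contat_lin[of "- 1"] in \<open>auto intro: DF_base\<close>)

lemma Ov_double: "x : Ov ==> 2 * x : Ov"
 by (rule Ov_cont[of "%x. 2 * x"]) (auto intro!: DF_base contat_lin)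

lemma Ov_sq: "x : Ov ==> x * x : Ov"
proof (rule Ov_cont[of "%x. x * x"])
 fix x :: 'k
 have "has_d (%x. x * x) x (2 * x)" unfolding has_d_def
 proof (intro allI impI)
  fix e :: 'k assume "e > 0"
  moreover have "\<bar>(x + h) * (x + h) - x * x - 2 * x * h\<bar> <= e * \<bar>h\<bar>" if "\<bar>h\<bar> < e" for h
  proof -
   have "(x + h) * (x + h) - x * x - 2 * x * h = h * h" by (simp add: algebra_simps)
   moreover have "\<bar>h * h\<bar> <= e * \<bar>h\<bar>" unfolding abs_mult by (rule mult_right_mono) (use that in auto)
   ultimately show ?thesis by simp
  qed
  ultimately show "EX d>0. ALL h. \<bar>h\<bar> < d --> \<bar>(x + h) * (x + h) - x * x - 2 * x * h\<bar> <= e * \<bar>h\<bar>" by blast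
 qed
 then show "contat (%x. x * x) x" by (rule has_d_cont)
qed (auto intro: DF_base)

lemma Ov_abs: "\<bar>x\<bar> : Ov <-> x : Ov"
 using Ov_uminus[of x] Ov_uminus[of "- x"] by (auto simp: abs_if)

lemma Ov_conv: "x : Ov ==> \<bar>y\<bar> <= \<bar>x\<bar> ==> y : Ov"
 using Ov_between[of "- \<bar>x\<bar>" "\<bar>x\<bar>" y] Ov_abs[of x] Ov_uminus[of "\<bar>x\<bar>"] by (simp add: abs_le_iff)

text \<open>The sum is at most twice the larger absolute value, so convexity reduces closure under
  addition to the one-variable function 2x, just as products reduce to squares.\<close>

lemma Ov_add: assumes "x : Ov" "y : Ov" shows "x + y : Ov"
proof -
 define m where "m = max \<bar>x\<bar> \<bar>y\<bar>"
 have "m : Ov" using assms by (auto simp: m_def max_def Ov_abs)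
 moreover have "\<bar>x + y\<bar> <= \<bar>2 * m\<bar>" using abs_triangle_ineq[of x y] by (simp add: m_def)
 ultimately show ?thesis using Ov_conv Ov_double by blast
qed

lemma Ov_mult: assumes "x : Ov" "y : Ov" shows "x * y : Ov"
proof -
 define m where "m = max \<bar>x\<bar> \<bar>y\<bar>"
 have m: "m : Ov" "\<bar>x\<bar> <= m" "\<bar>y\<bar> <= m" using assms by (auto simp: m_def max_def Ov_abs)
 have "\<bar>x * y\<bar> <= m * m" unfolding abs_mult using m by (intro mult_mono) (auto intro: order_trans[of _ "\<bar>x\<bar>"])
 also have "\<dots> <= \<bar>m * m\<bar>" by simp
 finally show ?thesis using Ov_conv Ov_sq m(1) by blast
qed

text \<open>Dominance instead of a value group: \<open>dm x y\<close> means v(x) \<ge> v(y), and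
  \<open>sm x y\<close> means v(x) > v(y), with v(0) infinite. In particular nothing is
  \<open>sm\<close> to 0.\<close>

definition dm :: "'k => 'k => bool" where "dm x y <-> (EX c:Ov. \<bar>x\<bar> <= \<bar>c * y\<bar>)"
definition sm :: "'k => 'k => bool" where "sm x y <-> (ALL c:Ov. \<bar>c * x\<bar> < \<bar>y\<bar>)"

lemma not_sm: "~ sm x y <-> dm y x" unfolding sm_def dm_def by (auto simp: not_less)
lemma not_dm: "~ dm x y <-> sm y x" using not_sm by blast

lemma dm_le: "\<bar>x\<bar> <= \<bar>y\<bar> ==> dm x y" unfolding dm_def by (intro bexI[of _ 1]) auto
lemma dm_refl [simp]: "dm x x" by (rule dm_le) simp
lemma dm_trans: assumes "dm x y" "dm y z" shows "dm x z"
proof -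
 obtain c e where c: "c : Ov" "\<bar>x\<bar> <= \<bar>c * y\<bar>" "e : Ov" "\<bar>y\<bar> <= \<bar>e * z\<bar>" using assms unfolding dm_def by blast
 have "\<bar>c * y\<bar> <= \<bar>(c * e) * z\<bar>" using mult_left_mono[OF c(4), of "\<bar>c\<bar>"] by (simp add: abs_mult mult.assoc)
 then show ?thesis unfolding dm_def using c Ov_mult by (meson order_trans)
qed
lemma sm_dm: "sm x y ==> dm y z ==> sm x z" using dm_trans not_sm by blast
lemma dm_sm: "dm x y ==> sm y z ==> sm x z" using dm_trans not_sm by blast
lemma sm_imp_dm: "sm x y ==> dm x y" unfolding sm_def by (rule dm_le) (force dest: bspec[OF _ Ov_1])
lemma sm_trans: "sm x y ==> sm y z ==> sm x z" using sm_imp_dm sm_dm by blast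
lemma sm_less: "sm x y ==> \<bar>x\<bar> < \<bar>y\<bar>" unfolding sm_def by (force dest: bspec[OF _ Ov_1])
lemma sm_irrefl [simp]: "~ sm x x" using not_sm by simp
lemma dm_total: "dm x y | dm y x" using dm_le by (meson linear)
lemma dm_0 [simp]: "dm 0 y" by (rule dm_le) simp
lemma sm_0 [simp]: "sm 0 y <-> y ~= 0" unfolding sm_def using Ov_ne by auto
lemma sm_0': "~ sm x 0" using sm_less by fastforce
lemma dm_abs [simp]: "dm \<bar>x\<bar> y = dm x y" "dm x \<bar>y\<bar> = dm x y" "sm \<bar>x\<bar> y = sm x y" "sm x \<bar>y\<bar> = sm x y"
 by (simp_all add: dm_def sm_def abs_mult)
lemma dm_minus [simp]: "dm (- x) y = dm x y" "dm x (- y) = dm x y" "sm (- x) y = sm x y" "sm x (- y) = sm x y"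
 by (simp_all add: dm_def sm_def)
lemma dm_diff_commute: "dm (x - y) z = dm (y - x) z" "sm (x - y) z = sm (y - x) z"
 using dm_minus(1)[of "y - x" z] dm_minus(3)[of "y - x" z] by simp_all
lemma dm_add: assumes "dm x z" "dm y z" shows "dm (x + y) z"
proof -
 obtain c e where c: "c : Ov" "\<bar>x\<bar> <= \<bar>c * z\<bar>" "e : Ov" "\<bar>y\<bar> <= \<bar>e * z\<bar>" using assms unfolding dm_def by blast
 have "\<bar>x + y\<bar> <= \<bar>c * z\<bar> + \<bar>e * z\<bar>" using c abs_triangle_ineq[of x y] by linarith
 also have "\<dots> = \<bar>(\<bar>c\<bar> + \<bar>e\<bar>) * z\<bar>" unfolding abs_mult by (simp add: distrib_right)
 finally show ?thesis unfolding dm_def using c Ov_add Ov_abs by blast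
qed
lemma dm_diff: "dm x z ==> dm y z ==> dm (x - y) z" using dm_add[of x z "- y"] by simp
lemma sm_add: assumes "sm x z" "sm y z" shows "sm (x + y) z"
proof -
 have "\<bar>x + y\<bar> <= \<bar>2 * x\<bar> | \<bar>x + y\<bar> <= \<bar>2 * y\<bar>" using abs_triangle_ineq[of x y] by (simp add: abs_mult) linarith
 moreover have "2 : Ov" using Ov_double[OF Ov_1] by simp
 ultimately have "dm (x + y) x | dm (x + y) y" unfolding dm_def by blast
 then show ?thesis using assms dm_sm by blast
qed
lemma sm_diff: "sm x z ==> sm y z ==> sm (x - y) z" using sm_add[of x z "- y"] by simp
lemma dm_mult: "dm x y ==> dm (w * x) (w * y)"
 unfolding dm_def by (metis abs_ge_zero abs_mult mult.left_commute mult_left_mono)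
lemma sm_mult: "w ~= 0 ==> sm (w * x) (w * y) <-> sm x y"
proof -
 assume w: "w ~= 0"
 have "\<bar>c * (w * x)\<bar> < \<bar>w * y\<bar> <-> \<bar>c * x\<bar> < \<bar>y\<bar>" for c
 proof -
  have "\<bar>c * (w * x)\<bar> = \<bar>w\<bar> * \<bar>c * x\<bar>" by (simp add: abs_mult)
  then show ?thesis using w by (simp add: abs_mult)
 qed
 then show ?thesis by (simp add: sm_def)
qed
lemma dm_mult_iff: "w ~= 0 ==> dm (w * x) (w * y) <-> dm x y" using sm_mult not_sm by blast
lemma dm_mult2: "dm x y ==> dm u v ==> dm (x * u) (y * v)"
 using dm_mult[of u v x] dm_mult[of x y v] by (metis dm_trans mult.commute)
lemma Ov_iff: "x : Ov <-> dm x 1"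
proof
 assume "dm x 1"
 then obtain c where "c : Ov" "\<bar>x\<bar> <= \<bar>c\<bar>" unfolding dm_def by auto
 then show "x : Ov" by (rule Ov_conv)
qed (auto simp: dm_def)

lemma dvN_Ov: "g ~= 0 ==> dv L N x g : Ov <-> dm x g"
 unfolding Ov_iff using dm_mult_iff[of g "x / g" 1] by (simp add: dvN)

lemma mideal_iff: "x : mideal L N Ov <-> sm x 1"
proof (cases "x = 0")
 case False
 have "inverse x : Ov <-> dm 1 x" unfolding Ov_iff using dm_mult_iff[of x "inverse x" 1] False by simp
 then show ?thesis using False not_dm[of 1 x] sm_imp_dm[of x 1] by (auto simp: mideal_def ivN Ov_iff)
qed (simp add: mideal_def)

lemma dvN_mideal: "g ~= 0 ==> dv L N x g : mideal L N Ov <-> sm x g"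
 unfolding mideal_iff using sm_mult[of g "x / g" 1] by (simp add: dvN)

lemma cball_iff: "g ~= 0 ==> y : cball_v L N Ov a g <-> dm (y - a) g"
 by (simp add: cball_v_def dvN_Ov)

lemma units_iff: "x : units L N Ov <-> dm x 1 & dm 1 x"
 by (auto simp: units_def mideal_iff Ov_iff not_sm)

lemma nonzeroN [simp]: "x : nonzero L N <-> x ~= 0" by (simp add: nonzero_def)

lemma scl_mideal: "ph ~= 0 ==> x : scl L N ph (mideal L N Ov) <-> sm x ph"
proof -
 assume p: "ph ~= 0"
 have "x : scl L N ph (mideal L N Ov) <-> x / ph : mideal L N Ov"
  using p by (auto simp: scl_def image_iff intro!: bexI[of _ "x / ph"])
 then show ?thesis using p sm_mult[of ph "x / ph" 1] by (simp add: mideal_iff)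
qed

lemma val_eq: "x ~= 0 ==> y ~= 0 ==> val L N Ov x = val L N Ov y <-> dm x y & dm y x"
proof -
 have v: "z : val L N Ov x <-> z ~= 0 & dm x z & dm z x" for x z
  using dm_mult_iff[of z "x / z" 1] dm_mult_iff[of z 1 "x / z"] by (auto simp: val_def units_iff dvN)
 assume "x ~= 0" "y ~= 0"
 then show ?thesis using v by (auto intro: dm_trans)
qed

end

section \<open>Leading terms along a nest of balls\<close>

locale nest = pb L N + tcv L N Ov for L :: "('f,'r) lang" and N :: "('k::linordered_field,'f,'r) struc" and Ov +
 fixes B :: "('k * 'k) set"
 assumes B0: "!!a g. (a, g) : B ==> g ~= 0"
  and Bmeet: "!!a g b h. (a, g) : B ==> (b, h) : B ==> EX y. dm (y - a) g & dm (y - b) h"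
  and Bempty: "!!y. EX (a, g):B. ~ dm (y - a) g"
begin

text \<open>Membership in the filter generated by the nest. It decides every definable predicate,
  hence serves as the ultrafilter for the germs.\<close>

definition evb :: "('k => bool) => bool" where
 "evb P <-> (EX (a, g):B. ALL x. dm (x - a) g --> P x)"

lemma evbI: "(a, g) : B ==> (!!x. dm (x - a) g ==> P x) ==> evb P" unfolding evb_def by blast
lemma evbE: assumes "evb P" obtains a g where "(a, g) : B" "!!x. dm (x - a) g ==> P x"
 using assms unfolding evb_def by blast

lemma B_sub: assumes "(a, g) : B" "(b, h) : B" "dm g h" "dm (x - a) g" shows "dm (x - b) h"
proof -
 obtain y where y: "dm (y - a) g" "dm (y - b) h" using Bmeet assms by blast
 have "dm (x - y) h" using dm_diff[OF assms(4) y(1)] dm_trans assms(3) by simp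
 then show ?thesis using dm_add[of "x - y" h "y - b"] y(2) by simp
qed

lemma evb_mono: "evb P ==> (!!x. P x ==> Q x) ==> evb Q" unfolding evb_def by blast

lemma evb_conj: assumes "evb P" "evb Q" shows "evb (%x. P x & Q x)"
proof -
 obtain a g where a: "(a, g) : B" "!!x. dm (x - a) g ==> P x" using assms(1) by (rule evbE) blast
 obtain b h where b: "(b, h) : B" "!!x. dm (x - b) h ==> Q x" using assms(2) by (rule evbE) blast
 show ?thesis
 proof (cases "dm g h")
  case True then show ?thesis using a b B_sub[OF a(1) b(1)] by (intro evbI[OF a(1)]) blast
 next
  case False then have "dm h g" using dm_total by blast
  then show ?thesis using a b B_sub[OF b(1) a(1)] by (intro evbI[OF b(1)]) blast
 qed
qed

lemma evb_ne: "evb P ==> EX x. P x" by (erule evbE) (metis diff_self dm_0)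
lemma not_evb_False: "~ evb (%x. False)" using evb_ne by blast

lemma evb_True: "evb (%x. True)" using Bempty[of 0] unfolding evb_def by (elim bexE) auto

lemma evb_ne_point: "evb (%x. x ~= c)"
proof -
 from Bempty[of c] obtain a g where "(a, g) : B" "~ dm (c - a) g" by (elim bexE) auto
 then show ?thesis by (intro evbI) auto
qed

lemma evb_notin: "finite C ==> evb (%x. x ~: C)"
proof (induction C rule: finite_induct)
 case empty then show ?case using evb_True by simp
next
 case (insert c C)
 then show ?case using evb_conj[OF evb_ne_point[of c] insert.IH] by simp
qed

lemma ball_convex: "dm (x - a) g ==> dm (y - a) g ==> x <= z ==> z <= y ==> dm (z - a) g"
proof -
 assume *: "dm (x - a) g" "dm (y - a) g" "x <= z" "z <= y"
 have "\<bar>z - a\<bar> <= \<bar>x - a\<bar> | \<bar>z - a\<bar> <= \<bar>y - a\<bar>" using *(3,4) by (auto simp: abs_if)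
 then show ?thesis using *(1,2) dm_le dm_trans by blast
qed

text \<open>Every point is outside some ball of the nest, so a small ball avoids the finitely many
  exceptional points, and a ball is convex.\<close>

lemma evb_dec: assumes "ds S" shows "evb S | evb (%x. ~ S x)"
proof -
 obtain C where C: "finite C" "!!x y. x <= y ==> (!!c. c : C ==> ~ (x <= c & c <= y)) ==> S x = S y"
  by (rule OMfin[OF assms]) blast
 obtain a g where a: "(a, g) : B" "!!x. dm (x - a) g ==> x ~: C"
  by (rule evbE[OF evb_notin[OF C(1)]]) blast
 have "S x = S y" if "dm (x - a) g" "dm (y - a) g" "x <= y" for x y
  using that a(2) ball_convex[OF that(1,2)] by (intro C(2)) auto
 then have "S x = S a" if "dm (x - a) g" for x
  using that by (metis diff_self dm_0 linear)
 then show ?thesis using evbI[OF a(1)] by (cases "S a") (blast, metis)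
qed

lemma half_small: "dm (2 * x) y = dm x y"
 using dm_le[of x "2 * x"] dm_trans[of x "2 * x" y] dm_add[of x y x] by (auto simp: abs_mult)

text \<open>Consider \<open>G\<close> = F/F', monotone on a ball. If some ball has radius much
  smaller than all values of \<open>G\<close> on it, then F changes over that ball by much less than
  its own size. Otherwise F'/F is huge compared with the reciprocal of the radius at some point,
  which forces an expansion rate forbidden by \<open>expansion_rate_bounded\<close>.\<close>

lemma rv_const_increasing:
 assumes F: "df F" and pos: "evb (%x. 0 < F x)" and dF: "evb (%x. has_d F x (F' x))"
  and F': "df F'" and p': "evb (%x. 0 < F' x)"
 shows "EX g. g ~= 0 & evb (%x. sm (F x - g) g)"
proof -
 define G where "G x = F x / F' x" for x
 have G: "df G" unfolding G_def by (rule DF_divide[OF F F'])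
 have "evb (%x. EX c. has_d G x c)"
  using evb_notin[OF finite_nondiff[OF G]] by simp
 then have Gd: "evb (%x. has_d G x (derivk G x))" by (rule evb_mono) (metis derivk_eq)
 have G': "df (derivk G)" by (rule df_derivk[OF G])
 have "evb (%x. 0 <= derivk G x) | evb (%x. ~ 0 <= derivk G x)"
  by (rule evb_dec) (intro D_base DF_base DFU G')
 then obtain up where s: "evb (%x. if up then 0 <= derivk G x else derivk G x <= 0)"
 proof
  assume "evb (%x. ~ 0 <= derivk G x)"
  then have "evb (%x. if False then 0 <= derivk G x else derivk G x <= 0)" by (rule evb_mono) auto
  then show ?thesis by (rule that)
 qed (use that[of True] in simp)
 obtain a1 g1 where 1: "(a1, g1) : B" and 1: "!!x. dm (x - a1) g1 ==> 0 < F x & has_d F x (F' x) & 0 < F' x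
   & has_d G x (derivk G x) & (if up then 0 <= derivk G x else derivk G x <= 0)"
  using evb_conj[OF pos evb_conj[OF dF evb_conj[OF p' evb_conj[OF Gd s]]]] by (rule evbE) blast
 note B1 = \<open>(a1, g1) : B\<close>
 let ?b1 = "%x. dm (x - a1) g1"
 have Gmono: "if up then G x <= G y else G y <= G x" if xy: "?b1 x" "?b1 y" "x <= y" for x y
 proof -
  have b: "?b1 z" if "x <= z" "z <= y" for z using ball_convex xy that by blast
  show ?thesis
  proof (cases up)
   case True
   then have "0 * (y - x) <= G y - G x" by (intro mvi[OF G xy(3), of "derivk G"]) (use 1 b in auto)
   then show ?thesis using True by simp
  next
   case False
   then have "G y - G x <= 0 * (y - x)" by (intro mvi_le[OF G xy(3), of "derivk G"]) (use 1 b in auto)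
   then show ?thesis using False by simp
  qed
 qed
 have Fmono: "F x <= F y" if xy: "?b1 x" "?b1 y" "x <= y" for x y
 proof -
  have b: "?b1 z" if "x <= z" "z <= y" for z using ball_convex xy that by blast
  have "0 * (y - x) <= F y - F x" by (rule mvi[OF F xy(3), of F']) (use 1 b in \<open>auto simp: less_imp_le\<close>)
  then show ?thesis by simp
 qed
 have Gpos: "0 < G x" if "?b1 x" for x using 1[OF that] by (simp add: G_def)
 have FG: "F' x = F x / G x" if "?b1 x" for x using 1[OF that] by (simp add: G_def)
 show ?thesis
 proof (cases "EX (a, g):B. dm g g1 & (ALL x. dm (x - a) g --> sm g (G x))")
  case True
  then obtain a g where ag: "(a, g) : B" "dm g g1" "!!x. dm (x - a) g ==> sm g (G x)" by blast
  have sub: "?b1 x" if "dm (x - a) g" for x using B_sub[OF ag(1) B1 ag(2) that] .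
  have step: "sm (F y - F x) (F y)" if xy: "dm (x - a) g" "dm (y - a) g" "x <= y" for x y
  proof -
   \<comment> \<open>By monotonicity of \<open>G\<close> its minimum on the segment is attained at
     an end, so F' = F/G is at most F y/m there, F being increasing as well.\<close>
   define m where "m = min (G x) (G y)"
   have m: "0 < m" "sm g m" using Gpos[OF sub] ag(3) xy by (auto simp: m_def min_def)
   have b: "?b1 z" if "x <= z" "z <= y" for z using ball_convex sub xy that by blast
   have "F y - F x <= (F y / m) * (y - x)"
   proof (rule mvi_le[OF F xy(3)])
    show "has_d F z (F' z)" if "x <= z" "z <= y" for z using 1[OF b[OF that]] by blast
    show "F' z <= F y / m" if z: "x <= z" "z <= y" for z
    proof -
     have "m <= G z" using Gmono[OF b[of x] b[of z]] Gmono[OF b[of z] b[of y]] z xy(3)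
      by (cases up) (auto simp: m_def min_le_iff_disj)
     then show ?thesis unfolding FG[OF b[OF z]] using Fmono[OF b[OF z] b[of y]] z xy(3) 1[OF b[OF z]] m
      by (intro frac_le) auto
    qed
   qed
   moreover have nn: "0 <= F y - F x" using Fmono[OF sub sub] xy by simp
   ultimately have "dm (F y - F x) ((F y / m) * (y - x))"
    by (intro dm_le, unfold abs_of_nonneg[OF nn]) (rule order_trans[OF _ abs_ge_self])
   moreover have "sm ((F y / m) * (y - x)) ((F y / m) * m)"
   proof -
    have "dm (y - x) g" using dm_diff[OF xy(2,1)] by simp
    then have "sm (y - x) m" using m(2) by (rule dm_sm)
    moreover have "F y / m ~= 0" using 1[OF sub[OF xy(2)]] m by simp
    ultimately show ?thesis using sm_mult by blast
   qed
   moreover have "(F y / m) * m = F y" using m(1) by simp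
   ultimately show ?thesis using dm_sm by metis
  qed
  have a: "dm (a - a) g" by simp
  have "sm (F x - F a) (F a)" if x: "dm (x - a) g" for x
  proof (cases "x <= a")
   case True then show ?thesis using step[OF x a True] dm_diff_commute by blast
  next
   case False
   then have s: "sm (F x - F a) (F x)" using step[OF a x] by simp
   then have "sm (2 * (F x - F a)) (F x)" using sm_add[OF s s] by (simp only: mult_2)
   then have "\<bar>2 * (F x - F a)\<bar> < \<bar>F x\<bar>" by (rule sm_less)
   then have "F x <= 2 * F a" using 1[OF sub[OF x]] by auto
   then have "dm (F x) (2 * F a)" using 1[OF sub[OF x]] by (intro dm_le) auto
   moreover have "dm (2 * F a) (F a)" unfolding half_small by simp
   ultimately show ?thesis using s dm_trans sm_dm by blast
  qed
  moreover have "F a ~= 0" using 1[OF sub[OF a]] by auto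
  ultimately show ?thesis by (intro exI[of _ "F a"] conjI evbI[OF ag(1)])
 next
  case False
  then have no: "EX x. dm (x - a) g & ~ sm g (G x)" if "(a, g) : B" "dm g g1" for a g using that by fast
  \<comment> \<open>The second ball does not contain \<open>a1\<close>, so its radius is strictly
    smaller in the valuation. A point \<xi> in it with \<open>G\<close> dominated by
    \<open>g2\<close> then has \<open>G \<xi>\<close> strictly below \<open>g1\<close>.\<close>
  from Bempty[of a1] obtain a2 g2 where 2: "(a2, g2) : B" "~ dm (a1 - a2) g2" by (elim bexE) auto
  have "~ dm g1 g2" using B_sub[OF B1 2(1), of a1] 2(2) by auto
  then have s21: "sm g2 g1" using not_dm by blast
  have "dm g2 g1" using s21 sm_imp_dm by blast
  then obtain \<xi> where \<xi>: "dm (\<xi> - a2) g2" "~ sm g2 (G \<xi>)" using no[OF 2(1)] by metis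
  have b\<xi>: "?b1 \<xi>" using B_sub[OF 2(1) B1 \<open>dm g2 g1\<close> \<xi>(1)] .
  have sG: "sm (G \<xi>) g1" using \<xi>(2) s21 dm_sm not_sm by blast
  define \<ll> where "\<ll> = \<bar>g1\<bar>"
  have l: "0 < \<ll>" using B0[OF B1] by (simp add: \<ll>_def)
  \<comment> \<open>The interval of length \<ll> ends at \<xi> if \<open>G\<close> increases and
    starts there if it decreases, so that \<open>G\<close> stays at most \<open>G \<xi>\<close> on
    it. Both choices remain inside the first ball.\<close>
  define \<alpha> where "\<alpha> = (if up then \<xi> - \<ll> else \<xi>)"
  define q where "q = \<ll> / G \<xi>"
  have bx: "?b1 (\<alpha> + \<ll> * x) & G (\<alpha> + \<ll> * x) <= G \<xi>" if x: "0 <= x" "x <= 1" for x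
  proof -
   have "dm (\<alpha> + \<ll> * x - \<xi>) g1"
   proof (rule dm_trans[OF dm_le])
    have lx: "0 <= \<ll> * x" "\<ll> * x <= \<ll>" using l x by (simp_all add: mult_left_le)
    show "\<bar>\<alpha> + \<ll> * x - \<xi>\<bar> <= \<bar>\<ll>\<bar>" using lx l by (auto simp: \<alpha>_def abs_if)
   qed (simp add: \<ll>_def)
   from dm_add[OF this b\<xi>] have "dm (\<alpha> + \<ll> * x - \<xi> + (\<xi> - a1)) g1" .
   moreover have "\<alpha> + \<ll> * x - \<xi> + (\<xi> - a1) = \<alpha> + \<ll> * x - a1" by simp
   ultimately have b: "?b1 (\<alpha> + \<ll> * x)" by (simp only:)
   have lx: "0 <= \<ll> * x" "\<ll> * x <= \<ll>" using l x by (simp_all add: mult_left_le)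
   then have "if up then \<alpha> + \<ll> * x <= \<xi> else \<xi> <= \<alpha> + \<ll> * x" by (simp add: \<alpha>_def)
   then show ?thesis using b Gmono[OF b b\<xi>] Gmono[OF b\<xi> b] by (cases up) auto
  qed
  have "EX c:dcl {}. q <= c"
  proof (rule expansion_rate_bounded[OF F l])
   show "0 < F (\<alpha> + \<ll> * x)" if "0 <= x" "x <= 1" for x using 1 bx[OF that] by blast
   fix x y :: 'k assume xy: "0 <= x" "x < y" "y <= 1"
   let ?X = "\<alpha> + \<ll> * x" and ?Y = "\<alpha> + \<ll> * y"
   have XY: "?X <= ?Y" using xy l by simp
   have c: "0 <= (z - \<alpha>) / \<ll> & (z - \<alpha>) / \<ll> <= 1 & \<alpha> + \<ll> * ((z - \<alpha>) / \<ll>) = z" if z: "?X <= z" "z <= ?Y" for z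
   proof -
    have "0 <= \<ll> * x" using xy l by simp
    then have z0: "0 <= z - \<alpha>" using z by simp
    have "z - \<alpha> <= \<ll> * y" using z by simp
    also have "\<dots> <= \<ll> * 1" using xy l by (intro mult_left_mono) auto
    finally have "z - \<alpha> <= \<ll>" by simp
    then show ?thesis using z0 l by (simp add: divide_le_eq)
   qed
   have bz: "?b1 z & G z <= G \<xi>" if "?X <= z" "z <= ?Y" for z
    using bx[of "(z - \<alpha>) / \<ll>"] c[OF that] by simp
   have "F ?X / G \<xi> * (?Y - ?X) <= F ?Y - F ?X"
   proof (rule mvi[OF F XY])
    show "has_d F z (F' z)" if "?X <= z" "z <= ?Y" for z using 1 bz[OF that] by blast
    show "F ?X / G \<xi> <= F' z" if z: "?X <= z" "z <= ?Y" for z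
    proof -
     have "F ?X <= F z" using Fmono bz[of ?X] bz[OF z] z XY by auto
     moreover have "0 < F ?X" using 1 bz[of ?X] XY by auto
     ultimately show ?thesis using FG[of z] bz[OF z] Gpos[of z] by (auto intro!: frac_le)
    qed
   qed
   moreover have "F ?X / G \<xi> * (?Y - ?X) = F ?X * (q * (y - x))" by (simp add: q_def algebra_simps diff_divide_distrib)
   ultimately show "F ?X * (1 + q * (y - x)) <= F ?Y" by (simp add: algebra_simps)
  qed
  \<comment> \<open>The rate \<ll> / G \<xi> is bounded by a member of the valuation ring, so
    \<open>G \<xi>\<close> is not small against the radius after all.\<close>
  then obtain c where c: "c : Ov" "q <= c" using dcl_empty_Ov by blast
  have "\<ll> <= c * G \<xi>" using c(2) Gpos[OF b\<xi>] by (simp add: q_def divide_le_eq)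
  then have "dm \<ll> (G \<xi>)" unfolding dm_def using c(1) l by (intro bexI[of _ c]) auto
  then have "~ sm (G \<xi>) g1" unfolding not_sm \<ll>_def by simp
  then show ?thesis using sG by blast
 qed
qed

lemma evb_tri: assumes "df f" shows "evb (%x. 0 < f x) | evb (%x. f x = 0) | evb (%x. f x < 0)"
proof -
 have 1: "evb (%x. 0 < f x) | evb (%x. ~ 0 < f x)" by (rule evb_dec) (intro D_base DF_base DFU assms)
 have 2: "evb (%x. f x = 0) | evb (%x. ~ f x = 0)" by (rule evb_dec) (intro D_base DF_base DFU assms)
 have "evb (%x. f x < 0)" if "evb (%x. ~ 0 < f x)" "evb (%x. ~ f x = 0)"
  by (rule evb_mono[OF evb_conj[OF that]]) auto
 then show ?thesis using 1 2 by blast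
qed

text \<open>The derivative has constant sign along the nest. The zero case makes F constant, the
  positive case is \<open>rv_const_increasing\<close>, and the negative one is reduced to these by
  passing to 1/F, whose leading term is inverted at the end.\<close>

lemma rv_const_pos:
 assumes F: "df F" and pos: "evb (%x. 0 < F x)" shows "EX g. g ~= 0 & evb (%x. sm (F x - g) g)"
proof -
 have diff: "evb (%x. has_d f x (derivk f x))" if "df f" for f
 proof -
  have "evb (%x. EX c. has_d f x c)" using evb_notin[OF finite_nondiff[OF that]] by simp
  then show ?thesis by (rule evb_mono) (metis derivk_eq)
 qed
 have F': "df (derivk F)" by (rule df_derivk[OF F])
 note tri = evb_tri
 have const: "EX g. g ~= 0 & evb (%x. sm (f x - g) g)" if f: "df f" "evb (%x. derivk f x = 0)" "evb (%x. 0 < f x)" for f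
 proof -
  obtain a g where ag: "(a, g) : B" "!!x. dm (x - a) g ==> has_d f x 0 & 0 < f x"
  proof (rule evbE[OF evb_conj[OF diff[OF f(1)] evb_conj[OF f(2,3)]]])
   fix a g assume "(a, g) : B" and *: "!!x. dm (x - a) g ==> has_d f x (derivk f x) & derivk f x = 0 & 0 < f x"
   moreover have "has_d f x 0 & 0 < f x" if "dm (x - a) g" for x using *[OF that] by auto
   ultimately show thesis by (rule_tac that)
  qed
  have le: "f x = f y" if xy: "dm (x - a) g" "dm (y - a) g" "x <= y" for x y
  proof -
   have "0 * (y - x) <= f y - f x"
    by (rule mvi[OF f(1) xy(3), of "%_. 0"]) (use ag ball_convex xy in blast)+
   moreover have "f y - f x <= 0 * (y - x)"
    by (rule mvi_le[OF f(1) xy(3), of "%_. 0"]) (use ag ball_convex xy in blast)+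
   ultimately show ?thesis by simp
  qed
  have a: "dm (a - a) g" by simp
  have fa: "f x = f a" if x: "dm (x - a) g" for x
   by (cases "x <= a", rule le[OF x a], assumption, rule le[OF a x, symmetric], simp)
  have fa0: "f a ~= 0" using ag(2)[OF a] by simp
  have "sm (f x - f a) (f a)" if "dm (x - a) g" for x unfolding fa[OF that] using fa0 by simp
  moreover note fa0
  ultimately show ?thesis by (intro exI[of _ "f a"] conjI evbI[OF ag(1)])
 qed
 consider "evb (%x. 0 < derivk F x)" | "evb (%x. derivk F x = 0)" | "evb (%x. derivk F x < 0)"
  using tri[OF F'] by blast
 then show ?thesis
 proof cases
  case 1 show ?thesis by (rule rv_const_increasing[OF F pos diff[OF F] F' 1])
 next
  case 2 show ?thesis by (rule const[OF F 2 pos])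
 next
  case 3
  \<comment> \<open>No rule for differentiating a quotient is used: a negative derivative of
    \<open>I\<close> and one of \<open>F\<close> would make both decrease just to the right of x,
    although \<open>I\<close> is the reciprocal of a positive function.\<close>
  define I where "I x = 1 / F x" for x
  have I: "df I" unfolding I_def by (intro DF_base F)
  have Ipos: "evb (%x. 0 < I x)" using evb_mono[OF pos, of "%x. 0 < I x"] by (simp add: I_def)
  have I': "df (derivk I)" by (rule df_derivk[OF I])
  obtain a g where ag: "(a, g) : B" "!!x. dm (x - a) g ==> has_d F x (derivk F x) & 0 < F x & derivk F x < 0 & has_d I x (derivk I x)"
   using evb_conj[OF diff[OF F] evb_conj[OF pos evb_conj[OF 3 diff[OF I]]]] by (rule evbE) blast
  have "0 <= derivk I x" if x: "dm (x - a) g" for x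
  proof (rule ccontr)
   assume n: "~ 0 <= derivk I x"
   have "has_d (%x. - I x) x (- derivk I x)" using ag(2)[OF x] has_d_uminus by blast
   then have "qd (%x. - I x) x 0" by (rule has_d_qd) (use n in simp)
   then obtain e where e: "e > 0" "!!h. 0 < h ==> h < e ==> I (x + h) < I x" unfolding qd_def evr_def by auto
   have "has_d (%x. - F x) x (- derivk F x)" using ag(2)[OF x] has_d_uminus by blast
   then have "qd (%x. - F x) x 0" by (rule has_d_qd) (use ag(2)[OF x] in simp)
   then obtain e' where e': "e' > 0" "!!h. 0 < h ==> h < e' ==> F (x + h) < F x" unfolding qd_def evr_def by auto
   define h where "h = min (min e e' / 2) \<bar>g\<bar>"
   have g: "g ~= 0" using B0 ag(1) by blast
   have h: "0 < h" "h < e" "h < e'" "h <= \<bar>g\<bar>" using e(1) e'(1) g by (auto simp: h_def min_def)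
   have "dm h g" using h by (intro dm_le) auto
   then have "dm (x + h - a) g" using dm_add[OF x] by (simp add: algebra_simps)
   then have "0 < F (x + h)" using ag(2) by blast
   moreover have "F (x + h) < F x" "I (x + h) < I x" using e e' h by auto
   moreover have "0 < F x" using ag(2)[OF x] by blast
   ultimately show False unfolding I_def using divide_strict_left_mono[of "F (x + h)" "F x" 1] by simp
  qed
  then have nn: "evb (%x. ~ derivk I x < 0)" using evbI[OF ag(1)] by (simp add: not_less)
  have "EX g. g ~= 0 & evb (%x. sm (I x - g) g)"
  proof -
   consider "evb (%x. 0 < derivk I x)" | "evb (%x. derivk I x = 0)" | "evb (%x. derivk I x < 0)"
    using tri[OF I'] by blast
   then show ?thesis
   proof cases
    case 1 show ?thesis by (rule rv_const_increasing[OF I Ipos diff[OF I] I' 1])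
   next
    case 2 show ?thesis by (rule const[OF I 2 Ipos])
   next
    case 3 then show ?thesis using evb_conj[OF nn 3] not_evb_False by simp
   qed
  qed
  then obtain c where c: "c ~= 0" "evb (%x. sm (I x - c) c)" by blast
  have "sm (F x - 1 / c) (1 / c)" if x: "0 < F x" "sm (I x - c) c" for x
  proof -
   have "sm (F x * (I x - c)) (F x * c)" using x by (simp add: sm_mult)
   moreover have "F x * (I x - c) = 1 - F x * c" using x by (simp add: I_def algebra_simps)
   ultimately have s: "sm (1 - F x * c) (F x * c)" by simp
   have "sm (1 - F x * c) 1"
   proof (rule ccontr)
    assume "~ sm (1 - F x * c) 1"
    then have "sm 1 (F x * c)" unfolding not_sm using s by (rule dm_sm)
    then have "sm (1 - (1 - F x * c)) (F x * c)" using s by (rule sm_diff)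
    then show False by simp
   qed
   then have "sm (F x * c - 1) 1" using dm_diff_commute(2) by blast
   then have "sm ((1 / c) * (F x * c - 1)) ((1 / c) * 1)" using c(1) by (subst sm_mult) auto
   then show ?thesis using c(1) by (simp add: algebra_simps diff_divide_distrib)
  qed
  then have "evb (%x. sm (F x - 1 / c) (1 / c))" using evb_mono[OF evb_conj[OF pos c(2)]] by simp
  then show ?thesis using c(1) by (intro exI[of _ "1 / c"]) auto
 qed
qed

lemma rv_const: assumes F: "df F" shows "evb (%x. F x = 0) | (EX g. g ~= 0 & evb (%x. sm (F x - g) g))"
proof -
 consider "evb (%x. 0 < F x)" | "evb (%x. F x = 0)" | "evb (%x. 0 < - F x)"
  using evb_tri[OF F] by auto
 then show ?thesis
 proof cases
  case 1 then show ?thesis using rv_const_pos[OF F] by blast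
 next
  case 3
  obtain g where g: "g ~= 0" "evb (%x. sm (- F x - g) g)" using rv_const_pos[OF DF_minus[OF F] 3] by blast
  have "evb (%x. sm (F x - - g) (- g))"
  proof (rule evb_mono[OF g(2)])
   fix x assume "sm (- F x - g) g"
   moreover have "F x - - g = - (- F x - g)" by simp
   ultimately show "sm (F x - - g) (- g)" by (simp only: dm_minus)
  qed
  then show ?thesis using g(1) by (metis neg_equal_0_iff_equal)
 qed blast
qed

end

section \<open>The structure of germs along a nest\<close>

context omf
begin

lemma DF_eval_trm: "wf_trm L t ==> DF A (%bt. eval_trm N bt t)"
proof -
 assume t: "wf_trm L t"
 have 1: "eval_trm N (%i. bt (Suc i)) t = eval_trm N bt (tsub (%i. Var (Suc i)) t)" for bt
  by (simp add: eval_tsub)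
 have "wf_fm L (Eq (Var 0) (tsub (%i. Var (Suc i)) t))" using t by (simp add: wf_tsub)
 then have "D0 (%bt. bt 0 = eval_trm N (%i. bt (Suc i)) t)" unfolding D0_def 1 by fastforce
 then show ?thesis unfolding DF_def by (rule D0_D)
qed

lemma D_sat: "wf_fm L ph ==> D A (%bt. sat N bt ph)"
 by (rule D0_D) (auto simp: D0_def)

lemma D_sat': "wf_fm L ph ==> (!!i. DF A (ta i)) ==> D A (%bt. sat N (%i. ta i bt) ph)"
 by (rule D_subst[OF D_sat])

lemma DF_eval_trm': "wf_trm L t ==> (!!i. DF A (ta i)) ==> DF A (%bt. eval_trm N (%i. ta i bt) t)"
 by (rule DF_subst[OF DF_eval_trm])

lemma df_fint:
 assumes "length Fs = fun_ar L f" "!!F. F : set Fs ==> df F"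
 shows "df (%x. fint N f (map (%F. F x) Fs))"
proof -
 have "wf_trm L (Fn f (map Var [0..<length Fs]))" using assms(1) by (simp add: list_all_iff)
 moreover have "df (if i < length Fs then Fs ! i else (%_. 0))" for i
  using assms(2)[of "Fs ! i"] by (cases "i < length Fs") (simp_all add: DF_0)
 ultimately have "df (%x. eval_trm N (%i. (if i < length Fs then Fs ! i else (%_. 0)) x) (Fn f (map Var [0..<length Fs])))"
  by (rule DF_eval_trm'[where ta = "%i bt. (if i < length Fs then Fs ! i else (%_. 0)) (bt 0)"])
 moreover have "map (eval_trm N (%i. (if i < length Fs then Fs ! i else (%_. 0)) x)) (map Var [0..<length Fs]) = map (%F. F x) Fs" for x
  by (rule nth_equalityI) auto
 ultimately show ?thesis by simp
qed

end

context nest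
begin

definition cls :: "('k => 'k) => ('k => 'k) set" where "cls F = {G. df G & evb (%x. F x = G x)}"
definition rep :: "('k => 'k) set => 'k => 'k" where "rep c = (SOME F. F : c)"

lemma cls_eq: assumes "df F" "df G" shows "cls F = cls G <-> evb (%x. F x = G x)"
proof
 assume "cls F = cls G"
 moreover have "G : cls G" using assms evb_True by (simp add: cls_def)
 ultimately have "G : cls F" by (simp only:)
 then show "evb (%x. F x = G x)" by (simp only: cls_def mem_Collect_eq)
next
 assume *: "evb (%x. F x = G x)"
 have tr: "evb (%x. f x = h x)" if "evb (%x. f x = g x)" "evb (%x. g x = h x)" for f g h
  by (rule evb_mono[OF evb_conj[OF that]]) (metis (no_types))
 have sy: "evb (%x. G x = F x)" by (rule evb_mono[OF *]) (rule sym)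
 have "evb (%x. F x = H x) <-> evb (%x. G x = H x)" for H
  using tr[OF *, of H] tr[OF sy, of H] by blast
 then show "cls F = cls G" unfolding cls_def by (intro Collect_cong conj_cong refl)
qed

lemma rep_cls: assumes "df F" shows "df (rep (cls F))" "evb (%x. rep (cls F) x = F x)" "cls (rep (cls F)) = cls F"
proof -
 have "F : cls F" using assms evb_True by (simp add: cls_def)
 then have "rep (cls F) : cls F" unfolding rep_def by (rule someI[of "%G. G : cls F"])
 then have *: "df (rep (cls F))" "evb (%x. F x = rep (cls F) x)" by (simp_all only: cls_def[of F] mem_Collect_eq)
 then show "df (rep (cls F))" by simp
 show "evb (%x. rep (cls F) x = F x)" by (rule evb_mono[OF *(2)]) simp
 then show "cls (rep (cls F)) = cls F" using cls_eq[OF *(1) assms] by simp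
qed

text \<open>A definable ultrapower: definable functions of one variable modulo agreement along the
  nest. Operations act on chosen representatives, and \<open>germs_fint\<close> and
  \<open>germs_rint\<close> show that the choice does not matter.\<close>

definition germs :: "(('k => 'k) set, 'f, 'r) struc" where
 "germs = \<lparr>univ = cls ` {F. df F}, fint = %f cs. cls (%x. fint N f (map (%c. rep c x) cs)),
   rint = %r cs. evb (%x. rint N r (map (%c. rep c x) cs))\<rparr>"

lemma evb_reps: "(!!F. F : set Fs ==> df F) ==> evb (%x. map (%c. rep c x) (map cls Fs) = map (%F. F x) Fs)"
proof (induction Fs)
 case Nil then show ?case using evb_True by simp
next
 case (Cons F Fs)
 have 1: "evb (%x. rep (cls F) x = F x)" by (rule rep_cls(2)) (use Cons.prems in simp)
 have 2: "evb (%x. map (%c. rep c x) (map cls Fs) = map (%F. F x) Fs)"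
  by (rule Cons.IH) (use Cons.prems in simp)
 show ?case by (rule evb_mono[OF evb_conj[OF 1 2]]) (simp only: list.map)
qed

lemma df_rep: "c : univ germs ==> df (rep c)"
 unfolding germs_def struc.simps by (elim imageE) (simp only: mem_Collect_eq rep_cls(1))

lemma df_fint_rep: assumes "length cs = fun_ar L f" "set cs <= univ germs"
 shows "df (%x. fint N f (map (%c. rep c x) cs))"
proof -
 have "df F" if "F : set (map rep cs)" for F using that assms(2) df_rep by auto
 then have "df (%x. fint N f (map (%F. F x) (map rep cs)))" by (intro df_fint) (simp add: assms(1))
 then show ?thesis by (simp only: map_map comp_def)
qed

lemma cls_univ: "df F ==> cls F : univ germs" unfolding germs_def struc.simps by (intro imageI CollectI)

lemma germs_ok: "struc_ok L germs"
 unfolding struc_ok_def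
proof (intro conjI allI impI)
 show "univ germs ~= {}" using cls_univ[OF DF_0] by blast
 fix f cs assume cs: "length cs = fun_ar L f & set cs <= univ germs"
 have "fint germs f cs = cls (%x. fint N f (map (%c. rep c x) cs))" by (simp add: germs_def)
 then show "fint germs f cs : univ germs" using cls_univ[OF df_fint_rep] cs by simp
qed

lemma germs_fint:
 assumes "length Fs = fun_ar L f" "!!F. F : set Fs ==> df F"
 shows "fint germs f (map cls Fs) = cls (%x. fint N f (map (%F. F x) Fs))"
proof -
 have "df (%x. fint N f (map (%c. rep c x) (map cls Fs)))"
  by (rule df_fint_rep) (use assms cls_univ in auto)
 note cls_eq[OF this df_fint[OF assms]]
 moreover have "evb (%x. fint N f (map (%c. rep c x) (map cls Fs)) = fint N f (map (%F. F x) Fs))"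
  by (rule evb_mono[OF evb_reps[OF assms(2)]]) (assumption, simp only:)
 ultimately have "cls (%x. fint N f (map (%c. rep c x) (map cls Fs))) = cls (%x. fint N f (map (%F. F x) Fs))"
  by blast
 then show ?thesis by (simp add: germs_def)
qed

lemma germs_rint:
 assumes "!!F. F : set Fs ==> df F"
 shows "rint germs r (map cls Fs) <-> evb (%x. rint N r (map (%F. F x) Fs))"
proof -
 have e: "evb (%x. map (%c. rep c x) (map cls Fs) = map (%F. F x) Fs)" by (rule evb_reps[OF assms])
 have "rint germs r (map cls Fs) <-> evb (%x. rint N r (map (%c. rep c x) (map cls Fs)))" by (simp add: germs_def)
 also have "\<dots> <-> evb (%x. rint N r (map (%F. F x) Fs))"
 proof
  assume "evb (%x. rint N r (map (%c. rep c x) (map cls Fs)))"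
  from evb_conj[OF e this] show "evb (%x. rint N r (map (%F. F x) Fs))" by (rule evb_mono) (metis (no_types, lifting))
 next
  assume "evb (%x. rint N r (map (%F. F x) Fs))"
  from evb_conj[OF e this] show "evb (%x. rint N r (map (%c. rep c x) (map cls Fs)))" by (rule evb_mono) (metis (no_types, lifting))
 qed
 finally show ?thesis .
qed

lemma germs_eval:
 assumes "!!i. df (bf i)"
 shows "wf_trm L t ==> eval_trm germs (%i. cls (bf i)) t = cls (%x. eval_trm N (%i. bf i x) t)"
proof (induction t)
 case (Fn f ts)
 have wf: "!!t. t : set ts ==> wf_trm L t" and len: "length ts = fun_ar L f" using Fn.prems by (auto simp: list_all_iff)
 define Fs where "Fs = map (%t x. eval_trm N (%i. bf i x) t) ts"
 have dfF: "df F" if "F : set Fs" for F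
  using that wf unfolding Fs_def by (auto intro!: DF_eval_trm'[where ta = "%i bt. bf i (bt 0)"] assms)
 have "map (eval_trm germs (%i. cls (bf i))) ts = map cls Fs"
  unfolding Fs_def using Fn.IH wf by simp
 then have "eval_trm germs (%i. cls (bf i)) (Fn f ts) = fint germs f (map cls Fs)" by (simp only: eval_trm.simps)
 also have "\<dots> = cls (%x. fint N f (map (%F. F x) Fs))" by (rule germs_fint) (use len dfF in \<open>auto simp: Fs_def\<close>)
 also have "(%x. fint N f (map (%F. F x) Fs)) = (%x. eval_trm N (%i. bf i x) (Fn f ts))"
  by (simp add: Fs_def comp_def)
 finally show ?case .
next
 case (Var n)
 show ?case by (simp only: eval_trm.simps)
qed

lemma evb_not: "ds S ==> evb (%x. ~ S x) <-> ~ evb S"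
proof
 assume n: "evb (%x. ~ S x)"
 show "~ evb S"
 proof
  assume "evb S"
  have "evb (%x. False)" by (rule evb_mono[OF evb_conj[OF \<open>evb S\<close> n]]) (erule conjE, erule notE, assumption)
  then show False using not_evb_False by blast
 qed
qed (use evb_dec in blast)

text \<open>The theorem of Los for this ultrapower. Negation works since the filter decides
  definable predicates; a witness for an existential quantifier is a definable function of x by
  definable choice, so its germ is an element of the structure.\<close>

theorem Los:
 assumes "!!i. df (bf i)" "wf_fm L ph"
 shows "sat germs (%i. cls (bf i)) ph <-> evb (%x. sat N (%i. bf i x) ph)"
 using assms
proof (induction ph arbitrary: bf)
 case (Eq s t)
 have "df (%x. eval_trm N (%i. bf i x) s)" "df (%x. eval_trm N (%i. bf i x) t)"
  using Eq.prems by (auto intro!: DF_eval_trm'[where ta = "%i bt. bf i (bt 0)"])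
 then show ?case using Eq.prems by (simp add: germs_eval cls_eq)
next
 case (Rl r ts)
 have wf: "!!t. t : set ts ==> wf_trm L t" using Rl.prems by (auto simp: list_all_iff)
 define Fs where "Fs = map (%t x. eval_trm N (%i. bf i x) t) ts"
 have dfF: "df F" if "F : set Fs" for F
  using that wf Rl.prems(1) unfolding Fs_def by (auto intro!: DF_eval_trm'[where ta = "%i bt. bf i (bt 0)"])
 have e: "map (eval_trm germs (%i. cls (bf i))) ts = map cls Fs"
  unfolding Fs_def using germs_eval[OF Rl.prems(1)] wf by simp
 have e2: "map (%F. F x) Fs = map (eval_trm N (%i. bf i x)) ts" for x by (simp add: Fs_def)
 have r: "rint germs r (map cls Fs) <-> evb (%x. rint N r (map (%F. F x) Fs))"
  by (rule germs_rint) (rule dfF)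
 show ?case unfolding sat.simps e r e2 ..
next
 case (Neg ph)
 have "sat germs (%i. cls (bf i)) ph <-> evb (%x. sat N (%i. bf i x) ph)" by (rule Neg.IH) (use Neg.prems in auto)
 moreover have "ds (%x. sat N (%i. bf i x) ph)"
  by (rule D_sat'[where ta = "%i bt. bf i (bt 0)"]) (use Neg.prems in auto)
 ultimately show ?case using evb_not by simp
next
 case (Conj ph \<psi>)
 have 1: "sat germs (%i. cls (bf i)) ph <-> evb (%x. sat N (%i. bf i x) ph)" by (rule Conj.IH) (use Conj.prems in auto)
 have 2: "sat germs (%i. cls (bf i)) \<psi> <-> evb (%x. sat N (%i. bf i x) \<psi>)" by (rule Conj.IH) (use Conj.prems in auto)
 have "evb P & evb Q <-> evb (%x. P x & Q x)" for P Q
  using evb_conj[of P Q] evb_mono[of "%x. P x & Q x" P] evb_mono[of "%x. P x & Q x" Q] by blast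
 then show ?case unfolding sat.simps 1 2 .
next
 case (Ex i ph)
 have wf: "wf_fm L ph" using Ex.prems by simp
 have IH: "sat germs ((%j. cls (bf j))(i := cls F)) ph <-> evb (%x. sat N ((%j. bf j x)(i := F x)) ph)" if "df F" for F
 proof -
  have "sat germs (%j. cls ((bf(i := F)) j)) ph <-> evb (%x. sat N (%j. (bf(i := F)) j x) ph)"
   by (rule Ex.IH) (use Ex.prems that in auto)
  moreover have "(%j. cls ((bf(i := F)) j)) = (%j. cls (bf j))(i := cls F)" by (rule ext) simp
  moreover have "(%j. (bf(i := F)) j x) = (%j. bf j x)(i := F x)" for x by auto
  ultimately show ?thesis by (simp only:)
 qed
 show ?case
 proof
  assume "sat germs (%j. cls (bf j)) (Ex i ph)"
  then obtain F where "df F" "sat germs ((%j. cls (bf j))(i := cls F)) ph" by (auto simp: germs_def)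
  then have "evb (%x. sat N ((%j. bf j x)(i := F x)) ph)" using IH by blast
  then show "evb (%x. sat N (%j. bf j x) (Ex i ph))" by (rule evb_mono) auto
 next
  assume ev: "evb (%x. sat N (%j. bf j x) (Ex i ph))"
  have "DF UNIV (%bt. if j = i then bt 0 else bf j (bt 1))" for j
   by (cases "j = i") (auto intro!: DF_var DF_app1[where F = "bf j", OF Ex.prems(1)])
  from D_sat'[OF wf, where ta = "%j bt. if j = i then bt 0 else bf j (bt 1)", OF this]
  have "D UNIV (%bt. sat N (%j. if j = i then bt 0 else bf j (bt (Suc 0))) ph)" by (simp only: One_nat_def)
  from choice1[where R = "%y bt. sat N (%j. if j = i then y else bf j (bt 0)) ph", OF this]
  obtain s where s: "DF UNIV s" "!!bt y. sat N (%j. if j = i then y else bf j (bt 0)) ph ==> sat N (%j. if j = i then s bt else bf j (bt 0)) ph"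
   by blast
  define F where "F x = s (%_. x)" for x
  have F: "df F" unfolding F_def by (rule DF_ren[OF s(1)])
  have u: "(%j. bf j x)(i := y) = (%j. if j = i then y else bf j x)" for x y by auto
  have "evb (%x. sat N ((%j. bf j x)(i := F x)) ph)" unfolding u F_def
   by (rule evb_mono[OF ev]) (use s(2)[of _ "%_. _"] in \<open>auto simp: u\<close>)
  then have "sat germs ((%j. cls (bf j))(i := cls F)) ph" using IH[OF F] by blast
  moreover have "cls F : univ germs" using F by (simp add: germs_def)
  ultimately show "sat germs (%j. cls (bf j)) (Ex i ph)" by auto
 qed
qed

lemma evb_const [simp]: "evb (%x. P) <-> P"
 using evb_True not_evb_False by (cases P) auto

lemma germs_elementary: "elementary L N germs (%c. cls (%_. c))"
 unfolding elementary_def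
proof (intro allI impI)
 fix ph :: "('f,'r) fm" and bt :: "nat => 'k" assume "wf_fm L ph & (ALL i. bt i : univ N)"
 then have "sat germs (%i. cls (%_. bt i)) ph <-> evb (%x. sat N (%i. bt i) ph)"
  by (intro Los) (auto intro: DFU)
 then show "sat N bt ph = sat germs ((%c. cls (%_. c)) \<circ> bt) ph" by (simp add: comp_def)
qed

lemma germs_ops:
 assumes F: "df F" and G: "df G"
 shows "ad L germs (cls F) (cls G) = cls (%x. F x + G x)" "ml L germs (cls F) (cls G) = cls (%x. F x * G x)"
  "ng L germs (cls F) = cls (%x. - F x)" "zr L germs = cls (%x. 0)" "ls L germs (cls F) (cls G) <-> evb (%x. F x < G x)"
proof -
 have l: "fun_ar L (sym_add L) = 2" "fun_ar L (sym_mul L) = 2" "fun_ar L (sym_neg L) = 1" "fun_ar L (sym_zero L) = 0"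
  using ok by (auto simp: lang_ok_def)
 show "ad L germs (cls F) (cls G) = cls (%x. F x + G x)"
  using germs_fint[of "[F, G]" "sym_add L"] F G l adN by (auto simp: ad_def)
 show "ml L germs (cls F) (cls G) = cls (%x. F x * G x)"
  using germs_fint[of "[F, G]" "sym_mul L"] F G l mlN by (auto simp: ml_def)
 show "ng L germs (cls F) = cls (%x. - F x)"
  using germs_fint[of "[F]" "sym_neg L"] F l ngN by (auto simp: ng_def)
 show "zr L germs = cls (%x. 0)"
  using germs_fint[of "[]" "sym_zero L"] l zrN by (auto simp: zr_def)
 show "ls L germs (cls F) (cls G) <-> evb (%x. F x < G x)"
  using germs_rint[of "[F, G]" "sym_less L"] F G lsN by (auto simp: ls_def)
qed

lemma germs_ab: assumes F: "df F" shows "ab L germs (cls F) = cls (%x. \<bar>F x\<bar>)"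
proof (cases "evb (%x. F x < 0)")
 case True
 then have "ab L germs (cls F) = cls (%x. - F x)" using germs_ops[OF F DF_0] by (simp add: ab_def)
 also have "\<dots> = cls (%x. \<bar>F x\<bar>)" by (subst cls_eq[OF DF_minus[OF F] DF_abs[OF F]]) (rule evb_mono[OF True], simp)
 finally show ?thesis .
next
 case False
 then have *: "evb (%x. ~ F x < 0)" using evb_dec[of "%x. F x < 0"] D_less[OF F DF_0] by blast
 have "ab L germs (cls F) = cls F" using False germs_ops[OF F DF_0] by (simp add: ab_def)
 also have "\<dots> = cls (%x. \<bar>F x\<bar>)" by (subst cls_eq[OF F DF_abs[OF F]]) (rule evb_mono[OF *], simp)
 finally show ?thesis .
qed

text \<open>The germ of the identity is new because no point lies in all balls. A nonzero germ has a
  leading term g by \<open>rv_const\<close>. The bound is stated for every k asymptotic to g, so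
  that k can later be taken from the ground structure instead of \<open>N\<close>.\<close>

theorem germ_extension:
 "EX (M :: (('k => 'k) set, 'f, 'r) struc) e. struc_ok L M & range e <= univ M & elementary L N M e & ~ univ M <= range e &
   (ALL y:univ M. y ~= zr L M --> (EX g. g ~= 0 &
    (ALL k. sm (g - k) k --> (ALL c:Ov. ls L M (ab L M (ml L M (e c) (sb L M y (e k)))) (ab L M (e k))))))"
proof (intro exI conjI)
 let ?e = "%c. cls (%_. c)"
 show "struc_ok L germs" by (rule germs_ok)
 show "range ?e <= univ germs" by (auto simp: germs_def DFU)
 show "elementary L N germs ?e" by (rule germs_elementary)
 show "~ univ germs <= range ?e"
 proof
  assume "univ germs <= range ?e"
  moreover have "cls (%x. x) : univ germs" by (simp add: germs_def DF_var)
  ultimately obtain c where "cls (%x. x) = ?e c" by blast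
  then have "evb (%x. x = c)" using cls_eq[of "%x. x" "%_. c"] DF_var DFU by blast
  have "evb (%x. False)" by (rule evb_mono[OF evb_conj[OF \<open>evb (%x. x = c)\<close> evb_ne_point[of c]]]) simp
  then show False using not_evb_False by blast
 qed
 show "ALL y:univ germs. y ~= zr L germs --> (EX g. g ~= 0 &
    (ALL k. sm (g - k) k --> (ALL c:Ov. ls L germs (ab L germs (ml L germs (?e c) (sb L germs y (?e k)))) (ab L germs (?e k)))))"
 proof (intro ballI impI)
  fix y assume "y : univ germs" and y0: "y ~= zr L germs"
  then obtain F where F: "df F" "y = cls F" by (auto simp: germs_def)
  have "~ evb (%x. F x = 0)" using y0 F(2) cls_eq[OF F(1) DF_0] germs_ops(4)[OF F(1) F(1)] by auto
  then obtain g where g: "g ~= 0" "evb (%x. sm (F x - g) g)" using rv_const[OF F(1)] by blast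
  have "ls L germs (ab L germs (ml L germs (?e c) (sb L germs y (?e k)))) (ab L germs (?e k))"
   if k: "sm (g - k) k" and c: "c : Ov" for c k
  proof -
   have "dm g k"
   proof (rule ccontr)
    assume "~ dm g k"
    then have "sm k g" using not_dm by blast
    then have "sm (g - k) g" using k sm_trans by blast
    then have "sm (g - k + k) g" using \<open>sm k g\<close> by (rule sm_add)
    then show False by simp
   qed
   then have ev: "evb (%x. \<bar>c * (F x - k)\<bar> < \<bar>k\<bar>)"
   proof (intro evb_mono[OF g(2)])
    fix x assume "sm (F x - g) g"
    then have "sm (F x - g) k" using \<open>dm g k\<close> by (rule sm_dm)
    then have "sm (F x - g + (g - k)) k" using k by (rule sm_add)
    then show "\<bar>c * (F x - k)\<bar> < \<bar>k\<bar>" using c by (simp add: sm_def)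
   qed
   have d: "df (%x. k)" "df (%x. c)" "df (%x. - k)" "df (%x. F x + - k)" "df (%x. c * (F x + - k))" "df (%x. \<bar>c * (F x + - k)\<bar>)" "df (%x. \<bar>k\<bar>)"
    by (intro DF_base DFU F)+
   have s: "sb L germs y (?e k) = cls (%x. F x + - k)" unfolding sb_def F(2)
    using germs_ops(3)[OF d(1) d(1)] germs_ops(1)[OF F(1) d(3)] by simp
   have m: "ml L germs (?e c) (sb L germs y (?e k)) = cls (%x. c * (F x + - k))" unfolding s
    by (rule germs_ops(2)[OF d(2) d(4)])
   show ?thesis unfolding m germs_ab[OF d(5)] germs_ab[OF d(1)] germs_ops(5)[OF d(6) d(7)] using ev by simp
  qed
  then show "EX g. g ~= 0 & (ALL k. sm (g - k) k --> (ALL c:Ov. ls L germs (ab L germs (ml L germs (?e c) (sb L germs y (?e k)))) (ab L germs (?e k))))"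
   using g(1) by blast
 qed
qed

end

section \<open>Functions of several variables at independent tuples\<close>

definition box :: "nat => 'k::linordered_field => (nat => 'k) => (nat => 'k) => bool" where
 "box n dt t gm <-> (ALL i<n. \<bar>gm i - t i\<bar> < dt)"

text \<open>A function of n variables is represented by a function on infinite valuations that reads
  only the first n slots. The arity then never enters the type.\<close>

definition dep :: "nat => ((nat => 'k) => 'b) => bool" where
 "dep n f <-> (ALL bt gm. (ALL i<n. bt i = gm i) --> f bt = f gm)"

definition contn :: "nat => ((nat => 'k::linordered_field) => 'k) => (nat => 'k) => bool" where
 "contn n f t <-> (ALL e>0. EX dt>0. ALL gm. box n dt t gm --> \<bar>f gm - f t\<bar> < e)"

definition gradat :: "nat => ((nat => 'k::linordered_field) => 'k) => (nat => 'k) => (nat => 'k) => bool" where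
 "gradat n f g u <-> (ALL e>0. EX dt>0. ALL y. box n dt u y -->
   \<bar>f y - f u - (\<Sum>i<n. g i * (y i - u i))\<bar> <= e * (\<Sum>i<n. \<bar>y i - u i\<bar>))"

definition pd :: "nat => ((nat => 'k::linordered_field) => 'k) => (nat => 'k) => 'k" where
 "pd i f gm = derivk (%x. f (gm(i := x))) (gm i)"

lemma depD: "dep n f ==> (!!i. i < n ==> bt i = gm i) ==> f bt = f gm"
 unfolding dep_def by blast

lemma box_mono: "box n d t gm ==> d <= d' ==> box n d' t gm"
 unfolding box_def by (meson less_le_trans)

lemma box_self [simp]: "0 < d ==> box n d t t" by (simp add: box_def)

lemma box_Suc: "box (Suc n) d t gm <-> box n d t gm & \<bar>gm n - t n\<bar> < d"
 by (auto simp: box_def less_Suc_eq)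

lemma box_cong: "(!!i. i < n ==> t i = t' i) ==> (!!i. i < n ==> gm i = gm' i) ==> box n d t gm <-> box n d t' gm'"
 by (simp add: box_def)

lemma box_tri: "box n d t gm ==> box n d' gm et ==> box n (d + d') t et"
 unfolding box_def
proof (intro allI impI)
 fix i assume *: "ALL i<n. \<bar>gm i - t i\<bar> < d" "ALL i<n. \<bar>et i - gm i\<bar> < d'" "i < n"
 have "\<bar>et i - t i\<bar> <= \<bar>gm i - t i\<bar> + \<bar>et i - gm i\<bar>" by (simp add: abs_if)
 then show "\<bar>et i - t i\<bar> < d + d'" using * by (smt (verit, ccfv_threshold) add_strict_mono le_less_trans)
qed

lemma contn_dep: assumes "dep n f" "!!i. i < n ==> t i = t' i" shows "contn n f t = contn n f t'"
proof -
 have "f t = f t'" by (rule depD[OF assms])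
 moreover have "box n d t gm = box n d t' gm" for d gm by (rule box_cong) (simp_all add: assms(2))
 ultimately show ?thesis by (simp add: contn_def)
qed

lemma pd_dep: "dep n f ==> i < n ==> dep n (pd i f)"
proof -
 assume f: "dep n f" and i: "i < n"
 show ?thesis unfolding dep_def
 proof (intro allI impI)
  fix bt gm :: "nat => 'a" assume e: "ALL i<n. bt i = gm i"
  have "f (bt(i := x)) = f (gm(i := x))" for x by (rule depD[OF f]) (use e in auto)
  then show "pd i f bt = pd i f gm" using e i by (simp add: pd_def)
 qed
qed

lemma gradat_pd: assumes "gradat n f g u" "i < n" shows "has_d (%x. f (u(i := x))) (u i) (g i)"
 unfolding has_d_def
proof (intro allI impI)
 fix e :: 'a assume "e > 0"
 then obtain d where d: "d > 0" "!!y. box n d u y ==> \<bar>f y - f u - (\<Sum>i<n. g i * (y i - u i))\<bar> <= e * (\<Sum>i<n. \<bar>y i - u i\<bar>)"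
  using assms(1) unfolding gradat_def by blast
 have "\<bar>f (u(i := u i + h)) - f (u(i := u i)) - g i * h\<bar> <= e * \<bar>h\<bar>" if h: "\<bar>h\<bar> < d" for h
 proof -
  let ?y = "u(i := u i + h)"
  have "box n d u ?y" using h d(1) by (auto simp: box_def)
  moreover have "(\<Sum>j<n. g j * (?y j - u j)) = (\<Sum>j<n. if j = i then g i * h else 0)" by (rule sum.cong) auto
  moreover have "(\<Sum>j<n. \<bar>?y j - u j\<bar>) = (\<Sum>j<n. if j = i then \<bar>h\<bar> else 0)" by (rule sum.cong) auto
  ultimately show ?thesis using d(2)[of ?y] assms(2) by simp
 qed
 then show "EX d>0. ALL h. \<bar>h\<bar> < d --> \<bar>f (u(i := u i + h)) - f (u(i := u i)) - g i * h\<bar> <= e * \<bar>h\<bar>" using d(1) by blast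
qed

lemma has_d_Lipschitz:
 assumes "has_d f x c" shows "EX d>0. ALL h. \<bar>h\<bar> < d --> \<bar>f (x + h) - f x\<bar> <= (\<bar>c\<bar> + 1) * \<bar>h\<bar>"
proof -
 obtain d where d: "d > 0" "!!h. \<bar>h\<bar> < d ==> \<bar>f (x + h) - f x - c * h\<bar> <= 1 * \<bar>h\<bar>"
  using assms unfolding has_d_def by (metis zero_less_one)
 have "\<bar>f (x + h) - f x\<bar> <= (\<bar>c\<bar> + 1) * \<bar>h\<bar>" if "\<bar>h\<bar> < d" for h
 proof -
  have "\<bar>f (x + h) - f x\<bar> <= \<bar>f (x + h) - f x - c * h\<bar> + \<bar>c * h\<bar>"
   using abs_triangle_ineq[of "f (x + h) - f x - c * h" "c * h"] by simp
  also have "\<dots> <= (\<bar>c\<bar> + 1) * \<bar>h\<bar>" using d(2)[OF that] by (simp add: distrib_right abs_mult)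
  finally show ?thesis .
 qed
 then show ?thesis using d(1) by blast
qed

lemma eventually_finite:
 fixes P :: "nat => 'k::linordered_field => bool"
 assumes "!!i. i < n ==> EX d>0. P i d" and mono: "!!i d d'. P i d ==> d' <= d ==> P i d'"
 shows "EX d>0. ALL i<n. P i d"
 using assms(1)
proof (induction n)
 case 0 then show ?case by (auto intro: zero_less_one)
next
 case (Suc n)
 then obtain d d' where "d > 0" "ALL i<n. P i d" "d' > 0" "P n d'" by (metis less_Suc_eq)
 then show ?case using mono by (intro exI[of _ "min d d'"]) (auto simp: less_Suc_eq intro: mono)
qed

lemma chain_curve:
 fixes G :: "(nat => 'k::linordered_field) => 'k"
 assumes G: "gradat n G g z" and c: "!!i. i < n ==> has_d (gm i) x0 (c i)" "!!i. gm i x0 = z i"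
 shows "has_d (%x. G (%i. gm i x)) x0 (\<Sum>i<n. g i * c i)"
 unfolding has_d_def
proof (intro allI impI)
 fix e :: 'k assume e: "e > 0"
 \<comment> \<open>The error of \<open>G\<close> is taken relative to \<open>M\<close>, which bounds
   the sum of the Lipschitz constants of the curves, and the errors of the curves relative to
   \<open>m\<close>, which bounds the gradient; each contributes e/2. The added 1 keeps both
   positive.\<close>
 define M where "M = (\<Sum>i<n. \<bar>c i\<bar> + 1) + 1"
 define m where "m = (\<Sum>i<n. \<bar>g i\<bar>) + 1"
 have M: "M > 0" "m > 0" unfolding M_def m_def by (intro add_nonneg_pos sum_nonneg; simp)+
 define e1 e2 where "e1 = e / 2 / M" and "e2 = e / 2 / m"
 have e12: "e1 > 0" "e2 > 0" "e1 * M = e / 2" "e2 * m = e / 2" using e M by (auto simp: e1_def e2_def)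
 obtain d where d: "d > 0" "!!y. box n d z y ==> \<bar>G y - G z - (\<Sum>i<n. g i * (y i - z i))\<bar> <= e1 * (\<Sum>i<n. \<bar>y i - z i\<bar>)"
  using G e12(1) unfolding gradat_def by blast
 let ?P = "%i r. ALL h. \<bar>h\<bar> < r --> \<bar>gm i (x0 + h) - z i\<bar> < d & \<bar>gm i (x0 + h) - z i\<bar> <= (\<bar>c i\<bar> + 1) * \<bar>h\<bar> &
   \<bar>gm i (x0 + h) - z i - c i * h\<bar> <= e2 * \<bar>h\<bar>"
 have "EX r>0. ALL i<n. ?P i r"
 proof (rule eventually_finite)
  fix i assume i: "i < n"
  obtain r1 where r1: "r1 > 0" "!!h. \<bar>h\<bar> < r1 ==> \<bar>gm i (x0 + h) - gm i x0\<bar> <= (\<bar>c i\<bar> + 1) * \<bar>h\<bar>"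
   using has_d_Lipschitz[OF c(1)[OF i]] by blast
  obtain r2 where r2: "r2 > 0" "!!h. \<bar>h\<bar> < r2 ==> \<bar>gm i (x0 + h) - gm i x0 - c i * h\<bar> <= e2 * \<bar>h\<bar>"
   using c(1)[OF i] e12(2) unfolding has_d_def by blast
  obtain r3 where r3: "r3 > 0" "!!y. \<bar>y - x0\<bar> < r3 ==> \<bar>gm i y - gm i x0\<bar> < d"
   using has_d_cont[OF c(1)[OF i]] d(1) unfolding contat_def by blast
  have "?P i (min r1 (min r2 r3))" using r1(2) r2(2) r3(2)[of "x0 + _"] c(2)[of i] by auto
  then show "EX r>0. ?P i r" using r1(1) r2(1) r3(1) by (metis min_less_iff_conj)
 qed auto
 then obtain r where r: "r > 0" "!!i. i < n ==> ?P i r" by blast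
 have "\<bar>G (%i. gm i (x0 + h)) - G (%i. gm i x0) - (\<Sum>i<n. g i * c i) * h\<bar> <= e * \<bar>h\<bar>" if h: "\<bar>h\<bar> < r" for h
 proof -
  let ?y = "%i. gm i (x0 + h)"
  have b: "box n d z ?y" using r(2) h by (auto simp: box_def)
  have "(\<Sum>i<n. \<bar>?y i - z i\<bar>) <= (\<Sum>i<n. (\<bar>c i\<bar> + 1) * \<bar>h\<bar>)" by (rule sum_mono) (use r(2) h in auto)
  also have "\<dots> = (\<Sum>i<n. \<bar>c i\<bar> + 1) * \<bar>h\<bar>" by (simp only: sum_distrib_right)
  also have "\<dots> <= M * \<bar>h\<bar>" by (rule mult_right_mono) (simp_all add: M_def)
  finally have "e1 * (\<Sum>i<n. \<bar>?y i - z i\<bar>) <= e1 * (M * \<bar>h\<bar>)" using e12(1) by (intro mult_left_mono) auto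
  then have 1: "\<bar>G ?y - G z - (\<Sum>i<n. g i * (?y i - z i))\<bar> <= e / 2 * \<bar>h\<bar>"
   using d(2)[OF b] e12(3) by (simp only: mult.assoc[symmetric])
  have "(\<Sum>i<n. g i * (?y i - z i)) - (\<Sum>i<n. g i * c i) * h = (\<Sum>i<n. g i * (?y i - z i - c i * h))"
   unfolding sum_distrib_right sum_subtractf[symmetric] by (rule sum.cong) (simp_all add: algebra_simps)
  also have "\<bar>\<dots>\<bar> <= (\<Sum>i<n. \<bar>g i * (?y i - z i - c i * h)\<bar>)" by (rule sum_abs)
  also have "\<dots> <= (\<Sum>i<n. \<bar>g i\<bar> * (e2 * \<bar>h\<bar>))" unfolding abs_mult
   by (rule sum_mono, rule mult_left_mono) (use r(2) h in auto)
  also have "\<dots> = (\<Sum>i<n. \<bar>g i\<bar>) * (e2 * \<bar>h\<bar>)" by (simp only: sum_distrib_right)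
  also have "\<dots> <= m * (e2 * \<bar>h\<bar>)" by (rule mult_right_mono) (use e12 in \<open>simp_all add: m_def\<close>)
  also have "\<dots> = e / 2 * \<bar>h\<bar>" using e12(4) by (simp only: mult.assoc[symmetric] mult.commute[of m])
  finally have 2: "\<bar>(\<Sum>i<n. g i * (?y i - z i)) - (\<Sum>i<n. g i * c i) * h\<bar> <= e / 2 * \<bar>h\<bar>" .
  have z: "(%i. gm i x0) = z" using c(2) by (rule ext)
  have tri: "\<bar>a - p\<bar> <= r ==> \<bar>p - q\<bar> <= r' ==> \<bar>a - q\<bar> <= r + r'" for a p q r r' :: 'k unfolding abs_le_iff by linarith
  have "\<bar>(G ?y - G z) - (\<Sum>i<n. g i * c i) * h\<bar> <= e / 2 * \<bar>h\<bar> + e / 2 * \<bar>h\<bar>" by (rule tri[OF 1 2])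
  also have "\<dots> = e * \<bar>h\<bar>" by (simp add: distrib_right[symmetric])
  finally show ?thesis unfolding z .
 qed
 then show "EX d>0. ALL h. \<bar>h\<bar> < d --> \<bar>G (%i. gm i (x0 + h)) - G (%i. gm i x0) - (\<Sum>i<n. g i * c i) * h\<bar> <= e * \<bar>h\<bar>"
  using r(1) by blast
qed

context omf
begin

lemma D_exval: assumes "D A P" shows "D A (%bt. EX bs. P (mix bt bs))"
proof -
 obtain s where s: "!!i. DF A (s i)" "!!bt bs. P (mix bt bs) ==> P (mix bt (%i. s i bt))"
  using Skolem[OF assms] by blast
 have "D A (%bt. P (%i. mix bt (%i. s i bt) i))"
  by (rule D_subst[OF assms, where ta = "%i bt. mix bt (%i. s i bt) i"])
   (rename_tac i, case_tac "even i", simp_all add: mix_def DF_var s(1))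
 moreover have "(EX bs. P (mix bt bs)) = P (%i. mix bt (%i. s i bt) i)" for bt using s(2) by blast
 ultimately show ?thesis by (simp only:)
qed

lemma D_allval: assumes "D A (%bt. R (%i. bt (Suc (2 * i))) (%i. bt (2 * i)))" shows "D A (%bt. ALL bs. R bs bt)"
 using D_not[OF D_exval[OF D_not[OF assms]]] by (simp only: mix_odd mix_even not_ex not_not)

lemma D_ball_nat: fixes n :: nat shows "(!!i. i < n ==> D A (P i)) ==> D A (%bt. ALL i<n. P i bt)"
proof (induction n)
 case 0 then show ?case using D_True by simp
next
 case (Suc n)
 have "D A (%bt. (ALL i<n. P i bt) & P n bt)" by (rule D_conj) (use Suc in auto)
 moreover have "(ALL i<Suc n. P i bt) = ((ALL i<n. P i bt) & P n bt)" for bt by (auto simp: less_Suc_eq)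
 ultimately show ?case by (simp only:)
qed

lemma D_box: "DF A d ==> (!!i. DF A (t i)) ==> (!!i. DF A (gm i)) ==> D A (%bt. box n (d bt) (%i. t i bt) (%i. gm i bt))"
 unfolding box_def by (rule D_ball_nat) (intro D_base DF_base)

lemma D_contn: assumes f: "DF A f" "!!i. DF A (ta i)" shows "D A (%bt. contn n f (%i. ta i bt))"
proof -
 have f': "DF A (%bt. f (%i. ta i (%j. bt (r j))))" for r
  by (rule DF_ren[of A "%bt. f (%i. ta i bt)"]) (rule DF_subst[OF f])
 show ?thesis unfolding contn_def
  by (intro D_base DF_base D_allval D_box DF_ren[OF f(1)] DF_ren[OF f(2)] f')
qed

lemma DF_upd: assumes "DF A f" "DF A g" shows "DF A (%bt. f ((%i. bt (r i))(n := g bt)))"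
proof -
 have "DF A (%bt. if i = n then g bt else bt (r i))" for i using assms(2) by (cases "i = n") (simp_all add: DF_var)
 from DF_subst[OF assms(1), where ta = "%i bt. if i = n then g bt else bt (r i)", OF this]
 show ?thesis by (simp only: fun_upd_def)
qed

lemma D_upd: assumes "D A P" "DF A g" shows "D A (%bt. P ((%i. bt (r i))(n := g bt)))"
proof -
 have "DF A (%bt. if i = n then g bt else bt (r i))" for i using assms(2) by (cases "i = n") (simp_all add: DF_var)
 from D_subst[OF assms(1), where ta = "%i bt. if i = n then g bt else bt (r i)", OF this]
 show ?thesis by (simp only: fun_upd_def)
qed

lemma DF_pd: assumes f: "DF A f" shows "DF A (pd i f)"
proof -
 have "DF A (%bt. f ((%j. bt (Suc j))(i := bt 0)))" by (rule DF_upd[OF f DF_var])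
 from DF_derivk[where F = "%x bt. f (bt(i := x))", OF this DF_var] show ?thesis by (simp only: pd_def[abs_def])
qed

lemma D_has_pd: assumes f: "DF A f" shows "D A (%bt. EX c. has_d (%x. f (bt(i := x))) (bt i) c)"
proof -
 have "DF A (%bt. f ((%j. bt (Suc (Suc j)))(i := bt 0)))" by (rule DF_upd[OF f DF_var])
 then show ?thesis by (intro D_ex D_has_d[where F = "%x bt. f ((%j. bt (Suc j))(i := x))"] DF_var)
qed


text \<open>Fixing all coordinates but one turns the fixed entries with index in \<open>I\<close>
  into parameters. All remaining entries can be set to 0, since \<open>P\<close> reads only the
  first m.\<close>

lemma D_fibre: assumes P: "D A P" "dep m P" "{..<m} - {n} <= I" shows "D (A Un t ` I) (%bt. P (t(n := bt 0)))"
proof -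
 have "DF (A Un t ` I) (%bt. if i = n then bt 0 else if i : I then t i else 0)" for i
  by (cases "i = n"; cases "i : I") (auto intro: DF_var DF_const DF_0)
 from D_subst[OF D_mono[OF P(1)], where ta = "%i bt. if i = n then bt 0 else if i : I then t i else 0", OF _ this]
 have "D (A Un t ` I) (%bt. P (%i. if i = n then bt 0 else if i : I then t i else 0))" by simp
 moreover have "P (%i. if i = n then x else if i : I then t i else 0) = P (t(n := x))" for x
  by (rule depD[OF P(2)]) (use P(3) in auto)
 ultimately show ?thesis by (simp only:)
qed

lemma DF_fibre: assumes f: "DF A f" "dep m f" "{..<m} - {n} <= I" shows "DF (A Un t ` I) (%bt. f (t(n := bt 0)))"
proof -
 have "DF (A Un t ` I) (%bt. if i = n then bt 0 else if i : I then t i else 0)" for i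
  by (cases "i = n"; cases "i : I") (auto intro: DF_var DF_const DF_0)
 from DF_subst[OF DF_mono[OF f(1)], where ta = "%i bt. if i = n then bt 0 else if i : I then t i else 0", OF _ this]
 have "DF (A Un t ` I) (%bt. f (%i. if i = n then bt 0 else if i : I then t i else 0))" by simp
 moreover have "f (%i. if i = n then x else if i : I then t i else 0) = f (t(n := x))" for x
  by (rule depD[OF f(2)]) (use f(3) in auto)
 ultimately show ?thesis by (simp only:)
qed

definition ind :: "'k set => nat => (nat => 'k) => bool" where
 "ind A n t <-> (ALL i<n. t i ~: dcl (A Un t ` {..<i}))"

lemma ind_Suc: "ind A (Suc n) t <-> ind A n t & t n ~: dcl (A Un t ` {..<n})"
 unfolding ind_def by (auto simp: less_Suc_eq)

text \<open>By exchange: an entry that became definable with the help of \<open>t n\<close> would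
  make \<open>t n\<close> definable from the others. This lets an induction on the length absorb the
  last coordinate into the parameters.\<close>

lemma ind_last: assumes "ind A (Suc n) t" shows "ind (insert (t n) A) n t"
 unfolding ind_def
proof (intro allI impI notI)
 fix i assume i: "i < n" and "t i : dcl (insert (t n) A Un t ` {..<i})"
 then have "t i : dcl (insert (t n) (A Un t ` {..<i}))" by simp
 moreover have "t i ~: dcl (A Un t ` {..<i})" using assms i unfolding ind_def by auto
 ultimately have "t n : dcl (insert (t i) (A Un t ` {..<i}))" by (rule exchange)
 moreover have "insert (t i) (A Un t ` {..<i}) <= A Un t ` {..<n}" using i by auto
 ultimately have "t n : dcl (A Un t ` {..<n})" using dcl_mono by blast
 then show False using assms by (simp add: ind_Suc)
qed

lemma ind_any: "ind A n t ==> i < n ==> t i ~: dcl (A Un t ` ({..<n} - {i}))"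
proof (induction n)
 case (Suc n)
 show ?case
 proof (cases "i = n")
  case True
  then have "{..<Suc n} - {i} = {..<n}" by auto
  then show ?thesis using Suc.prems True by (simp add: ind_Suc)
 next
  case False
  then have i: "i < n" using Suc.prems by simp
  show ?thesis
  proof
   assume "t i : dcl (A Un t ` ({..<Suc n} - {i}))"
   moreover have "A Un t ` ({..<Suc n} - {i}) = insert (t n) (A Un t ` ({..<n} - {i}))"
    using i by (auto simp: less_Suc_eq image_iff)
   moreover have "t i ~: dcl (A Un t ` ({..<n} - {i}))" using Suc i by (simp add: ind_Suc)
   ultimately have "t n : dcl (insert (t i) (A Un t ` ({..<n} - {i})))" using exchange by simp
   moreover have "insert (t i) (A Un t ` ({..<n} - {i})) = A Un t ` {..<n}" using i by (auto simp: image_iff)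
   ultimately show False using Suc.prems by (simp add: ind_Suc)
  qed
 qed
qed simp

lemma nondcl_diff: assumes f: "DF A (%bt. f (bt 0))" and c: "c ~: dcl A" shows "EX a. has_d f c a"
proof (rule ccontr)
 assume n: "~ ?thesis"
 have "D A (%bt. ~ (EX c. has_d f (bt 0) c))" unfolding has_d_def
  by (intro D_base DF_base DF_app1[where F = f, OF f])
 from finite_subset_dcl[where S = "%x. ~ (EX c. has_d f x c)", OF this finite_nondiff[OF DF_UNIV[OF f]]]
 show False using n c by blast
qed

lemma supd_pos_is_sup: assumes "0 < supd S" shows "is_sup S (supd S)"
proof (cases "EX b. is_sup S b")
 case True
 then obtain b where b: "is_sup S b" ..
 show ?thesis unfolding supd_eq[OF b] by (rule b)
next
 case False
 then have "supd S = 0" unfolding supd_def by (rule if_not_P)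
 then show ?thesis using assms by simp
qed

lemma sup_radius:
 assumes "0 < supd (%e. e <= 1 & (ALL x. \<bar>x - s\<bar> < e --> S x))" "\<bar>x - s\<bar> < supd (%e. e <= 1 & (ALL x. \<bar>x - s\<bar> < e --> S x))"
 shows "S x"
 using is_sup_less[OF supd_pos_is_sup[OF assms(1)] assms(2)] by blast

lemma sup_radius_pos:
 assumes "ds S" "0 < d" "!!x. \<bar>x - s\<bar> < d ==> S x"
 shows "0 < supd (%e. e <= 1 & (ALL x. \<bar>x - s\<bar> < e --> S x))"
proof -
 let ?E = "%e. e <= 1 & (ALL x. \<bar>x - s\<bar> < e --> S x)"
 have E: "?E (min d 1)" using assms(3) by auto
 have "ds ?E" by (intro D_base DF_base DFU D_app1[OF assms(1)])
 then obtain e where e: "is_sup ?E e" using sup_exists[where S = ?E and ?x0.0 = "min d 1" and b = 1] E by blast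
 have "min d 1 <= e" using e E unfolding is_sup_def by blast
 moreover have "0 < min d 1" using assms(2) by simp
 ultimately have "0 < e" by (rule less_le_trans[rotated])
 then show ?thesis by (simp only: supd_eq[OF e])
qed

text \<open>Peeling off the last coordinate \<open>s\<close>: by exchange the other coordinates stay independent
  over \<open>s\<close>, so radii in the last direction are continuous functions of them.\<close>

lemma radius_box:
 assumes C: "!!A f. ind A n t ==> DF A f ==> dep n f ==> contn n f t"
  and t: "ind A (Suc n) t" and P: "D A P" "dep (Suc n) P"
  and d: "0 < d" "!!x. \<bar>x - t n\<bar> < d ==> P (t(n := x))"
 shows "EX dt>0. ALL gm. box n dt t gm --> (ALL x. \<bar>x - t n\<bar> < dt --> P (gm(n := x)))"
proof -
 define s where "s = t n"
 define ef where "ef gm = supd (%e. e <= 1 & (ALL x. \<bar>x - s\<bar> < e --> P (gm(n := x))))" for gm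
 have P': "D (insert s A) P" by (rule D_mono[OF P(1)]) auto
 have s: "DF (insert s A) (%bt. s)" by (rule DF_const) simp
 have eps: "DF (insert s A) ef" unfolding ef_def[abs_def]
  by (rule DF_supd[where R = "%e gm. e <= 1 & (ALL x. \<bar>x - s\<bar> < e --> P (gm(n := x)))"])
   (intro D_base DF_base s D_upd[OF P'])
 have dep: "dep n ef" unfolding dep_def
 proof (intro allI impI)
  fix bt gm :: "nat => 'k" assume *: "ALL i<n. bt i = gm i"
  have "P (bt(n := x)) = P (gm(n := x))" for x by (rule depD[OF P(2)]) (use * in auto)
  then show "ef bt = ef gm" by (simp only: ef_def)
 qed
 have c: "contn n ef t" by (rule C[OF _ eps dep]) (use ind_last[OF t] in \<open>simp add: s_def\<close>)
 have "D (A Un t ` {..<n}) (%bt. P (t(n := bt 0)))" by (rule D_fibre[OF P]) auto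
 then have "0 < ef t" unfolding ef_def
  by (intro sup_radius_pos[where S = "%x. P (t(n := x))", OF D_UNIV d(1)]) (use d(2) in \<open>auto simp: s_def\<close>)
 then have e2: "0 < ef t / 2" by simp
 then obtain dt where dt: "dt > 0" "!!gm. box n dt t gm ==> \<bar>ef gm - ef t\<bar> < ef t / 2"
  using c unfolding contn_def by blast
 have "P (gm(n := x))" if b: "box n (min dt (ef t / 2)) t gm" "\<bar>x - t n\<bar> < min dt (ef t / 2)" for gm x
 proof -
  have "\<bar>ef gm - ef t\<bar> < ef t / 2" by (rule dt(2)) (rule box_mono[OF b(1)], simp)
  then have "ef t - ef t / 2 < ef gm" unfolding abs_less_iff by linarith
  then have "ef t / 2 < ef gm" by simp
  then have "0 < ef gm" "\<bar>x - s\<bar> < ef gm" using b(2) e2 by (simp_all add: s_def)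
  then show ?thesis unfolding ef_def by (rule sup_radius[where S = "%x. P (gm(n := x))"])
 qed
 then show ?thesis using dt(1) e2 by (intro exI[of _ "min dt (ef t / 2)"]) auto
qed

text \<open>Induction on the length. In the last coordinate \<open>f\<close> is monotone near s, on
  a radius which depends continuously on the other coordinates by the induction hypothesis over
  \<open>insert s A\<close>. For fixed last coordinate s - r or s + r, \<open>f\<close> is
  continuous in the others. Monotonicity squeezes \<open>f\<close> between these two slices.\<close>

theorem generic_continuous: "ind A n t ==> DF A f ==> dep n f ==> contn n f t"
proof (induction n arbitrary: A f)
 case 0
 have e: "f gm = f t" for gm by (rule depD[OF 0(3)]) simp
 have "\<bar>f gm - f t\<bar> < r" if "r > 0" for gm r unfolding e[of gm] using that by simp
 then show ?case unfolding contn_def by (intro allI impI exI[of _ 1]) auto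
next
 case (Suc n)
 note C = Suc.IH and t = Suc.prems(1) and f = Suc.prems(2) and df = Suc.prems(3)
 define s where "s = t n"
 let ?A = "A Un t ` {..<n}"
 define ph where "ph x = f (t(n := x))" for x
 have sA: "s ~: dcl ?A" using t by (simp add: ind_Suc s_def)
 have ph: "DF ?A (%bt. ph (bt 0))" unfolding ph_def by (rule DF_fibre[OF f df]) auto
 have pht: "ph s = f t" by (simp add: ph_def s_def)
 have phc: "contat ph s" using nondcl_diff[OF ph sA] has_d_cont by blast
 have "D ?A (%bt. EX c. has_d ph (bt 0) c)" unfolding has_d_def
  by (intro D_base DF_base DF_app1[where F = ph, OF ph])
 then obtain d1 where d1: "d1 > 0" "!!x. \<bar>x - s\<bar> < d1 ==> EX c. has_d ph x c"
  using not_dcl_nbhd[where S = "%x. EX c. has_d ph x c", OF _ sA] nondcl_diff[OF ph sA] by metis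
 have "D ?A (%bt. 0 <= derivk ph (bt 0))" by (intro D_base DF_base df_derivk ph)
 then obtain d2 where d2: "d2 > 0" "!!x. \<bar>x - s\<bar> < d2 ==> (0 <= derivk ph x) = (0 <= derivk ph s)"
  using not_dcl_nbhd[where S = "%x. 0 <= derivk ph x", OF _ sA] by metis
 define d where "d = min d1 d2"
 \<comment> \<open>Multiplication by this sign makes \<open>f\<close> weakly increasing in the last
   coordinate in both cases, so one squeezing argument suffices.\<close>
 define sg where "sg = (if 0 <= derivk ph s then 1 else - 1 :: 'k)"
 define mon where "mon gm e <-> (ALL x. \<bar>x - s\<bar> < e --> (ALL y. \<bar>y - s\<bar> < e --> x <= y --> sg * f (gm(n := x)) <= sg * f (gm(n := y))))" for gm e
 have mt: "mon t d" unfolding mon_def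
 proof (intro allI impI)
  fix x y assume xy: "\<bar>x - s\<bar> < d" "\<bar>y - s\<bar> < d" "x <= y"
  have z: "\<bar>z - s\<bar> < d" if "x <= z" "z <= y" for z using xy that by (auto simp: abs_less_iff)
  have dz: "has_d ph z (derivk ph z)" if "x <= z" "z <= y" for z using d1(2)[of z] z[OF that] derivk_eq by (fastforce simp: d_def)
  show "sg * f (t(n := x)) <= sg * f (t(n := y))"
  proof (cases "0 <= derivk ph s")
   case True
   have "0 * (y - x) <= ph y - ph x"
    by (rule mvi[OF DF_UNIV[OF ph] xy(3) dz]) (use d2(2) z True in \<open>auto simp: d_def\<close>)
   then show ?thesis using True by (simp add: sg_def ph_def)
  next
   case False
   have "ph y - ph x <= 0 * (y - x)"
   proof (rule mvi_le[OF DF_UNIV[OF ph] xy(3) dz])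
    show "derivk ph w <= 0" if "x <= w" "w <= y" for w using d2(2)[of w] z[OF that] False by (simp add: d_def)
   qed
   then show ?thesis using False by (simp add: sg_def ph_def)
  qed
 qed
 let ?B = "insert s A"
 have sB: "DF ?B (%bt. s)" by (rule DF_const) simp
 have fB: "DF ?B f" by (rule DF_mono[OF f]) auto
 have sgB: "DF ?B (%bt. sg)" unfolding sg_def using DF_1 DF_minus[OF DF_1] by auto
 define \<mu> where "\<mu> gm = supd (%e. e <= 1 & mon gm e)" for gm
 have \<mu>D: "DF ?B \<mu>" unfolding \<mu>_def[abs_def] mon_def
  by (rule DF_supd[where R = "%e gm. e <= 1 & (ALL x. \<bar>x - s\<bar> < e --> (ALL y. \<bar>y - s\<bar> < e --> x <= y --> sg * f (gm(n := x)) <= sg * f (gm(n := y))))"])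
   (intro D_base DF_base sB sgB DF_upd[OF fB])
 have fdep: "f (bt(n := x)) = f (gm(n := x))" if "!!i. i < n ==> bt i = gm i" for bt gm x
  by (rule depD[OF df]) (use that in auto)
 have \<mu>dep: "dep n \<mu>" unfolding dep_def
 proof (intro allI impI)
  fix bt gm :: "nat => 'k" assume *: "ALL i<n. bt i = gm i"
  have "f (bt(n := x)) = f (gm(n := x))" for x by (rule fdep) (use * in auto)
  then show "\<mu> bt = \<mu> gm" by (simp only: \<mu>_def mon_def)
 qed
 have indB: "ind ?B n t" using ind_last[OF t] by (simp add: s_def)
 have \<mu>c: "contn n \<mu> t" by (rule C[OF indB \<mu>D \<mu>dep])
 have dsm: "ds (%e. e <= 1 & mon t e)" unfolding mon_def
  by (intro D_base DF_base DFU DF_app1[where F = "%x. f (t(n := x))", OF DF_UNIV[OF ph[unfolded ph_def]]])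
 have d0: "0 < d" using d1 d2 by (simp add: d_def)
 have md: "min d 1 <= 1 & mon t (min d 1)" using mt unfolding mon_def by auto
 obtain m where m: "is_sup (%e. e <= 1 & mon t e) m"
  using sup_exists[where S = "%e. e <= 1 & mon t e" and ?x0.0 = "min d 1" and b = 1] dsm md by blast
 have "min d 1 <= m" using m md unfolding is_sup_def by blast
 then have \<mu>t: "0 < \<mu> t" using d0 supd_eq[OF m] unfolding \<mu>_def by (auto simp: min_def split: if_splits)
 \<comment> \<open>At x = s this is the induction hypothesis over \<open>insert s A\<close>. As a
   property of x it is definable over the other coordinates, and s is generic over these, so it
   persists at s - r and s + r, where the hypothesis itself cannot be applied.\<close>
 define Q where "Q x <-> contn n (%gm. f (gm(n := x))) t" for x
 have Qs: "Q s" unfolding Q_def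
 proof (rule C[OF indB])
  show "DF ?B (%gm. f (gm(n := s)))" by (rule DF_upd[OF fB sB, where r = "%i. i"])
  show "dep n (%gm. f (gm(n := s)))" unfolding dep_def using fdep by blast
 qed
 have "D ?A (%bt. Q (bt 0))"
 proof -
  have ti: "DF ?A (%bt. if i < n then t i else 0)" for i by (cases "i < n") (auto intro: DF_const DF_0)
  have fA: "DF ?A f" by (rule DF_mono[OF f]) auto
  have 1: "DF ?A (%bt. f ((%i. bt (r i))(n := bt k)))" for r k by (rule DF_upd[OF fA DF_var])
  have 2: "DF ?A (%bt. f (t(n := bt k)))" for k using DF_ren[OF ph[unfolded ph_def], of "%_. k"] .
  have "D ?A (%bt. ALL e>0. EX dt>0. ALL gm. box n dt (%i. if i < n then t i else 0) gm --> \<bar>f (gm(n := bt 0)) - f (t(n := bt 0))\<bar> < e)"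
   by (intro D_base DF_base D_allval D_box ti 1 2)
  moreover have "box n dt (%i. if i < n then t i else 0) gm = box n dt t gm" for dt gm by (rule box_cong) auto
  ultimately show ?thesis by (simp only: Q_def contn_def)
 qed
 then obtain d3 where d3: "d3 > 0" "!!x. \<bar>x - s\<bar> < d3 ==> Q x"
  using not_dcl_nbhd[where S = Q, OF _ sA] Qs by metis
 show ?case unfolding contn_def
 proof (intro allI impI)
  fix e :: 'k assume e: "e > 0"
  then have e2: "e / 2 > 0" by simp
  obtain d4 where d4: "d4 > 0" "!!y. \<bar>y - s\<bar> < d4 ==> \<bar>ph y - ph s\<bar> < e / 2" using phc e2 unfolding contat_def by blast
  define r where "r = min (min d3 d4) (\<mu> t / 2) / 2"
  have r: "0 < r" "r < d3" "r < d4" "r < \<mu> t / 2"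
  proof -
   have m: "0 < min (min d3 d4) (\<mu> t / 2)" using d3(1) d4(1) \<mu>t by simp
   then show "0 < r" by (simp add: r_def)
   have half: "x / 2 < x" if "0 < x" for x :: 'k using that by simp
   have "r < min (min d3 d4) (\<mu> t / 2)" unfolding r_def by (rule half[OF m])
   then show "r < d3" "r < d4" "r < \<mu> t / 2" by simp_all
  qed
  have Q12: "Q (s - r)" "Q (s + r)" using d3(2) r by auto
  obtain dt1 where dt1: "dt1 > 0" "!!gm. box n dt1 t gm ==> \<bar>f (gm(n := s - r)) - f (t(n := s - r))\<bar> < e / 2" using Q12(1) e2 unfolding Q_def contn_def by blast
  obtain dt2 where dt2: "dt2 > 0" "!!gm. box n dt2 t gm ==> \<bar>f (gm(n := s + r)) - f (t(n := s + r))\<bar> < e / 2" using Q12(2) e2 unfolding Q_def contn_def by blast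
  have "\<mu> t / 2 > 0" using \<mu>t by simp
  then obtain dt3 where dt3: "dt3 > 0" "!!gm. box n dt3 t gm ==> \<bar>\<mu> gm - \<mu> t\<bar> < \<mu> t / 2" using \<mu>c unfolding contn_def by blast
  define dt where "dt = min (min dt1 dt2) (min dt3 r)"
  have "\<bar>f gm - f t\<bar> < e" if b: "box (Suc n) dt t gm" for gm
  proof -
   have bn: "box n dt t gm" "\<bar>gm n - s\<bar> < r" using b by (auto simp: box_Suc dt_def s_def)
   have b123: "box n dt1 t gm" "box n dt2 t gm" "box n dt3 t gm" by (rule box_mono[OF bn(1)], simp add: dt_def)+
   have "\<mu> t - \<mu> t / 2 < \<mu> gm" using dt3(2)[OF b123(3)] unfolding abs_less_iff by linarith
   then have "r < \<mu> gm" "0 < \<mu> gm" using r by simp_all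
   then have "is_sup (%e. e <= 1 & mon gm e) (\<mu> gm)" unfolding \<mu>_def by (intro supd_pos_is_sup)
   from is_sup_less[OF this \<open>r < \<mu> gm\<close>] obtain e' where e': "mon gm e'" "r < e'" by blast
   have "\<bar>s - r - s\<bar> < e'" "\<bar>gm n - s\<bar> < e'" "\<bar>s + r - s\<bar> < e'" "s - r <= gm n" "gm n <= s + r"
    using e'(2) r bn(2) by (auto simp: abs_less_iff)
   then have "sg * f (gm(n := s - r)) <= sg * f (gm(n := gm n))" "sg * f (gm(n := gm n)) <= sg * f (gm(n := s + r))"
    using e'(1) unfolding mon_def by blast+
   moreover have "gm(n := gm n) = gm" by simp
   ultimately have mn: "sg * f (gm(n := s - r)) <= sg * f gm" "sg * f gm <= sg * f (gm(n := s + r))" by (simp_all only:)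
   have n1: "\<bar>f (gm(n := s - r)) - f t\<bar> < e"
   proof -
    have "\<bar>ph (s - r) - ph s\<bar> < e / 2" by (rule d4(2)) (use r in simp)
    moreover have "\<bar>f (gm(n := s - r)) - ph (s - r)\<bar> < e / 2" using dt1(2)[OF b123(1)] by (simp only: ph_def)
    ultimately have "\<bar>(f (gm(n := s - r)) - ph (s - r)) + (ph (s - r) - ph s)\<bar> < e / 2 + e / 2"
     by (meson abs_triangle_ineq add_strict_mono le_less_trans)
    then show ?thesis by (simp add: pht)
   qed
   have n2: "\<bar>f (gm(n := s + r)) - f t\<bar> < e"
   proof -
    have "\<bar>ph (s + r) - ph s\<bar> < e / 2" by (rule d4(2)) (use r in simp)
    moreover have "\<bar>f (gm(n := s + r)) - ph (s + r)\<bar> < e / 2" using dt2(2)[OF b123(2)] by (simp only: ph_def)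
    ultimately have "\<bar>(f (gm(n := s + r)) - ph (s + r)) + (ph (s + r) - ph s)\<bar> < e / 2 + e / 2"
     by (meson abs_triangle_ineq add_strict_mono le_less_trans)
    then show ?thesis by (simp add: pht)
   qed
   show ?thesis using mn n1 n2 by (cases "0 <= derivk ph s") (simp_all add: sg_def abs_less_iff)
  qed
  moreover have "0 < dt" using dt1(1) dt2(1) dt3(1) r(1) by (simp add: dt_def)
  ultimately show "EX dt>0. ALL gm. box (Suc n) dt t gm --> \<bar>f gm - f t\<bar> < e" by blast
 qed
qed

text \<open>In the last coordinate \<open>P\<close> persists because \<open>t m\<close> is not
  definable from the rest; \<open>radius_box\<close> makes the radius uniform for nearby values of
  the other coordinates.\<close>

theorem generic_open:
 assumes "ind A n t" "D A P" "dep n P" "P t" shows "EX dt>0. ALL gm. box n dt t gm --> P gm"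
proof (cases n)
 case 0
 then have "P gm" for gm using depD[OF assms(3), of gm t] assms(4) by simp
 then show ?thesis by (auto intro: zero_less_one)
next
 case (Suc m)
 have t: "ind A (Suc m) t" and P: "dep (Suc m) P" using assms(1,3) Suc by auto
 have "D (A Un t ` {..<m}) (%bt. P (t(m := bt 0)))" by (rule D_fibre[OF assms(2) P]) auto
 moreover have "t m ~: dcl (A Un t ` {..<m})" using t by (simp add: ind_Suc)
 ultimately obtain d where d: "d > 0" "!!x. \<bar>x - t m\<bar> < d ==> P (t(m := x)) = P (t(m := t m))"
  using not_dcl_nbhd[where S = "%x. P (t(m := x))"] by metis
 have "P (t(m := x))" if "\<bar>x - t m\<bar> < d" for x using d(2)[OF that] assms(4) by simp
 then have "EX dt>0. ALL gm. box m dt t gm --> (ALL x. \<bar>x - t m\<bar> < dt --> P (gm(m := x)))"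
  by (intro radius_box[OF _ t assms(2) P d(1)] generic_continuous)
 then obtain dt where dt: "dt > 0" "!!gm x. box m dt t gm ==> \<bar>x - t m\<bar> < dt ==> P (gm(m := x))" by blast
 have "P gm" if "box n dt t gm" for gm using dt(2)[of gm "gm m"] that Suc by (simp add: box_Suc)
 then show ?thesis using dt(1) by blast
qed

lemma mvi_abs:
 assumes f: "df f" and d: "!!x. min a b <= x ==> x <= max a b ==> has_d f x (f' x)"
  and c: "!!x. min a b <= x ==> x <= max a b ==> \<bar>f' x - c\<bar> <= e"
 shows "\<bar>f b - f a - c * (b - a)\<bar> <= e * \<bar>b - a\<bar>"
proof -
 have *: "\<bar>f v - f u - c * (v - u)\<bar> <= e * (v - u)" if uv: "u <= v" "min a b = u" "max a b = v" for u v
 proof -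
  have "(c - e) * (v - u) <= f v - f u"
  proof (rule mvi[OF f uv(1)])
   show "has_d f x (f' x)" "c - e <= f' x" if "u <= x" "x <= v" for x using d[of x] c[of x] that uv by (simp_all add: abs_le_iff)
  qed
  moreover have "f v - f u <= (c + e) * (v - u)"
  proof (rule mvi_le[OF f uv(1)])
   show "has_d f x (f' x)" "f' x <= c + e" if "u <= x" "x <= v" for x using d[of x] c[of x] that uv by (simp_all add: abs_le_iff)
  qed
  ultimately show ?thesis by (simp add: abs_le_iff algebra_simps)
 qed
 show ?thesis
 proof (cases "a <= b")
  case True then show ?thesis using *[of a b] by (simp add: min_def max_def)
 next
  case False
  then have "\<bar>f a - f b - c * (a - b)\<bar> <= e * (a - b)" using *[of b a] by (simp add: min_def max_def)
  moreover have "f a - f b - c * (a - b) = - (f b - f a - c * (b - a))" by (simp add: algebra_simps)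
  ultimately show ?thesis using False by (simp only: abs_minus_cancel) simp
 qed
qed

definition pdiff :: "nat => ((nat => 'k) => 'k) => (nat => 'k) => bool" where
 "pdiff n f gm <-> (ALL i<n. (EX c. has_d (%x. f (gm(i := x))) (gm i) c) & contn n (pd i f) gm)"

lemma gradat_of_pdiff:
 assumes f: "DF UNIV f" "dep n f" and d: "0 < d" "!!gm. box n d u gm ==> pdiff n f gm"
 shows "gradat n f (%i. pd i f u) u"
 unfolding gradat_def
proof (intro allI impI)
 fix e :: 'k assume e: "e > 0"
 have "EX r>0. ALL i<n. r <= d & (ALL gm. box n r u gm --> \<bar>pd i f gm - pd i f u\<bar> < e)"
 proof (rule eventually_finite)
  fix i assume i: "i < n"
  have "contn n (pd i f) u" using d(2)[of u] d(1) i by (auto simp: pdiff_def)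
  then obtain r where "r > 0" "ALL gm. box n r u gm --> \<bar>pd i f gm - pd i f u\<bar> < e" using e unfolding contn_def by blast
  then show "EX r>0. r <= d & (ALL gm. box n r u gm --> \<bar>pd i f gm - pd i f u\<bar> < e)"
   using d(1) by (intro exI[of _ "min r d"]) (auto dest: box_mono[where d' = r])
 next
  fix i and r r' :: 'k
  assume "r <= d & (ALL gm. box n r u gm --> \<bar>pd i f gm - pd i f u\<bar> < e)" "r' <= r"
  then show "r' <= d & (ALL gm. box n r' u gm --> \<bar>pd i f gm - pd i f u\<bar> < e)" by (meson box_mono order_trans)
 qed
 then obtain r where r: "r > 0" "!!i gm. i < n ==> box n r u gm ==> \<bar>pd i f gm - pd i f u\<bar> < e" "n > 0 ==> r <= d" by blast
 have "\<bar>f y - f u - (\<Sum>i<n. pd i f u * (y i - u i))\<bar> <= e * (\<Sum>i<n. \<bar>y i - u i\<bar>)" if y: "box n r u y" for y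
 proof -
  \<comment> \<open>The path from u to y changes one coordinate at a time, and each leg is
    controlled by the one-variable mean value inequality with a partial derivative close to its
    value at u.\<close>
  define w where "w k = (%i. if i < k then y i else u i)" for k
  have "\<bar>f (w k) - f u - (\<Sum>i<k. pd i f u * (y i - u i))\<bar> <= e * (\<Sum>i<k. \<bar>y i - u i\<bar>)" if "k <= n" for k
   using that
  proof (induction k)
   case 0 then show ?case by (simp add: w_def)
  next
   case (Suc k)
   let ?ph = "%x. f ((w k)(k := x))"
   have k: "k < n" using Suc.prems by simp
   have bx: "box n r u ((w k)(k := x))" if x: "min (u k) (y k) <= x" "x <= max (u k) (y k)" for x
   proof -
    have "\<bar>y k - u k\<bar> < r" using y k by (simp add: box_def)
    moreover have "\<bar>x - u k\<bar> <= \<bar>y k - u k\<bar>" using x by (auto simp: min_def max_def abs_if split: if_splits)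
    ultimately show ?thesis using y r(1) by (auto simp: box_def w_def)
   qed
   have "df ?ph"
   proof -
    have "DF UNIV (%bt. if i = k then bt 0 else w k i)" for i by (cases "i = k") (auto intro: DFU DF_var)
    from DF_subst[OF f(1), where ta = "%i bt. if i = k then bt 0 else w k i", OF this] show ?thesis by (simp only: fun_upd_def)
   qed
   then have "\<bar>?ph (y k) - ?ph (u k) - pd k f u * (y k - u k)\<bar> <= e * \<bar>y k - u k\<bar>"
   proof (rule mvi_abs[where f' = "%x. pd k f ((w k)(k := x))"])
    fix x assume x: "min (u k) (y k) <= x" "x <= max (u k) (y k)"
    have "box n d u ((w k)(k := x))" by (rule box_mono[OF bx[OF x]]) (use r(3) k in simp)
    from d(2)[OF this] k obtain c where "has_d (%z. f (((w k)(k := x))(k := z))) (((w k)(k := x)) k) c" unfolding pdiff_def by blast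
    then have "has_d ?ph x c" by simp
    moreover have "pd k f ((w k)(k := x)) = derivk ?ph x" by (simp add: pd_def)
    ultimately show "has_d ?ph x (pd k f ((w k)(k := x)))" using derivk_eq by metis
    show "\<bar>pd k f ((w k)(k := x)) - pd k f u\<bar> <= e" using r(2)[OF k bx[OF x]] by simp
   qed
   moreover have "(w k)(k := y k) = w (Suc k)" "(w k)(k := u k) = w k" by (auto simp: w_def less_Suc_eq)
   ultimately have 1: "\<bar>f (w (Suc k)) - f (w k) - pd k f u * (y k - u k)\<bar> <= e * \<bar>y k - u k\<bar>" by (simp only:)
   have 2: "\<bar>f (w k) - f u - (\<Sum>i<k. pd i f u * (y i - u i))\<bar> <= e * (\<Sum>i<k. \<bar>y i - u i\<bar>)" using Suc by simp
   show ?case using 1 2 abs_triangle_ineq[of "f (w (Suc k)) - f (w k) - pd k f u * (y k - u k)" "f (w k) - f u - (\<Sum>i<k. pd i f u * (y i - u i))"]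
    by (simp add: algebra_simps)
  qed
  from this[of n] have "\<bar>f (w n) - f u - (\<Sum>i<n. pd i f u * (y i - u i))\<bar> <= e * (\<Sum>i<n. \<bar>y i - u i\<bar>)" by simp
  moreover have "f (w n) = f y" by (rule depD[OF f(2)]) (simp add: w_def)
  ultimately show ?thesis by simp
 qed
 then show "EX dt>0. ALL y. box n dt u y --> \<bar>f y - f u - (\<Sum>i<n. pd i f u * (y i - u i))\<bar> <= e * (\<Sum>i<n. \<bar>y i - u i\<bar>)" using r(1) by blast
qed

text \<open>The functions tested by a T-derivation, in the encoding by valuations: definable without
  parameters, and C1 on an open set \<open>U\<close> definable without parameters.\<close>

definition c1f :: "nat => ((nat => 'k) => 'k) => ((nat => 'k) => bool) => bool" where
 "c1f n f U <-> DF {} f & dep n f & D {} U & dep n U &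
   (ALL gm. U gm --> (EX dt>0. ALL et. box n dt gm et --> U et)) &
   (ALL gm. U gm --> gradat n f (%i. pd i f gm) gm & (ALL i<n. contn n (pd i f) gm))"

text \<open>Each partial derivative exists at \<open>t\<close>, since each entry is generic over the
  others, and is continuous there by \<open>generic_continuous\<close>. By
  \<open>generic_open\<close> this persists on a box, and \<open>U\<close> is the interior of the
  set where it holds.\<close>

theorem generic_c1:
 assumes t: "ind {} n t" and f: "DF {} f" "dep n f" shows "EX U. c1f n f U & U t"
proof -
 have D: "D {} (pdiff n f)" unfolding pdiff_def[abs_def]
  by (rule D_ball_nat, rule D_conj, rule D_has_pd[OF f(1)], rule D_contn[OF DF_pd[OF f(1)], where ta = "%i bt. bt i"], rule DF_var)
 have dep: "dep n (pdiff n f)" unfolding dep_def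
 proof (intro allI impI)
  fix bt gm :: "nat => 'k" assume e: "ALL i<n. bt i = gm i"
  have 1: "f (bt(i := x)) = f (gm(i := x))" for i x by (rule depD[OF f(2)]) (use e in auto)
  have 2: "contn n (pd i f) bt = contn n (pd i f) gm" if "i < n" for i by (rule contn_dep[OF pd_dep[OF f(2) that]]) (use e in auto)
  show "pdiff n f bt = pdiff n f gm" unfolding pdiff_def 1 using 2 e by auto
 qed
 have pt: "pdiff n f t" unfolding pdiff_def
 proof (intro allI impI conjI)
  fix i assume i: "i < n"
  have "DF ({} Un t ` ({..<n} - {i})) (%bt. f (t(i := bt 0)))" by (rule DF_fibre[OF f]) auto
  from nondcl_diff[where f = "%x. f (t(i := x))", OF this ind_any[OF t i]] show "EX c. has_d (%x. f (t(i := x))) (t i) c" .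
  show "contn n (pd i f) t" by (rule generic_continuous[OF t DF_pd[OF f(1)] pd_dep[OF f(2) i]])
 qed
 define U where "U gm <-> (EX dt>0. ALL et. box n dt gm et --> pdiff n f et)" for gm
 have "c1f n f U" unfolding c1f_def
 proof (intro conjI allI impI f)
  show "D {} U" unfolding U_def[abs_def] by (intro D_base DF_base D_allval D_box D_ren[OF D])
  show "dep n U" unfolding dep_def U_def
  proof (intro allI impI)
   fix bt gm :: "nat => 'k" assume e: "ALL i<n. bt i = gm i"
   have "box n d bt et = box n d gm et" for d et by (rule box_cong) (use e in auto)
   then show "(EX dt>0. ALL et. box n dt bt et --> pdiff n f et) = (EX dt>0. ALL et. box n dt gm et --> pdiff n f et)" by (simp only:)
  qed
  fix gm assume "U gm"
  then obtain dt where d: "dt > 0" "!!et. box n dt gm et ==> pdiff n f et" unfolding U_def by blast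
  then have d2: "dt / 2 > 0" by simp
  have "U et" if b: "box n (dt / 2) gm et" for et unfolding U_def
  proof (intro exI[of _ "dt / 2"] conjI allI impI d2)
   fix ze assume "box n (dt / 2) et ze"
   from box_tri[OF b this] show "pdiff n f ze" by (intro d(2)) simp
  qed
  then show "EX dt>0. ALL et. box n dt gm et --> U et" using d2 by blast
  show "gradat n f (%i. pd i f gm) gm" by (rule gradat_of_pdiff[OF DF_UNIV[OF f(1)] f(2) d])
  show "contn n (pd i f) gm" if "i < n" for i using d(2)[of gm] d(1) that by (simp add: pdiff_def)
 qed
 moreover have "U t" unfolding U_def by (rule generic_open[OF t D dep pt])
 ultimately show ?thesis by blast
qed

end

section \<open>Extending derivations to definable closures\<close>

lemma pd_proj: "i < n ==> pd k (%gm. gm j) t = (if k = j then 1 else 0)" for t :: "nat => 'k::linordered_field"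
proof -
 have "has_d (%x. x) (t j) 1" "has_d (%x. t j) (t k) 0" unfolding has_d_def by (auto intro: exI[of _ 1])
 then show ?thesis unfolding pd_def by (cases "k = j") (simp_all add: derivk_eq)
qed

lemma pd_indep: assumes "!!x. f (t(k := x)) = f t" shows "pd k f t = 0"
proof -
 have "has_d (%x. f t) (t k) 0" unfolding has_d_def by (auto intro: exI[of _ 1])
 then show ?thesis unfolding pd_def assms by (rule derivk_eq)
qed

context omf
begin

lemma dcl_finite: assumes "z : dcl X" shows "EX F<=X. finite F & z : dcl F"
proof -
 have "D X (%bt. bt 0 = z)" using assms by (simp add: dcl_def DF_def)
 then obtain P0 br where P: "D0 P0" "!!i. br i : insert 0 X" "!!bt. (bt 0 = z) = P0 (mix bt br)"
  unfolding D_def by blast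
 obtain ph where ph: "!!bt. P0 bt = sat N bt ph" using P(1) unfolding D0_def by blast
 obtain n where n: "!!bt gm. (ALL i<n. bt i = gm i) ==> sat N bt ph = sat N gm ph" using sat_support[of N ph] by blast
 define F where "F = br ` {..<n} - {0} Un (br ` {..<n} Int X)"
 define br' where "br' i = (if i < n then br i else 0)" for i
 have "(bt 0 = z) = P0 (mix bt br')" for bt
 proof -
  have "sat N (mix bt br) ph = sat N (mix bt br') ph" by (rule n) (auto simp: mix_def br'_def)
  then show ?thesis using P(3) ph by blast
 qed
 moreover have "br' i : insert 0 F" for i by (auto simp: br'_def F_def)
 ultimately have "D F (%bt. bt 0 = z)" unfolding D_def using P(1) by blast
 then have "z : dcl F" by (rule dclI)
 moreover have "finite F" "F <= X" using P(2) by (auto simp: F_def)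
 ultimately show ?thesis by blast
qed

lemma dcl_fun: assumes "z : dcl (s ` I)"
 obtains q where "DF {} q" "!!bt gm. (!!i. i : I ==> bt i = gm i) ==> q bt = q gm" "q s = z"
proof -
 have "D (s ` I) (%bt. bt 0 = z)" using assms by (simp add: dcl_def DF_def)
 then obtain P0 br where P: "D0 P0" "!!i. br i : insert 0 (s ` I)" "!!bt. (bt 0 = z) = P0 (mix bt br)"
  unfolding D_def by blast
 define bk where "bk i = (SOME j. j : I & s j = br i)" for i
 have bk: "bk i : I" "s (bk i) = br i" if "br i : s ` I" for i
 proof -
  have "EX j. j : I & s j = br i" using that by auto
  from someI_ex[OF this] show "bk i : I" "s (bk i) = br i" unfolding bk_def by auto
 qed
 define R where "R y bt = P0 (mix (%_. y) (%i. if br i : s ` I then bt (bk i) else 0))" for y bt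
 have "DF {} (%bt. mix (%_. bt 0) (%i. if br i : s ` I then bt (Suc (bk i)) else 0) j)" for j
  by (cases "even j"; cases "br (j div 2) : s ` I") (auto simp: mix_def DF_var DF_0)
 from D_subst[OF D0_D[OF P(1)], OF this] have "D {} (%bt. R (bt 0) (%i. bt (Suc i)))" unfolding R_def by simp
 then obtain q where q: "DF {} q" "!!bt y. R y bt ==> R (q bt) bt" using choice1 by blast
 define q' where "q' bt = q (%i. if i : I then bt i else 0)" for bt
 have "DF {} (%bt. if i : I then bt i else 0)" for i by (cases "i : I") (simp_all add: DF_var DF_0)
 from DF_subst[OF q(1), where ta = "%i bt. if i : I then bt i else 0", OF this] have 1: "DF {} q'" unfolding q'_def .
 have 2: "q' bt = q' gm" if "!!i. i : I ==> bt i = gm i" for bt gm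
 proof -
  have "(%i. if i : I then bt i else 0) = (%i. if i : I then gm i else 0)" using that by auto
  then show ?thesis by (simp only: q'_def)
 qed
 let ?s = "%i. if i : I then s i else 0"
 have "(%i. if br i : s ` I then ?s (bk i) else 0) = br" using bk P(2) by fastforce
 then have R: "R y ?s = (y = z)" for y unfolding R_def using P(3)[of "%_. y"] by simp
 have "R (q ?s) ?s" by (rule q(2)[of z]) (simp add: R)
 then have 3: "q' s = z" unfolding R q'_def .
 show thesis by (rule that[OF 1 2 3])
qed

lemma dcl_fun_tuple: assumes "z : dcl (s ` {..<m})" obtains q where "DF {} q" "dep m q" "q s = z"
proof (rule dcl_fun[OF assms])
 fix q assume q: "DF {} q" "!!bt gm. (!!i. i : {..<m} ==> bt i = gm i) ==> q bt = q gm" "q s = z"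
 have "dep m q" unfolding dep_def by (intro allI impI, rule q(2)) simp
 then show thesis using that q(1,3) by blast
qed

lemma ind_spanning: "finite F ==> EX m s. ind {} m s & s ` {..<m} <= F & F <= dcl (s ` {..<m})"
proof (induction F rule: finite_induct)
 case empty
 then show ?case by (intro exI[of _ 0]) (auto simp: ind_def)
next
 case (insert x F)
 then obtain m s where s: "ind {} m s" "s ` {..<m} <= F" "F <= dcl (s ` {..<m})" by blast
 show ?case
 proof (cases "x : dcl (s ` {..<m})")
  case True then show ?thesis using s by blast
 next
  case False
  let ?s = "s(m := x)"
  have i: "?s ` {..<k} = s ` {..<k}" if "k <= m" for k using that by (intro image_cong) auto
  have "ind {} (Suc m) ?s" unfolding ind_def
  proof (intro allI impI)
   fix j assume j: "j < Suc m"
   have 1: "?s ` {..<j} = s ` {..<j}" using i[of j] j by simp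
   show "?s j ~: dcl ({} Un ?s ` {..<j})" unfolding 1 using s(1) False j unfolding ind_def by (cases "j = m") auto
  qed
  moreover have S: "?s ` {..<Suc m} = insert x (s ` {..<m})" unfolding lessThan_Suc image_insert i[OF order_refl] by simp
  moreover have "insert x F <= dcl (insert x (s ` {..<m}))"
   using s(3) dcl_mono[of "s ` {..<m}" "insert x (s ` {..<m})"] subset_dcl[of "insert x (s ` {..<m})"] by blast
  ultimately show ?thesis using s(2) by (intro exI[of _ "Suc m"] exI[of _ ?s]) (simp only: S, blast)
 qed
qed

text \<open>Finitely many elements of \<open>dcl X\<close> use finitely many parameters. An
  independent subtuple spanning these serves all the elements simultaneously, which is what a
  comparison of representations needs.\<close>

lemma joint_rep: fixes n :: nat assumes "!!i. i < n ==> gm i : dcl X"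
 obtains m s q where "ind {} m s" "s ` {..<m} <= X" "ALL i<n. DF {} (q i) & dep m (q i) & q i s = gm i"
proof -
 have "ALL i. EX F. i < n --> F <= X & finite F & gm i : dcl F" using dcl_finite[OF assms] by blast
 from choice[OF this] obtain G where G: "!!i. i < n ==> G i <= X & finite (G i) & gm i : dcl (G i)" by blast
 let ?F = "\<Union>i<n. G i"
 have "finite ?F" by (rule finite_UN_I) (use G in auto)
 from ind_spanning[OF this] obtain m s where s: "ind {} m s" "s ` {..<m} <= ?F" "?F <= dcl (s ` {..<m})" by blast
 have "gm i : dcl (s ` {..<m})" if i: "i < n" for i
 proof -
  have "G i <= dcl (s ` {..<m})" using s(3) i by blast
  from dcl_mono[OF this] show ?thesis using G[OF i] by auto
 qed
 then have "ALL i. EX q. i < n --> DF {} q & dep m q & q s = gm i" by (meson dcl_fun_tuple)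
 from choice[OF this] obtain q where "ALL i<n. DF {} (q i) & dep m (q i) & q i s = gm i" by blast
 moreover have "s ` {..<m} <= X" using s(2) G by blast
 ultimately show thesis using that s(1) by blast
qed

lemma single_rep: assumes "z : dcl X"
 obtains m s q where "ind {} m s" "s ` {..<m} <= X" "DF {} q" "dep m q" "q s = z"
proof -
 obtain m s q where "ind {} m s" "s ` {..<m} <= X" "ALL i<1::nat. DF {} (q i) & dep m (q i) & q i s = z"
  by (rule joint_rep[of 1 "%_. z"]) (rule assms)
 then show thesis using that by auto
qed

text \<open>The value which the chain rule forces on the derivative of \<open>q s\<close> once the
  derivatives of the entries of s are given by \<open>bs\<close>.\<close>

definition dvl :: "('k => 'k) => nat => (nat => 'k) => ((nat => 'k) => 'k) => 'k" where
 "dvl bs m s q = (\<Sum>k<m. pd k q s * bs (s k))"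

text \<open>Two functions definable without parameters that agree at an independent tuple agree on a
  box around it, so their partial derivatives agree. Hence the forced value depends on the element
  \<open>q s\<close> only, as long as s is kept.\<close>

lemma dvl_germ: assumes s: "ind {} m s" and q: "DF {} q" "dep m q" and r: "DF {} r" "dep m r" and e: "q s = r s"
 shows "k < m ==> pd k q s = pd k r s" "dvl bs m s q = dvl bs m s r"
proof -
 have "D {} (%bt. q bt = r bt)" by (rule D_eq[OF q(1) r(1)])
 moreover have "dep m (%bt. q bt = r bt)" using q(2) r(2) unfolding dep_def by metis
 ultimately obtain d where d: "d > 0" "!!gm. box m d s gm ==> q gm = r gm" using generic_open[OF s, of "%bt. q bt = r bt"] e by blast
 show *: "pd k q s = pd k r s" if k: "k < m" for k
 proof -
  have 1: "DF ({} Un s ` ({..<m} - {k})) (%bt. q (s(k := bt 0)))" by (rule DF_fibre[OF q]) auto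
  obtain a where a: "has_d (%x. q (s(k := x))) (s k) a"
   using nondcl_diff[where f = "%x. q (s(k := x))", OF 1 ind_any[OF s k]] by blast
  have eq: "q (s(k := s k + h)) = r (s(k := s k + h))" if "\<bar>h\<bar> < d" for h
   by (rule d(2)) (use that d(1) in \<open>auto simp: box_def\<close>)
  have "has_d (%x. r (s(k := x))) (s k) a" unfolding has_d_def
  proof (intro allI impI)
   fix e :: 'k assume "e > 0"
   then obtain d1 where d1: "d1 > 0" "!!h. \<bar>h\<bar> < d1 ==> \<bar>q (s(k := s k + h)) - q (s(k := s k)) - a * h\<bar> <= e * \<bar>h\<bar>"
    using a unfolding has_d_def by blast
   have "\<bar>r (s(k := s k + h)) - r (s(k := s k)) - a * h\<bar> <= e * \<bar>h\<bar>" if "\<bar>h\<bar> < min d d1" for h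
   proof -
    have "\<bar>h\<bar> < d" using that by simp
    from eq[OF this] have 1: "r (s(k := s k + h)) = q (s(k := s k + h))" by (rule sym)
    have 2: "r (s(k := s k)) = q (s(k := s k))" using assms(6) by simp
    show ?thesis unfolding 1 2 using d1(2)[of h] that by simp
   qed
   then show "EX d>0. ALL h. \<bar>h\<bar> < d --> \<bar>r (s(k := s k + h)) - r (s(k := s k)) - a * h\<bar> <= e * \<bar>h\<bar>"
    using d(1) d1(1) by (intro exI[of _ "min d d1"]) auto
  qed
  then show ?thesis using a unfolding pd_def by (simp only: derivk_eq)
 qed
 show "dvl bs m s q = dvl bs m s r" unfolding dvl_def by (rule sum.cong) (use * in auto)
qed

lemma dvl_comp:
 assumes s: "ind {} m s" and q: "ALL i<n. DF {} (q i) & dep m (q i) & q i s = gm i"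
  and p: "gradat n p (%i. pd i p gm) gm" "dep n p"
 shows "dvl bs m s (%bt. p (%i. if i < n then q i bt else 0)) = (\<Sum>i<n. pd i p gm * dvl bs m s (q i))"
proof -
 have "pd k (%bt. p (%i. if i < n then q i bt else 0)) s = (\<Sum>i<n. pd i p gm * pd k (q i) s)" if k: "k < m" for k
 proof -
  let ?c = "%i x. if i < n then q i (s(k := x)) else gm i"
  have c: "has_d (?c i) (s k) (pd k (q i) s)" if i: "i < n" for i
  proof -
   have "DF {} (q i)" "dep m (q i)" using q i by auto
   then have 1: "DF ({} Un s ` ({..<m} - {k})) (%bt. q i (s(k := bt 0)))" by (rule DF_fibre) auto
   obtain a where a: "has_d (%x. q i (s(k := x))) (s k) a"
    using nondcl_diff[where f = "%x. q i (s(k := x))", OF 1 ind_any[OF s k]] by blast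
   moreover have "pd k (q i) s = a" unfolding pd_def by (rule derivk_eq[OF a])
   ultimately show ?thesis using i by simp
  qed
  have "has_d (%x. p (%i. ?c i x)) (s k) (\<Sum>i<n. pd i p gm * pd k (q i) s)"
   by (rule chain_curve[OF p(1)]) (use c q in auto)
  moreover have "p (%i. ?c i x) = p (%i. if i < n then q i (s(k := x)) else 0)" for x
   by (rule depD[OF p(2)]) simp
  ultimately show ?thesis unfolding pd_def[of k "%bt. p (%i. if i < n then q i bt else 0)"] by (simp only: derivk_eq)
 qed
 then have "dvl bs m s (%bt. p (%i. if i < n then q i bt else 0)) = (\<Sum>k<m. (\<Sum>i<n. pd i p gm * pd k (q i) s) * bs (s k))"
  unfolding dvl_def by (intro sum.cong) auto
 also have "\<dots> = (\<Sum>i<n. \<Sum>k<m. pd i p gm * pd k (q i) s * bs (s k))"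
  unfolding sum_distrib_right by (rule sum.swap)
 also have "\<dots> = (\<Sum>i<n. pd i p gm * dvl bs m s (q i))" unfolding dvl_def sum_distrib_left by (simp only: mult.assoc)
 finally show ?thesis .
qed

lemma DF_comp: assumes p: "DF {} p" "dep n p" and q: "ALL i<n. DF {} (q i) & dep m (q i) & q i s = gm i"
 shows "DF {} (%bt. p (%i. if i < n then q i bt else 0))" "dep m (%bt. p (%i. if i < n then q i bt else 0))"
  "p (%i. if i < n then q i s else 0) = p gm"
proof -
 have "DF {} (%bt. if i < n then q i bt else 0)" for i using q by (cases "i < n") (auto simp: DF_0)
 from DF_subst[OF p(1), where ta = "%i bt. if i < n then q i bt else 0", OF this]
 show "DF {} (%bt. p (%i. if i < n then q i bt else 0))" .
 show "dep m (%bt. p (%i. if i < n then q i bt else 0))" unfolding dep_def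
 proof (intro allI impI)
  fix bt gm :: "nat => 'k" assume e: "ALL i<m. bt i = gm i"
  show "p (%i. if i < n then q i bt else 0) = p (%i. if i < n then q i gm else 0)"
  proof (rule depD[OF p(2)])
   fix i assume i: "i < n"
   have "q i bt = q i gm" by (rule depD[of m]) (use q i e in auto)
   then show "(if i < n then q i bt else 0) = (if i < n then q i gm else 0)" using i by simp
  qed
 qed
 show "p (%i. if i < n then q i s else 0) = p gm" by (rule depD[OF p(2)]) (use q in auto)
qed

text \<open>A T-derivation on a part \<open>E\<close> of the field only, so that it can be extended
  one generator at a time. The domain is controlled by the membership of the arguments; on a set
  closed under \<open>dcl\<close> the values of f stay inside.\<close>

definition tdE :: "'k set => ('k => 'k) => bool" where
 "tdE E d <-> (ALL n f U gm. c1f n f U --> U gm --> (ALL i<n. gm i : E) --> d (f gm) = (\<Sum>i<n. pd i f gm * d (gm i)))"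

text \<open>Compatibility of prescribed values on \<open>X\<close> with all algebraic relations over generic tuples:
  exactly what is needed to extend them to a derivation on \<open>dcl X\<close>.\<close>

definition consist :: "'k set => ('k => 'k) => bool" where
 "consist X bs <-> (ALL m s q. ind {} m s --> s ` {..<m} <= X --> DF {} q --> dep m q --> q s : X --> bs (q s) = dvl bs m s q)"

lemma tdE_dvl: assumes "tdE E d" "ind {} m s" "s ` {..<m} <= E" "DF {} q" "dep m q" shows "d (q s) = dvl d m s q"
proof -
 obtain U where U: "c1f m q U" "U s" using generic_c1[OF assms(2,4,5)] by blast
 have "ALL i<m. s i : E" using assms(3) by auto
 then show ?thesis using assms(1) U unfolding tdE_def dvl_def by blast
qed

lemma generic_gradat: "ind {} n t ==> DF {} f ==> dep n f ==> gradat n f (%i. pd i f t) t"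
 using generic_c1 unfolding c1f_def by blast

text \<open>Both tuples are written as functions of one independent tuple s from \<open>X\<close>.
  Consistency identifies the prescribed values on their entries with forced values over s, the chain
  rule moves both sides to s, and there \<open>dvl_germ\<close> applies.\<close>

lemma dvl_unique:
 assumes X: "consist X bs" and t: "ind {} m t" "t ` {..<m} <= X" "DF {} p" "dep m p"
  and t': "ind {} m' t'" "t' ` {..<m'} <= X" "DF {} p'" "dep m' p'" and e: "p t = p' t'"
 shows "dvl bs m t p = dvl bs m' t' p'"
proof -
 let ?gm = "%i. if i < m then t i else t' (i - m)"
 have "?gm i : dcl X" if "i < m + m'" for i using that t(2) t'(2) subset_dcl by fastforce
 then obtain l s q where s: "ind {} l s" "s ` {..<l} <= X" "ALL i<m + m'. DF {} (q i) & dep l (q i) & q i s = ?gm i"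
  by (rule joint_rep)
 have q: "ALL i<m. DF {} (q i) & dep l (q i) & q i s = t i" using s(3) by simp
 have q': "ALL i<m'. DF {} (q (m + i)) & dep l (q (m + i)) & q (m + i) s = t' i"
 proof (intro allI impI)
  fix i assume "i < m'"
  then show "DF {} (q (m + i)) & dep l (q (m + i)) & q (m + i) s = t' i" using s(3)[rule_format, of "m + i"] by simp
 qed
 have v: "dvl bs l s (q i) = bs (t i)" if i: "i < m" for i
 proof -
  have e: "q i s = t i" "DF {} (q i)" "dep l (q i)" using q i by auto
  then have "q i s : X" using t(2) i by auto
  then have "bs (q i s) = dvl bs l s (q i)" using X s(1,2) e(2,3) unfolding consist_def by blast
  then show ?thesis unfolding e(1) by (rule sym)
 qed
 have v': "dvl bs l s (q (m + i)) = bs (t' i)" if i: "i < m'" for i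
 proof -
  have e: "q (m + i) s = t' i" "DF {} (q (m + i))" "dep l (q (m + i))" using q' i by auto
  then have "q (m + i) s : X" using t'(2) i by auto
  then have "bs (q (m + i) s) = dvl bs l s (q (m + i))" using X s(1,2) e(2,3) unfolding consist_def by blast
  then show ?thesis unfolding e(1) by (rule sym)
 qed
 have "dvl bs m t p = (\<Sum>i<m. pd i p t * dvl bs l s (q i))" unfolding dvl_def[of bs m] by (rule sum.cong) (use v in auto)
 also have "\<dots> = dvl bs l s (%bt. p (%i. if i < m then q i bt else 0))"
  by (rule dvl_comp[OF s(1) q generic_gradat[OF t(1,3,4)] t(4), symmetric])
 also have "\<dots> = dvl bs l s (%bt. p' (%i. if i < m' then q (m + i) bt else 0))"
 proof (rule dvl_germ(2)[OF s(1)])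
  show "DF {} (%bt. p (%i. if i < m then q i bt else 0))" "dep l (%bt. p (%i. if i < m then q i bt else 0))"
   by (rule DF_comp(1,2)[OF t(3,4) q])+
  show "DF {} (%bt. p' (%i. if i < m' then q (m + i) bt else 0))" "dep l (%bt. p' (%i. if i < m' then q (m + i) bt else 0))"
   by (rule DF_comp(1,2)[OF t'(3,4) q'])+
  show "p (%i. if i < m then q i s else 0) = p' (%i. if i < m' then q (m + i) s else 0)"
   unfolding DF_comp(3)[OF t(3,4) q] DF_comp(3)[OF t'(3,4) q'] by (rule e)
 qed
 also have "\<dots> = (\<Sum>i<m'. pd i p' t' * dvl bs l s (q (m + i)))"
  by (rule dvl_comp[OF s(1) q' generic_gradat[OF t'(1,3,4)] t'(4)])
 also have "\<dots> = dvl bs m' t' p'" unfolding dvl_def[of bs m'] by (rule sum.cong) (use v' in auto)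
 finally show ?thesis .
qed

text \<open>Every element of \<open>dcl X\<close> gets the value forced by some representation;
  \<open>dvl_unique\<close> makes this well defined, and \<open>joint_rep\<close> with the chain
  rule gives the derivation law for arguments in \<open>dcl X\<close>.\<close>

theorem consist_extend: assumes X: "consist X bs" shows "EX d. tdE (dcl X) d & (ALL x:X. d x = bs x)"
proof -
 define rep where "rep z v <-> (EX m t p. ind {} m t & t ` {..<m} <= X & DF {} p & dep m p & p t = z & v = dvl bs m t p)" for z v
 define d where "d z = (SOME v. rep z v)" for z
 have d: "d (p t) = dvl bs m t p" if t: "ind {} m t" "t ` {..<m} <= X" "DF {} p" "dep m p" for m t p
 proof -
  have "rep (p t) (dvl bs m t p)" unfolding rep_def using t by blast
  then have "rep (p t) (d (p t))" unfolding d_def by (rule someI)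
  then obtain m' t' p' where t': "ind {} m' t'" "t' ` {..<m'} <= X" "DF {} p'" "dep m' p'" "p' t' = p t" "d (p t) = dvl bs m' t' p'"
   unfolding rep_def by blast
  show ?thesis unfolding t'(6) by (rule dvl_unique[OF X t'(1-4) t t'(5)])
 qed
 have "tdE (dcl X) d" unfolding tdE_def
 proof (intro allI impI)
  fix n f U gm assume f: "c1f n f U" "U gm" "ALL i<n. gm i : dcl X"
  then obtain m s q where s: "ind {} m s" "s ` {..<m} <= X" and q: "ALL i<n. DF {} (q i) & dep m (q i) & q i s = gm i"
   using joint_rep[of n gm X] by blast
  have fD: "DF {} f" "dep n f" "gradat n f (%i. pd i f gm) gm" using f(1,2) unfolding c1f_def by blast+
  have "d (gm i) = dvl bs m s (q i)" if i: "i < n" for i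
  proof -
   have e: "q i s = gm i" "DF {} (q i)" "dep m (q i)" using q i by auto
   show ?thesis using d[OF s e(2,3)] unfolding e(1) .
  qed
  moreover have "d (f gm) = dvl bs m s (%bt. f (%i. if i < n then q i bt else 0))"
   using d[OF s DF_comp(1,2)[OF fD(1,2) q]] unfolding DF_comp(3)[OF fD(1,2) q] .
  ultimately show "d (f gm) = (\<Sum>i<n. pd i f gm * d (gm i))" using dvl_comp[OF s(1) q fD(3,2), of bs] by simp
 qed
 moreover have "d x = bs x" if x: "x : X" for x
 proof -
  have "x : dcl X" using x subset_dcl by blast
  then obtain m s q where s: "ind {} m s" "s ` {..<m} <= X" and q: "DF {} q" "dep m q" "q s = x" by (rule single_rep)
  have "bs (q s) = dvl bs m s q" using X s q x unfolding consist_def by blast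
  then show ?thesis using d[OF s q(1,2)] q(3) by simp
 qed
 ultimately show ?thesis by blast
qed

text \<open>The derivative of \<open>a\<close> is free because \<open>a\<close> is independent over
  \<open>E\<close>. When \<open>a\<close> occurs in the tuple, either \<open>q s = a\<close>, and q
  may be replaced by a projection, or \<open>q s\<close> lies in \<open>E\<close>; then it is
  definable from the other entries, so the partial derivative in the place of \<open>a\<close>
  vanishes.\<close>

lemma consist_insert:
 assumes E: "dcl E <= E" "tdE E d" and a: "a ~: E" shows "consist (insert a E) (d(a := b))"
 unfolding consist_def
proof (intro allI impI)
 let ?bs = "d(a := b)"
 fix m s q assume s: "ind {} m s" "s ` {..<m} <= insert a E" and q: "DF {} q" "dep m q" "q s : insert a E"
 have dE: "dvl ?bs m s r = dvl d m s r" if "s ` {..<m} <= E" for r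
  unfolding dvl_def by (rule sum.cong) (use that a in auto)
 show "?bs (q s) = dvl ?bs m s q"
 proof (cases "s ` {..<m} <= E")
  case True
  have "q s : dcl (s ` {..<m})"
  proof -
   define t where "t i = (if i < m then s i else 0)" for i
   have "q s = q t" by (rule depD[OF q(2)]) (simp add: t_def)
   moreover have "t i : dcl (s ` {..<m})" for i using subset_dcl[of "s ` {..<m}"] DF_0 by (auto simp: t_def dcl_def)
   then have "q t : dcl (s ` {..<m})" by (rule dcl_app[OF DF_mono[OF q(1) empty_subsetI]])
   ultimately show ?thesis by simp
  qed
  then have "q s : E" using dcl_mono[OF True] E(1) by blast
  then have "q s ~= a" using a by blast
  then show ?thesis using tdE_dvl[OF E(2) s(1) True q(1,2)] dE[OF True] by simp
 next
  case False
  then obtain k where k: "k < m" "s k = a" using s(2) by auto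
  let ?I = "{..<m} - {k}"
  have nk: "s i ~= a" if "i < m" "i ~= k" for i
  proof
   assume "s i = a"
   then have "s k : s ` ?I" using that k by auto
   then show False using ind_any[OF s(1) k(1)] subset_dcl[of "{} Un s ` ?I"] by auto
  qed
  then have sE: "s ` ?I <= E" using s(2) by auto
  show ?thesis
  proof (cases "q s = a")
   case True
   have "dvl ?bs m s q = dvl ?bs m s (%bt. bt k)"
    by (rule dvl_germ(2)[OF s(1) q(1,2)]) (use True k in \<open>auto simp: DF_var dep_def\<close>)
   also have "\<dots> = (\<Sum>j<m. if j = k then b else 0)" unfolding dvl_def
    by (rule sum.cong) (use k in \<open>auto simp: pd_proj[OF k(1)]\<close>)
   also have "\<dots> = b" using k by simp
   finally show ?thesis using True by simp
  next
   case False
   then have e: "q s : E" using q(3) by blast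
   have "q s : dcl (s ` ?I)"
   proof (rule ccontr)
    assume n: "q s ~: dcl (s ` ?I)"
    define t where "t i = (if i < m then s i else 0)" for i
    have "q s = q t" by (rule depD[OF q(2)]) (simp add: t_def)
    moreover have "t i : dcl (insert a (s ` ?I))" for i using subset_dcl[of "insert a (s ` ?I)"] DF_0 k by (auto simp: t_def dcl_def)
    then have "q t : dcl (insert a (s ` ?I))" by (rule dcl_app[OF DF_mono[OF q(1) empty_subsetI]])
    ultimately have "q s : dcl (insert a (s ` ?I))" by simp
    from exchange[OF this n] have "a : dcl (insert (q s) (s ` ?I))" .
    moreover have "insert (q s) (s ` ?I) <= E" using e sE by blast
    ultimately show False using dcl_mono E(1) a by blast
   qed
   then obtain r where r: "DF {} r" "!!bt gm. (!!i. i : ?I ==> bt i = gm i) ==> r bt = r gm" "r s = q s"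
    by (rule dcl_fun) blast
   have rm: "dep m r" unfolding dep_def by (intro allI impI, rule r(2)) simp
   have pk: "pd k r s = 0" by (rule pd_indep) (rule r(2), auto)
   have "?bs (q s) = d (r s)" using r(3) False by simp
   also have "\<dots> = dvl ?bs m s r"
   proof -
        txt \<open>Reorder the tuple so that \<open>a\<close> is dropped: move the last entry into its place.\<close>
        obtain m' where m': "m = Suc m'" using k(1) by (cases m) auto
    define w where "w i = (if i = k then m' else i)" for i
    define u where "u i = s (w i)" for i
    define w' where "w' i = (if i = m' then k else i)" for i
    define r' where "r' bt = r (%i. bt (w' i))" for bt
    have wi: "w ` {..<m'} = ?I" using k(1) m' by (auto simp: w_def image_iff less_Suc_eq)
    have inj: "inj_on w {..<m'}" using k(1) m' by (auto simp: inj_on_def w_def split: if_splits)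
    have "ind {} m' u" unfolding ind_def
    proof (intro allI impI notI)
     fix i assume i: "i < m'" "u i : dcl ({} Un u ` {..<i})"
     have wi': "w i < m" using i(1) m' by (auto simp: w_def)
     have "u ` {..<i} <= s ` ({..<m} - {w i})"
     proof
      fix x assume "x : u ` {..<i}"
      then obtain j where j: "j < i" "x = s (w j)" by (auto simp: u_def)
      have "w j ~= w i" using inj_onD[OF inj, of j i] j(1) i(1) by auto
      moreover have "w j < m" using j(1) i(1) m' by (auto simp: w_def)
      ultimately show "x : s ` ({..<m} - {w i})" using j(2) by blast
     qed
     then have "s (w i) : dcl ({} Un s ` ({..<m} - {w i}))" using i(2) dcl_mono[of "{} Un u ` {..<i}" "{} Un s ` ({..<m} - {w i})"] by (auto simp: u_def)
     then show False using ind_any[OF s(1) wi'] by blast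
    qed
    moreover have ui: "u ` {..<m'} <= E" unfolding u_def image_image[symmetric, of s w] wi by (rule sE)
    moreover have r'D: "DF {} r'" unfolding r'_def by (rule DF_ren[OF r(1)])
    moreover have "dep m' r'" unfolding dep_def r'_def
    proof (intro allI impI)
     fix bt gm :: "nat => 'k" assume *: "ALL i<m'. bt i = gm i"
     show "r (%i. bt (w' i)) = r (%i. gm (w' i))"
      by (rule r(2)) (use * k(1) m' in \<open>auto simp: w'_def less_Suc_eq\<close>)
    qed
    ultimately have 1: "d (r' u) = dvl d m' u r'" by (intro tdE_dvl[OF E(2)])
    have 2: "r' u = r s" unfolding r'_def
     by (rule r(2)) (use k(1) m' in \<open>auto simp: w'_def u_def w_def less_Suc_eq\<close>)
    have 3: "pd j r' u = pd (w j) r s" if j: "j < m'" for j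
    proof -
     have "r' (u(j := x)) = r (s(w j := x))" for x unfolding r'_def
      by (rule r(2)) (use k(1) m' j in \<open>auto simp: w'_def u_def w_def less_Suc_eq\<close>)
     then show ?thesis unfolding pd_def by (simp only:) (simp only: u_def)
    qed
    have "dvl d m' u r' = (\<Sum>j<m'. pd (w j) r s * d (s (w j)))" unfolding dvl_def u_def[symmetric]
     by (rule sum.cong) (use 3 in auto)
    also have "\<dots> = (\<Sum>j\<in>?I. pd j r s * d (s j))" using sum.reindex[OF inj, of "%j. pd j r s * d (s j)"] by (simp add: wi o_def)
    also have "\<dots> = (\<Sum>j\<in>?I. pd j r s * ?bs (s j))" by (rule sum.cong) (use nk in auto)
    also have "\<dots> = dvl ?bs m s r" unfolding dvl_def using sum.remove[of "{..<m}" k "%j. pd j r s * ?bs (s j)"] k(1) by (simp only: pk finite_lessThan lessThan_iff simp_thms mult_zero_left add_0)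
    finally show ?thesis using 1 2 by simp
   qed
   also have "\<dots> = dvl ?bs m s q" by (rule dvl_germ(2)[OF s(1) r(1) rm q(1,2) r(3)])
   finally show ?thesis .
  qed
 qed
qed

text \<open>The value at z is forced by the values at the entries of a tuple from \<open>X\<close>,
  and the forced value is linear in these.\<close>

lemma tdE_linear_relation:
 assumes "tdE (dcl X) d0" "tdE (dcl X) d1" "tdE (dcl X) d2" "!!x. x : X ==> d2 x = d0 x + b * d1 x" "z : dcl X"
 shows "d2 z = d0 z + b * d1 z"
proof -
 obtain m s q where s: "ind {} m s" "s ` {..<m} <= X" and q: "DF {} q" "dep m q" "q s = z"
  by (rule single_rep[OF assms(5)])
 have s': "s ` {..<m} <= dcl X" using s(2) subset_dcl by blast
 have "dvl d2 m s q = (\<Sum>k<m. pd k q s * (d0 (s k) + b * d1 (s k)))" unfolding dvl_def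
  by (rule sum.cong) (use assms(4) s(2) in auto)
 also have "\<dots> = dvl d0 m s q + b * dvl d1 m s q" unfolding dvl_def by (simp add: algebra_simps sum.distrib sum_distrib_left)
 finally show ?thesis
  using tdE_dvl[OF assms(1) s(1) s' q(1,2)] tdE_dvl[OF assms(2) s(1) s' q(1,2)] tdE_dvl[OF assms(3) s(1) s' q(1,2)] q(3) by simp
qed

end

section \<open>Choosing new derivatives in a spherically complete field\<close>

context omf
begin

lemma val_dcl: assumes "DF A q" "dep m q" "s ` {..<m} <= dcl A" shows "q s : dcl A"
proof -
 define t where "t i = (if i < m then s i else 0)" for i
 have "q s = q t" by (rule depD[OF assms(2)]) (simp add: t_def)
 moreover have "t i : dcl A" for i using assms(3) DF_0 by (auto simp: t_def dcl_def)
 then have "q t : dcl A" by (rule dcl_app[OF assms(1)])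
 ultimately show ?thesis by simp
qed

lemma definable_point: assumes "D E (%bt. S (bt 0))" "S y" shows "EX e:dcl E. S e"
proof -
 obtain s where s: "DF E s" "!!bt y. S y ==> S (s bt)" by (rule choice1[of E "%y bt. S y", OF assms(1)]) blast
 have "s (%_. 0) : dcl E" by (rule dcl_app[OF s(1)]) (simp add: dcl_def DF_0)
 then show ?thesis using s(2)[OF assms(2)] by blast
qed

lemma dcl_0: "0 : dcl A" by (simp add: dcl_def DF_0)

end

text \<open>\<open>K0\<close> is closed under definability and supplies a leading term for every
  nonzero element: the ambient field is immediate over it.\<close>

locale imm = tcv L N Ov for L :: "('f,'r) lang" and N :: "('k::linordered_field,'f,'r) struc" and Ov :: "'k set" +
 fixes K0 :: "'k set"
 assumes K0: "dcl K0 <= K0" and imm: "!!y. y ~= 0 ==> EX g:K0. sm (y - g) g"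
begin

lemma two_Ov: "2 : Ov" using Ov_add[OF Ov_1 Ov_1] by simp

lemma dm_2: "\<bar>x\<bar> <= 2 * \<bar>y\<bar> ==> dm x y" unfolding dm_def by (intro bexI[OF _ two_Ov]) (simp add: abs_mult)

lemma sm_half: assumes "sm (y - g) g" shows "\<bar>g\<bar> < 2 * \<bar>y\<bar>" "\<bar>y\<bar> < 2 * \<bar>g\<bar>"
proof -
 have "\<bar>2 * (y - g)\<bar> < \<bar>g\<bar>" using assms two_Ov unfolding sm_def by blast
 then show "\<bar>g\<bar> < 2 * \<bar>y\<bar>" "\<bar>y\<bar> < 2 * \<bar>g\<bar>" by (auto simp: abs_if algebra_simps split: if_splits)
qed

lemma imm_bound: "EX g:K0. \<bar>y\<bar> <= 2 * \<bar>g\<bar> & dm g y"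
proof (cases "y = 0")
 case True
 have "0 : K0" using dcl_0 K0 by blast
 then show ?thesis using True by (intro bexI[of _ 0]) auto
next
 case False
 then obtain g where g: "g : K0" "sm (y - g) g" using imm by blast
 show ?thesis using g(1) sm_half[OF g(2)] by (intro bexI[of _ g]) (auto intro: dm_2)
qed

text \<open>Induction on the number of summands: divide by the last coefficient, which is asymptotic to a constant,
  and subtract the value at one point.\<close>

lemma linear_form_small:
 fixes n :: nat
 assumes E: "dcl E <= E" "K0 <= E"
 shows "D E (%bt. S (bt 0)) ==> S y ==> (!!i. i < n ==> DF E (%bt. h i (bt 0))) ==>
  (!!e. e : E ==> S e ==> sm (\<Sum>i<n. h i e * c i) w) ==> sm (\<Sum>i<n. h i y * c i) w"
proof (induction n arbitrary: S h w)
 case 0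
 obtain e where "e : dcl E" "S e" using definable_point[OF 0(1,2)] by blast
 then show ?case using 0(4)[of e] E(1) by auto
next
 case (Suc n)
 have h: "DF E (%bt. h i (f bt))" if "i < Suc n" "DF E f" for i f by (rule DF_app1[where F = "h i", OF Suc.prems(3)[OF that(1)] that(2)])
 have hn: "DF E (%bt. h n (f bt))" if "DF E f" for f by (rule h) (use that in auto)
 show ?case
 proof (cases "h n y = 0")
  case True
  have "sm (\<Sum>i<n. h i y * c i) w"
  proof (rule Suc.IH[where S = "%x. S x & h n x = 0"])
   show "D E (%bt. S (bt 0) & h n (bt 0) = 0)" by (intro D_base DF_base Suc.prems(1) hn)
   show "S y & h n y = 0" using Suc.prems(2) True by blast
   show "DF E (%bt. h i (bt 0))" if "i < n" for i using Suc.prems(3) that by simp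
   show "sm (\<Sum>i<n. h i e * c i) w" if "e : E" "S e & h n e = 0" for e using Suc.prems(4)[of e] that by simp
  qed
  then show ?thesis using True by simp
 next
  case False
  then obtain g where g: "g : K0" "sm (h n y - g) g" using imm by blast
  have g0: "g ~= 0" using g(2) sm_0' by blast
  have gE: "DF E (%bt. g)" by (rule DF_const) (use g E in blast)
  \<comment> \<open>The valuation ring is only convex and need not be definable in the o-minimal
    structure, so being asymptotic to \<open>g\<close> is weakened to inequalities up to the factor
    2. These are definable over \<open>E\<close> and still determine the size of
    \<open>h n x\<close> in the valuation.\<close>
  define S1 where "S1 x <-> S x & \<bar>g\<bar> < 2 * \<bar>h n x\<bar> & \<bar>h n x\<bar> < 2 * \<bar>g\<bar>" for x
  have S1D: "D E (%bt. S1 (bt 0))" unfolding S1_def by (intro D_base DF_base Suc.prems(1) hn gE)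
  have S1y: "S1 y" unfolding S1_def using Suc.prems(2) sm_half[OF g(2)] by blast
  have S1dm: "dm g (h n x)" "dm (h n x) g" "h n x ~= 0" if "S1 x" for x
   using that g0 by (auto simp: S1_def intro: dm_2)
  obtain e0 where e0: "e0 : E" "S1 e0" using definable_point[where S = S1, OF S1D S1y] E(1) by blast
  define k where "k i x = h i x / h n x" for i x
  define X where "X x = (\<Sum>i<n. k i x * c i) + c n" for x
  have hX: "(\<Sum>i<Suc n. h i x * c i) = h n x * X x" if "h n x ~= 0" for x
   using that by (simp add: X_def k_def distrib_left sum_distrib_left)
  have X: "sm (X e) (w / g)" if e: "e : E" "S1 e" for e
  proof -
   have "sm (h n e * X e) w" using Suc.prems(4)[of e] e hX[OF S1dm(3)[OF e(2)]] by (simp add: S1_def)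
   moreover have "dm (g * X e) (h n e * X e)" by (rule dm_mult2[OF S1dm(1)[OF e(2)] dm_refl])
   ultimately have "sm (g * X e) (g * (w / g))" using dm_sm g0 by fastforce
   then show ?thesis using sm_mult[OF g0] by blast
  qed
  have "sm (\<Sum>i<n. (k i y - k i e0) * c i) (w / g)"
  proof (rule Suc.IH[where S = S1 and h = "%i x. k i x - k i e0", OF S1D S1y])
   show "DF E (%bt. k i (bt 0) - k i e0)" if "i < n" for i
   proof -
    have kE: "DF E (%bt. k i (bt 0))" unfolding k_def by (intro DF_base h hn) (use that in auto)
    have "k i e0 : dcl E" using dcl_app[OF kE, of "%_. e0"] e0 subset_dcl by blast
    then have "DF E (%bt. k i e0)" by (rule DF_dcl)
    then show ?thesis using kE by (intro DF_base)
   qed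
   fix e assume e: "e : E" "S1 e"
   have "(\<Sum>i<n. (k i e - k i e0) * c i) = X e - X e0" by (simp add: X_def left_diff_distrib sum_subtractf)
   then show "sm (\<Sum>i<n. (k i e - k i e0) * c i) (w / g)" using sm_diff[OF X[OF e] X[OF e0]] by simp
  qed
  moreover have "(\<Sum>i<n. (k i y - k i e0) * c i) = X y - X e0" by (simp add: X_def left_diff_distrib sum_subtractf)
  ultimately have "sm (X y - X e0) (w / g)" by simp
  from sm_add[OF this X[OF e0]] have "sm (X y) (w / g)" by simp
  then have "sm (g * X y) (g * (w / g))" using sm_mult[OF g0] by blast
  moreover have "dm (h n y * X y) (g * X y)" by (rule dm_mult2[OF S1dm(2)[OF S1y] dm_refl])
  ultimately have "sm (h n y * X y) (g * (w / g))" using dm_sm by blast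
  then show ?thesis using hX[OF S1dm(3)[OF S1y]] g0 by simp
 qed
qed

text \<open>Spherical completeness is about closed balls. If some ball of the family has least
  radius, its centre works. Otherwise a point common to the closed balls lies in every open one,
  because each of them has a strictly smaller ball inside.\<close>

lemma open_balls:
 assumes sph: "sph_complete L N Ov" and P: "!!c r. (c, r) : P ==> r ~= 0"
  and meet: "!!c r c' r'. (c, r) : P ==> (c', r') : P ==> dm r' r ==> sm (c' - c) r"
 shows "EX b. ALL c r. (c, r) : P --> sm (b - c) r"
proof (cases "EX c0 r0. (c0, r0) : P & (ALL c r. (c, r) : P --> dm r0 r)")
 case True then show ?thesis using meet by blast
next
 case False
 have "EX y:univ N. ALL (a, g):P. y : cball_v L N Ov a g"
 proof -
  have "P <= univ N \<times> nonzero L N" using P by auto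
  moreover have "ALL (a, g):P. ALL (b, h):P. cball_v L N Ov a g Int cball_v L N Ov b h ~= {}"
  proof (intro ballI, clarify)
   fix a g b h assume ab: "(a, g) : P" "(b, h) : P" and e: "cball_v L N Ov a g Int cball_v L N Ov b h = {}"
   note I = cball_iff[OF P[OF ab(1)]] cball_iff[OF P[OF ab(2)]]
   show False
   proof (cases "dm h g")
    case True
    then have "b : cball_v L N Ov a g Int cball_v L N Ov b h" using meet[OF ab] by (simp add: I sm_imp_dm)
    then show False using e by blast
   next
    case False
    then have "dm g h" using dm_total by blast
    then have "a : cball_v L N Ov a g Int cball_v L N Ov b h" using meet[OF ab(2,1)] by (simp add: I sm_imp_dm)
    then show False using e by blast
   qed
  qed
  ultimately show ?thesis using sph unfolding sph_complete_def by blast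
 qed
 then obtain y where y: "!!c r. (c, r) : P ==> dm (y - c) r" using cball_iff P by fastforce
 have "sm (y - c) r" if c: "(c, r) : P" for c r
 proof -
  obtain c' r' where c': "(c', r') : P" "~ dm r r'" using False c not_dm dm_total by blast
  have "(EX c'' r''. (c'', r'') : P & sm r'' r)" using False c not_dm by blast
  then obtain c'' r'' where c'': "(c'', r'') : P" "sm r'' r" by blast
  have "sm (y - c'') r" using dm_sm[OF y[OF c''(1)] c''(2)] .
  moreover have "sm (c'' - c) r" by (rule meet[OF c c''(1) sm_imp_dm[OF c''(2)]])
  ultimately show ?thesis using sm_add by fastforce
 qed
 then show ?thesis by blast
qed

text \<open>Such a \<open>J\<close> stands for a neighbourhood of 0 bounded by a cut in the
  valuation: the maximal ideal, the valuation ring, an open ball. A pair \<open>(J, ph)\<close>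
  demands that the derivation map \<open>J\<close> into ph times the maximal ideal.\<close>

definition downc :: "('k => bool) => bool" where "downc J <-> (ALL x y. dm x y --> J y --> J x)"

context
 fixes E d a
 assumes E: "dcl E <= E" "K0 <= E" and d: "tdE E d" and a: "a ~: E"
begin

text \<open>Write z as \<open>ph a\<close> with \<open>ph\<close> definable over \<open>E\<close>.
  Then \<open>dt z\<close> is the derivative of \<open>ph\<close> at \<open>a\<close>; if it is 0,
  it is 0 near the generic point \<open>a\<close>, so \<open>ph\<close> is locally constant there.
  Hence \<open>a\<close> is not definable from z over \<open>E\<close>, and exchange forces z into
  \<open>dcl E\<close>.\<close>

lemma zero_derivative_in:
 assumes dt: "tdE (dcl (insert a E)) dt" "!!x. x : E ==> dt x = 0" "dt a = 1" and z: "z : dcl (insert a E)" "dt z = 0"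
 shows "z : E"
proof (rule ccontr)
 assume nz: "z ~: E"
 obtain m s q where s: "ind {} m s" "s ` {..<m} <= insert a E" and q: "DF {} q" "dep m q" "q s = z" by (rule single_rep[OF z(1)])
 have "~ s ` {..<m} <= E"
 proof
  assume "s ` {..<m} <= E"
  then have "q s : dcl E" by (intro val_dcl[OF DF_mono[OF q(1)] q(2)]) (use subset_dcl in auto)
  then show False using nz q(3) E(1) by blast
 qed
 then obtain k where k: "k < m" "s k = a" using s(2) by auto
 let ?I = "{..<m} - {k}"
 have nk: "s i ~= a" if "i < m" "i ~= k" for i
 proof
  assume "s i = a"
  then have "s k : s ` ?I" using that k by auto
  then show False using ind_any[OF s(1) k(1)] subset_dcl[of "{} Un s ` ?I"] by auto
 qed
 then have sE: "s ` ?I <= E" using s(2) by auto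
 have "dt z = dvl dt m s q" using tdE_dvl[OF dt(1) s(1) _ q(1,2)] s(2) subset_dcl q(3) by blast
 also have "\<dots> = (\<Sum>i<m. if i = k then pd k q s else 0)" unfolding dvl_def by (rule sum.cong) (use dt(2,3) sE k in auto)
 finally have pk: "pd k q s = 0" using k(1) z(2) by simp
 define ph where "ph x = q (s(k := x))" for x
 have DFm: "DF ({} Un s ` ?I) f ==> DF E f" for f by (rule DF_mono) (use sE in auto)
 have ph: "DF E (%bt. ph (bt 0))" unfolding ph_def by (rule DFm[OF DF_fibre[OF q(1,2)]]) auto
 have aE: "a ~: dcl E" using a E by blast
 have "D E (%bt. has_d ph (bt 0) 0)" unfolding has_d_def by (intro D_base DF_base DF_app1[where F = ph, OF ph])
 moreover have "has_d ph a 0" using nondcl_diff[OF ph aE] pk derivk_eq k unfolding pd_def ph_def by metis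
 ultimately obtain r where r: "r > 0" "!!x. \<bar>x - a\<bar> < r ==> has_d ph x 0"
  using not_dcl_nbhd[where S = "%x. has_d ph x 0", OF _ aE] by metis
 have const: "ph x = ph a" if x: "\<bar>x - a\<bar> < r" for x
 proof -
  have "\<bar>ph x - ph a - 0 * (x - a)\<bar> <= 0 * \<bar>x - a\<bar>"
  proof (rule mvi_abs[OF DF_UNIV[OF ph], where f' = "%_. 0"])
   fix u assume "min a x <= u" "u <= max a x"
   then have "\<bar>u - a\<bar> < r" using x by (auto simp: min_def max_def abs_if split: if_splits)
   then show "has_d ph u 0" by (rule r(2))
  qed simp
  then show ?thesis by simp
 qed
 have "z : dcl E"
 proof -
  have e: "ph a = z" unfolding ph_def k(2)[symmetric] by (simp add: q(3))
  have "a ~: dcl (insert z E)"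
  proof
   assume "a : dcl (insert z E)"
   then obtain f where f: "DF E (%bt. f (bt 0))" "a = f z" using dcl_insert_fun by metis
   have "D E (%bt. f (ph (bt 0)) = bt 0)" by (intro D_base DF_base DF_app1[where F = f, OF f(1)] ph)
   then obtain r' where r': "r' > 0" "!!x. \<bar>x - a\<bar> < r' ==> (f (ph x) = x) = (f (ph a) = a)"
    using not_dcl_nbhd[where S = "%x. f (ph x) = x", OF _ aE] by metis
   define x where "x = a + min r r' / 2"
   have mr: "0 < min r r' / 2" "min r r' / 2 < min r r'" using r(1) r'(1) half_gt_zero[of "min r r'"] by (simp_all only: half_gt_zero_iff min_less_iff_conj) (simp_all add: field_simps min_def)
   then have xr: "\<bar>x - a\<bar> < r" "\<bar>x - a\<bar> < r'" by (simp_all add: x_def)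
   note x = const[OF xr(1)] r'(2)[OF xr(2)]
   have fa: "f (ph a) = a" unfolding e by (rule f(2)[symmetric])
   have "f (ph a) = x" using x(2) fa unfolding x(1) by blast
   then have "x = a" unfolding fa by (rule sym)
   then show False using mr(1) by (simp add: x_def)
  qed
  then show ?thesis using exchange[OF z(1)] by blast
 qed
 then show False using nz E(1) by blast
qed

text \<open>Write z1 as q of a tuple with z2 in place k and the other entries in \<open>E\<close>.
  Since \<open>d' z2 = 0\<close>, \<open>d' z1\<close> is a linear form in derivatives of elements
  of \<open>E\<close>, with coefficients depending definably on z2. With e from \<open>E\<close> in
  place of z2 this form is a difference of two small derivatives, and
  \<open>linear_form_small\<close> transfers the bound back to z2.\<close>

lemma small_derivative_transfer:
 assumes J1: "downc J1" "!!e. e : E ==> J1 e ==> sm (d e) ph1" "ph1 ~= 0"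
  and J2: "downc J2" "!!e. e : E ==> J2 e ==> sm (d e) ph2"
  and z1: "z1 : dcl (insert a E)" "z1 ~: E" "J1 z1" and z2: "z2 : dcl (insert a E)" "z2 ~: E" "J2 z2"
  and d': "tdE (dcl (insert a E)) d'" "!!x. x : E ==> d' x = d x" "d' z2 = 0"
  and dt: "tdE (dcl (insert a E)) dt" "!!x. x : E ==> dt x = 0" "dt z2 ~= 0"
  and r: "dm (ph2 * dt z1) (ph1 * dt z2)"
 shows "sm (d' z1) ph1"
proof -
 have "z2 ~: dcl E" using z2(2) E(1) by blast
 from exchange[OF z2(1) this] have "a : dcl (insert z2 E)" .
 then have "insert a E <= dcl (insert z2 E)" using subset_dcl[of "insert z2 E"] by blast
 from dcl_mono[OF this] have z1': "z1 : dcl (insert z2 E)" using z1(1) by auto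
 obtain m s q where s: "ind {} m s" "s ` {..<m} <= insert z2 E" and q: "DF {} q" "dep m q" "q s = z1" by (rule single_rep[OF z1'])
 have "~ s ` {..<m} <= E"
 proof
  assume "s ` {..<m} <= E"
  then have "q s : dcl E" by (intro val_dcl[OF DF_mono[OF q(1)] q(2)]) (use subset_dcl in auto)
  then show False using z1(2) q(3) E(1) by blast
 qed
 then obtain k where k: "k < m" "s k = z2" using s(2) by auto
 let ?I = "{..<m} - {k}"
 have nk: "s i ~= z2" if "i < m" "i ~= k" for i
 proof
  assume "s i = z2"
  then have "s k : s ` ?I" using that k by auto
  then show False using ind_any[OF s(1) k(1)] subset_dcl[of "{} Un s ` ?I"] by auto
 qed
 then have sE: "s ` ?I <= E" using s(2) by auto
 have sX: "s ` {..<m} <= dcl (insert a E)" using s(2) z2(1) subset_dcl[of "insert a E"] by blast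
 obtain U where U: "c1f m q U" "U s" using generic_c1[OF s(1) q(1,2)] by blast
 have UD: "D {} U" "dep m U" using U(1) unfolding c1f_def by blast+
 let ?hk = "pd k q s"
 have "dt z1 = dvl dt m s q" using tdE_dvl[OF dt(1) s(1) sX q(1,2)] q(3) by simp
 also have "\<dots> = (\<Sum>i<m. if i = k then ?hk * dt z2 else 0)" unfolding dvl_def by (rule sum.cong) (use dt(2) sE k in auto)
 finally have "dt z1 = ?hk * dt z2" using k(1) by simp
 \<comment> \<open>Since \<open>dt\<close> vanishes on \<open>E\<close>,
   \<open>dt z1 = pd k q s * dt z2\<close>. The comparison of the two radii thus becomes the bound
   \<open>dm (ph2 * pd k q s) ph1\<close>, which makes the correction term for e small.\<close>
 then have "dm (dt z2 * (ph2 * ?hk)) (dt z2 * ph1)" using r by (simp add: mult.commute mult.left_commute)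
 then have hk: "dm (ph2 * ?hk) ph1" using dm_mult_iff[OF dt(3)] by blast
 obtain g1 where g1: "g1 : K0" "\<bar>z1\<bar> <= 2 * \<bar>g1\<bar>" "dm g1 z1" using imm_bound by blast
 obtain g2 where g2: "g2 : K0" "\<bar>z2\<bar> <= 2 * \<bar>g2\<bar>" "dm g2 z2" using imm_bound by blast
 obtain g where g: "g : K0" "\<bar>?hk\<bar> <= 2 * \<bar>g\<bar>" "dm g ?hk" using imm_bound by blast
 have gE: "DF E (%bt. g)" "DF E (%bt. g1)" "DF E (%bt. g2)" using g(1) g1(1) g2(1) E(2) by (auto intro: DF_const)
 have sub: "{} Un s ` ?I <= E" using sE by auto
 have qE: "DF E (%bt. q (s(k := bt 0)))" by (rule DF_mono[OF DF_fibre[OF q(1,2)] sub]) auto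
 have pE: "DF E (%bt. pd i q (s(k := bt 0)))" if "i < m" for i
  by (rule DF_mono[OF DF_fibre[OF DF_pd[OF q(1)] pd_dep[OF q(2) that]] sub]) auto
 have UE: "D E (%bt. U (s(k := bt 0)))" by (rule D_mono[OF D_fibre[OF UD] sub]) auto
 \<comment> \<open>A definable stand-in for closeness to z2. The bounds up to the factor 2, with
   \<open>g2\<close>, \<open>g1\<close>, \<open>g\<close> from \<open>K0\<close>, keep e and q
   dominated by z2 and z1, hence inside \<open>J2\<close> and \<open>J1\<close>, and the partial
   derivative dominated by its value at z2.\<close>
 define S where "S x <-> U (s(k := x)) & \<bar>x\<bar> <= 2 * \<bar>g2\<bar> & \<bar>q (s(k := x))\<bar> <= 2 * \<bar>g1\<bar> & \<bar>pd k q (s(k := x))\<bar> <= 2 * \<bar>g\<bar>" for x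
 have SD: "D E (%bt. S (bt 0))" unfolding S_def by (intro D_base DF_base UE gE qE pE k(1))
 have sk: "s(k := z2) = s" using k(2) by auto
 have Sz: "S z2" unfolding S_def sk using U(2) g1(2) g2(2) g(2) q(3) by simp
 define h where "h i x = (if i = k then 0 else pd i q (s(k := x)))" for i x
 have hE: "DF E (%bt. h i (bt 0))" if "i < m" for i using pE[OF that] DF_0 by (cases "i = k") (simp_all add: h_def)
 have sumk: "(\<Sum>i<m. h i x * d (s i)) = (\<Sum>i<m. pd i q (s(k := x)) * et i) - pd k q (s(k := x)) * et k"
  if "!!i. i < m ==> i ~= k ==> et i = d (s i)" for x et
 proof -
  have "(\<Sum>i<m. h i x * d (s i)) = (\<Sum>i\<in>?I. h i x * d (s i))"
   using k(1) by (intro sum.mono_neutral_right) (auto simp: h_def)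
  also have "\<dots> = (\<Sum>i\<in>?I. pd i q (s(k := x)) * et i)" by (rule sum.cong) (use that in \<open>auto simp: h_def\<close>)
  finally show ?thesis using sum.remove[of "{..<m}" k "%i. pd i q (s(k := x)) * et i"] k(1) by simp
 qed
 have "sm (\<Sum>i<m. h i z2 * d (s i)) ph1"
 proof (rule linear_form_small[where S = S, OF E SD Sz hE])
  fix e assume e: "e : E" "S e"
  let ?gm = "s(k := e)"
  have gmE: "ALL i<m. ?gm i : E" using sE e(1) by auto
  have "?gm ` {..<m} <= E" using gmE by blast
  then have "?gm ` {..<m} <= dcl E" using subset_dcl[of E] by (rule order_trans)
  then have "q ?gm : dcl E" by (rule val_dcl[OF DF_mono[OF q(1) empty_subsetI] q(2)])
  then have qE': "q ?gm : E" using E(1) by blast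
  have "dm (q ?gm) z1" using e(2) g1(3) dm_2 dm_trans unfolding S_def by blast
  then have 1: "sm (d (q ?gm)) ph1" using J1(1,2) z1(3) qE' unfolding downc_def by blast
  have "dm e z2" using e(2) g2(3) dm_2 dm_trans unfolding S_def by blast
  then have 2: "sm (d e) ph2" using J2(1,2) z2(3) e(1) unfolding downc_def by blast
  have "dm (pd k q ?gm) ?hk" using e(2) g(3) dm_2 dm_trans unfolding S_def by blast
  then have "dm (pd k q ?gm * d e) (?hk * d e)" by (rule dm_mult2) simp
  moreover have "sm (?hk * d e) ph1"
  proof (cases "?hk = 0")
   case True then show ?thesis using J1(3) by simp
  next
   case False
   then have "sm (?hk * d e) (?hk * ph2)" using sm_mult 2 by blast
   then show ?thesis using sm_dm hk by (simp add: mult.commute)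
  qed
  ultimately have 3: "sm (pd k q ?gm * d e) ph1" by (rule dm_sm)
  have "U ?gm" using e(2) by (simp add: S_def)
  then have "d (q ?gm) = (\<Sum>i<m. pd i q ?gm * d (?gm i))" using d U(1) gmE unfolding tdE_def by blast
  then have "(\<Sum>i<m. h i e * d (s i)) = d (q ?gm) - pd k q ?gm * d e" using sumk[of "%i. d (?gm i)" e] by simp
  then show "sm (\<Sum>i<m. h i e * d (s i)) ph1" using sm_diff[OF 1 3] by simp
 qed
 moreover have "d' z1 = dvl d' m s q" using tdE_dvl[OF d'(1) s(1) sX q(1,2)] q(3) by simp
 then have "(\<Sum>i<m. h i z2 * d (s i)) = d' z1" using sumk[of "%i. d' (s i)" z2] d'(2,3) sE k unfolding sk dvl_def by auto
 ultimately show ?thesis by simp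
qed

theorem derivation_step:
 assumes sph: "sph_complete L N Ov"
  and J: "!!J ph. (J, ph) : \<J> ==> downc J & ph ~= 0 & (ALL e:E. J e --> sm (d e) ph)"
 shows "EX d'. tdE (dcl (insert a E)) d' & (ALL x:E. d' x = d x) & (ALL J ph. (J, ph) : \<J> --> (ALL z:dcl (insert a E). J z --> sm (d' z) ph))"
proof -
 let ?X = "insert a E"
 have ext: "EX d'. tdE (dcl ?X) d' & (ALL x:E. d' x = d x) & d' a = b" for b
 proof -
  obtain d' where "tdE (dcl ?X) d'" "!!x. x : ?X ==> d' x = (d(a := b)) x" using consist_extend[OF consist_insert[OF E(1) d a]] by blast
  then show ?thesis using a by (intro exI[of _ d']) (auto split: if_splits)
 qed
 have "tdE E (%_. 0)" unfolding tdE_def by simp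
 from consist_extend[OF consist_insert[OF E(1) this a], of 1] obtain dt where "tdE (dcl ?X) dt" "!!x. x : ?X ==> dt x = ((%_. 0)(a := 1)) x" by blast
 then have dt: "tdE (dcl ?X) dt" "!!x. x : E ==> dt x = 0" "dt a = 1" using a by auto
 obtain d0 where d0: "tdE (dcl ?X) d0" "!!x. x : E ==> d0 x = d x" "d0 a = 0" using ext[of 0] by blast
 have lin: "d' z = d0 z + b * dt z" if "tdE (dcl ?X) d'" "ALL x:E. d' x = d x" "d' a = b" "z : dcl ?X" for d' b z
  by (rule tdE_linear_relation[OF d0(1) dt(1) that(1) _ that(4)]) (use that d0 dt in auto)
 have dt0: "dt z ~= 0" if "z : dcl ?X" "z ~: E" for z using zero_derivative_in[OF dt] that by blast
 \<comment> \<open>As d' z = d0 z + b * dt z, the derivative of z is below \<open>ph\<close> exactly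
   if b lies in the open ball with centre - d0 z / dt z and radius ph / dt z. For z outside
   \<open>E\<close> the divisor is nonzero by \<open>zero_derivative_in\<close>.\<close>
 define P where "P = {(- d0 z / dt z, ph / dt z) | z J ph. z : dcl ?X & z ~: E & (J, ph) : \<J> & J z}"
 have "EX b. ALL c r. (c, r) : P --> sm (b - c) r"
 proof (rule open_balls[OF sph])
  show "r ~= 0" if "(c, r) : P" for c r using that J dt0 unfolding P_def by force
  fix c1 r1 c2 r2 assume "(c1, r1) : P" "(c2, r2) : P" and r: "dm r2 r1"
  then obtain z1 J1 ph1 z2 J2 ph2 where
   1: "c1 = - d0 z1 / dt z1" "r1 = ph1 / dt z1" "z1 : dcl ?X" "z1 ~: E" "(J1, ph1) : \<J>" "J1 z1" and
   2: "c2 = - d0 z2 / dt z2" "r2 = ph2 / dt z2" "z2 : dcl ?X" "z2 ~: E" "(J2, ph2) : \<J>" "J2 z2"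
   unfolding P_def by blast
  note n1 = dt0[OF 1(3,4)] and n2 = dt0[OF 2(3,4)]
  \<comment> \<open>With b at the centre \<open>c2\<close> of the smaller ball the derivative of z2
    vanishes, and smallness of the derivative of z1 says exactly that \<open>c2\<close> lies in the
    other ball.\<close>
  obtain d' where d': "tdE (dcl ?X) d'" "ALL x:E. d' x = d x" "d' a = c2" using ext by blast
  have "dm ((dt z1 * dt z2) * r2) ((dt z1 * dt z2) * r1)" by (rule dm_mult[OF r])
  then have r': "dm (ph2 * dt z1) (ph1 * dt z2)" using n1 n2 by (simp add: 1(2) 2(2) mult.commute)
  have z20: "d' z2 = 0" using lin[OF d' 2(3)] n2 by (simp add: 2(1))
  have "d' z1 = dt z1 * (c2 - c1)" using lin[OF d' 1(3)] n1 by (simp add: 1(1) algebra_simps)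
  moreover have "sm (d' z1) ph1"
  proof -
   have A1: "downc J1" "!!e. e : E ==> J1 e ==> sm (d e) ph1" "ph1 ~= 0" using J[OF 1(5)] by blast+
   have A2: "downc J2" "!!e. e : E ==> J2 e ==> sm (d e) ph2" using J[OF 2(5)] by blast+
   have A3: "!!x. x : E ==> d' x = d x" using d'(2) by blast
   show ?thesis by (rule small_derivative_transfer[OF A1 A2 1(3,4,6) 2(3,4,6) d'(1) A3 z20 dt(1,2) n2 r'])
  qed
  ultimately have "sm (dt z1 * (c2 - c1)) (dt z1 * r1)" using n1 by (simp add: 1(2))
  then show "sm (c2 - c1) r1" using sm_mult[OF n1] by blast
 qed
 then obtain b where b: "!!c r. (c, r) : P ==> sm (b - c) r" by blast
 obtain d' where d': "tdE (dcl ?X) d'" "ALL x:E. d' x = d x" "d' a = b" using ext by blast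
 have "sm (d' z) ph" if "(J, ph) : \<J>" "z : dcl ?X" "J z" for J ph z
 proof (cases "z : E")
  case True then show ?thesis using J[OF that(1)] d'(2) that(3) by simp
 next
  case False
  note n = dt0[OF that(2) False]
  have "sm (b - (- d0 z / dt z)) (ph / dt z)" by (rule b) (use that False in \<open>auto simp: P_def\<close>)
  then have "sm (dt z * (b - (- d0 z / dt z))) (dt z * (ph / dt z))" using sm_mult[OF n] by blast
  moreover have "dt z * (b - (- d0 z / dt z)) = d' z" using lin[OF d' that(2)] n by (simp add: algebra_simps)
  ultimately show ?thesis using n by simp
 qed
 then show ?thesis using d' by blast
qed

end

definition good :: "(('k => bool) \<times> 'k) set => ('k => 'k) => 'k set => ('k => 'k) => bool" where
 "good \<J> d E d' <-> dcl E <= E & K0 <= E & tdE E d' & (ALL x:K0. d' x = d x) & (ALL J ph. (J, ph) : \<J> --> (ALL z:E. J z --> sm (d' z) ph))"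

theorem derivation_extends:
 assumes sph: "sph_complete L N Ov" and d: "tdE K0 d"
  and J: "!!J ph. (J, ph) : \<J> ==> downc J & ph ~= 0 & (ALL e:K0. J e --> sm (d e) ph)"
 shows "EX d'. good \<J> d UNIV d'"
proof -
 \<comment> \<open>A partial derivation is replaced by its graph, so that extension becomes
   inclusion of sets and unions of chains can be formed.\<close>
 define G where "G E d' = (%x. (x, d' x :: 'k)) ` E" for E :: "'k set" and d'
 define A where "A = {G E d' | E d'. good \<J> d E d'}"
 have G: "(x, y) : G E d' <-> x : E & y = d' x" for x y E d' by (auto simp: G_def)
 have "good \<J> d K0 d" unfolding good_def using K0 d J by blast
 then have "A ~= {}" by (auto simp: A_def)
 moreover have "\<Union>C : A" if C: "C ~= {}" "subset.chain A C" for C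
 proof -
  define E where "E = fst ` \<Union>C"
  define e where "e x = (THE y. (x, y) : \<Union>C)" for x
  have CA: "C <= A" using C(2) unfolding subset_chain_def by blast
  have fin: "EX E' d'. good \<J> d E' d' & G E' d' : C & F <= E' & E' <= E & (ALL x:E'. e x = d' x)" if F: "finite F" "F <= E" for F
  proof -
   define u where "u x = (SOME y. (x, y) : \<Union>C)" for x
   have u: "(x, u x) : \<Union>C" if x: "x : F" for x
   proof -
    have "x : fst ` \<Union>C" using x F(2) unfolding E_def by blast
    then obtain p where "p : \<Union>C" "x = fst p" by blast
    then have "(x, snd p) : \<Union>C" by simp
    then show ?thesis unfolding u_def by (rule someI)
   qed
   have "finite ((%x. (x, u x)) ` F)" "(%x. (x, u x)) ` F <= \<Union>C" using F(1) u by auto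
   then obtain B where B: "B : C" "(%x. (x, u x)) ` F <= B" by (rule finite_subset_Union_chain[OF _ _ C])
   then obtain E' d' where E': "B = G E' d'" "good \<J> d E' d'" using CA unfolding A_def by blast
   have "e x = d' x" if x: "x : E'" for x
   proof -
    have 1: "(x, d' x) : \<Union>C" using B(1) E'(1) x G by blast
    have "y = d' x" if y: "(x, y) : \<Union>C" for y
    proof -
     obtain B' where B': "B' : C" "(x, y) : B'" using y by blast
     obtain E'' d'' where E'': "B' = G E'' d''" using B'(1) CA unfolding A_def by blast
     have "B <= B' | B' <= B" using C(2) B(1) B'(1) unfolding subset_chain_def by blast
     then show ?thesis using B'(2) x unfolding E'(1) E'' by (auto simp: G_def)
    qed
    then show ?thesis unfolding e_def using 1 by blast
   qed
   moreover have "F <= E'" using B(2) unfolding E'(1) by (auto simp: G_def)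
   moreover have "E' <= E"
   proof
    fix x assume "x : E'"
    then have "(x, d' x) : \<Union>C" using B(1) E'(1) G by blast
    then show "x : E" unfolding E_def by (rule rev_image_eqI) simp
   qed
   ultimately show ?thesis using E' B(1) by blast
  qed
  have "good \<J> d E e" unfolding good_def
  proof (intro conjI)
   show "dcl E <= E"
   proof
    fix z assume "z : dcl E"
    then obtain F where F: "F <= E" "finite F" "z : dcl F" using dcl_finite by blast
    obtain E' d' where E': "good \<J> d E' d'" "F <= E'" "E' <= E" using fin[OF F(2,1)] by blast
    have "z : dcl E'" using dcl_mono[OF E'(2)] F(3) by blast
    then show "z : E" using E' unfolding good_def by blast
   qed
   obtain E1 d1 where "good \<J> d E1 d1" "E1 <= E" "ALL x:E1. e x = d1 x" using fin[of "{}"] by auto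
   then show "K0 <= E" "ALL x:K0. e x = d x" unfolding good_def by auto
   show "ALL J ph. (J, ph) : \<J> --> (ALL z:E. J z --> sm (e z) ph)"
   proof (intro allI impI ballI)
    fix J ph z assume *: "(J, ph) : \<J>" "z : E" "J z"
    obtain E' d' where E': "good \<J> d E' d'" "{z} <= E'" "ALL x:E'. e x = d' x" using fin[of "{z}"] *(2) by auto
    then show "sm (e z) ph" using * unfolding good_def by auto
   qed
   show "tdE E e" unfolding tdE_def
   proof (intro allI impI)
    fix n f U gm assume f: "c1f n f U" "U gm" "ALL i<n. gm i : E"
    have "finite (gm ` {..<n})" "gm ` {..<n} <= E" using f(3) by auto
    from fin[OF this] obtain E' d' where E': "good \<J> d E' d'" "gm ` {..<n} <= E'" "ALL x:E'. e x = d' x" by (elim exE conjE)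
    have gm: "ALL i<n. gm i : E'" using E'(2) by auto
    note c1 = f(1)[unfolded c1f_def]
    note fD = conjunct1[OF c1] conjunct1[OF conjunct2[OF c1]]
    have "gm ` {..<n} <= dcl E'" using E'(2) subset_dcl[of E'] by (rule order_trans)
    then have "f gm : dcl E'" by (rule val_dcl[OF DF_mono[OF fD(1) empty_subsetI] fD(2)])
    then have "f gm : E'" using E'(1) unfolding good_def by blast
    then have "e (f gm) = d' (f gm)" using E'(3) by blast
    also have "\<dots> = (\<Sum>i<n. pd i f gm * d' (gm i))" using E'(1) f(1,2) gm unfolding good_def tdE_def by blast
    also have "\<dots> = (\<Sum>i<n. pd i f gm * e (gm i))" by (rule sum.cong) (use gm E'(3) in auto)
    finally show "e (f gm) = (\<Sum>i<n. pd i f gm * e (gm i))" .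
   qed
  qed
  moreover have "\<Union>C = G E e"
  proof
   show "\<Union>C <= G E e"
   proof
    fix p assume p: "p : \<Union>C"
    then have "fst p : E" unfolding E_def by blast
    then obtain E' d' where E': "G E' d' : C" "fst p : E'" "ALL x:E'. e x = d' x" using fin[of "{fst p}"] by auto
    obtain B where B: "B : C" "p : B" using p by blast
    have "B <= G E' d' | G E' d' <= B" using C(2) B(1) E'(1) unfolding subset_chain_def by blast
    moreover obtain E'' d'' where E'': "B = G E'' d''" using B(1) CA unfolding A_def by blast
    ultimately have "snd p = d' (fst p)" using B(2) E'(2) unfolding E'' by (cases p) (auto simp: G_def)
    then show "p : G E e" using \<open>fst p : E\<close> E'(2,3) by (cases p) (simp add: G)
   qed
   show "G E e <= \<Union>C"
   proof
    fix p assume "p : G E e"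
    then obtain x where x: "p = (x, e x)" "x : E" by (auto simp: G_def)
    then obtain E' d' where E': "G E' d' : C" "x : E'" "ALL x:E'. e x = d' x" using fin[of "{x}"] by auto
    then have "p : G E' d'" using x(1) by (simp add: G)
    then show "p : \<Union>C" using E'(1) by blast
   qed
  qed
  ultimately show ?thesis unfolding A_def by blast
 qed
 ultimately obtain M where M: "M : A" "!!X. X : A ==> M <= X ==> X = M" using subset_Zorn_nonempty[of A] by blast
 then obtain E d1 where E: "M = G E d1" "good \<J> d E d1" unfolding A_def by blast
 have "E = UNIV"
 proof (rule ccontr)
  assume "E ~= UNIV"
  then obtain a where a: "a ~: E" by blast
  have E1: "dcl E <= E" "K0 <= E" "tdE E d1" using E(2) unfolding good_def by blast+
  have J': "downc J & ph ~= 0 & (ALL e:E. J e --> sm (d1 e) ph)" if "(J, ph) : \<J>" for J ph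
   using J[OF that] E(2) that unfolding good_def by blast
  obtain d2 where d2: "tdE (dcl (insert a E)) d2" "ALL x:E. d2 x = d1 x"
   "ALL J ph. (J, ph) : \<J> --> (ALL z:dcl (insert a E). J z --> sm (d2 z) ph)"
   using derivation_step[OF E1 a sph J'] by blast
  have sub: "insert a E <= dcl (insert a E)" by (rule subset_dcl)
  have "good \<J> d (dcl (insert a E)) d2" unfolding good_def
   using E1(2) E(2) d2 sub unfolding good_def by auto
  then have "G (dcl (insert a E)) d2 : A" unfolding A_def by blast
  moreover have "M <= G (dcl (insert a E)) d2" unfolding E(1) using d2(2) sub by (auto simp: G_def)
  ultimately have "G (dcl (insert a E)) d2 = G E d1" using M(2) E(1) by blast
  then have "a : E" using sub G[of a "d2 a"] by blast
  then show False using a by blast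
 qed
 then show ?thesis using E(2) by blast
qed

end

section \<open>The ground structure inside an immediate elementary extension\<close>

lemma lsum_N: "(!!x y. ad L M x y = x + y) ==> zr L M = (0::'k::linordered_field) ==> lsum L M (map f [0..<n]) = (\<Sum>i<n. f i)"
proof -
 assume a: "!!x y. ad L M x y = x + y" "zr L M = (0::'k)"
 have "foldr (ad L M) xs z = sum_list xs + z" for xs z by (induction xs) (simp_all add: a add.assoc)
 then have "lsum L M (map f [0..<n]) = sum_list (map f [0..<n])" by (simp add: lsum_def a)
 then show ?thesis by (simp add: sum_list_sum_nth atLeast0LessThan)
qed

definition hull :: "('k::linordered_field) set => 'k set" where "hull S = {y. EX c:S. \<bar>y\<bar> <= \<bar>c\<bar>}"

lemma elementary_fint: assumes el: "elementary L K M e" and K: "struc_ok L K" and xs: "length xs = fun_ar L f" "set xs <= univ K"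
 shows "e (fint K f xs) = fint M f (map e xs)"
proof -
 let ?n = "length xs" and ?bt = "%i. if i < length xs then xs ! i else fint K f xs"
 have u: "fint K f xs : univ K" using K xs unfolding struc_ok_def by blast
 have b: "?bt i : univ K" for i using xs(2) u by auto
 have m: "map (%i. ?bt i) [0..<?n] = xs" by (rule nth_equalityI) auto
 have m': "map (%i. e (?bt i)) [0..<?n] = map e xs" by (rule nth_equalityI) auto
 have "wf_fm L (Eq (Fn f (map Var [0..<?n])) (Var ?n))" using xs(1) by (simp add: list_all_iff)
 then have "sat K ?bt (Eq (Fn f (map Var [0..<?n])) (Var ?n)) <-> sat M (e \<circ> ?bt) (Eq (Fn f (map Var [0..<?n])) (Var ?n))"
  using el[unfolded elementary_def, rule_format, of "Eq (Fn f (map Var [0..<?n])) (Var ?n)" ?bt] b by blast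
 then show ?thesis using m m' by (simp add: o_def cong: map_cong)
qed

lemma elementary_inj: assumes el: "elementary L K M e" shows "inj_on e (univ K)"
proof (rule inj_onI)
 fix x y assume xy: "x : univ K" "y : univ K" "e x = e y"
 show "x = y" using el[unfolded elementary_def, rule_format, of "Eq (Var 0) (Var 1)" "%i. if i = 0 then x else y"] xy by simp
qed

lemma elementary_rint: assumes el: "elementary L K M e" and x0: "x0 : univ K" and xs: "length xs = rel_ar L r" "set xs <= univ K"
 shows "rint M r (map e xs) <-> rint K r xs"
proof -
 let ?n = "length xs" and ?bt = "%i. if i < length xs then xs ! i else x0"
 have b: "?bt i : univ K" for i using xs(2) x0 by auto
 have m: "map (%i. ?bt i) [0..<?n] = xs" by (rule nth_equalityI) auto
 have m': "map (%i. e (?bt i)) [0..<?n] = map e xs" by (rule nth_equalityI) auto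
 have "wf_fm L (Rl r (map Var [0..<?n]))" using xs(1) by (simp add: list_all_iff)
 then have "sat K ?bt (Rl r (map Var [0..<?n])) <-> sat M (e \<circ> ?bt) (Rl r (map Var [0..<?n]))"
  using el[unfolded elementary_def, rule_format, of "Rl r (map Var [0..<?n])" ?bt] b by blast
 then show ?thesis using m m' by (simp add: o_def cong: map_cong)
qed

text \<open>No valuation ring on \<open>N\<close> is given. Immediacy is stated with the ring of
  \<open>K\<close> only, and the ring of \<open>N\<close> is then constructed as the convex hull of
  its image.\<close>

locale kn = omf L N for L :: "('f,'r) lang" and N :: "('k::linordered_field,'f,'r) struc" +
 fixes K :: "('a,'f,'r) struc" and e :: "'a => 'k" and \<O> :: "'a set"
 assumes Kok: "struc_ok L K" and el: "elementary L K N e" and Ktc: "tconvex L K \<O>"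
  and immK: "!!y. y ~= 0 ==> EX g:univ K. ALL c:\<O>. \<bar>e c * (y - e g)\<bar> < \<bar>e g\<bar>"
begin

lemma el_sat: "wf_fm L ph ==> (!!i. bt i : univ K) ==> sat K bt ph <-> sat N (e \<circ> bt) ph"
 using el unfolding elementary_def by blast

definition x0 where "x0 = (SOME x. x : univ K)"
lemma x0: "x0 : univ K" using Kok unfolding struc_ok_def x0_def by (simp add: some_in_eq)

lemma e_inj: "x : univ K ==> y : univ K ==> e x = e y ==> x = y"
 by (rule inj_onD[OF elementary_inj[OF el]])

lemma inj_e: "inj_on e (univ K)" using e_inj by (auto intro: inj_onI)

lemmas e_fint = elementary_fint[OF el Kok] and e_rint = elementary_rint[OF el x0]

lemma emb_e: "emb L K N e" unfolding emb_def using inj_e e_fint e_rint by auto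

lemma ars: "fun_ar L (sym_zero L) = 0" "fun_ar L (sym_one L) = 0" "fun_ar L (sym_add L) = 2" "fun_ar L (sym_neg L) = 1"
 "fun_ar L (sym_mul L) = 2" "rel_ar L (sym_less L) = 2" using ok unfolding lang_ok_def by auto

lemma clK: "zr L K : univ K" "on L K : univ K" "x : univ K ==> y : univ K ==> ad L K x y : univ K"
 "x : univ K ==> ng L K x : univ K" "x : univ K ==> y : univ K ==> ml L K x y : univ K"
 using Kok ars unfolding struc_ok_def zr_def on_def ad_def ng_def ml_def by auto

lemma eops: "e (zr L K) = 0" "e (on L K) = 1" "x : univ K ==> y : univ K ==> e (ad L K x y) = e x + e y"
 "x : univ K ==> e (ng L K x) = - e x" "x : univ K ==> y : univ K ==> e (ml L K x y) = e x * e y"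
 "x : univ K ==> y : univ K ==> ls L K x y <-> e x < e y"
 unfolding zrN[symmetric] onN[symmetric] adN[symmetric] ngN[symmetric] mlN[symmetric] lsN[symmetric]
 using e_fint[of "[]" "sym_zero L"] e_fint[of "[]" "sym_one L"] e_fint[of "[x, y]" "sym_add L"] e_fint[of "[x]" "sym_neg L"]
  e_fint[of "[x, y]" "sym_mul L"] e_rint[of "[x, y]" "sym_less L"] ars
 by (simp_all add: zr_def on_def ad_def ng_def ml_def ls_def)

lemma sbK: "x : univ K ==> y : univ K ==> sb L K x y : univ K" "x : univ K ==> y : univ K ==> e (sb L K x y) = e x - e y"
 by (simp_all add: sb_def clK eops)
lemma abK: "x : univ K ==> ab L K x : univ K" "x : univ K ==> e (ab L K x) = \<bar>e x\<bar>"
 by (simp_all add: ab_def clK eops abs_if)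
lemma leK: "x : univ K ==> y : univ K ==> le L K x y <-> e x <= e y" unfolding le_def le_less using e_inj[of x y] by (auto simp: eops)
lemma posK: "pos L K x <-> x : univ K & 0 < e x" by (auto simp: pos_def clK eops)
lemma lsumK: "(!!i. i < n ==> f i : univ K) ==> lsum L K (map f [0..<n]) : univ K & e (lsum L K (map f [0..<n])) = (\<Sum>i<n. e (f i))"
proof -
 assume f: "!!i. i < n ==> f i : univ K"
 have "set xs <= univ K ==> lsum L K xs : univ K & e (lsum L K xs) = sum_list (map e xs)" for xs
  unfolding lsum_def by (induction xs) (auto simp: clK eops)
 from this[of "map f [0..<n]"] f show ?thesis by (auto simp: sum_list_sum_nth atLeast0LessThan)
qed

abbreviation "KK \<equiv> e ` univ K"

text \<open>An element definable over the image solves a formula with parameters from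
  \<open>K\<close> that has no other solution. By elementarity the formula has a solution in
  \<open>K\<close>, whose image must be that element.\<close>

lemma dcl_KK: "dcl KK <= KK"
proof
 fix c assume "c : dcl KK"
 then have "D KK (%bt. bt 0 = c)" by (simp add: dcl_def DF_def)
 then obtain P0 br where P: "D0 P0" "!!i. br i : insert 0 KK" "!!bt. (bt 0 = c) = P0 (mix bt br)" unfolding D_def by blast
 obtain ph where ph: "wf_fm L ph" "!!bt. P0 bt = sat N bt ph" using P(1) unfolding D0_def by blast
 have "0 : KK" using clK(1) eops(1) by force
 then have "br i : KK" for i using P(2)[of i] by auto
 then have "ALL i. EX x. x : univ K & e x = br i" by (metis imageE)
 then obtain br' where r: "!!i. br' i : univ K" "!!i. e (br' i) = br i" by metis
 define bt where "bt = mix (%_. zr L K) br'"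
 have b: "bt i : univ K" for i by (simp add: bt_def mix_def clK r)
 have eb: "(e \<circ> bt)(0 := z) = mix ((%_. 0)(0 := z)) br" for z
  by (rule ext) (auto simp: bt_def mix_def eops r elim!: oddE evenE)
 have key: "sat N ((e \<circ> bt)(0 := z)) ph <-> z = c" for z unfolding eb using P(3)[of "(%_. 0)(0 := z)"] ph(2) by simp
 have "sat N (e \<circ> bt) (Ex 0 ph)" using key by simp
 then have "sat K bt (Ex 0 ph)" using el_sat[of "Ex 0 ph" bt] ph(1) b by simp
 then obtain x where x: "x : univ K" "sat K (bt(0 := x)) ph" by auto
 then have "sat N (e \<circ> (bt(0 := x))) ph" using el_sat[of ph "bt(0 := x)"] ph(1) b by simp
 moreover have "e \<circ> (bt(0 := x)) = (e \<circ> bt)(0 := e x)" by auto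
 ultimately have "e x = c" using key by simp
 then show "c : KK" using x(1) by blast
qed

definition io where "io = inv_into (univ K) e"
lemma io: "z : KK ==> io z : univ K" "z : KK ==> e (io z) = z" "x : univ K ==> io (e x) = x"
 unfolding io_def by (simp_all add: inv_into_into f_inv_into_f inj_e)

lemma def_set_restrict: assumes "def_set L N {} n S" shows "def_set L K {} n {xs : tuples K n. map e xs : S}"
proof -
 obtain ph bt where ph: "wf_fm L ph" "ALL i:fv ph. n <= i --> bt i : {}" and S: "S = {xs : tuples N n. sat N (asg xs bt) ph}"
  using assms unfolding def_set_def by blast
 have "map e xs : S <-> sat K (asg xs (%_. x0)) ph" if xs: "xs : tuples K n" for xs
 proof -
  have "sat K (asg xs (%_. x0)) ph <-> sat N (e \<circ> asg xs (%_. x0)) ph"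
   by (rule el_sat[OF ph(1)]) (use xs x0 in \<open>auto simp: asg_def tuples_def\<close>)
  also have "\<dots> <-> sat N (asg (map e xs) bt) ph"
  proof (rule sat_cong)
   fix i assume "i : fv ph"
   then have "i < n" using ph(2) by force
   then show "(e \<circ> asg xs (%_. x0)) i = asg (map e xs) bt i" using xs by (simp add: asg_def tuples_def)
  qed
  finally show ?thesis using xs by (simp add: S tuples_def)
 qed
 then have "{xs : tuples K n. map e xs : S} = {xs : tuples K n. sat K (asg xs (%_. x0)) ph}" by blast
 then show ?thesis unfolding def_set_def using ph by (intro exI[of _ ph] exI[of _ "%_. x0"]) auto
qed

lemma F_KK: assumes "DF {} (%bt. F (bt 0))" "x : univ K" shows "F (e x) : KK"
proof -
 have "(%bt. F (bt 0)) (%_. e x) : dcl KK" by (rule dcl_app[OF DF_mono[OF assms(1)]]) (use assms(2) subset_dcl[of KK] in auto)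
 then show ?thesis using dcl_KK by auto
qed

lemma O_sub: "\<O> <= univ K" and O_ne: "\<O> ~= {}" using Ktc unfolding tconvex_def by blast+

lemma O_cont:
 assumes F: "DF {} (%bt. F (bt 0))" and c: "!!x. x : univ K ==> cont_at L K (%x. io (F (e x))) x" and x: "x : \<O>"
 shows "io (F (e x)) : \<O>"
proof -
 let ?F = "%x. io (F (e x))"
 have u: "?F x : univ K" if "x : univ K" for x using io(1)[OF F_KK[OF F that]] .
 have "def_set L N {} 2 {[x, F x] | x. x : univ N}" using def_fun1_of_DF[OF F] unfolding def_fun1_def by blast
 from def_set_restrict[OF this] have "def_set L K {} 2 {xs : tuples K 2. map e xs : {[x, F x] | x. x : univ N}}" .
 moreover have "{xs : tuples K 2. map e xs : {[x, F x] | x. x : univ N}} = {[x, ?F x] | x. x : univ K}"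
 proof (intro equalityI subsetI)
  fix xs assume "xs : {xs : tuples K 2. map e xs : {[x, F x] | x. x : univ N}}"
  then obtain a b where ab: "xs = [a, b]" "a : univ K" "b : univ K" "e b = F (e a)" by (auto simp: tuples_def length_Suc_conv numeral_2_eq_2)
  then have "b = ?F a" using io(3)[of b] by simp
  then show "xs : {[x, ?F x] | x. x : univ K}" using ab(1,2) by blast
 next
  fix xs assume "xs : {[x, ?F x] | x. x : univ K}"
  then obtain a where a: "xs = [a, ?F a]" "a : univ K" by blast
  then show "xs : {xs : tuples K 2. map e xs : {[x, F x] | x. x : univ N}}"
   using u[OF a(2)] io(2)[OF F_KK[OF F a(2)]] by (simp add: tuples_def)
 qed
 ultimately have "def_fun1 L K {} ?F" unfolding def_fun1_def using u by simp
 then have "?F ` \<O> <= \<O>" using Ktc c unfolding tconvex_def by blast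
 then show ?thesis using x by blast
qed

lemma O_const: assumes "c : dcl {}" shows "io c : \<O>"
proof -
 obtain x where x: "x : \<O>" using O_ne by blast
 have "c : KK" using assms dcl_mono[of "{}" KK] dcl_KK by blast
 then have u: "io c : univ K" by (rule io)
 show ?thesis
 proof (rule O_cont[where F = "%_. c", OF _ _ x])
  show "DF {} (%bt. c)" using assms by (rule DF_dcl)
  show "cont_at L K (%x. io c) y" if "y : univ K" for y
   unfolding cont_at_def posK by (auto simp: u sbK abK clK eops)
 qed
qed

lemma two_O: "EX c:\<O>. e c = 2"
proof -
 have "DF {} (%bt. 2)" by (intro DF_base)
 then have 2: "2 : dcl {}" by (simp add: dcl_def)
 then have "2 : KK" using dcl_mono[of "{}" KK] dcl_KK by blast
 then show ?thesis using O_const[OF 2] io(2) by blast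
qed

lemma immK2: "y ~= 0 ==> EX g:univ K. (ALL c:\<O>. \<bar>e c * (y - e g)\<bar> < \<bar>e g\<bar>) & e g ~= 0 & \<bar>e g\<bar> < 2 * \<bar>y\<bar> & \<bar>y\<bar> < 2 * \<bar>e g\<bar>"
proof -
 assume "y ~= 0"
 then obtain g where g: "g : univ K" "ALL c:\<O>. \<bar>e c * (y - e g)\<bar> < \<bar>e g\<bar>" using immK by blast
 obtain c where c: "c : \<O>" "e c = 2" using two_O by blast
 have "\<bar>2 * (y - e g)\<bar> < \<bar>e g\<bar>" using g(2) c by force
 then show ?thesis using g by (intro bexI[of _ g]) (auto simp: abs_if algebra_simps split: if_splits)
qed

lemma KK_DF: "DF KK (%bt. z) ==> z : KK" using dcl_KK by (auto simp: dcl_def)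
lemma DF_e: "x : univ K ==> DF KK (%bt. e x)" by (rule DF_const) simp

text \<open>Below every positive element of \<open>N\<close> there is a positive one from
  \<open>K\<close>, so radii in limits can be chosen in the image and limits over \<open>K\<close>
  and \<open>N\<close> correspond.\<close>

lemma coinitial: assumes "0 < dt" shows "EX x:univ K. 0 < e x & e x < dt"
proof -
 obtain g where g: "g : univ K" "e g ~= 0" "\<bar>e g\<bar> < 2 * \<bar>dt\<bar>" using immK2[of dt] assms by auto
 have "\<bar>e g\<bar> / 2 : KK" by (rule KK_DF) (intro DF_base DF_e g(1))
 then obtain x where "x : univ K" "e x = \<bar>e g\<bar> / 2" by (metis imageE)
 then show ?thesis using g(2,3) assms by (intro bexI[of _ x]) auto
qed

lemma O_contat: assumes F: "DF {} (%bt. F (bt 0))" and c: "!!x. contat F x" and x: "x : \<O>" shows "EX y:\<O>. e y = F (e x)"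
proof -
 have "io (F (e x)) : \<O>"
 proof (rule O_cont[OF F _ x])
  fix z assume z: "z : univ K"
  show "cont_at L K (%x. io (F (e x))) z" unfolding cont_at_def
  proof (intro allI impI)
   fix ef assume "pos L K ef"
   then have ep: "ef : univ K" "0 < e ef" by (simp_all add: posK)
   obtain r where r: "r > 0" "!!y. \<bar>y - e z\<bar> < r ==> \<bar>F y - F (e z)\<bar> < e ef" using c[of "e z"] ep(2) unfolding contat_def by blast
   obtain dt where dt: "dt : univ K" "0 < e dt" "e dt < r" using coinitial[OF r(1)] by blast
   note u = io(1)[OF F_KK[OF F]] and v = io(2)[OF F_KK[OF F]]
   have "ls L K (ab L K (sb L K (io (F (e y))) (io (F (e z))))) ef" if y: "y : univ K" "ls L K (ab L K (sb L K y z)) dt" for y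
   proof -
    have "\<bar>e y - e z\<bar> < e dt" using y z dt(1) by (simp add: eops abK sbK)
    then have "\<bar>F (e y) - F (e z)\<bar> < e ef" using dt(3) by (intro r(2)) simp
    then show ?thesis using y z u v ep(1) by (simp add: eops abK sbK)
   qed
   then show "EX dt. pos L K dt & (ALL y:univ K. ls L K (ab L K (sb L K y z)) dt --> ls L K (ab L K (sb L K (io (F (e y))) (io (F (e z))))) ef)"
    using dt posK by blast
  qed
 qed
 moreover have "e (io (F (e x))) = F (e x)" by (rule io(2)[OF F_KK[OF F]]) (use x O_sub in blast)
 ultimately show ?thesis by blast
qed

lemma O_conv: assumes "c : \<O>" "x : univ K" "\<bar>e x\<bar> <= \<bar>e c\<bar>" shows "x : \<O>"
proof -
 have cont: "contat uminus y" for y :: 'k unfolding contat_def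
 proof (intro allI impI)
  fix r :: 'k assume "r > 0"
  moreover have "\<bar>- z - - y\<bar> < r" if "\<bar>z - y\<bar> < r" for z using that by (simp add: abs_minus_commute)
  ultimately show "EX d>0. ALL z. \<bar>z - y\<bar> < d --> \<bar>- z - - y\<bar> < r" by blast
 qed
 obtain c' where c': "c' : \<O>" "e c' = - e c" using O_contat[where F = uminus, OF DF_minus[OF DF_var] cont assms(1)] by blast
 have between: "!!a b y. a : \<O> ==> b : \<O> ==> y : univ K ==> e a <= e y ==> e y <= e b ==> y : \<O>"
  using Ktc leK O_sub unfolding tconvex_def by (meson subsetD)
 show ?thesis
 proof (cases "0 <= e c")
  case True then show ?thesis using between[OF c'(1) assms(1,2)] c'(2) assms(3) by (simp add: abs_le_iff)
 next
  case False then show ?thesis using between[OF assms(1) c'(1) assms(2)] c'(2) assms(3) by (simp add: abs_le_iff)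
 qed
qed

definition Ov where "Ov = hull (e ` \<O>)"

lemma OvI: "c : \<O> ==> \<bar>y\<bar> <= \<bar>e c\<bar> ==> y : Ov" unfolding Ov_def hull_def by blast
lemma OvE: assumes "y : Ov" obtains c where "c : \<O>" "\<bar>y\<bar> <= \<bar>e c\<bar>" using assms unfolding Ov_def hull_def by blast
lemma Ov_e: "x : univ K ==> e x : Ov <-> x : \<O>" using OvI OvE O_conv by (metis order_refl)

lemma contatN: "cont_at L N F x <-> contat F x" unfolding cont_at_def contat_def by simp

text \<open>A value of F at a point of the hull is, up to bounded factors, also attained at a point
  of \<open>K\<close> within the same bound, by elementarity; there the T-convexity of the ring of
  \<open>K\<close> applies.\<close>

lemma hull_tconvex: "tconvex L N Ov"
 unfolding tconvex_def
proof (intro conjI ballI impI allI)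
 show "Ov <= univ N" by simp
 obtain c where c: "c : \<O>" using O_ne by blast
 show "Ov ~= {}" using OvI[OF c, of 0] by auto
next
 fix x z y assume x: "x : Ov" and z: "z : Ov" and y: "le L N x y & le L N y z"
 have xyz: "x <= y" "y <= z" using y by (auto simp: le_def)
 obtain a b where a: "a : \<O>" "\<bar>x\<bar> <= \<bar>e a\<bar>" and b: "b : \<O>" "\<bar>z\<bar> <= \<bar>e b\<bar>" using x z by (meson OvE)
 show "y : Ov"
 proof (cases "0 <= y")
  case True then show ?thesis using xyz b by (intro OvI[OF b(1)]) simp
 next
  case False then show ?thesis using xyz a by (intro OvI[OF a(1)]) simp
 qed
next
 fix F assume F: "def_fun1 L N {} F & (ALL x:univ N. cont_at L N F x)"
 have FD: "DF {} (%bt. F (bt 0))"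
 proof -
  have "D {} (%bt. map bt [0..<2] : {[x, F x] | x. x : univ N})" by (rule D_of_def_set) (use F in \<open>simp add: def_fun1_def\<close>)
  moreover have "(map bt [0..<2] : {[x, F x] | x. x : univ N}) = (bt 1 = F (bt 0))" for bt
   by (simp add: numeral_2_eq_2)
  ultimately have "D {} (%bt. bt 1 = F (bt 0))" by (simp only:)
  from D_ren[OF this, of "%i. if i = 1 then 0 else Suc i"] show ?thesis unfolding DF_def by (simp add: One_nat_def)
 qed
 have Fc: "contat F x" for x using F contatN by simp
 show "F ` Ov <= Ov"
 proof
  fix w assume "w : F ` Ov"
  then obtain y where y: "y : Ov" "w = F y" by blast
  obtain c where c: "c : \<O>" "\<bar>y\<bar> <= \<bar>e c\<bar>" using y(1) by (rule OvE)
  have cu: "c : univ K" using c O_sub by blast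
  show "w : Ov"
  proof (cases "w = 0")
   case True then show ?thesis using OvI[OF c(1), of 0] by simp
  next
   case False
   then obtain g where g: "g : univ K" "e g ~= 0" "\<bar>e g\<bar> < 2 * \<bar>w\<bar>" "\<bar>w\<bar> < 2 * \<bar>e g\<bar>" using immK2 by blast
   \<comment> \<open>The condition mentions only elements of \<open>K\<close>. A solution z from
     \<open>K\<close> lies in the ring, and |w| < 2|g| < 4|F z|; hence the function 4F is used
     below.\<close>
   have S: "D KK (%bt. \<bar>bt 0\<bar> <= \<bar>e c\<bar> & \<bar>e g\<bar> < 2 * \<bar>F (bt 0)\<bar>)"
    by (intro D_base DF_base DF_e g(1) cu DF_mono[OF FD]) auto
   obtain z where z: "z : dcl KK" "\<bar>z\<bar> <= \<bar>e c\<bar> & \<bar>e g\<bar> < 2 * \<bar>F z\<bar>"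
    using definable_point[where S = "%z. \<bar>z\<bar> <= \<bar>e c\<bar> & \<bar>e g\<bar> < 2 * \<bar>F z\<bar>", OF S] c(2) g(3) y(2) by blast
   then obtain x where x: "x : univ K" "z = e x" using dcl_KK by blast
   have xO: "x : \<O>" using O_conv[OF c(1) x(1)] z(2) x(2) by simp
   have "DF {} (%bt. 4 * F (bt 0))" by (intro DF_base FD)
   moreover have "contat (%x. 4 * F x) v" for v unfolding contat_def
   proof (intro allI impI)
    fix r :: 'k assume "r > 0"
    then have "r / 4 > 0" by simp
    then obtain d where d: "d > 0" "!!u. \<bar>u - v\<bar> < d ==> \<bar>F u - F v\<bar> < r / 4" using Fc[of v] unfolding contat_def by blast
    have "\<bar>4 * F u - 4 * F v\<bar> < r" if "\<bar>u - v\<bar> < d" for u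
    proof -
     have "\<bar>4 * F u - 4 * F v\<bar> = 4 * \<bar>F u - F v\<bar>" by (simp only: right_diff_distrib[symmetric] abs_mult abs_numeral)
     then show ?thesis using d(2)[OF that] by simp
    qed
    then show "EX d>0. ALL u. \<bar>u - v\<bar> < d --> \<bar>4 * F u - 4 * F v\<bar> < r" using d(1) by blast
   qed
   ultimately obtain y' where y': "y' : \<O>" "e y' = 4 * F (e x)" using O_contat[where F = "%x. 4 * F x", OF _ _ xO] by blast
   show ?thesis by (rule OvI[OF y'(1)]) (use y'(2) z(2) x(2) g(4) in \<open>simp add: abs_mult\<close>)
  qed
 qed
qed

sublocale tcv L N Ov by unfold_locales (rule hull_tconvex)

lemma sm_e: assumes "!!c. c : \<O> ==> \<bar>e c * x\<bar> < \<bar>y\<bar>" shows "sm x y" unfolding sm_def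
proof
 fix c assume "c : Ov"
 then obtain b where b: "b : \<O>" "\<bar>c\<bar> <= \<bar>e b\<bar>" by (rule OvE)
 have "\<bar>c * x\<bar> <= \<bar>e b * x\<bar>" unfolding abs_mult by (rule mult_right_mono[OF b(2)]) simp
 then show "\<bar>c * x\<bar> < \<bar>y\<bar>" using assms[OF b(1)] by simp
qed

sublocale imm L N Ov KK
proof unfold_locales
 show "dcl KK <= KK" by (rule dcl_KK)
 fix y :: 'k assume "y ~= 0"
 then obtain g where "g : univ K" "ALL c:\<O>. \<bar>e c * (y - e g)\<bar> < \<bar>e g\<bar>" using immK by blast
 then show "EX g:KK. sm (y - g) g" using sm_e by blast
qed

lemma sm_asymp: "sm (y - g) g ==> dm g y & dm y g" using sm_half dm_2 by (meson less_imp_le)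

end

lemma gradat_cong: "(!!i. i < n ==> g i = g' i) ==> gradat n f g u = gradat n f g' u"
proof -
 assume "!!i. i < n ==> g i = g' i"
 then have "(\<Sum>i<n. g i * (y i - u i)) = (\<Sum>i<n. g' i * (y i - u i))" for y by (intro sum.cong) auto
 then show ?thesis by (simp add: gradat_def)
qed

section \<open>Formal T-derivations and the lift of the derivation\<close>

context kn
begin

definition fl :: "nat => 'a list => nat => 'k" where "fl n xs i = (if i < n then e (xs ! i) else 0)"

lemma tup_nth: "xs : tuples K n ==> i < n ==> xs ! i : univ K" unfolding tuples_def by auto

lemma fl_KK: assumes "DF {} g" "dep n g" "xs : tuples K n" shows "g (fl n xs) : KK"
proof -
 have "fl n xs ` {..<n} <= KK" using tup_nth[OF assms(3)] by (auto simp: fl_def)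
 then have "fl n xs ` {..<n} <= dcl KK" using subset_dcl[of KK] by (rule order_trans)
 then show ?thesis using val_dcl[OF DF_mono[OF assms(1) empty_subsetI] assms(2)] dcl_KK by blast
qed

lemma nearK: assumes "xs : tuples K n" "ys : tuples K n" "r : univ K" shows "near L K r ys xs <-> box n (e r) (fl n xs) (fl n ys)"
proof -
 have l: "length xs = n" using assms(1) by (simp add: tuples_def)
 have "ls L K (ab L K (sb L K (ys ! i) (xs ! i))) r <-> \<bar>fl n ys i - fl n xs i\<bar> < e r" if i: "i < n" for i
  using tup_nth[OF assms(1) i] tup_nth[OF assms(2) i] assms(3) i by (simp add: eops abK sbK fl_def)
 then show ?thesis unfolding near_def box_def l by blast
qed

text \<open>A C1 function definable without parameters takes values and partial derivatives in the
  image at tuples from the image, so it restricts to a C1 function on \<open>K\<close>. The formal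
  condition on \<open>d\<close> is then applied to the restriction.\<close>

theorem tdE_of_tderiv: assumes td: "tderiv L K d" shows "tdE KK (%z. e (d (io z)))"
 unfolding tdE_def
proof (intro allI impI)
 fix n f U gm assume c: "c1f n f U" and gm: "U gm" "ALL i<n. gm i : KK"
 note c' = c[unfolded c1f_def]
 have f: "DF {} f" "dep n f" and U: "D {} U" "dep n U" using c' by blast+
 have Uo: "!!gm. U gm ==> EX dt>0. ALL et. box n dt gm et --> U et" using c' by blast
 have Ug: "!!gm. U gm ==> gradat n f (%i. pd i f gm) gm" using c' by blast
 have Uc: "!!gm i. U gm ==> i < n ==> contn n (pd i f) gm" using c' by blast
 define V where "V = {xs : tuples K n. U (fl n xs)}"
 define F where "F xs = io (f (fl n xs))" for xs
 define G where "G xs = map (%i. io (pd i f (fl n xs))) [0..<n]" for xs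
 have F: "F xs : univ K" "e (F xs) = f (fl n xs)" if "xs : tuples K n" for xs
  using io(1,2)[OF fl_KK[OF f that]] by (simp_all add: F_def)
 have G: "G xs ! i : univ K" "e (G xs ! i) = pd i f (fl n xs)" if "xs : tuples K n" "i < n" for xs i
  using io(1,2)[OF fl_KK[OF DF_pd[OF f(1)] pd_dep[OF f(2) that(2)] that(1)]] that(2) by (simp_all add: G_def)
 have Vt: "V <= tuples K n" by (auto simp: V_def)
 have small: "EX r. pos L K r & e r < dt" if "0 < dt" for dt using coinitial[OF that] posK by blast
 have op: "open_tup L K n V" unfolding open_tup_def
 proof (intro conjI ballI Vt)
  fix u assume "u : V"
  then have u: "u : tuples K n" "U (fl n u)" by (auto simp: V_def)
  obtain dt where dt: "dt > 0" "!!et. box n dt (fl n u) et ==> U et" using Uo[OF u(2)] by blast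
  obtain r where r: "pos L K r" "e r < dt" using small[OF dt(1)] by blast
  have "y : V" if y: "y : tuples K n" "near L K r y u" for y
  proof -
   have "box n (e r) (fl n u) (fl n y)" using nearK[OF u(1) y(1)] y(2) r(1) posK by blast
   then have "U (fl n y)" by (intro dt(2)) (rule box_mono, assumption, use r(2) in simp)
   then show ?thesis using y(1) by (simp add: V_def)
  qed
  then show "EX dt. pos L K dt & (ALL y:tuples K n. near L K dt y u --> y : V)" using r(1) by blast
 qed
 have df: "def_fun L K {} n V F" unfolding def_fun_def
 proof (intro conjI ballI Vt)
  show "F xs : univ K" if "xs : V" for xs using F(1) that Vt by blast
  define P where "P bt <-> U bt & bt n = f bt" for bt
  have PD: "D {} P" unfolding P_def[abs_def] by (intro D_conj U(1) D_eq DF_var f(1))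
  have supp: "P bt = P gm" if "!!i. i < Suc n ==> bt i = gm i" for bt gm
  proof -
   have 1: "U bt = U gm" by (rule depD[OF U(2)]) (use that in auto)
   have 2: "f bt = f gm" by (rule depD[OF f(2)]) (use that in auto)
   have 3: "bt n = gm n" using that by simp
   show ?thesis unfolding P_def 1 2 3 by (rule refl)
  qed
  let ?S = "{zs. length zs = Suc n & P (%i. if i < Suc n then zs ! i else 0)}"
  have "def_set L N {} (Suc n) ?S" by (rule def_set_of_D[OF PD supp])
  from def_set_restrict[OF this] have "def_set L K {} (Suc n) {xs : tuples K (Suc n). map e xs : ?S}" .
  moreover have "{xs : tuples K (Suc n). map e xs : ?S} = {xs @ [F xs] | xs. xs : V}"
  proof -
   have key: "map e (xs @ [x]) : ?S <-> U (fl n xs) & e x = f (fl n xs)" if "length xs = n" for xs x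
   proof -
    let ?z = "%i. if i < Suc n then map e (xs @ [x]) ! i else 0"
    have 1: "?z i = fl n xs i" if "i < n" for i using that \<open>length xs = n\<close> by (simp add: fl_def nth_append)
    have 2: "U ?z = U (fl n xs)" "f ?z = f (fl n xs)" by (rule depD[OF U(2)], erule 1, rule depD[OF f(2)], erule 1)
    have 3: "?z n = e x" using that by (simp add: nth_append)
    have "length (map e (xs @ [x])) = Suc n" using that by simp
    then have "map e (xs @ [x]) : ?S <-> P ?z" by (simp only: mem_Collect_eq simp_thms)
    then show ?thesis unfolding P_def 2 3 .
   qed
   show ?thesis
   proof (intro equalityI subsetI)
    fix ys assume ys: "ys : {xs : tuples K (Suc n). map e xs : ?S}"
    then obtain xs x where x: "ys = xs @ [x]" "length xs = n" unfolding tuples_def by (auto simp: length_Suc_conv_rev)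
    then have "xs : tuples K n" "x : univ K" using ys by (auto simp: tuples_def)
    moreover have "U (fl n xs) & e x = f (fl n xs)" using key[OF x(2)] ys x(1) by blast
    ultimately show "ys : {xs @ [F xs] | xs. xs : V}" using x(1) F(2) e_inj F(1) by (metis (mono_tags, lifting) V_def mem_Collect_eq)
   next
    fix ys assume "ys : {xs @ [F xs] | xs. xs : V}"
    then obtain xs where xs: "ys = xs @ [F xs]" "xs : tuples K n" "U (fl n xs)" by (auto simp: V_def)
    then have l: "length xs = n" by (simp add: tuples_def)
    have "map e ys : ?S" unfolding xs(1) key[OF l] using xs F(2) by blast
    moreover have "ys : tuples K (Suc n)" using xs(1,2) F(1)[OF xs(2)] by (simp add: tuples_def)
    ultimately show "ys : {xs : tuples K (Suc n). map e xs : ?S}" by blast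
   qed
  qed
  ultimately show "def_set L K {} (Suc n) {xs @ [F xs] | xs. xs : V}" by simp
 qed
 have C1: "C1_with L K n V F G" unfolding C1_with_def
 proof (intro conjI ballI allI impI)
  fix u assume "u : V"
  then have u: "u : tuples K n" "U (fl n u)" and lu: "length u = n" by (auto simp: V_def tuples_def)
  show "has_grad L K V F (G u) u" unfolding has_grad_def
  proof (intro conjI allI impI)
   show "length (G u) = length u" by (simp add: G_def lu)
   show "set (G u) <= univ K" using G(1)[OF u(1)] by (auto simp: in_set_conv_nth G_def)
   fix ef assume "pos L K ef"
   then have ep: "ef : univ K" "0 < e ef" by (simp_all add: posK)
   obtain dt where dt: "dt > 0" "!!y. box n dt (fl n u) y ==>
     \<bar>f y - f (fl n u) - (\<Sum>i<n. pd i f (fl n u) * (y i - fl n u i))\<bar> <= e ef * (\<Sum>i<n. \<bar>y i - fl n u i\<bar>)"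
    using Ug[OF u(2)] ep(2) unfolding gradat_def by blast
   obtain r where r: "pos L K r" "e r < dt" using small[OF dt(1)] by blast
   have "le L K (ab L K (sb L K (sb L K (F y) (F u)) (lsum L K (map (%i. ml L K (G u ! i) (sb L K (y ! i) (u ! i))) [0..<length u]))))
       (ml L K ef (lsum L K (map (%i. ab L K (sb L K (y ! i) (u ! i))) [0..<length u])))" if y: "y : V" "near L K r y u" for y
   proof -
    have yt: "y : tuples K n" using y(1) Vt by blast
    have b: "box n (e r) (fl n u) (fl n y)" using nearK[OF u(1) yt] y(2) r(1) posK by blast
    have "box n dt (fl n u) (fl n y)" by (rule box_mono[OF b]) (use r(2) in simp)
    from dt(2)[OF this] have i: "\<bar>f (fl n y) - f (fl n u) - (\<Sum>i<n. pd i f (fl n u) * (fl n y i - fl n u i))\<bar> <= e ef * (\<Sum>i<n. \<bar>fl n y i - fl n u i\<bar>)" .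
    have t: "y ! i : univ K" "u ! i : univ K" if "i < n" for i using tup_nth[OF yt that] tup_nth[OF u(1) that] .
    let ?s1 = "lsum L K (map (%i. ml L K (G u ! i) (sb L K (y ! i) (u ! i))) [0..<n])"
    let ?s2 = "lsum L K (map (%i. ab L K (sb L K (y ! i) (u ! i))) [0..<n])"
    have 1: "?s1 : univ K & e ?s1 = (\<Sum>i<n. e (ml L K (G u ! i) (sb L K (y ! i) (u ! i))))"
     by (rule lsumK) (simp add: clK sbK t G(1)[OF u(1)])
    have 2: "?s2 : univ K & e ?s2 = (\<Sum>i<n. e (ab L K (sb L K (y ! i) (u ! i))))"
     by (rule lsumK) (simp add: abK sbK t)
    have 3: "(\<Sum>i<n. e (ml L K (G u ! i) (sb L K (y ! i) (u ! i)))) = (\<Sum>i<n. pd i f (fl n u) * (fl n y i - fl n u i))"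
     by (rule sum.cong) (simp_all add: eops sbK t G[OF u(1)] fl_def)
    have 4: "(\<Sum>i<n. e (ab L K (sb L K (y ! i) (u ! i)))) = (\<Sum>i<n. \<bar>fl n y i - fl n u i\<bar>)"
     by (rule sum.cong) (simp_all add: abK sbK t fl_def)
    show ?thesis unfolding lu using 1 2 i 3 4 F[OF yt] F[OF u(1)] ep(1) by (simp add: leK abK sbK clK eops)
   qed
   then show "EX dt. pos L K dt & (ALL y:V. near L K dt y u --> le L K (ab L K (sb L K (sb L K (F y) (F u)) (lsum L K (map (%i. ml L K (G u ! i) (sb L K (y ! i) (u ! i))) [0..<length u]))))
       (ml L K ef (lsum L K (map (%i. ab L K (sb L K (y ! i) (u ! i))) [0..<length u]))))" using r(1) by blast
  qed
  fix i ef assume i: "i < n" and "pos L K ef"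
  then have ep: "ef : univ K" "0 < e ef" by (simp_all add: posK)
  obtain dt where dt: "dt > 0" "!!y. box n dt (fl n u) y ==> \<bar>pd i f y - pd i f (fl n u)\<bar> < e ef"
   using Uc[OF u(2) i] ep(2) unfolding contn_def by blast
  obtain r where r: "pos L K r" "e r < dt" using small[OF dt(1)] by blast
  have "ls L K (ab L K (sb L K (G y ! i) (G u ! i))) ef" if y: "y : V" "near L K r y u" for y
  proof -
   have yt: "y : tuples K n" using y(1) Vt by blast
   have b: "box n (e r) (fl n u) (fl n y)" using nearK[OF u(1) yt] y(2) r(1) posK by blast
   have "box n dt (fl n u) (fl n y)" by (rule box_mono[OF b]) (use r(2) in simp)
   from dt(2)[OF this] show ?thesis using G[OF yt i] G[OF u(1) i] ep(1) by (simp add: eops abK sbK)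
  qed
  then show "EX dt. pos L K dt & (ALL y:V. near L K dt y u --> ls L K (ab L K (sb L K (G y ! i) (G u ! i))) ef)" using r(1) by blast
 qed
 define u where "u = map (%i. io (gm i)) [0..<n]"
 have ut: "u : tuples K n" using io(1) gm(2) by (auto simp: u_def tuples_def)
 have flu: "fl n u i = gm i" if "i < n" for i using io(2) gm(2) that by (simp add: fl_def u_def)
 have "U (fl n u) = U gm" by (rule depD[OF U(2)]) (rule flu)
 then have uV: "u : V" using ut gm(1) by (simp add: V_def)
 have fu: "f (fl n u) = f gm" by (rule depD[OF f(2)]) (rule flu)
 have pu: "pd i f (fl n u) = pd i f gm" if "i < n" for i by (rule depD[OF pd_dep[OF f(2) that]]) (rule flu)
 have dK: "d x : univ K" if "x : univ K" for x using td that unfolding tderiv_def by blast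
 have "d (F u) = lsum L K (map (%i. ml L K (G u ! i) (d (u ! i))) [0..<n])" using td op df C1 uV unfolding tderiv_def by blast
 moreover have "e (lsum L K (map (%i. ml L K (G u ! i) (d (u ! i))) [0..<n])) = (\<Sum>i<n. e (ml L K (G u ! i) (d (u ! i))))"
  using lsumK[of n "%i. ml L K (G u ! i) (d (u ! i))"] clK(5) G(1)[OF ut] dK tup_nth[OF ut] by blast
 moreover have "\<dots> = (\<Sum>i<n. pd i f gm * e (d (io (gm i))))"
  by (rule sum.cong) (use dK tup_nth[OF ut] in \<open>simp_all add: eops G[OF ut] pu\<close>, simp add: u_def)
 ultimately show "e (d (io (f gm))) = (\<Sum>i<n. pd i f gm * e (d (io (gm i))))" by (simp add: F_def fu)
qed

text \<open>A function on tuples is turned into one on valuations, with value 0 off its domain. Any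
  gradient given with it must consist of the partial derivatives, so the formal condition is the one
  encoded by \<open>tdE\<close>.\<close>

theorem tderiv_of_tdE: assumes td: "tdE UNIV d" shows "tderiv L N d"
 unfolding tderiv_def
proof (intro conjI allI impI ballI)
 show "d ` univ N <= univ N" by simp
 fix n U F G u
 assume "open_tup L N n U & def_fun L N {} n U F & C1_with L N n U F G" and u: "u : U"
 then have op: "open_tup L N n U" and dfu: "def_fun L N {} n U F" and C1: "C1_with L N n U F G" by blast+
 have UT: "U <= tuples N n" using op unfolding open_tup_def by blast
 define tup where "tup bt = map bt [0..<n]" for bt :: "nat => 'k"
 have tt: "tup bt : tuples N n" for bt by (simp add: tup_def tuples_def)
 have tn: "tup bt ! i = bt i" if "i < n" for bt i using that by (simp add: tup_def)
 have tl: "length (tup bt) = n" for bt by (simp add: tup_def)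
 have near: "near L N r (tup et) (tup gm) <-> box n r gm et" for r et gm unfolding near_def box_def tl using tn by simp
 define V where "V bt <-> tup bt : U" for bt
 define f where "f bt = (if V bt then F (tup bt) else 0)" for bt
 define P where "P bt <-> V bt & bt n = F (tup bt)" for bt
 have "D {} (%bt. map bt [0..<Suc n] : {xs @ [F xs] | xs. xs : U})" by (rule D_of_def_set) (use dfu in \<open>simp add: def_fun_def\<close>)
 moreover have "(map bt [0..<Suc n] : {xs @ [F xs] | xs. xs : U}) = P bt" for bt
  unfolding P_def V_def tup_def by auto
 ultimately have PD: "D {} P" by (simp only:)
 have tu: "tup (bt(n := y)) = tup bt" for bt y by (simp add: tup_def)
 have Pu: "P (bt(n := y)) <-> V bt & y = F (tup bt)" for bt y by (simp add: P_def V_def tu)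
 have PU: "D {} (%bt. P ((%i. bt (r i))(n := bt k)))" for r k by (rule D_upd[OF PD DF_var])
 have VP: "V bt = (EX y. P (bt(n := y)))" for bt by (simp add: Pu)
 have VD: "D {} V" unfolding VP[abs_def] by (rule D_ex[where Q = "%y bt. P (bt(n := y))"]) (rule PU)
 have fD: "DF {} f"
 proof (rule DF_I[where R = "%y bt. P (bt(n := y)) | (~ V bt & y = 0)"])
  show "D {} (%bt. P ((%i. bt (Suc i))(n := bt 0)) | ~ V (%i. bt (Suc i)) & bt 0 = 0)"
   by (intro D_base DF_base PU D_ren[OF VD, of Suc])
  show "y = f bt <-> P (bt(n := y)) | ~ V bt & y = 0" for bt y by (auto simp: f_def Pu)
 qed
 have tc: "tup bt = tup gm" if "ALL i<n. bt i = gm i" for bt gm using that by (simp add: tup_def)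
 have dep: "dep n V" "dep n f" unfolding dep_def V_def f_def using tc by metis+
 have Vo: "EX dt>0. ALL et. box n dt gm et --> V et" if v: "V gm" for gm
 proof -
  obtain dt where "pos L N dt" "ALL y:tuples N n. near L N dt y (tup gm) --> y : U" using op v unfolding open_tup_def V_def by blast
  then show ?thesis using near tt unfolding V_def posN by blast
 qed
 have gr: "gradat n f (%i. G (tup gm) ! i) gm" if V: "V gm" for gm unfolding gradat_def
 proof (intro allI impI)
  fix ef :: 'k assume "ef > 0"
  then have "pos L N ef" by simp
  have hg: "has_grad L N U F (G (tup gm)) (tup gm)" using C1 V unfolding C1_with_def V_def by blast
  obtain dt1 where d1: "pos L N dt1" "!!y. y : U ==> near L N dt1 y (tup gm) ==>
    le L N (ab L N (sb L N (sb L N (F y) (F (tup gm))) (lsum L N (map (%i. ml L N (G (tup gm) ! i) (sb L N (y ! i) (tup gm ! i))) [0..<length (tup gm)]))))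
       (ml L N ef (lsum L N (map (%i. ab L N (sb L N (y ! i) (tup gm ! i))) [0..<length (tup gm)])))"
   using hg \<open>pos L N ef\<close> unfolding has_grad_def by blast
  obtain dt2 where d2: "dt2 > 0" "!!et. box n dt2 gm et ==> V et" using Vo[OF V] by blast
  have lN: "lsum L N (map h [0..<n]) = (\<Sum>i<n. h i)" for h by (rule lsum_N) simp_all
  have "\<bar>f y - f gm - (\<Sum>i<n. G (tup gm) ! i * (y i - gm i))\<bar> <= ef * (\<Sum>i<n. \<bar>y i - gm i\<bar>)" if y: "box n (min dt1 dt2) gm y" for y
  proof -
   have b: "box n dt1 gm y" "box n dt2 gm y" by (rule box_mono[OF y], simp)+
   have Vy: "V y" by (rule d2(2)[OF b(2)])
   have s: "(\<Sum>i<n. G (tup gm) ! i * (tup y ! i - tup gm ! i)) = (\<Sum>i<n. G (tup gm) ! i * (y i - gm i))"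
    "(\<Sum>i<n. \<bar>tup y ! i - tup gm ! i\<bar>) = (\<Sum>i<n. \<bar>y i - gm i\<bar>)" by (rule sum.cong; simp add: tn)+
   have "le L N (\<bar>F (tup y) - F (tup gm) - (\<Sum>i<n. G (tup gm) ! i * (y i - gm i))\<bar>) (ef * (\<Sum>i<n. \<bar>y i - gm i\<bar>))"
    using d1(2)[of "tup y"] Vy near b(1) unfolding V_def tl lN by (simp add: s)
   then show ?thesis using Vy V by (auto simp: le_def f_def)
  qed
  then show "EX dt>0. ALL y. box n dt gm y --> \<bar>f y - f gm - (\<Sum>i<n. G (tup gm) ! i * (y i - gm i))\<bar> <= ef * (\<Sum>i<n. \<bar>y i - gm i\<bar>)"
   using d1(1) d2(1) by (intro exI[of _ "min dt1 dt2"]) simp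
 qed
 have pdG: "pd i f gm = G (tup gm) ! i" if "V gm" "i < n" for gm i
  unfolding pd_def by (rule derivk_eq[OF gradat_pd[OF gr[OF that(1)] that(2)]])
 have "c1f n f V" unfolding c1f_def
 proof (intro conjI allI impI fD dep VD)
  fix gm assume V: "V gm"
  show "EX dt>0. ALL et. box n dt gm et --> V et" by (rule Vo[OF V])
  show "gradat n f (%i. pd i f gm) gm" using gr[OF V] gradat_cong[of n "%i. pd i f gm" "%i. G (tup gm) ! i" f gm] pdG[OF V] by blast
  fix i assume i: "i < n"
  show "contn n (pd i f) gm" unfolding contn_def
  proof (intro allI impI)
   fix ef :: 'k assume "ef > 0"
   then have "pos L N ef" by simp
   then obtain dt1 where d1: "pos L N dt1" "!!y. y : U ==> near L N dt1 y (tup gm) ==> ls L N (ab L N (sb L N (G y ! i) (G (tup gm) ! i))) ef"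
    using C1 V i unfolding C1_with_def V_def by blast
   obtain dt2 where d2: "dt2 > 0" "!!et. box n dt2 gm et ==> V et" using Vo[OF V] by blast
   have "\<bar>pd i f y - pd i f gm\<bar> < ef" if y: "box n (min dt1 dt2) gm y" for y
   proof -
    have b: "box n dt1 gm y" "box n dt2 gm y" by (rule box_mono[OF y], simp)+
    have Vy: "V y" by (rule d2(2)[OF b(2)])
    have "ls L N (ab L N (sb L N (G (tup y) ! i) (G (tup gm) ! i))) ef" using d1(2) Vy near b(1) unfolding V_def by blast
    then show ?thesis by (simp add: pdG[OF Vy i] pdG[OF V i])
   qed
   then show "EX dt>0. ALL y. box n dt gm y --> \<bar>pd i f y - pd i f gm\<bar> < ef"
    using d1(1) d2(1) by (intro exI[of _ "min dt1 dt2"]) simp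
  qed
 qed
 moreover define gm where "gm i = (if i < n then u ! i else 0)" for i
 have lu: "length u = n" using u UT by (auto simp: tuples_def)
 have tg: "tup gm = u" by (rule nth_equalityI) (simp_all add: tl lu tn, simp add: gm_def)
 have Vgm: "V gm" using u by (simp add: V_def tg)
 ultimately have "d (f gm) = (\<Sum>i<n. pd i f gm * d (gm i))" using td unfolding tdE_def by blast
 moreover have "(\<Sum>i<n. pd i f gm * d (gm i)) = (\<Sum>i<n. G u ! i * d (u ! i))"
  by (rule sum.cong) (simp_all add: pdG[OF Vgm] tg, simp add: gm_def)
 moreover have "f gm = F u" using Vgm by (simp add: f_def tg)
 moreover have "lsum L N (map (%i. ml L N (G u ! i) (d (u ! i))) [0..<n]) = (\<Sum>i<n. G u ! i * d (u ! i))"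
  by (subst lsum_N) simp_all
 ultimately show "d (F u) = lsum L N (map (%i. ml L N (G u ! i) (d (u ! i))) [0..<n])" by simp
qed

lemma tdE_zero: assumes "tdE E d" shows "d 0 = 0"
proof -
 have "c1f 0 (%_. 0) (%_. True)" unfolding c1f_def
  by (intro conjI allI impI DF_0 D_True) (auto simp: dep_def gradat_def intro: exI[of _ 1])
 then have "d ((%_. 0) (%_. 0)) = (\<Sum>i<0. pd i (%_. 0) (%_. 0) * d ((%_. 0) i))" using assms unfolding tdE_def by blast
 then show ?thesis by simp
qed

lemma tdE_diff: assumes "tdE UNIV d" shows "d (x - y) = d x - d y"
proof -
 let ?f = "%bt::nat => 'k. bt 0 - bt 1"
 have h: "has_d (%x. x - b) a 1" "has_d (%x. b - x) a (- 1)" for a b :: 'k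
  unfolding has_d_def by (auto intro: exI[of _ 1])
 have p: "pd 0 ?f = (%_. 1)" "pd 1 ?f = (%_. - 1)" unfolding pd_def by (rule ext, simp add: derivk_eq[OF h(1)] derivk_eq[OF h(2)])+
 have s2: "(\<Sum>i<2. h i) = h 0 + h 1" for h :: "nat => 'k" by (simp add: numeral_2_eq_2)
 have "c1f 2 ?f (%_. True)" unfolding c1f_def
 proof (intro conjI allI impI)
  show "DF {} ?f" by (intro DF_base)
  show "dep 2 ?f" "dep 2 (%_. True)" by (auto simp: dep_def)
  show "D {} (%_. True)" by (rule D_True)
  show "EX dt>0. ALL et. box 2 dt gm et --> True" for gm by (auto intro: exI[of _ 1])
  fix gm :: "nat => 'k"
  have z: "(y 0 - y 1) - (gm 0 - gm 1) - (1 * (y 0 - gm 0) + - 1 * (y 1 - gm 1)) = 0" for y :: "nat => 'k" by (simp add: algebra_simps)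
  show "gradat 2 ?f (%i. pd i ?f gm) gm" unfolding gradat_def s2 p z by (auto intro: exI[of _ 1])
  show "contn 2 (pd i ?f) gm" if "i < 2" for i
  proof -
   have "i = 0 | i = 1" using that by auto
   then show ?thesis unfolding contn_def using p by (auto intro: exI[of _ 1])
  qed
 qed
 then have "d (?f (%i. if i = 0 then x else y)) = (\<Sum>i<2. pd i ?f (%i. if i = 0 then x else y) * d ((%i. if i = 0 then x else y) i))"
  using assms[unfolded tdE_def, rule_format, of 2 ?f "%_. True" "%i. if i = 0 then x else y"] by blast
 then show ?thesis unfolding s2 p by simp
qed

lemma ivK: assumes "x : univ K" "x ~= zr L K" shows "iv L K x : univ K & e (iv L K x) = 1 / e x"
proof -
 have x: "e x ~= 0" using e_inj[OF assms(1) clK(1)] assms(2) eops(1) by auto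
 have "1 / e x : KK" by (rule KK_DF) (intro DF_base DF_e assms(1))
 then obtain y where y: "y : univ K" "e y = 1 / e x" by (metis imageE)
 have "ml L K x y = on L K" by (rule e_inj) (use assms(1) y x in \<open>simp_all add: clK eops\<close>)
 moreover have "z = y" if "z : univ K" "ml L K x z = on L K" for z
 proof -
  have "e x * e z = 1" using that assms(1) eops(2,5) by metis
  then show ?thesis using e_inj[OF that(1) y(1)] y(2) x by (simp add: field_simps)
 qed
 ultimately have "iv L K x = y" unfolding iv_def using y(1) by blast
 then show ?thesis using y by simp
qed

lemma mideal_K: assumes "x : univ K" shows "x : mideal L K \<O> <-> sm (e x) 1"
proof -
 have 0: "x = zr L K <-> e x = 0" using e_inj[OF assms clK(1)] eops(1) by auto
 have "x : mideal L K \<O> <-> x : \<O> & (x = zr L K | iv L K x ~: \<O>)" by (auto simp: mideal_def)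
 also have "\<dots> <-> dm (e x) 1 & (e x = 0 | ~ dm (1 / e x) 1)"
  using ivK[OF assms] Ov_e[OF assms] Ov_e[of "iv L K x"] Ov_iff 0 by metis
 also have "\<dots> <-> sm (e x) 1"
 proof (cases "e x = 0")
  case False
  have "dm (1 / e x) 1 <-> dm 1 (e x)" using dm_mult_iff[OF False, of "1 / e x" 1] False by simp
  then show ?thesis using False not_dm sm_imp_dm by blast
 qed simp
 finally show ?thesis .
qed

lemma dvK_mideal: assumes "x : univ K" "g : nonzero L K" shows "dv L K x g : mideal L K \<O> <-> sm (e x) (e g)"
proof -
 have g: "g : univ K" "g ~= zr L K" using assms(2) by (auto simp: nonzero_def)
 have g0: "e g ~= 0" using e_inj[OF g(1) clK(1)] g(2) eops(1) by auto
 have d: "dv L K x g : univ K" "e (dv L K x g) = e x * (1 / e g)" using ivK[OF g] assms(1) by (simp_all add: dv_def clK eops)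
 have "sm (e x * (1 / e g)) 1 <-> sm (e g * (e x * (1 / e g))) (e g * 1)" by (rule sm_mult[OF g0, symmetric])
 then show ?thesis unfolding mideal_K[OF d(1)] d(2) using g0 by simp
qed

lemma nonzero_e: "g : nonzero L K ==> g : univ K & e g ~= 0"
 using e_inj[OF _ clK(1)] eops(1) by (auto simp: nonzero_def)

theorem immediate_e: "immediate L K \<O> N Ov e"
 unfolding immediate_def
proof (intro conjI ballI)
 fix y assume "y : nonzero L N"
 then have y: "y ~= 0" by simp
 then obtain g where g: "g : univ K" "sm (y - e g) (e g)" using imm by blast
 have g0: "e g ~= 0" using g(2) sm_0' by metis
 then have "g : nonzero L K" using g(1) eops(1) by (auto simp: nonzero_def)
 then show "EX x:nonzero L K. val L N Ov (e x) = val L N Ov y" using val_eq[OF g0 y] sm_asymp[OF g(2)] by blast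
next
 fix y assume "y : Ov"
 then have y: "dm y 1" by (simp add: Ov_iff)
 show "EX x:\<O>. sb L N y (e x) : mideal L N Ov"
 proof (cases "y = 0")
  case True
  have "zr L K : \<O>" using Ov_e[OF clK(1)] eops(1) Ov_0 by simp
  then show ?thesis using True by (intro bexI[of _ "zr L K"]) (simp_all add: mideal_iff eops)
 next
  case False
  then obtain g where g: "g : univ K" "sm (y - e g) (e g)" using imm by blast
  have d: "dm (e g) 1" using sm_asymp[OF g(2)] y dm_trans by blast
  then have "g : \<O>" using Ov_e[OF g(1)] Ov_iff by blast
  then show ?thesis using sm_dm[OF g(2) d] by (intro bexI[of _ g]) (simp_all add: mideal_iff)
 qed
qed

theorem derivation_lift:
 assumes sph: "sph_complete L N Ov" and td: "tderiv L K d" and vc: "vcont L K \<O> d"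
 shows "EX d'. tderiv L N d' & vcont L N Ov d' & ext_via L K \<O> d N Ov d' e & strict L K \<O> d N Ov d' e"
proof -
 define dd where "dd z = e (d (io z))" for z
 have dde: "dd (e x) = e (d x)" if "x : univ K" for x using io(3)[OF that] by (simp add: dd_def)
 have dK: "d x : univ K" if "x : univ K" for x using td that unfolding tderiv_def by blast
 have td': "tdE KK dd" using tdE_of_tderiv[OF td] unfolding dd_def .
 \<comment> \<open>All conditions of this kind valid on \<open>K\<close> are preserved together.
   Continuity uses the instances with \<open>sm z c\<close>, after subtracting the point considered;
   strictness uses \<open>sm z 1\<close> for the maximal ideal and \<open>dm z 1\<close> for the
   ring.\<close>
 define \<J> where "\<J> = {(J, ph). downc J & ph ~= 0 & (ALL z:KK. J z --> sm (dd z) ph)}"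
 obtain d' where g: "good \<J> dd UNIV d'" using derivation_extends[OF sph td', of \<J>] unfolding \<J>_def by blast
 have tN: "tdE UNIV d'" and ext: "!!x. x : univ K ==> d' (e x) = e (d x)"
  and J: "!!J ph z. (J, ph) : \<J> ==> J z ==> sm (d' z) ph" using g dde unfolding good_def by auto
 have ds: "downc (%z. sm z c)" "downc (%z. dm z c)" for c unfolding downc_def using dm_sm dm_trans by blast+
 have "vcont L N Ov d'" unfolding vcont_def
 proof (intro ballI)
  fix a ef assume "ef : nonzero L N"
  then have ep: "ef ~= 0" by simp
  then obtain g where g: "g : univ K" "sm (ef - e g) (e g)" using imm by blast
  have g0: "e g ~= 0" using g(2) sm_0' by metis
  then have gn: "g : nonzero L K" using g(1) eops(1) by (auto simp: nonzero_def)
  obtain c where c: "c : nonzero L K" "!!y. y : univ K ==> dv L K (sb L K y (zr L K)) c : mideal L K \<O> ==>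
    dv L K (sb L K (d y) (d (zr L K))) g : mideal L K \<O>" using vc clK(1) gn unfolding vcont_def by blast
  have d0: "e (d (zr L K)) = 0" using tdE_zero[OF td'] dde[OF clK(1)] eops(1) by simp
  have "sm (dd z) (e g)" if z: "z : KK" "sm z (e c)" for z
  proof -
   obtain x where x: "x : univ K" "z = e x" using z(1) by blast
   have "dv L K (sb L K x (zr L K)) c : mideal L K \<O>"
    using dvK_mideal[OF sbK(1)[OF x(1) clK(1)] c(1)] z(2) x by (simp add: sbK clK eops)
   from c(2)[OF x(1) this] have "sm (e (sb L K (d x) (d (zr L K)))) (e g)"
    using dvK_mideal[OF sbK(1)[OF dK[OF x(1)] dK[OF clK(1)]] gn] by blast
   then show ?thesis using dde[OF x(1)] d0 x(2) by (simp add: sbK dK x(1) clK)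
  qed
  then have *: "(%z. sm z (e c), e g) : \<J>" unfolding \<J>_def using ds(1) g0 by blast
  have c0: "e c ~= 0" using nonzero_e[OF c(1)] by blast
  show "EX c:nonzero L N. ALL y:univ N. dv L N (sb L N y a) c : mideal L N Ov --> dv L N (sb L N (d' y) (d' a)) ef : mideal L N Ov"
  proof (intro bexI[of _ "e c"] ballI impI)
   show "e c : nonzero L N" using c0 by simp
   fix y assume "dv L N (sb L N y a) (e c) : mideal L N Ov"
   then have "sm (y - a) (e c)" unfolding dvN_mideal[OF c0] by simp
   then have "sm (d' (y - a)) (e g)" by (rule J[OF *])
   then have "sm (d' y - d' a) ef" using tdE_diff[OF tN] sm_dm sm_asymp[OF g(2)] by metis
   then show "dv L N (sb L N (d' y) (d' a)) ef : mideal L N Ov" unfolding dvN_mideal[OF ep] by simp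
  qed
 qed
 moreover have "ext_via L K \<O> d N Ov d' e" unfolding ext_via_def using emb_e Ov_e ext by blast
 moreover have "strict L K \<O> d N Ov d' e" unfolding strict_def
 proof (intro ballI conjI impI)
  fix ph assume "ph : nonzero L K"
  then have ph: "ph : univ K" "e ph ~= 0" using nonzero_e by blast+
  have scl: "sm (e (d x)) (e ph)" if s: "d x : scl L K ph (mideal L K \<O>)" for x
  proof -
   obtain m where m: "m : mideal L K \<O>" "d x = ml L K ph m" using s unfolding scl_def by blast
   have mu: "m : univ K" using m(1) O_sub unfolding mideal_def by blast
   have "sm (e m) 1" using m(1) mideal_K[OF mu] by blast
   then have "sm (e ph * e m) (e ph * 1)" using sm_mult[OF ph(2)] by blast
   then show ?thesis using m(2) mu ph(1) by (simp add: eops)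
  qed
  show "d' ` mideal L N Ov <= scl L N (e ph) (mideal L N Ov)" if a: "d ` mideal L K \<O> <= scl L K ph (mideal L K \<O>)"
  proof -
   have "sm (dd z) (e ph)" if z: "z : KK" "sm z 1" for z
   proof -
    obtain x where x: "x : univ K" "z = e x" using z(1) by blast
    then have "x : mideal L K \<O>" using mideal_K z(2) by blast
    then show ?thesis using scl a x dde by auto
   qed
   then have *: "(%z. sm z 1, e ph) : \<J>" unfolding \<J>_def using ds(1) ph(2) by blast
   show ?thesis using J[OF *] by (auto simp: mideal_iff scl_mideal[OF ph(2)])
  qed
  show "d' ` Ov <= scl L N (e ph) (mideal L N Ov)" if a: "d ` \<O> <= scl L K ph (mideal L K \<O>)"
  proof -
   have "sm (dd z) (e ph)" if z: "z : KK" "dm z 1" for z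
   proof -
    obtain x where x: "x : univ K" "z = e x" using z(1) by blast
    then have "x : \<O>" using Ov_e[OF x(1)] Ov_iff z(2) by blast
    then show ?thesis using scl a x dde by auto
   qed
   then have *: "(%z. dm z 1, e ph) : \<J>" unfolding \<J>_def using ds(2) ph(2) by blast
   show ?thesis using J[OF *] by (auto simp: Ov_iff scl_mideal[OF ph(2)])
  qed
 qed
 ultimately show ?thesis using tderiv_of_tdE[OF tN] by blast
qed

text \<open>A family of balls witnessing the failure of spherical completeness is a nest in the
  sense of the germ construction. The leading term of a germ is replaced by an asymptotic element of
  \<open>K\<close>, so the extension is immediate over \<open>K\<close> itself.\<close>

theorem proper_extension:
 assumes pb: "pb L N" and nsph: "~ sph_complete L N Ov"
 shows "EX (M :: (('k => 'k) set, 'f, 'r) struc) h. struc_ok L M & range h <= univ M & elementary L N M h & ~ univ M <= range h &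
   (ALL y:univ M. y ~= zr L M --> (EX g:univ K. ALL c:\<O>. ls L M (ab L M (ml L M (h (e c)) (sb L M y (h (e g))))) (ab L M (h (e g)))))"
proof -
 obtain B where B: "B <= univ N \<times> nonzero L N" "ALL (a, g):B. ALL (b, h):B. cball_v L N Ov a g Int cball_v L N Ov b h ~= {}"
  "~ (EX y:univ N. ALL (a, g):B. y : cball_v L N Ov a g)" using nsph unfolding sph_complete_def by blast
 have B0: "g ~= 0" if "(a, g) : B" for a g using B(1) that by auto
 interpret pb L N by (rule pb)
 interpret nest L N Ov B
 proof unfold_locales
  show "g ~= 0" if "(a, g) : B" for a g using B0 that .
  show "EX y. dm (y - a) g & dm (y - b) h" if "(a, g) : B" "(b, h) : B" for a g b h
  proof -
   have "cball_v L N Ov a g Int cball_v L N Ov b h ~= {}" using B(2) that by blast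
   then show ?thesis using cball_iff[OF B0[OF that(1)]] cball_iff[OF B0[OF that(2)]] by blast
  qed
  show "EX (a, g):B. ~ dm (y - a) g" for y using B(3) cball_iff B0 by fastforce
 qed
 from germ_extension obtain M :: "(('k => 'k) set, 'f, 'r) struc" and h where
  M: "struc_ok L M & range h <= univ M & elementary L N M h & ~ univ M <= range h &
   (ALL y:univ M. y ~= zr L M --> (EX g. g ~= 0 &
    (ALL k. sm (g - k) k --> (ALL c:Ov. ls L M (ab L M (ml L M (h c) (sb L M y (h k)))) (ab L M (h k))))))"
  by (elim exE)
 have I: "EX g:univ K. ALL c:\<O>. ls L M (ab L M (ml L M (h (e c)) (sb L M y (h (e g))))) (ab L M (h (e g)))"
  if y: "y : univ M" "y ~= zr L M" for y
 proof -
  from M y have "EX g. g ~= 0 & (ALL k. sm (g - k) k --> (ALL c:Ov. ls L M (ab L M (ml L M (h c) (sb L M y (h k)))) (ab L M (h k))))"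
   by (simp only: simp_thms)
  then obtain g where g: "g ~= 0" "ALL k. sm (g - k) k --> (ALL c:Ov. ls L M (ab L M (ml L M (h c) (sb L M y (h k)))) (ab L M (h k)))"
   by (elim exE conjE)
  obtain q where q: "q : univ K" "sm (g - e q) (e q)" using imm[OF g(1)] by blast
  have l: "ALL c:Ov. ls L M (ab L M (ml L M (h c) (sb L M y (h (e q))))) (ab L M (h (e q)))" using g(2) q(2) by (elim allE[of _ "e q"] impE)
  have "ALL c:\<O>. ls L M (ab L M (ml L M (h (e c)) (sb L M y (h (e q))))) (ab L M (h (e q)))"
  proof
   fix c assume "c : \<O>"
   then have "e c : Ov" by (rule OvI) simp
   then show "ls L M (ab L M (ml L M (h (e c)) (sb L M y (h (e q))))) (ab L M (h (e q)))" by (rule bspec[OF l])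
  qed
  then show ?thesis using q(1) by (rule bexI)
 qed
 show ?thesis by (intro exI[of _ M] exI[of _ h] conjI ballI impI I) (use M in \<open>simp_all only: simp_thms\<close>)
qed

end

section \<open>Transport of structure along an injection\<close>

definition push :: "('k => 'u) => ('k,'f,'r) struc => ('u,'f,'r) struc" where
 "push j N = \<lparr>univ = j ` univ N, fint = (%f xs. j (fint N f (map (inv_into (univ N) j) xs))),
   rint = (%r xs. rint N r (map (inv_into (univ N) j) xs))\<rparr>"

lemma push_simps: "univ (push j N) = j ` univ N" "fint (push j N) f xs = j (fint N f (map (inv_into (univ N) j) xs))"
 "rint (push j N) r xs = rint N r (map (inv_into (univ N) j) xs)" by (simp_all add: push_def)

lemma map_inv: assumes "inj_on j (univ N)" "set xs <= univ N" shows "map (inv_into (univ N) j) (map j xs) = xs"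
 using assms by (induction xs) auto

lemma eval_univ: assumes "struc_ok L N" "!!i. bt i : univ N" shows "wf_trm L t ==> eval_trm N bt t : univ N"
proof (induction t)
 case (Fn f ts)
 then have "set (map (eval_trm N bt) ts) <= univ N" by (auto simp: list_all_iff)
 then show ?case using assms(1) Fn.prems unfolding struc_ok_def by simp
qed (use assms in simp)

lemma eval_push: assumes "struc_ok L N" "inj_on j (univ N)" "!!i. bt i : univ N"
 shows "wf_trm L t ==> eval_trm (push j N) (j \<circ> bt) t = j (eval_trm N bt t)"
proof (induction t)
 case (Fn f ts)
 have *: "eval_trm (push j N) (j \<circ> bt) t = j (eval_trm N bt t)" if t: "t : set ts" for t
  by (rule Fn.IH[OF t]) (use Fn.prems t in \<open>auto simp: list_all_iff\<close>)
 have "map (eval_trm (push j N) (j \<circ> bt)) ts = map j (map (eval_trm N bt) ts)"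
  unfolding map_map by (rule map_cong[OF refl]) (simp only: o_apply *)
 moreover have "set (map (eval_trm N bt) ts) <= univ N" using Fn.prems eval_univ[OF assms(1,3)] by (auto simp: list_all_iff)
 ultimately show ?case using map_inv[OF assms(2)] by (simp only: eval_trm.simps push_simps)
qed simp

lemma sat_push: assumes "struc_ok L N" "inj_on j (univ N)"
 shows "wf_fm L ph ==> (!!i. bt i : univ N) ==> sat (push j N) (j \<circ> bt) ph <-> sat N bt ph"
proof (induction ph arbitrary: bt)
 case (Eq s t)
 then have w: "wf_trm L s" "wf_trm L t" by simp_all
 note u = eval_univ[OF assms(1) Eq.prems(2) w(1)] eval_univ[OF assms(1) Eq.prems(2) w(2)]
 show ?case unfolding sat.simps eval_push[OF assms Eq.prems(2) w(1)] eval_push[OF assms Eq.prems(2) w(2)]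
  by (rule inj_on_eq_iff[OF assms(2) u])
next
 case (Rl r ts)
 have *: "eval_trm (push j N) (j \<circ> bt) t = j (eval_trm N bt t)" if t: "t : set ts" for t
  by (rule eval_push[OF assms Rl.prems(2)]) (use Rl.prems(1) t in \<open>auto simp: list_all_iff\<close>)
 have "map (eval_trm (push j N) (j \<circ> bt)) ts = map j (map (eval_trm N bt) ts)"
  unfolding map_map by (rule map_cong[OF refl]) (simp only: o_apply *)
 moreover have "set (map (eval_trm N bt) ts) <= univ N" using Rl.prems eval_univ[OF assms(1) Rl.prems(2)] by (auto simp: list_all_iff)
 ultimately show ?case using map_inv[OF assms(2)] by (simp only: sat.simps push_simps)
next
 case (Ex x ph)
 have "sat (push j N) ((j \<circ> bt)(x := j a)) ph <-> sat N (bt(x := a)) ph" if "a : univ N" for a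
 proof -
  have e: "(j \<circ> bt)(x := j a) = j \<circ> bt(x := a)" by auto
  show ?thesis unfolding e by (rule Ex.IH) (use Ex.prems that in auto)
 qed
 then show ?case unfolding sat.simps push_simps by blast
qed auto

lemma push_ok: assumes "struc_ok L N" "inj_on j (univ N)" shows "struc_ok L (push j N)"
 unfolding struc_ok_def
proof (intro conjI allI impI)
 show "univ (push j N) ~= {}" using assms(1) by (simp add: push_simps struc_ok_def)
 fix f xs assume *: "length xs = fun_ar L f & set xs <= univ (push j N)"
 then have "set (map (inv_into (univ N) j) xs) <= univ N" by (auto simp: push_simps inv_into_into)
 then show "fint (push j N) f xs : univ (push j N)" using assms(1) * by (auto simp: push_simps struc_ok_def)
qed

lemma push_elementary: "struc_ok L N ==> inj_on j (univ N) ==> elementary L N (push j N) j"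
 unfolding elementary_def using sat_push by blast

lemma elementary_maps: assumes "elementary L K M e" "struc_ok L K" shows "x : univ K ==> e x : univ M"
proof -
 assume x: "x : univ K"
 have "sat K (%_. x) (Ex 0 (Eq (Var 0) (Var 1))) <-> sat M (e \<circ> (%_. x)) (Ex 0 (Eq (Var 0) (Var 1)))"
  using assms(1) x unfolding elementary_def by (metis wf_fm.simps(1,5) wf_trm.simps(1))
 then show ?thesis using x by auto
qed

lemma elementary_trans: assumes "elementary L K M e" "elementary L M N h" "struc_ok L K" shows "elementary L K N (h \<circ> e)"
 unfolding elementary_def
proof (intro allI impI)
 fix ph bt assume *: "wf_fm L ph & (ALL i::nat. bt i : univ K)"
 then have "sat K bt ph <-> sat M (e \<circ> bt) ph" using assms(1) unfolding elementary_def by blast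
 also have "\<dots> <-> sat N (h \<circ> (e \<circ> bt)) ph"
  using assms(2) * elementary_maps[OF assms(1,3)] unfolding elementary_def by simp
 finally show "sat K bt ph <-> sat N (h \<circ> e \<circ> bt) ph" by (simp only: o_assoc)
qed

text \<open>Kept apart from \<open>ps\<close> because o-minimality of \<open>N\<close> is itself
  obtained by transport: \<open>N\<close> is copied into the type on which the hypotheses on
  \<open>T\<close> hold, and the property is pulled back.\<close>

locale ps0 =
 fixes L :: "('f,'r) lang" and N :: "('k,'f,'r) struc" and j :: "'k => 'u"
 assumes j: "inj j" and Nok: "struc_ok L N" and UN0 [simp]: "univ N = UNIV"
begin

definition M where "M = push j N"

lemma pj [simp]: "inv j (j x) = x" using j by simp
lemma jmem [simp]: "j x : j ` S <-> x : S" using j by (rule inj_image_mem_iff)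
lemma jeq [simp]: "j x = j y <-> x = y" using j by (simp add: inj_eq)
lemma uM [simp]: "univ M = range j" by (simp add: M_def push_simps)
lemma fM: "fint M f (map j xs) = j (fint N f xs)" by (simp add: M_def push_simps o_def)
lemma rM: "rint M r (map j xs) = rint N r xs" by (simp add: M_def push_simps o_def)

lemma satM: "wf_fm L ph ==> sat M (j \<circ> bt) ph <-> sat N bt ph"
 unfolding M_def by (rule sat_push[OF Nok]) (simp_all add: j)

lemma def_set_pull: assumes "def_set L M (j ` A) n S" shows "def_set L N A n {xs. length xs = n & map j xs : S}"
proof -
 obtain ph bt where ph: "wf_fm L ph" "ALL i:fv ph. n <= i --> bt i : j ` A" and S: "S = {xs : tuples M n. sat M (asg xs bt) ph}"
  using assms unfolding def_set_def by blast
 have "map j xs : S <-> sat N (asg xs (inv j \<circ> bt)) ph" if xs: "length xs = n" for xs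
 proof -
  have "sat M (asg (map j xs) bt) ph <-> sat M (j \<circ> asg xs (inv j \<circ> bt)) ph"
  proof (rule sat_cong)
   fix i assume i: "i : fv ph"
   show "asg (map j xs) bt i = (j \<circ> asg xs (inv j \<circ> bt)) i"
   proof (cases "i < n")
    case False
    then obtain a where "bt i = j a" using ph(2) i by auto
    then show ?thesis using False xs by (simp add: asg_def)
   qed (use xs in \<open>simp add: asg_def\<close>)
  qed
  then show ?thesis using satM[OF ph(1)] xs by (auto simp: S tuples_def)
 qed
 then have "{xs. length xs = n & map j xs : S} = {xs : tuples N n. sat N (asg xs (inv j \<circ> bt)) ph}" by (auto simp: tuples_def)
 moreover have "ALL i:fv ph. n <= i --> (inv j \<circ> bt) i : A" using ph(2) by (metis comp_apply imageE pj)
 ultimately show ?thesis unfolding def_set_def using ph(1) by blast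
qed

lemma def_set_push: assumes "def_set L N A n S" shows "def_set L M (j ` A) n (map j ` S)"
proof -
 obtain ph bt where ph: "wf_fm L ph" "ALL i:fv ph. n <= i --> bt i : A" and S: "S = {xs : tuples N n. sat N (asg xs bt) ph}"
  using assms unfolding def_set_def by blast
 have a: "j \<circ> asg xs bt = asg (map j xs) (j \<circ> bt)" for xs by (auto simp: asg_def)
 have "map j ` S = {xs : tuples M n. sat M (asg xs (j \<circ> bt)) ph}"
 proof (intro equalityI subsetI)
  fix ys assume "ys : {xs : tuples M n. sat M (asg xs (j \<circ> bt)) ph}"
  then have ys: "length ys = n" "set ys <= range j" "sat M (asg ys (j \<circ> bt)) ph" by (auto simp: tuples_def)
  then obtain xs where xs: "ys = map j xs" by (metis ex_map_conv subset_iff rangeE)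
  then show "ys : map j ` S" using ys satM[OF ph(1)] unfolding xs by (auto simp: S tuples_def a[symmetric])
 qed (auto simp: S tuples_def a[symmetric] satM[OF ph(1)])
 then show ?thesis unfolding def_set_def using ph by (intro exI[of _ ph] exI[of _ "j \<circ> bt"]) auto
qed

end

locale ps = omf L N + ps0 L N j for L :: "('f,'r) lang" and N :: "('k::linordered_field,'f,'r) struc" and j :: "'k => 'u"
begin

lemma opM [simp]: "zr L M = j 0" "on L M = j 1" "ad L M (j x) (j y) = j (x + y)" "ng L M (j x) = j (- x)" "ml L M (j x) (j y) = j (x * y)"
 "ls L M (j x) (j y) <-> x < y"
 unfolding zrN[symmetric] onN[symmetric] adN[symmetric] ngN[symmetric] mlN[symmetric] lsN[symmetric]
 using fM[of "sym_zero L" "[]"] fM[of "sym_one L" "[]"] fM[of "sym_add L" "[x, y]"] fM[of "sym_neg L" "[x]"] fM[of "sym_mul L" "[x, y]"] rM[of "sym_less L" "[x, y]"]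
 by (simp_all add: zr_def on_def ad_def ng_def ml_def ls_def)

lemma opM2 [simp]: "sb L M (j x) (j y) = j (x - y)" "ab L M (j x) = j \<bar>x\<bar>" "le L M (j x) (j y) <-> x <= y" "pos L M (j x) <-> 0 < x"
 by (auto simp: sb_def ab_def le_def pos_def abs_if)

lemma posM: "pos L M z <-> (EX x. z = j x & 0 < x)" by (auto simp: pos_def)

lemma ivM: "x ~= 0 ==> iv L M (j x) = j (inverse x)"
 unfolding iv_def by (rule the_equality) (auto simp: field_simps)
lemma dvM: "y ~= 0 ==> dv L M (j x) (j y) = j (x / y)" by (simp add: dv_def ivM divide_inverse)
lemma nzM: "nonzero L M = j ` nonzero L N" by (auto simp: nonzero_def)
lemma midM: "mideal L M (j ` S) = j ` mideal L N S"
proof -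
 have "j x : mideal L M (j ` S) <-> x : mideal L N S" for x
  by (cases "x = 0") (auto simp: mideal_def ivM ivN)
 moreover have "mideal L M (j ` S) <= range j" by (auto simp: mideal_def)
 ultimately show ?thesis by blast
qed
lemma unM: "units L M (j ` S) = j ` units L N S" unfolding units_def midM by (simp add: image_set_diff[OF j])
lemma sclM: "scl L M (j ph) (j ` S) = j ` scl L N ph S" by (force simp: scl_def)
lemma valM: "val L M (j ` S) (j x) = j ` val L N S x"
proof -
 have "j y : val L M (j ` S) (j x) <-> y : val L N S x" for y
  by (cases "y = 0") (auto simp: val_def nzM unM dvM dvN nonzero_def)
 moreover have "val L M (j ` S) (j x) <= range j" by (auto simp: val_def nonzero_def)
 ultimately show ?thesis by blast
qed
lemma cbM: "g ~= 0 ==> cball_v L M (j ` S) (j a) (j g) = j ` cball_v L N S a g"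
 by (auto simp: cball_v_def dvM dvN)

lemma contM: "cont_at L M F (j x) ==> (!!y. F (j y) = j (G y)) ==> cont_at L N G x"
proof -
 assume c: "cont_at L M F (j x)" and FG: "!!y. F (j y) = j (G y)"
 show ?thesis unfolding cont_at_def
 proof (intro allI impI)
  fix ef assume "pos L N ef"
  then have "pos L M (j ef)" by simp
  then obtain dt where d: "pos L M dt" "ALL y:univ M. ls L M (ab L M (sb L M y (j x))) dt --> ls L M (ab L M (sb L M (F y) (F (j x)))) (j ef)"
   using c unfolding cont_at_def by blast
  obtain r where r: "dt = j r" "0 < r" using d(1) unfolding posM by blast
  have "ls L N (ab L N (sb L N (G y) (G x))) ef" if "ls L N (ab L N (sb L N y x)) r" for y
   using bspec[OF d(2), of "j y"] that by (simp add: r FG)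
  then show "EX dt. pos L N dt & (ALL y:univ N. ls L N (ab L N (sb L N y x)) dt --> ls L N (ab L N (sb L N (G y) (G x))) ef)"
   using r(2) by (intro exI[of _ r]) simp
 qed
qed

lemma tconvexM: assumes "tconvex L N S" shows "tconvex L M (j ` S)"
 unfolding tconvex_def
proof (intro conjI ballI allI impI)
 show "j ` S <= univ M" "j ` S ~= {}" using assms by (auto simp: tconvex_def)
 fix x z y assume xz: "x : j ` S" "z : j ` S" "y : univ M" "le L M x y & le L M y z"
 then obtain a b c where abc: "x = j a" "a : S" "z = j b" "b : S" "y = j c" by auto
 then have "le L N a c & le L N c b" using xz(4) by (auto simp: le_def)
 then have "c : S" using assms abc(2,4) unfolding tconvex_def by (metis UN UNIV_I)
 then show "y : j ` S" using abc(5) by simp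
next
 fix F assume F: "def_fun1 L M {} F & (ALL x:univ M. cont_at L M F x)"
 define G where "G x = inv j (F (j x))" for x
 have FG: "F (j x) = j (G x)" for x using F unfolding def_fun1_def G_def by (auto simp: f_inv_into_f)
 have "def_set L N {} 2 {xs. length xs = 2 & map j xs : {[x, F x] | x. x : univ M}}"
  by (rule def_set_pull) (use F in \<open>simp add: def_fun1_def\<close>)
 moreover have "{xs. length xs = 2 & map j xs : {[x, F x] | x. x : univ M}} = {[x, G x] | x. x : univ N}"
  by (auto simp: FG length_Suc_conv numeral_2_eq_2)
 ultimately have "def_fun1 L N {} G" by (simp add: def_fun1_def)
 moreover have "ALL x:univ N. cont_at L N G x"
 proof
  fix x
  have "cont_at L M F (j x)" using F by simp
  then show "cont_at L N G x" by (rule contM) (rule FG)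
 qed
 ultimately have "G ` S <= S" using assms unfolding tconvex_def by blast
 then show "F ` (j ` S) <= j ` S" using FG by auto
qed

lemma lsumM: "lsum L M (map (%i. j (h i)) [0..<n]) = j (\<Sum>i<n. h i)"
proof -
 have "foldr (ad L M) (map j xs) (zr L M) = j (sum_list xs)" for xs by (induction xs) simp_all
 from this[of "map h [0..<n]"] show ?thesis by (simp add: lsum_def sum_list_sum_nth atLeast0LessThan o_def)
qed

lemma lsumN: "lsum L N (map h [0..<n]) = (\<Sum>i<n. h i)" by (rule lsum_N) simp_all

lemma nearM: "length x = n ==> length y = n ==> near L M (j r) (map j y) (map j x) <-> near L N r y x" by (simp add: near_def)

lemma tderivM: assumes td: "tderiv L N d" shows "tderiv L M (%z. j (d (inv j z)))"
 unfolding tderiv_def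
proof (intro conjI allI impI ballI)
 show "(%z. j (d (inv j z))) ` univ M <= univ M" by auto
 fix n U F H u0
 assume "open_tup L M n U & def_fun L M {} n U F & C1_with L M n U F H" and u0: "u0 : U"
 then have op: "open_tup L M n U" and dfu: "def_fun L M {} n U F" and C1: "C1_with L M n U F H" by blast+
 have UT: "U <= tuples M n" using op unfolding open_tup_def by blast
 define V where "V = {xs. length xs = n & map j xs : U}"
 define G where "G xs = inv j (F (map j xs))" for xs
 define E where "E xs = map (inv j) (H (map j xs))" for xs
 have VU: "EX xs:V. ys = map j xs" if "ys : U" for ys
 proof -
  have "length ys = n" "set ys <= range j" using that UT by (auto simp: tuples_def)
  then obtain xs where "ys = map j xs" by (metis ex_map_conv subset_iff rangeE)
  then show ?thesis using that \<open>length ys = n\<close> by (auto simp: V_def)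
 qed
 have VT: "V <= tuples N n" by (auto simp: V_def tuples_def)
 have FG: "F (map j xs) = j (G xs)" if "xs : V" for xs using dfu that unfolding def_fun_def V_def G_def by (auto simp: f_inv_into_f)
 have hg: "has_grad L M U F (H (map j xs)) (map j xs)" if "xs : V" for xs using C1 that unfolding C1_with_def V_def by blast
 have HE: "H (map j xs) = map j (E xs)" "length (E xs) = n" if "xs : V" for xs
 proof -
  have h: "length (H (map j xs)) = n" "set (H (map j xs)) <= range j" using hg[OF that] that unfolding has_grad_def V_def by auto
  have "map (%x. j (inv j x)) ys = ys" if "set ys <= range j" for ys using that by (induction ys) (auto simp: f_inv_into_f)
  then show "H (map j xs) = map j (E xs)" "length (E xs) = n" using h by (simp_all add: E_def o_def)
 qed
 have op': "open_tup L N n V" unfolding open_tup_def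
 proof (intro conjI ballI VT)
  fix u assume u: "u : V"
  then have "map j u : U" "length u = n" by (auto simp: V_def)
  then obtain dt where dt: "pos L M dt" "ALL y:tuples M n. near L M dt y (map j u) --> y : U" using op unfolding open_tup_def by blast
  then obtain r where r: "dt = j r" "0 < r" unfolding posM by blast
  have "y : V" if y: "y : tuples N n" "near L N r y u" for y
  proof -
   have "length y = n" using y(1) by (simp add: tuples_def)
   moreover have "map j y : tuples M n" using \<open>length y = n\<close> by (auto simp: tuples_def)
   then have "map j y : U" using dt(2) nearM[OF \<open>length u = n\<close> \<open>length y = n\<close>] y(2) unfolding r(1) by blast
   ultimately show ?thesis by (simp add: V_def)
  qed
  then show "EX dt. pos L N dt & (ALL y:tuples N n. near L N dt y u --> y : V)" using r(2) by (intro exI[of _ r]) simp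
 qed
 have df': "def_fun L N {} n V G" unfolding def_fun_def
 proof (intro conjI ballI VT)
  have "def_set L N {} (Suc n) {xs. length xs = Suc n & map j xs : {xs @ [F xs] | xs. xs : U}}"
   by (rule def_set_pull) (use dfu in \<open>simp add: def_fun_def\<close>)
  moreover have "{xs. length xs = Suc n & map j xs : {xs @ [F xs] | xs. xs : U}} = {xs @ [G xs] | xs. xs : V}"
  proof (intro equalityI subsetI)
   fix zs assume "zs : {xs. length xs = Suc n & map j xs : {xs @ [F xs] | xs. xs : U}}"
   then obtain ys where ys: "length zs = Suc n" "map j zs = ys @ [F ys]" "ys : U" by blast
   obtain xs z where z: "zs = xs @ [z]" "length xs = n" using ys(1) by (auto simp: length_Suc_conv_rev)
   have "map j xs = ys" "j z = F ys" using ys(2) unfolding z(1) by auto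
   moreover from this have "xs : V" using z(2) ys(3) by (simp add: V_def)
   ultimately have "z = G xs" using FG[of xs] by auto
   then show "zs : {xs @ [G xs] | xs. xs : V}" using z(1) \<open>xs : V\<close> by blast
  next
   fix zs assume "zs : {xs @ [G xs] | xs. xs : V}"
   then obtain xs where xs: "zs = xs @ [G xs]" "xs : V" by blast
   then have "length zs = Suc n" "map j zs = map j xs @ [F (map j xs)]" "map j xs : U" using FG by (auto simp: V_def)
   then show "zs : {xs. length xs = Suc n & map j xs : {xs @ [F xs] | xs. xs : U}}" by blast
  qed
  ultimately show "def_set L N {} (Suc n) {xs @ [G xs] | xs. xs : V}" by simp
 qed simp
 have C1': "C1_with L N n V G E" unfolding C1_with_def
 proof (intro conjI ballI allI impI)
  fix u assume u: "u : V"
  then have lu: "length u = n" by (simp add: V_def)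
  note uU = u[unfolded V_def, simplified, THEN conjunct2]
  show "has_grad L N V G (E u) u" unfolding has_grad_def
  proof (intro conjI allI impI)
   show "length (E u) = length u" "set (E u) <= univ N" using HE[OF u] lu by simp_all
   fix ef assume "pos L N ef"
   then have "pos L M (j ef)" by simp
   then obtain dt where dt: "pos L M dt" "!!y. y : U ==> near L M dt y (map j u) ==>
     le L M (ab L M (sb L M (sb L M (F y) (F (map j u))) (lsum L M (map (%i. ml L M (H (map j u) ! i) (sb L M (y ! i) (map j u ! i))) [0..<length (map j u)]))))
       (ml L M (j ef) (lsum L M (map (%i. ab L M (sb L M (y ! i) (map j u ! i))) [0..<length (map j u)])))"
    using hg[OF u] unfolding has_grad_def by blast
   obtain r where r: "dt = j r" "0 < r" using dt(1) unfolding posM by blast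
   have "le L N (ab L N (sb L N (sb L N (G y) (G u)) (lsum L N (map (%i. ml L N (E u ! i) (sb L N (y ! i) (u ! i))) [0..<length u]))))
       (ml L N ef (lsum L N (map (%i. ab L N (sb L N (y ! i) (u ! i))) [0..<length u])))" if y: "y : V" "near L N r y u" for y
   proof -
    have ly: "length y = n" "map j y : U" using y(1) by (simp_all add: V_def)
    have n: "near L M dt (map j y) (map j u)" unfolding r(1) using nearM[OF lu ly(1)] y(2) by blast
    have 1: "map (%i. ml L M (H (map j u) ! i) (sb L M (map j y ! i) (map j u ! i))) [0..<n] = map (%i. j (E u ! i * (y ! i - u ! i))) [0..<n]"
     by (rule map_cong[OF refl]) (simp add: HE[OF u] lu ly)
    have 2: "map (%i. ab L M (sb L M (map j y ! i) (map j u ! i))) [0..<n] = map (%i. j \<bar>y ! i - u ! i\<bar>) [0..<n]"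
     by (rule map_cong[OF refl]) (simp add: lu ly)
    show ?thesis using dt(2)[OF ly(2) n] unfolding length_map lu 1 2 lsumM lsumN FG[OF y(1)] FG[OF u] by (simp add: le_def le_less)
   qed
   then show "EX dt. pos L N dt & (ALL y:V. near L N dt y u --> le L N (ab L N (sb L N (sb L N (G y) (G u)) (lsum L N (map (%i. ml L N (E u ! i) (sb L N (y ! i) (u ! i))) [0..<length u]))))
       (ml L N ef (lsum L N (map (%i. ab L N (sb L N (y ! i) (u ! i))) [0..<length u]))))" using r(2) by (intro exI[of _ r]) simp
  qed
  fix i ef assume i: "i < n" and "pos L N ef"
  then have "pos L M (j ef)" by simp
  then obtain dt where dt: "pos L M dt" "!!y. y : U ==> near L M dt y (map j u) ==> ls L M (ab L M (sb L M (H y ! i) (H (map j u) ! i))) (j ef)"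
   using C1 i uU unfolding C1_with_def by blast
  obtain r where r: "dt = j r" "0 < r" using dt(1) unfolding posM by blast
  have "ls L N (ab L N (sb L N (E y ! i) (E u ! i))) ef" if y: "y : V" "near L N r y u" for y
  proof -
   have ly: "length y = n" "map j y : U" using y(1) by (simp_all add: V_def)
   have n: "near L M dt (map j y) (map j u)" unfolding r(1) using nearM[OF lu ly(1)] y(2) by blast
   show ?thesis using dt(2)[OF ly(2) n] i by (simp add: HE[OF u] HE[OF y(1)])
  qed
  then show "EX dt. pos L N dt & (ALL y:V. near L N dt y u --> ls L N (ab L N (sb L N (E y ! i) (E u ! i))) ef)" using r(2) by (intro exI[of _ r]) simp
 qed
 obtain u where u: "u : V" "u0 = map j u" using VU[OF u0] by blast
 have lu: "length u = n" using u(1) by (simp add: V_def)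
 have "d (G u) = lsum L N (map (%i. ml L N (E u ! i) (d (u ! i))) [0..<n])" using td op' df' C1' u(1) unfolding tderiv_def by blast
 then have 1: "d (G u) = (\<Sum>i<n. E u ! i * d (u ! i))" by (simp add: lsumN)
 have 2: "map (%i. ml L M (H u0 ! i) (j (d (inv j (u0 ! i))))) [0..<n] = map (%i. j (E u ! i * d (u ! i))) [0..<n]"
  unfolding u(2) by (rule map_cong[OF refl]) (simp add: HE[OF u(1)] lu)
 show "j (d (inv j (F u0))) = lsum L M (map (%i. ml L M (H u0 ! i) (j (d (inv j (u0 ! i))))) [0..<n])"
  unfolding 2 lsumM by (simp only: u(2) FG[OF u(1)] pj 1)
qed

lemma vcontM: assumes "vcont L N S d" shows "vcont L M (j ` S) (%z. j (d (inv j z)))"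
 unfolding vcont_def
proof (intro ballI)
 fix a ef assume "a : univ M" "ef : nonzero L M"
 then obtain a' e' where a: "a = j a'" "ef = j e'" "e' ~= 0" by (auto simp: nzM nonzero_def)
 then obtain c where c: "c ~= 0" "!!y. dv L N (y - a') c : mideal L N S ==> dv L N (d y - d a') e' : mideal L N S"
  using assms unfolding vcont_def nonzero_def by (force simp: sbN)
 show "EX c:nonzero L M. ALL y:univ M. dv L M (sb L M y a) c : mideal L M (j ` S) -->
   dv L M (sb L M (j (d (inv j y))) (j (d (inv j a)))) ef : mideal L M (j ` S)"
  by (rule bexI[of _ "j c"]) (use c a(3) in \<open>auto simp: a dvM midM nzM nonzero_def dvN\<close>)
qed

lemma sphM: assumes "sph_complete L N S" shows "sph_complete L M (j ` S)"
 unfolding sph_complete_def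
proof (intro allI impI)
 fix B assume B: "B <= univ M \<times> nonzero L M" "ALL (a, g):B. ALL (b, h):B. cball_v L M (j ` S) a g Int cball_v L M (j ` S) b h ~= {}"
 define B' where "B' = {(a, g). (j a, j g) : B}"
 have nz: "g ~= 0" if "(a, g) : B'" for a g using subsetD[OF B(1), of "(j a, j g)"] that by (auto simp: B'_def nzM nonzero_def)
 have "B' <= univ N \<times> nonzero L N" using nz by (auto simp: nonzero_def)
 moreover have "ALL (a, g):B'. ALL (b, h):B'. cball_v L N S a g Int cball_v L N S b h ~= {}"
 proof (intro ballI, clarify)
  fix a g b h assume ab: "(a, g) : B'" "(b, h) : B'" and e: "cball_v L N S a g Int cball_v L N S b h = {}"
  have "cball_v L M (j ` S) (j a) (j g) Int cball_v L M (j ` S) (j b) (j h) ~= {}" using B(2) ab unfolding B'_def by blast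
  then show False using e unfolding cbM[OF nz[OF ab(1)]] cbM[OF nz[OF ab(2)]] image_Int[OF j, symmetric] by simp
 qed
 ultimately obtain y where y: "ALL (a, g):B'. y : cball_v L N S a g" using assms unfolding sph_complete_def by blast
 show "EX y:univ M. ALL (a, g):B. y : cball_v L M (j ` S) a g"
 proof (intro bexI[of _ "j y"] ballI, clarify)
  fix a g assume ag: "(a, g) : B"
  then obtain a' g' where a': "a = j a'" "g = j g'" using B(1) by (auto simp: nzM)
  then have b: "(a', g') : B'" using ag by (simp add: B'_def)
  then show "j y : cball_v L M (j ` S) a g" using y unfolding a' cbM[OF nz[OF b]] by auto
 qed simp
qed

lemma immediateM: assumes "immediate L K \<O> N S e" shows "immediate L K \<O> M (j ` S) (j \<circ> e)"
 unfolding immediate_def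
proof (intro conjI ballI)
 fix y assume "y : nonzero L M"
 then obtain y' where y': "y = j y'" "y' : nonzero L N" by (auto simp: nzM)
 then obtain x where "x : nonzero L K" "val L N S (e x) = val L N S y'" using assms unfolding immediate_def by blast
 then show "EX x:nonzero L K. val L M (j ` S) ((j \<circ> e) x) = val L M (j ` S) y" unfolding y'(1) comp_apply valM by auto
next
 fix y assume "y : j ` S"
 then obtain y' where y': "y = j y'" "y' : S" by blast
 then obtain x where "x : \<O>" "sb L N y' (e x) : mideal L N S" using assms unfolding immediate_def by blast
 then show "EX x:\<O>. sb L M y ((j \<circ> e) x) : mideal L M (j ` S)" unfolding y'(1) comp_apply midM by (auto simp: opM2(1) simp flip: sbN)
qed

lemma strictM: assumes "strict L K \<O> d N S dN e" shows "strict L K \<O> d M (j ` S) (%z. j (dN (inv j z))) (j \<circ> e)"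
proof -
 have 1: "(%z. j (dN (inv j z))) ` (j ` X) = j ` (dN ` X)" for X by (simp add: image_image)
 show ?thesis using assms unfolding strict_def midM comp_apply sclM 1 inj_image_subset_iff[OF j] .
qed

lemma ext_viaM: assumes "ext_via L K \<O> d N S dN e" shows "ext_via L K \<O> d M (j ` S) (%z. j (dN (inv j z))) (j \<circ> e)"
proof -
 have e: "emb L K N e" and r: "ALL x:univ K. x : \<O> <-> e x : S" "ALL x:univ K. dN (e x) = e (d x)" using assms unfolding ext_via_def by blast+
 have "emb L K M (j \<circ> e)" unfolding emb_def
 proof (intro conjI allI impI)
  show "inj_on (j \<circ> e) (univ K)" using e unfolding emb_def by (simp add: inj_on_def)
  show "(j \<circ> e) ` univ K <= univ M" by auto
  fix f xs assume "length xs = fun_ar L f & set xs <= univ K"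
  then show "(j \<circ> e) (fint K f xs) = fint M f (map (j \<circ> e) xs)" using e fM[of f "map e xs"] unfolding emb_def by simp
 next
  fix r xs assume "length xs = rel_ar L r & set xs <= univ K"
  then show "rint M r (map (j \<circ> e) xs) = rint K r xs" using e rM[of r "map e xs"] unfolding emb_def by simp
 qed
 then show ?thesis using r unfolding ext_via_def by simp
qed

end

section \<open>Transfer of sentences and of the ordered field axioms\<close>

lemma sentence_transfer:
 assumes "elementary L K M e" "sentence L ph" "struc_ok L K" "satall K ph" shows "satall M ph"
proof -
 obtain x where x: "x : univ K" using assms(3) unfolding struc_ok_def by blast
 have "sat K (%_. x) ph" using assms(4) x unfolding satall_def by simp
 then have "sat M (e \<circ> (%_. x)) ph"
  using assms(1)[unfolded elementary_def, rule_format, of ph "%_. x"] assms(2) x by (simp add: sentence_def)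
 moreover have "sat M bt ph = sat M (e \<circ> (%_. x)) ph" for bt by (rule sat_cong) (use assms(2) in \<open>simp add: sentence_def\<close>)
 ultimately show ?thesis unfolding satall_def by blast
qed

lemma model_transfer:
 assumes "elementary L K M e" "ALL ph:T. sentence L ph" "is_model L T K" "struc_ok L M" shows "is_model L T M"
 using assms sentence_transfer[OF assms(1)] unfolding is_model_def by blast

text \<open>Validity of a formula in at most three variables is expressed by a sentence, written
  with the existential quantifier, the only one in the syntax.\<close>

lemma satall_transfer:
 assumes el: "elementary L K M e" and ph: "wf_fm L ph" "fv ph <= {0, 1, 2}" and K: "struc_ok L K" "satall K ph" shows "satall M ph"
proof (rule ccontr)
 let ?\<psi> = "Neg (Ex 0 (Ex 1 (Ex 2 (Neg ph))))"
 have "satall K ?\<psi>" using K(2) unfolding satall_def by simp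
 moreover have "sentence L ?\<psi>" using ph unfolding sentence_def by auto
 ultimately have s: "satall M ?\<psi>" using sentence_transfer[OF el] K(1) by blast
 assume "~ satall M ph"
 then obtain bt where bt: "ALL i. bt i : univ M" "~ sat M bt ph" unfolding satall_def by blast
 have eq: "bt(0 := bt 0, 1 := bt 1, 2 := bt 2) = bt" by auto
 have "~ sat M (bt(0 := bt 0, 1 := bt 1, 2 := bt 2)) ph" unfolding eq by (rule bt(2))
 then have "sat M bt (Ex 0 (Ex 1 (Ex 2 (Neg ph))))" unfolding sat.simps using bt(1) by blast
 moreover have "sat M bt ?\<psi>" using s bt(1) unfolding satall_def by blast
 ultimately show False unfolding sat.simps(3) by blast
qed

text \<open>The ordered field axioms at three points, gathered into one predicate that the single
  formula \<open>axfm\<close> expresses. Models of \<open>T\<close> are known to be fields only on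
  the type of the hypotheses; the axioms reach extensions on other types along elementary
  maps.\<close>

definition ofax :: "'u set => 'u => 'u => ('u => 'u => 'u) => ('u => 'u) => ('u => 'u => 'u) => ('u => 'u => bool) => 'u => 'u => 'u => bool" where
 "ofax U z u a n m l x y w <-> z ~= u & a (a x y) w = a x (a y w) & m (m x y) w = m x (m y w) & m x (a y w) = a (m x y) (m x w) &
   a x y = a y x & m x y = m y x & a x z = x & m x u = x & a x (n x) = z & (x = z | (EX y:U. m x y = u)) &
   ~ l x x & (~ l x y | ~ l y w | l x w) & (l x y | x = y | l y x) & (~ l x y | l (a x w) (a y w)) & (~ l z x | ~ l z y | l z (m x y))"

type_synonym 'u ops = "'u set \<times> 'u * 'u \<times> ('u => 'u => 'u) \<times> ('u => 'u) \<times> ('u => 'u => 'u) \<times> ('u => 'u => bool)"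

fun ordfield :: "'u ops => bool" where
 "ordfield (U, z, u, a, n, m, l) <-> z : U & u : U & (ALL x:U. ALL y:U. a x y : U & m x y : U) & (ALL x:U. n x : U) &
   (ALL x:U. ALL y:U. ALL w:U. ofax U z u a n m l x y w)"

definition ops_of :: "('f,'r) lang => ('u,'f,'r) struc => 'u ops" where
 "ops_of L M = (univ M, zr L M, on L M, ad L M, ng L M, ml L M, ls L M)"

definition Or where "Or ph \<psi> = Neg (Conj (Neg ph) (Neg \<psi>))"

definition axfm :: "('f,'r) lang => ('f,'r) fm" where
 "axfm L = (let z = Fn (sym_zero L) []; u = Fn (sym_one L) []; a = (%s t. Fn (sym_add L) [s, t]); n = (%s. Fn (sym_neg L) [s]);
   m = (%s t. Fn (sym_mul L) [s, t]); l = (%s t. Rl (sym_less L) [s, t]); x = Var 0; y = Var 1; w = Var 2 in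
  Conj (Neg (Eq z u)) (Conj (Eq (a (a x y) w) (a x (a y w))) (Conj (Eq (m (m x y) w) (m x (m y w))) (Conj (Eq (m x (a y w)) (a (m x y) (m x w)))
  (Conj (Eq (a x y) (a y x)) (Conj (Eq (m x y) (m y x)) (Conj (Eq (a x z) x) (Conj (Eq (m x u) x) (Conj (Eq (a x (n x)) z)
  (Conj (Or (Eq x z) (Ex 1 (Eq (m x y) u))) (Conj (Neg (l x x)) (Conj (Or (Neg (l x y)) (Or (Neg (l y w)) (l x w)))
  (Conj (Or (l x y) (Or (Eq x y) (l y x))) (Conj (Or (Neg (l x y)) (l (a x w) (a y w))) (Or (Neg (l z x)) (Or (Neg (l z y)) (l z (m x y))))))))))))))))))"

lemma sat_axfm: "sat M bt (axfm L) <-> ofax (univ M) (zr L M) (on L M) (ad L M) (ng L M) (ml L M) (ls L M) (bt 0) (bt 1) (bt 2)"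
 unfolding axfm_def Let_def Or_def ofax_def zr_def on_def ad_def ng_def ml_def ls_def by (simp del: One_nat_def)

lemma axfm_wf: "lang_ok L ==> wf_fm L (axfm L)" "fv (axfm L) <= {0, 1, 2}"
 unfolding axfm_def Let_def Or_def lang_ok_def by auto

lemma satall_axfm: assumes "lang_ok L" "struc_ok L M" shows "satall M (axfm L) <-> ordfield (ops_of L M)"
proof -
 let ?P = "ofax (univ M) (zr L M) (on L M) (ad L M) (ng L M) (ml L M) (ls L M)"
 have cl: "zr L M : univ M" "on L M : univ M" "x : univ M ==> y : univ M ==> ad L M x y : univ M"
  "x : univ M ==> ng L M x : univ M" "x : univ M ==> y : univ M ==> ml L M x y : univ M" for x y
  using assms unfolding struc_ok_def lang_ok_def zr_def on_def ad_def ng_def ml_def by auto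
 have "satall M (axfm L) <-> (ALL bt. (ALL i::nat. bt i : univ M) --> ?P (bt 0) (bt 1) (bt 2))" unfolding satall_def sat_axfm by (rule refl)
 also have "\<dots> <-> (ALL x:univ M. ALL y:univ M. ALL w:univ M. ?P x y w)"
 proof (intro iffI ballI)
  fix x y w assume *: "ALL bt. (ALL i::nat. bt i : univ M) --> ?P (bt 0) (bt 1) (bt 2)" and xyz: "x : univ M" "y : univ M" "w : univ M"
  show "?P x y w" using *[rule_format, of "%i. if i = 0 then x else if i = 1 then y else w"] xyz by simp
 qed blast
 finally show ?thesis unfolding ops_of_def using cl by simp
qed

lemma ordfield_rcf: assumes "is_rcf L M" shows "ordfield (ops_of L M)"
proof -
 note t0 = assms[unfolded is_rcf_def Let_def]
 note c_z = conjunct1[OF t0] and t1 = conjunct2[OF t0]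
 note c_u = conjunct1[OF t1] and t2 = conjunct2[OF t1]
 note c_ne = conjunct1[OF t2] and t3 = conjunct2[OF t2]
 note c_cl = conjunct1[OF t3] and t4 = conjunct2[OF t3]
 note c_ng = conjunct1[OF t4] and t5 = conjunct2[OF t4]
 note c_as = conjunct1[OF t5] and t6 = conjunct2[OF t5]
 note c_cm = conjunct1[OF t6] and t7 = conjunct2[OF t6]
 note c_un = conjunct1[OF t7] and t8 = conjunct2[OF t7]
 note c_iv = conjunct1[OF t8] and t9 = conjunct2[OF t8]
 note c_ir = conjunct1[OF t9] and t10 = conjunct2[OF t9]
 note c_tr = conjunct1[OF t10] and t11 = conjunct2[OF t10]
 note c_to = conjunct1[OF t11] and t12 = conjunct2[OF t11]
 note c_am = conjunct1[OF t12] and t13 = conjunct2[OF t12]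
 note c_mp = conjunct1[OF t13] and t14 = conjunct2[OF t13]
 have "ofax (univ M) (zr L M) (on L M) (ad L M) (ng L M) (ml L M) (ls L M) x y w"
  if x: "x : univ M" and y: "y : univ M" and w: "w : univ M" for x y w
  unfolding ofax_def
  using c_ne c_as[THEN bspec, OF x, THEN bspec, OF y, THEN bspec, OF w] c_cm[THEN bspec, OF x, THEN bspec, OF y]
   c_un[THEN bspec, OF x] c_iv[THEN bspec, OF x] c_ir[THEN bspec, OF x] c_tr[THEN bspec, OF x, THEN bspec, OF y, THEN bspec, OF w]
   c_to[THEN bspec, OF x, THEN bspec, OF y] c_am[THEN bspec, OF x, THEN bspec, OF y, THEN bspec, OF w] c_mp[THEN bspec, OF x, THEN bspec, OF y]
  by blast
 then show ?thesis unfolding ops_of_def ordfield.simps using c_z c_u c_cl c_ng by blast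
qed

lemma ordfield_transfer:
 assumes "elementary L K M e" "lang_ok L" "struc_ok L K" "struc_ok L M" "ordfield (ops_of L K)" shows "ordfield (ops_of L M)"
proof -
 have "satall K (axfm L)" using satall_axfm[OF assms(2,3)] assms(5) by (rule iffD2)
 then have "satall M (axfm L)" by (rule satall_transfer[OF assms(1) axfm_wf(1)[OF assms(2)] axfm_wf(2) assms(3)])
 with satall_axfm[OF assms(2,4)] show ?thesis by (rule iffD1)
qed

context ps0
begin

lemma lsM: "ls L M (j x) (j y) <-> ls L N x y" using rM[of "sym_less L" "[x, y]"] by (simp add: ls_def)

lemma ominimal_pull: assumes om: "ominimal_struc L M" shows "ominimal_struc L N"
 unfolding ominimal_struc_def
proof (intro allI impI)
 fix S assume S: "def_set L N (univ N) 1 S"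
 then have "def_set L M (univ M) 1 (map j ` S)" using def_set_push[of "univ N" 1 S] by simp
 from om[unfolded ominimal_struc_def, rule_format, OF this]
 obtain P I where PI0: "finite P" "P <= univ M" "finite I" "ALL (a, b):I. set_option a <= univ M & set_option b <= univ M"
  and eq: "{x. [x] : map j ` S} = P Un (\<Union>(a, b)\<in>I. oint L M a b)" by (elim exE conjE)
 note PI = PI0(1,3,4)
 define g where "g = (%(a, b). (map_option (inv j) a, map_option (inv j) b))"
 have oi: "j x : oint L M a b <-> x : oint L N (map_option (inv j) a) (map_option (inv j) b)"
  if "set_option a <= range j" "set_option b <= range j" for x a b
  using that by (cases a; cases b) (auto simp: oint_def lsM)
 have S1: "[x] : S <-> [j x] : map j ` S" for x
 proof
  assume "[j x] : map j ` S"
  then obtain xs where xs: "[j x] = map j xs" "xs : S" by (rule imageE)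
  from xs(1) have "xs = [x]" by (cases xs) auto
  then show "[x] : S" using xs(2) by simp
 next
  assume "[x] : S"
  then have "map j [x] : map j ` S" by (rule imageI)
  then show "[j x] : map j ` S" by (simp only: list.map)
 qed
 have gI: "j x : oint L M (fst p) (snd p) <-> x : oint L N (fst (g p)) (snd (g p))" if p: "p : I" for p x
 proof (cases p)
  case (Pair a b)
  then have "set_option a <= range j & set_option b <= range j" using PI(3) p by auto
  then show ?thesis using oi[of a b x] Pair by (simp add: g_def)
 qed
 have jP: "j x : P <-> x : inv j ` (P Int range j)" for x
 proof
  assume "j x : P"
  then show "x : inv j ` (P Int range j)" by (intro image_eqI[of _ _ "j x"]) auto
 qed auto
 have "{x. [x] : S} = inv j ` (P Int range j) Un (\<Union>(a, b)\<in>g ` I. oint L N a b)"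
 proof (intro set_eqI)
  fix x
  have "[x] : S <-> j x : P | (EX p:I. j x : oint L M (fst p) (snd p))"
   unfolding S1 using eqset_imp_iff[OF eq, of "j x"] by (simp only: mem_Collect_eq Un_iff UN_iff case_prod_beta)
  also have "\<dots> <-> x : inv j ` (P Int range j) | (EX p:I. x : oint L N (fst (g p)) (snd (g p)))"
   unfolding jP using gI by blast
  finally show "x : {x. [x] : S} <-> x : inv j ` (P Int range j) Un (\<Union>(a, b)\<in>g ` I. oint L N a b)"
   by (simp only: mem_Collect_eq Un_iff UN_iff case_prod_beta bex_simps)
 qed
 then show "EX P I. finite P & P <= univ N & finite I & (ALL (a, b):I. set_option a <= univ N & set_option b <= univ N) &
    {x. [x] : S} = P Un (\<Union>(a, b)\<in>I. oint L N a b)"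
  using PI(1,2) by (intro exI[of _ "inv j ` (P Int range j)"] exI[of _ "g ` I"]) auto
qed

end

context ps
begin

lemma pb_pull:
 assumes M: "!!F. def_fun1 L M (univ M) F ==>
    (EX f. def_set L M (univ M) 2 {[x, f x] | x. pos L M x} & (ALL x. pos L M x --> pos L M (f x)) &
       (ALL x y. pos L M x & pos L M y --> f (ml L M x y) = ml L M (f x) (f y)) &
       (EX c:univ M. ALL x:univ M. ls L M c x --> ls L M (ab L M (F x)) (f x)))"
 shows "pb L N"
proof (unfold_locales)
 fix F assume F: "def_fun1 L N UNIV F"
 define F' where "F' z = j (F (inv j z))" for z
 have "def_set L M (j ` UNIV) 2 (map j ` {[x, F x] | x. x : univ N})" by (rule def_set_push) (use F in \<open>simp add: def_fun1_def\<close>)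
 moreover have "map j ` {[x, F x] | x. x : univ N} = {[x, F' x] | x. x : univ M}" by (force simp: F'_def)
 ultimately have d: "def_set L M (univ M) 2 {[x, F' x] | x. x : univ M}" by (simp only: uM)
 have "ALL x:univ M. F' x : univ M" by (simp add: F'_def)
 then have "def_fun1 L M (univ M) F'" unfolding def_fun1_def using d by (rule conjI)
 from M[OF this] obtain f where f: "def_set L M (univ M) 2 {[x, f x] | x. pos L M x}" "ALL x. pos L M x --> pos L M (f x)"
  "ALL x y. pos L M x & pos L M y --> f (ml L M x y) = ml L M (f x) (f y)"
  "EX c:univ M. ALL x:univ M. ls L M c x --> ls L M (ab L M (F' x)) (f x)" by (elim exE conjE)
 define h where "h x = inv j (f (j x))" for x
 have fh: "f (j x) = j (h x)" "0 < h x" if "0 < x" for x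
 proof -
  have "pos L M (f (j x))" using f(2) that by simp
  then obtain y where y: "f (j x) = j y" "0 < y" unfolding posM by blast
  then show "f (j x) = j (h x)" "0 < h x" by (simp_all add: h_def)
 qed
 have fex: "EX c. ALL x. c < x --> \<bar>F x\<bar> < h x"
 proof -
  obtain c where c: "ALL x:univ M. ls L M (j c) x --> ls L M (ab L M (F' x)) (f x)" using f(4) by auto
  have "\<bar>F x\<bar> < h x" if "max c 0 < x" for x
  proof -
   have "ls L M (ab L M (F' (j x))) (f (j x))" using bspec[OF c, of "j x"] that by simp
   then show ?thesis using fh(1)[of x] that by (simp add: F'_def)
  qed
  then show ?thesis by blast
 qed
 have "def_set L N UNIV 2 {xs. length xs = 2 & map j xs : {[x, f x] | x. pos L M x}}" by (rule def_set_pull) (use f(1) in simp)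
 moreover have "{xs. length xs = 2 & map j xs : {[x, f x] | x. pos L M x}} = {[x, h x] | x. pos L N x}"
  by (auto simp: posM fh length_Suc_conv numeral_2_eq_2)
 ultimately have 1: "def_set L N UNIV 2 {[x, h x] | x. pos L N x}" by simp
 have 3: "h (x * y) = h x * h y" if "0 < x" "0 < y" for x y
 proof -
  have "pos L M (j x)" "pos L M (j y)" using that by simp_all
  then have "f (ml L M (j x) (j y)) = ml L M (f (j x)) (f (j y))" using f(3) by blast
  then show ?thesis using fh(1)[OF that(1)] fh(1)[OF that(2)] fh(1)[of "x * y"] that by simp
 qed
 show "EX f. def_set L N UNIV 2 {[x, f x] | x. pos L N x} & (ALL x. pos L N x --> pos L N (f x)) &
       (ALL x y. pos L N x & pos L N y --> f (ml L N x y) = ml L N (f x) (f y)) &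
       (EX c:UNIV. ALL x:UNIV. ls L N c x --> ls L N (ab L N (F x)) (f x))"
  using 1 fh(2) 3 fex by (intro exI[of _ h]) simp
qed

end

section \<open>A size bound for immediate extensions\<close>

text \<open>An element is recorded through its residues, at every scale \<open>g\<close>, relative to a center of its ball of radius \<open>g\<close>.
  No o-minimality is used: it is only known for extensions that are already known to be small.\<close>

lemma immediate_injection_field:
 fixes e :: "'a => 'k::linordered_field" and U \<O> :: "'a set"
 assumes O: "!!x y. x : \<O> ==> y : \<O> ==> EX z:\<O>. e z = e x + e y" "!!x y. x : \<O> ==> y : \<O> ==> EX z:\<O>. e z = e x * e y"
  "!!x. x : \<O> ==> EX z:\<O>. e z = \<bar>e x\<bar>" "EX z:\<O>. e z = 1" and U0: "EX z:U. e z = 0"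
  and imm: "!!y. y ~= 0 ==> EX g:U. ALL c:\<O>. \<bar>e c * (y - e g)\<bar> < \<bar>e g\<bar>"
 shows "EX bf :: 'k => 'a => 'a. inj bf"
proof -
 define dm where "dm x y <-> (EX c:\<O>. \<bar>x\<bar> <= \<bar>e c\<bar> * \<bar>y\<bar>)" for x y
 have not_dm: "(ALL c:\<O>. \<bar>e c * x\<bar> < \<bar>y\<bar>) <-> ~ dm y x" for x y by (auto simp: dm_def abs_mult not_le)
 obtain one where one: "one : \<O>" "e one = 1" using O(4) by blast
 have refl: "dm x y" if "\<bar>x\<bar> <= \<bar>y\<bar>" for x y using that one unfolding dm_def by (intro bexI[of _ one]) auto
 have trans: "dm x z" if "dm x y" "dm y z" for x y z
 proof -
  obtain c c' where c: "c : \<O>" "\<bar>x\<bar> <= \<bar>e c\<bar> * \<bar>y\<bar>" "c' : \<O>" "\<bar>y\<bar> <= \<bar>e c'\<bar> * \<bar>z\<bar>" using \<open>dm x y\<close> \<open>dm y z\<close> unfolding dm_def by blast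
  obtain d where d: "d : \<O>" "e d = e c * e c'" using O(2)[OF c(1,3)] by blast
  have "\<bar>x\<bar> <= \<bar>e c\<bar> * (\<bar>e c'\<bar> * \<bar>z\<bar>)" using c(2) mult_left_mono[OF c(4), of "\<bar>e c\<bar>"] by simp
  then show ?thesis using d unfolding dm_def by (intro bexI[of _ d]) (simp_all add: abs_mult mult.assoc)
 qed
 have add: "dm (x + y) z" if "dm x z" "dm y z" for x y z
 proof -
  obtain c c' where c: "c : \<O>" "\<bar>x\<bar> <= \<bar>e c\<bar> * \<bar>z\<bar>" "c' : \<O>" "\<bar>y\<bar> <= \<bar>e c'\<bar> * \<bar>z\<bar>" using \<open>dm x z\<close> \<open>dm y z\<close> unfolding dm_def by blast
  obtain a a' where a: "a : \<O>" "e a = \<bar>e c\<bar>" "a' : \<O>" "e a' = \<bar>e c'\<bar>" using O(3)[OF c(1)] O(3)[OF c(3)] by blast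
  obtain d where d: "d : \<O>" "e d = e a + e a'" using O(1)[OF a(1,3)] by blast
  have "\<bar>x + y\<bar> <= \<bar>e c\<bar> * \<bar>z\<bar> + \<bar>e c'\<bar> * \<bar>z\<bar>" using c(2,4) abs_triangle_ineq[of x y] by simp
  also have "\<dots> = \<bar>e d\<bar> * \<bar>z\<bar>" using d(2) a(2,4) by (simp add: distrib_right)
  finally show ?thesis using d(1) unfolding dm_def by blast
 qed
 have neg: "dm (- x) z = dm x z" for x z by (simp add: dm_def)
 have asy: "dm y (e g) & dm (e g) y" if "~ dm (e g) (y - e g)" for y g
 proof -
  have t: "dm (e g) y"
  proof (rule ccontr)
   assume n: "~ dm (e g) y"
   have "dm y (e g)" using n refl by (metis linear)
   have "dm (e g) (y - e g)"
   proof (rule ccontr)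
    assume m: "~ dm (e g) (y - e g)"
    have "\<bar>e g\<bar> <= \<bar>e one\<bar> * \<bar>e g\<bar>" using one by simp
    obtain two where two: "two : \<O>" "e two = 1 + 1" using O(1)[OF one(1) one(1)] one(2) by auto
    have "\<bar>e two * (y - e g)\<bar> < \<bar>e g\<bar>" "\<bar>e two * y\<bar> < \<bar>e g\<bar>" using m n not_dm two(1) by blast+
    then show False using two(2) by (auto simp: abs_if algebra_simps split: if_splits)
   qed
   then show False using that by blast
  qed
  obtain two where two: "two : \<O>" "e two = 1 + 1" using O(1)[OF one(1) one(1)] one(2) by auto
  have "\<bar>e two * (y - e g)\<bar> < \<bar>e g\<bar>" using that not_dm two(1) by blast
  then have "\<bar>y\<bar> <= \<bar>e two\<bar> * \<bar>e g\<bar>" using two(2) by (auto simp: abs_if algebra_simps split: if_splits)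
  then show ?thesis using t two(1) unfolding dm_def by blast
 qed
 have imm': "EX g:U. ~ dm (e g) (y - e g)" if "y ~= 0" for y using imm[OF that] not_dm by blast
 \<comment> \<open>The centre is chosen from the ball as a set, so it depends on y only through its
   ball of radius \<open>e g\<close>, and two points of one ball share it.\<close>
 define cen where "cen y g = (SOME x. x : {x. dm (x - y) (e g)})" for y g
 define bf where "bf y g = (SOME q. q : U & ~ dm (e g) (y - cen y g - e q))" for y g
 have q: "~ dm (e g) (y - cen y g - e (bf y g))" if g: "e g ~= 0" for y g
 proof -
  have "y : {x. dm (x - y) (e g)}" using refl[of 0 "e g"] by simp
  then have "cen y g : {x. dm (x - y) (e g)}" unfolding cen_def by (rule someI)
  then have c: "dm (y - cen y g) (e g)" using neg[of "cen y g - y"] by simp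
  have "EX q. q : U & ~ dm (e g) (y - cen y g - e q)"
  proof (cases "y - cen y g = 0")
   case True
   then show ?thesis using U0 g by (auto simp: dm_def)
  next
   case False
   then obtain q where q: "q : U" "~ dm (e q) (y - cen y g - e q)" using imm' by blast
   have "dm (e q) (e g)" using asy[OF q(2)] c trans by blast
   then show ?thesis using q trans by blast
  qed
  then show ?thesis unfolding bf_def using someI_ex[of "%q. q : U & ~ dm (e g) (y - cen y g - e q)"] by blast
 qed
 have tot: "dm x y | dm y x" for x y using refl by (meson linear)
 have "inj bf"
 proof (rule injI, rule ccontr)
  fix y y' assume eq: "bf y = bf y'" and "y ~= y'"
  \<comment> \<open>The scale is the leading term of y - y'. Both points then lie in one ball of
    radius \<open>e g\<close>, but a common residue would make their difference smaller than
    \<open>e g\<close>.\<close>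
  then obtain g where g: "~ dm (e g) (y - y' - e g)" using imm'[of "y - y'"] by auto
  have g0: "e g ~= 0" using g refl[of "e g" "y - y' - e g"] by auto
  have d: "dm (y - y') (e g)" "dm (e g) (y - y')" using asy[OF g] by blast+
  have "dm (x - y) (e g) <-> dm (x - y') (e g)" for x
   using add[of "x - y" "e g" "y - y'"] add[of "x - y'" "e g" "y' - y"] d(1) neg[of "y - y'"] by auto
  then have c: "cen y g = cen y' g" unfolding cen_def by simp
  let ?a = "y - cen y g - e (bf y g)" and ?b = "y' - cen y g - e (bf y g)"
  have a: "~ dm (e g) ?a" by (rule q[OF g0])
  have "~ dm (e g) (y' - cen y' g - e (bf y' g))" by (rule q[OF g0])
  then have "~ dm (e g) ?b" unfolding c eq .
  note ab = a this
  have "dm (e g) (?a - ?b)" using d(2) by simp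
  show False
  proof (cases "dm ?a ?b")
   case True
   have "dm (?a - ?b) ?b" using add[OF True, of "- ?b"] neg[of ?b] refl[of ?b ?b] by simp
   then show False using trans[OF \<open>dm (e g) (?a - ?b)\<close>] ab by blast
  next
   case False
   then have "dm ?b ?a" using tot by blast
   have "dm (?a - ?b) ?a" using add[of ?a ?a "- ?b"] neg[of ?b] refl[of ?a ?a] \<open>dm ?b ?a\<close> by simp
   then show False using trans[OF \<open>dm (e g) (?a - ?b)\<close>] ab by blast
  qed
 qed
 then show ?thesis by blast
qed

text \<open>No valuation ring of \<open>M\<close> occurs: every nonzero element has a leading term
  from \<open>K\<close>, measured with the ring of \<open>K\<close>. In this form the property
  survives transport and unions of elementary chains.\<close>

definition imme :: "('f,'r) lang => ('a,'f,'r) struc => 'a set => ('b,'f,'r) struc => ('a => 'b) => bool" where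
 "imme L K \<O> M e <-> (ALL y:univ M. y ~= zr L M -->
   (EX g:univ K. ALL c:\<O>. ls L M (ab L M (ml L M (e c) (sb L M y (e g)))) (ab L M (e g))))"

lemma struc_cl: assumes "lang_ok L" "struc_ok L M"
 shows "zr L M : univ M" "on L M : univ M" "x : univ M ==> y : univ M ==> ad L M x y : univ M"
  "x : univ M ==> ng L M x : univ M" "x : univ M ==> y : univ M ==> ml L M x y : univ M"
  "x : univ M ==> y : univ M ==> sb L M x y : univ M" "x : univ M ==> ab L M x : univ M"
 using assms unfolding struc_ok_def lang_ok_def zr_def on_def ad_def ng_def ml_def sb_def ab_def by auto

lemma push_ops: assumes "inj_on j (univ N)"
 shows "zr L (push j N) = j (zr L N)" "on L (push j N) = j (on L N)"
  "x : univ N ==> y : univ N ==> ad L (push j N) (j x) (j y) = j (ad L N x y)"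
  "x : univ N ==> ng L (push j N) (j x) = j (ng L N x)"
  "x : univ N ==> y : univ N ==> ml L (push j N) (j x) (j y) = j (ml L N x y)"
  "x : univ N ==> y : univ N ==> ls L (push j N) (j x) (j y) <-> ls L N x y"
 using assms by (simp_all add: zr_def on_def ad_def ng_def ml_def ls_def push_simps)

lemma imme_push:
 assumes "lang_ok L" "struc_ok L N" and j: "inj_on j (univ N)" and e: "!!x. x : univ K ==> e x : univ N" "\<O> <= univ K" and i: "imme L K \<O> N e"
 shows "imme L K \<O> (push j N) (j \<circ> e)"
 unfolding imme_def
proof (intro ballI impI)
 note cl = struc_cl[OF assms(1,2)] and p = push_ops[OF j]
 fix y assume "y : univ (push j N)" "y ~= zr L (push j N)"
 then obtain y' where y': "y = j y'" "y' : univ N" "y' ~= zr L N" unfolding push_simps p by blast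
 then obtain g where g: "g : univ K" "ALL c:\<O>. ls L N (ab L N (ml L N (e c) (sb L N y' (e g)))) (ab L N (e g))" using i unfolding imme_def by blast
 have sb: "sb L (push j N) (j a) (j b) = j (sb L N a b)" if "a : univ N" "b : univ N" for a b using that by (simp add: sb_def p cl)
 have ab: "ab L (push j N) (j a) = j (ab L N a)" if "a : univ N" for a using that by (simp add: ab_def p cl)
 have "ls L (push j N) (ab L (push j N) (ml L (push j N) ((j \<circ> e) c) (sb L (push j N) y ((j \<circ> e) g)))) (ab L (push j N) ((j \<circ> e) g))" if c: "c : \<O>" for c
  using g(2) c e g(1) y'(2) by (simp add: y'(1) sb ab p cl subset_iff)
 then show "EX g:univ K. ALL c:\<O>. ls L (push j N) (ab L (push j N) (ml L (push j N) ((j \<circ> e) c) (sb L (push j N) y ((j \<circ> e) g)))) (ab L (push j N) ((j \<circ> e) g))"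
  using g(1) by blast
qed

definition Oring :: "('f,'r) lang => ('a,'f,'r) struc => 'a set => bool" where
 "Oring L K \<O> <-> (ALL x:\<O>. ALL y:\<O>. ad L K x y : \<O> & ml L K x y : \<O>) & (ALL x:\<O>. ab L K x : \<O>) & on L K : \<O>"

definition final :: "('f,'r) lang => ('f,'r) fm set => ('a,'f,'r) struc => 'a set => ('a => 'a) => bool" where
 "final L T K \<O> d <-> (EX (M :: (('a + 'f + 'r + nat) set, 'f, 'r) struc) OvM dM e.
      tdiff L T M OvM dM & ext_via L K \<O> d M OvM dM e &
      immediate L K \<O> M OvM e & strict L K \<O> d M OvM dM e & sph_complete L M OvM)"

definition setting :: "('f,'r) lang => ('f,'r) fm set => ('a,'f,'r) struc => 'a set => ('a => 'a) => bool" where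
 "setting L T K \<O> d <-> lang_ok L & (ALL ph:T. sentence L ph) & ominimal_th TYPE(('a + 'f + 'r + nat) set) L T &
   power_bounded TYPE(('a + 'f + 'r + nat) set) L T & tdiff L T K \<O> d"

text \<open>Everything to be proved by field arithmetic in one extension \<open>M\<close> with
  operations \<open>X\<close>. The size bound presupposes only that \<O> is a ring; the second
  clause presupposes an injection into the type of the hypotheses, yields that \<O> is a ring, and
  continues with a proper extension or the final one.\<close>

definition Goal :: "'b ops => 'a itself => 'f itself => 'r itself => bool" where
 "Goal X _ _ _ <-> (ALL (L::('f,'r) lang) T (K::('a,'f,'r) struc) \<O> d (M::('b,'f,'r) struc) e.
   setting L T K \<O> d --> struc_ok L M --> ops_of L M = X --> elementary L K M e --> imme L K \<O> M e -->
   (Oring L K \<O> --> (EX bf::'b => 'a => 'a. inj_on bf (univ M))) &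
   (ALL bp::'b => ('a + 'f + 'r + nat) set. inj_on bp (univ M) --> Oring L K \<O> &
    ((EX (M'::(('b => 'b) set,'f,'r) struc) h. struc_ok L M' & elementary L M M' h & ~ univ M' <= h ` univ M & imme L K \<O> M' (h \<circ> e))
     | final L T K \<O> d)))"

text \<open>A type definition cannot depend on the field under consideration. We therefore take as carrier of \<open>cur\<close> an ordered
  field on which \<open>Goal\<close> fails, if there is one; what is proved for \<open>cur\<close> then holds for all ordered fields on the base type.\<close>

definition cx :: "('c * 'a * 'f * 'r) itself => ('c + rat) ops" where
 "cx _ = (SOME X. ordfield X & ((EX Y::('c + rat) ops. ordfield Y & ~ Goal Y TYPE('a) TYPE('f) TYPE('r)) --> ~ Goal X TYPE('a) TYPE('f) TYPE('r)))"

text \<open>The summand \<open>rat\<close> ensures that the type carries some ordered field, without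
  which the type definition would have no carrier to choose.\<close>

lemma ordfield_rat: "EX X::('c + rat) ops. ordfield X"
proof -
 have ball: "(ALL x:range Inr. P x) <-> (ALL q. P (Inr q))" for P :: "'c + rat => bool" by blast
 have "EX y. x * y = (1::rat)" if "x ~= 0" for x using that by (intro exI[of _ "1 / x"]) simp
 then have "ordfield (range Inr :: ('c + rat) set, Inr 0, Inr 1, %x y. Inr (projr x + projr y), %x. Inr (- projr x), %x y. Inr (projr x * projr y), %x y. projr x < projr y :: bool)"
  unfolding ordfield.simps ofax_def ball by (auto simp: algebra_simps)
 then show ?thesis by blast
qed

lemma cx: "ordfield (cx (t :: ('c * 'a * 'f * 'r) itself))"
 "ordfield (Y :: ('c + rat) ops) ==> ~ Goal Y TYPE('a) TYPE('f) TYPE('r) ==> ~ Goal (cx (t :: ('c * 'a * 'f * 'r) itself)) TYPE('a) TYPE('f) TYPE('r)"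
proof -
 have "EX X::('c + rat) ops. ordfield X & ((EX Y::('c + rat) ops. ordfield Y & ~ Goal Y TYPE('a) TYPE('f) TYPE('r)) --> ~ Goal X TYPE('a) TYPE('f) TYPE('r))"
  using ordfield_rat by blast
 from someI_ex[OF this] show "ordfield (cx (t :: ('c * 'a * 'f * 'r) itself))"
  "ordfield (Y :: ('c + rat) ops) ==> ~ Goal Y TYPE('a) TYPE('f) TYPE('r) ==> ~ Goal (cx (t :: ('c * 'a * 'f * 'r) itself)) TYPE('a) TYPE('f) TYPE('r)"
  unfolding cx_def by blast+
qed

section \<open>A type of class \<open>linordered_field\<close> for the chosen carrier\<close>

definition "oU X = fst X" for X :: "'u ops"
definition "oz X = fst (snd X)" for X :: "'u ops"
definition "ou X = fst (snd (snd X))" for X :: "'u ops"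
definition "oa X = fst (snd (snd (snd X)))" for X :: "'u ops"
definition "on' X = fst (snd (snd (snd (snd X))))" for X :: "'u ops"
definition "om X = fst (snd (snd (snd (snd (snd X)))))" for X :: "'u ops"
definition "ol X = snd (snd (snd (snd (snd (snd X)))))" for X :: "'u ops"

lemmas o_defs = oU_def oz_def ou_def oa_def on'_def om_def ol_def

lemma ordfieldD: assumes "ordfield X"
 shows "oz X : oU X" "ou X : oU X" "x : oU X ==> y : oU X ==> oa X x y : oU X" "x : oU X ==> y : oU X ==> om X x y : oU X"
  "x : oU X ==> on' X x : oU X" "x : oU X ==> y : oU X ==> w : oU X ==> ofax (oU X) (oz X) (ou X) (oa X) (on' X) (om X) (ol X) x y w"
 using assms by (cases X; simp add: o_defs)+

typedef ('c,'a,'f,'r) cur = "oU (cx TYPE('c * 'a * 'f * 'r))" using ordfieldD(1)[OF cx(1)] by blast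

instantiation cur :: (type, type, type, type) field
begin
definition zero_cur :: "('a,'b,'c,'d) cur" where "0 = Abs_cur (oz (cx TYPE('a * 'b * 'c * 'd)))"
definition one_cur :: "('a,'b,'c,'d) cur" where "1 = Abs_cur (ou (cx TYPE('a * 'b * 'c * 'd)))"
definition plus_cur :: "('a,'b,'c,'d) cur => ('a,'b,'c,'d) cur => ('a,'b,'c,'d) cur" where "x + y = Abs_cur (oa (cx TYPE('a * 'b * 'c * 'd)) (Rep_cur x) (Rep_cur y))"
definition uminus_cur :: "('a,'b,'c,'d) cur => ('a,'b,'c,'d) cur" where "- x = Abs_cur (on' (cx TYPE('a * 'b * 'c * 'd)) (Rep_cur x))"
definition minus_cur :: "('a,'b,'c,'d) cur => ('a,'b,'c,'d) cur => ('a,'b,'c,'d) cur" where "(x::('a,'b,'c,'d) cur) - y = x + - y"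
definition times_cur :: "('a,'b,'c,'d) cur => ('a,'b,'c,'d) cur => ('a,'b,'c,'d) cur" where "x * y = Abs_cur (om (cx TYPE('a * 'b * 'c * 'd)) (Rep_cur x) (Rep_cur y))"
definition inverse_cur :: "('a,'b,'c,'d) cur => ('a,'b,'c,'d) cur" where "inverse (x::('a,'b,'c,'d) cur) = (if x = 0 then 0 else SOME y. x * y = 1)"
definition divide_cur :: "('a,'b,'c,'d) cur => ('a,'b,'c,'d) cur => ('a,'b,'c,'d) cur" where "(x::('a,'b,'c,'d) cur) div y = x * inverse y"

lemma rep_cur: "Rep_cur (0::('a,'b,'c,'d) cur) = oz (cx TYPE('a * 'b * 'c * 'd))" "Rep_cur (1::('a,'b,'c,'d) cur) = ou (cx TYPE('a * 'b * 'c * 'd))"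
 "Rep_cur (x + y) = oa (cx TYPE('a * 'b * 'c * 'd)) (Rep_cur x) (Rep_cur y)" "Rep_cur (- x) = on' (cx TYPE('a * 'b * 'c * 'd)) (Rep_cur x)"
 "Rep_cur (x * y) = om (cx TYPE('a * 'b * 'c * 'd)) (Rep_cur x) (Rep_cur y)" for x y :: "('a,'b,'c,'d) cur"
 unfolding zero_cur_def one_cur_def plus_cur_def uminus_cur_def times_cur_def
 by (simp_all add: Abs_cur_inverse ordfieldD[OF cx(1)] Rep_cur)

lemma cur_ax:
 fixes x y w :: "('a,'b,'c,'d) cur"
 shows "(0::('a,'b,'c,'d) cur) ~= 1" "x + y + w = x + (y + w)" "x * y * w = x * (y * w)" "x * (y + w) = x * y + x * w" "x + y = y + x" "x * y = y * x"
  "x + 0 = x" "x * 1 = x" "x + - x = 0" "x ~= 0 ==> EX y. x * y = 1" "~ ol (cx TYPE('a * 'b * 'c * 'd)) (Rep_cur x) (Rep_cur x)"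
  "ol (cx TYPE('a * 'b * 'c * 'd)) (Rep_cur x) (Rep_cur y) ==> ol (cx TYPE('a * 'b * 'c * 'd)) (Rep_cur y) (Rep_cur w) ==> ol (cx TYPE('a * 'b * 'c * 'd)) (Rep_cur x) (Rep_cur w)"
  "ol (cx TYPE('a * 'b * 'c * 'd)) (Rep_cur x) (Rep_cur y) | x = y | ol (cx TYPE('a * 'b * 'c * 'd)) (Rep_cur y) (Rep_cur x)"
  "ol (cx TYPE('a * 'b * 'c * 'd)) (Rep_cur x) (Rep_cur y) ==> ol (cx TYPE('a * 'b * 'c * 'd)) (Rep_cur (x + w)) (Rep_cur (y + w))"
  "ol (cx TYPE('a * 'b * 'c * 'd)) (Rep_cur 0) (Rep_cur x) ==> ol (cx TYPE('a * 'b * 'c * 'd)) (Rep_cur 0) (Rep_cur y) ==> ol (cx TYPE('a * 'b * 'c * 'd)) (Rep_cur 0) (Rep_cur (x * y))"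
proof -
 note A = ordfieldD(6)[OF cx(1) Rep_cur Rep_cur Rep_cur, of x y w, unfolded ofax_def]
 note R = Rep_cur_inject[symmetric] rep_cur
 from A show "(0::('a,'b,'c,'d) cur) ~= 1" "x + y + w = x + (y + w)" "x * y * w = x * (y * w)" "x * (y + w) = x * y + x * w" "x + y = y + x" "x * y = y * x"
  "x + 0 = x" "x * 1 = x" "x + - x = 0" unfolding R by blast+
 from A show "~ ol (cx TYPE('a * 'b * 'c * 'd)) (Rep_cur x) (Rep_cur x)"
  "ol (cx TYPE('a * 'b * 'c * 'd)) (Rep_cur x) (Rep_cur y) ==> ol (cx TYPE('a * 'b * 'c * 'd)) (Rep_cur y) (Rep_cur w) ==> ol (cx TYPE('a * 'b * 'c * 'd)) (Rep_cur x) (Rep_cur w)"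
  "ol (cx TYPE('a * 'b * 'c * 'd)) (Rep_cur x) (Rep_cur y) | x = y | ol (cx TYPE('a * 'b * 'c * 'd)) (Rep_cur y) (Rep_cur x)"
  "ol (cx TYPE('a * 'b * 'c * 'd)) (Rep_cur x) (Rep_cur y) ==> ol (cx TYPE('a * 'b * 'c * 'd)) (Rep_cur (x + w)) (Rep_cur (y + w))"
  "ol (cx TYPE('a * 'b * 'c * 'd)) (Rep_cur 0) (Rep_cur x) ==> ol (cx TYPE('a * 'b * 'c * 'd)) (Rep_cur 0) (Rep_cur y) ==> ol (cx TYPE('a * 'b * 'c * 'd)) (Rep_cur 0) (Rep_cur (x * y))"
  unfolding R by blast+
 assume "x ~= 0"
 then obtain v where v: "v : oU (cx TYPE('a * 'b * 'c * 'd))" "om (cx TYPE('a * 'b * 'c * 'd)) (Rep_cur x) v = ou (cx TYPE('a * 'b * 'c * 'd))"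
  using A unfolding R by blast
 have "x * Abs_cur v = 1" unfolding R Abs_cur_inverse[OF v(1)] by (rule v(2))
 then show "EX y. x * y = 1" by blast
qed

instance
proof
 fix a b c :: "('a,'b,'c,'d) cur"
 show "a + b + c = a + (b + c)" "a + b = b + a" "a * b * c = a * (b * c)" "a * b = b * a" "(0::('a,'b,'c,'d) cur) ~= 1" by (rule cur_ax)+
 show "0 + a = a" using cur_ax(5,7) by metis
 show "- a + a = 0" using cur_ax(5,9) by metis
 show "a - b = a + - b" by (rule minus_cur_def)
 show "1 * a = a" using cur_ax(6,8) by metis
 show "(a + b) * c = a * c + b * c" using cur_ax(4,6) by metis
 show "inverse (0::('a,'b,'c,'d) cur) = 0" by (simp add: inverse_cur_def)
 show "a div b = a * inverse b" by (rule divide_cur_def)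
 assume "a ~= 0"
 then have "a * inverse a = 1" using someI_ex[OF cur_ax(10)[OF \<open>a ~= 0\<close>]] by (simp add: inverse_cur_def)
 then show "inverse a * a = 1" using cur_ax(6) by metis
qed
end

instantiation cur :: (type, type, type, type) linordered_field
begin
definition less_cur :: "('a,'b,'c,'d) cur => ('a,'b,'c,'d) cur => bool" where "x < y <-> ol (cx TYPE('a * 'b * 'c * 'd)) (Rep_cur x) (Rep_cur y)"
definition less_eq_cur :: "('a,'b,'c,'d) cur => ('a,'b,'c,'d) cur => bool" where "(x::('a,'b,'c,'d) cur) <= y <-> x < y | x = y"
definition abs_cur :: "('a,'b,'c,'d) cur => ('a,'b,'c,'d) cur" where "\<bar>(x::('a,'b,'c,'d) cur)\<bar> = (if x < 0 then - x else x)"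
definition sgn_cur :: "('a,'b,'c,'d) cur => ('a,'b,'c,'d) cur" where "sgn (x::('a,'b,'c,'d) cur) = (if x = 0 then 0 else if 0 < x then 1 else - 1)"

instance
proof
 fix a b c :: "('a,'b,'c,'d) cur"
 have irr: "~ x < x" for x :: "('a,'b,'c,'d) cur" unfolding less_cur_def by (rule cur_ax)
 have tr: "x < y ==> y < z ==> x < z" for x y z :: "('a,'b,'c,'d) cur" unfolding less_cur_def by (rule cur_ax)
 have tot: "x < y | x = y | y < x" for x y :: "('a,'b,'c,'d) cur" unfolding less_cur_def by (rule cur_ax)
 have am: "x < y ==> x + z < y + z" for x y z :: "('a,'b,'c,'d) cur" unfolding less_cur_def by (rule cur_ax)
 have mp: "0 < x ==> 0 < y ==> 0 < x * y" for x y :: "('a,'b,'c,'d) cur" unfolding less_cur_def by (rule cur_ax)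
 show "(a < b) = (a <= b & ~ b <= a)" unfolding less_eq_cur_def by (metis irr tr)
 show "a <= a" by (simp add: less_eq_cur_def)
 show "a <= b ==> b <= c ==> a <= c" unfolding less_eq_cur_def using tr by blast
 show "a <= b ==> b <= a ==> a = b" unfolding less_eq_cur_def by (metis irr tr)
 show "a <= b | b <= a" unfolding less_eq_cur_def using tot by blast
 show "a <= b ==> c + a <= c + b" unfolding less_eq_cur_def using am[of a b c] by (auto simp: add.commute)
 show "a < b ==> 0 < c ==> c * a < c * b"
 proof -
  assume ab: "a < b" and c: "0 < c"
  have "0 < b - a" using am[OF ab, of "- a"] by simp
  then have "0 + c * a < c * (b - a) + c * a" by (intro am mp c)
  then show ?thesis by (simp add: algebra_simps)
 qed
 show "\<bar>a\<bar> = (if a < 0 then - a else a)" by (rule abs_cur_def)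
 show "sgn a = (if a = 0 then 0 else if 0 < a then 1 else - 1)" by (rule sgn_cur_def)
qed
end

lemma settingD: assumes "setting L T K \<O> d"
 shows "lang_ok L" "ALL ph:T. sentence L ph" "struc_ok L K" "is_model L T K" "tconvex L K \<O>" "tderiv L K d" "vcont L K \<O> d" "\<O> <= univ K"
 using assms unfolding setting_def tdiff_def is_model_def tconvex_def by blast+

text \<open>The carrier of M is copied onto the type \<open>cur\<close>, where class arithmetic
  applies. Given an injection into the type of the hypotheses, o-minimality and power boundedness
  are pulled back. If the hull of the ring is spherically complete, the derivation lifts and all is
  pushed forward; otherwise the germs yield a proper immediate extension.\<close>

lemma Goal_cur:
 fixes L :: "('f,'r) lang" and K :: "('a,'f,'r) struc" and M :: "('c + rat,'f,'r) struc"
 assumes S: "setting L T K \<O> d" and Mok: "struc_ok L M" and ops: "ops_of L M = cx TYPE('c * 'a * 'f * 'r)"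
  and el: "elementary L K M e" and im: "imme L K \<O> M e"
 shows "Oring L K \<O> ==> EX bf::'c + rat => 'a => 'a. inj_on bf (univ M)"
  and "inj_on (bp :: 'c + rat => ('a + 'f + 'r + nat) set) (univ M) ==> Oring L K \<O> &
    ((EX (M'::((('c + rat) => ('c + rat)) set,'f,'r) struc) h. struc_ok L M' & elementary L M M' h & ~ univ M' <= h ` univ M & imme L K \<O> M' (h \<circ> e))
     | final L T K \<O> d)"
proof -
 note sd = settingD[OF S]
 let ?A = "Abs_cur :: 'c + rat => ('c,'a,'f,'r) cur"
 note o1 = arg_cong[OF ops, of oU] arg_cong[OF ops, of oz] arg_cong[OF ops, of ou] arg_cong[OF ops, of oa] arg_cong[OF ops, of on'] arg_cong[OF ops, of om] arg_cong[OF ops, of ol]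
 have o: "oU (cx TYPE('c * 'a * 'f * 'r)) = univ M" "oz (cx TYPE('c * 'a * 'f * 'r)) = zr L M" "ou (cx TYPE('c * 'a * 'f * 'r)) = on L M"
  "oa (cx TYPE('c * 'a * 'f * 'r)) = ad L M" "on' (cx TYPE('c * 'a * 'f * 'r)) = ng L M" "om (cx TYPE('c * 'a * 'f * 'r)) = ml L M" "ol (cx TYPE('c * 'a * 'f * 'r)) = ls L M"
  using o1 unfolding ops_of_def o_defs by simp_all
 have rep: "Rep_cur x : univ M" for x :: "('c,'a,'f,'r) cur" using Rep_cur[of x] by (simp add: o)
 have RA: "Rep_cur (?A x) = x" if "x : univ M" for x by (rule Abs_cur_inverse) (simp add: o that)
 have injA: "inj_on ?A (univ M)" using RA by (metis inj_onI)
 have surjA: "?A ` univ M = UNIV"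
 proof -
  have "x : ?A ` univ M" for x using rep[of x] Rep_cur_inverse[of x] by (metis image_eqI)
  then show ?thesis by blast
 qed
 define N where "N = push ?A M"
 have uN: "univ N = UNIV" by (simp add: N_def push_simps surjA)
 have Nok: "struc_ok L N" unfolding N_def by (rule push_ok[OF Mok injA])
 have elN: "elementary L M N ?A" unfolding N_def by (rule push_elementary[OF Mok injA])
 define e0 where "e0 = ?A \<circ> e"
 have el0: "elementary L K N e0" unfolding e0_def by (rule elementary_trans[OF el elN sd(3)])
 have eM: "e x : univ M" if "x : univ K" for x by (rule elementary_maps[OF el sd(3) that])
 note p = push_ops[OF injA, where L = L, folded N_def]
 have AR: "?A (Rep_cur x) = x" for x by (rule Rep_cur_inverse)
 have c0: "zr L N = 0" "on L N = 1" unfolding p zero_cur_def one_cur_def o by (rule refl)+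
 have c1: "ad L N x y = x + y" "ng L N x = - x" "ml L N x y = x * y" "ls L N x y <-> x < y" for x y
  using p(3)[OF rep[of x] rep[of y]] p(4)[OF rep[of x]] p(5)[OF rep[of x] rep[of y]] p(6)[OF rep[of x] rep[of y]]
  unfolding AR plus_cur_def uminus_cur_def times_cur_def less_cur_def o by blast+
 have c2: "sb L N x y = x - y" "ab L N x = \<bar>x\<bar>" for x y by (simp_all add: sb_def c1) (simp add: ab_def c0 c1 abs_if)
 have im0: "imme L K \<O> N e0" unfolding N_def e0_def by (rule imme_push[OF sd(1) Mok injA eM sd(8) im])
 have immN: "EX g:univ K. ALL c:\<O>. \<bar>e0 c * (y - e0 g)\<bar> < \<bar>e0 g\<bar>" if "y ~= 0" for y
  using im0 that unfolding imme_def uN c0 c1 c2 by blast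
 have ar: "fun_ar L (sym_zero L) = 0" "fun_ar L (sym_one L) = 0" "fun_ar L (sym_add L) = 2" "fun_ar L (sym_neg L) = 1"
  "fun_ar L (sym_mul L) = 2" "rel_ar L (sym_less L) = 2" using sd(1) unfolding lang_ok_def by auto
 show "EX bf::'c + rat => 'a => 'a. inj_on bf (univ M)" if R: "Oring L K \<O>"
 proof -
  have h: "e0 (zr L K) = 0" "e0 (on L K) = 1" unfolding c0[symmetric]
   using elementary_fint[OF el0 sd(3), of "[]" "sym_zero L"] elementary_fint[OF el0 sd(3), of "[]" "sym_one L"] ar by (simp_all add: zr_def on_def)
  have h2: "e0 (ad L K x y) = e0 x + e0 y" "e0 (ml L K x y) = e0 x * e0 y" "e0 (ng L K x) = - e0 x" if "x : univ K" "y : univ K" for x y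
   unfolding c1[symmetric] using elementary_fint[OF el0 sd(3), of "[x, y]" "sym_add L"] elementary_fint[OF el0 sd(3), of "[x, y]" "sym_mul L"]
    elementary_fint[OF el0 sd(3), of "[x]" "sym_neg L"] ar that by (simp_all add: ad_def ml_def ng_def)
  have hl: "EX z:\<O>. e0 z = \<bar>e0 x\<bar>" if x: "x : \<O>" for x
  proof -
   have u: "x : univ K" using x sd(8) by blast
   have "sat K (%i. if i = 0 then x else zr L K) (Rl (sym_less L) [Var 0, Var 1]) <-> sat N (e0 \<circ> (%i. if i = 0 then x else zr L K)) (Rl (sym_less L) [Var 0, Var 1])"
    using el0[unfolded elementary_def, rule_format, of "Rl (sym_less L) [Var 0, Var 1]" "%i. if i = 0 then x else zr L K"] u struc_cl(1)[OF sd(1,3)] ar by simp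
   then have "ls L K x (zr L K) <-> e0 x < 0" unfolding c1(4)[symmetric] ls_def by (simp add: h)
   then have "e0 (ab L K x) = \<bar>e0 x\<bar>" using h2(3)[OF u u] by (simp add: ab_def abs_if)
   moreover have "ab L K x : \<O>" using R x unfolding Oring_def by blast
   ultimately show ?thesis by blast
  qed
  have "EX bf :: ('c,'a,'f,'r) cur => 'a => 'a. inj bf"
  proof (rule immediate_injection_field[where e = e0 and U = "univ K" and \<O> = \<O>])
   show "EX z:\<O>. e0 z = e0 x + e0 y" "EX z:\<O>. e0 z = e0 x * e0 y" if "x : \<O>" "y : \<O>" for x y
    using h2(1,2)[of x y] that R sd(8) unfolding Oring_def by blast+
   show "EX z:\<O>. e0 z = \<bar>e0 x\<bar>" if "x : \<O>" for x by (rule hl[OF that])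
   show "EX z:\<O>. e0 z = 1" using R h(2) unfolding Oring_def by blast
   show "EX z:univ K. e0 z = 0" using h(1) struc_cl(1)[OF sd(1,3)] by blast
  qed (rule immN)
  then obtain bf :: "('c,'a,'f,'r) cur => 'a => 'a" where "inj bf" by blast
  then have "inj_on (bf \<circ> ?A) (univ M)" using injA by (simp add: comp_inj_on inj_on_subset)
  then show ?thesis by blast
 qed
 assume bp: "inj_on bp (univ M)"
 define j where "j = bp \<circ> (Rep_cur :: ('c,'a,'f,'r) cur => _)"
 have j: "inj j"
 proof (rule injI)
  fix x y assume "j x = j y"
  then have "bp (Rep_cur x) = bp (Rep_cur y)" by (simp add: j_def)
  then have "Rep_cur x = Rep_cur y" by (rule inj_onD[OF bp _ rep rep])
  then show "x = y" by (simp only: Rep_cur_inject)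
 qed
 interpret P0: ps0 L N j by unfold_locales (use j Nok uN in auto)
 have jM: "struc_ok L P0.M" "elementary L N P0.M j" unfolding P0.M_def using push_ok[OF Nok] push_elementary[OF Nok] j by (simp_all add: uN)
 have elj: "elementary L K P0.M (j \<circ> e0)" by (rule elementary_trans[OF el0 jM(2) sd(3)])
 have mod: "is_model L T P0.M" by (rule model_transfer[OF elj sd(2,4) jM(1)])
 have omM: "ominimal_struc L P0.M" using S mod unfolding setting_def ominimal_th_def by blast
 have omN: "ominimal_struc L N" by (rule P0.ominimal_pull[OF omM])
 interpret O: omf L N by unfold_locales (use sd(1) uN c0 c1 omN in auto)
 interpret P: ps L N j by unfold_locales
 interpret X: kn L N K e0 \<O> by unfold_locales (use sd(3,5) el0 immN in auto)
 have pb: "pb L N"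
 proof (rule P.pb_pull)
  fix F assume "def_fun1 L P0.M (univ P0.M) F"
  then show "EX f. def_set L P0.M (univ P0.M) 2 {[x, f x] | x. pos L P0.M x} & (ALL x. pos L P0.M x --> pos L P0.M (f x)) &
       (ALL x y. pos L P0.M x & pos L P0.M y --> f (ml L P0.M x y) = ml L P0.M (f x) (f y)) &
       (EX c:univ P0.M. ALL x:univ P0.M. ls L P0.M c x --> ls L P0.M (ab L P0.M (F x)) (f x))"
   using S mod unfolding setting_def power_bounded_def by blast
 qed
 have ring: "Oring L K \<O>" unfolding Oring_def
 proof (intro conjI ballI)
  fix x y assume x: "x : \<O>" and y: "y : \<O>"
  have u: "x : univ K" "y : univ K" using x y sd(8) by blast+
  have v: "e0 x : X.Ov" "e0 y : X.Ov" using X.Ov_e u x y by blast+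
  show "ad L K x y : \<O>" using X.Ov_add[OF v] X.Ov_e[OF X.clK(3)[OF u]] X.eops(3)[OF u] by simp
  show "ml L K x y : \<O>" using X.Ov_mult[OF v] X.Ov_e[OF X.clK(5)[OF u]] X.eops(5)[OF u] by simp
 next
  fix x assume x: "x : \<O>"
  have u: "x : univ K" using x sd(8) by blast
  show "ab L K x : \<O>" using X.Ov_e[OF X.abK(1)[OF u]] X.abK(2)[OF u] X.Ov_abs X.Ov_e[OF u] x by simp
 next
  show "on L K : \<O>" using X.Ov_e[OF X.clK(2)] X.eops(2) X.Ov_1 by simp
 qed
 show "Oring L K \<O> & ((EX (M'::((('c + rat) => ('c + rat)) set,'f,'r) struc) h. struc_ok L M' & elementary L M M' h & ~ univ M' <= h ` univ M & imme L K \<O> M' (h \<circ> e)) | final L T K \<O> d)"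
 proof (cases "sph_complete L N X.Ov")
  case True
  obtain d' where d': "tderiv L N d'" "vcont L N X.Ov d'" "ext_via L K \<O> d N X.Ov d' e0" "strict L K \<O> d N X.Ov d' e0"
   using X.derivation_lift[OF True sd(6,7)] by blast
  have "final L T K \<O> d" unfolding final_def tdiff_def
  proof (intro exI conjI)
   show "is_model L T P0.M" by (rule mod)
   show "tconvex L P0.M (j ` X.Ov)" by (rule P.tconvexM[OF X.hull_tconvex])
   show "tderiv L P0.M (%z. j (d' (inv j z)))" by (rule P.tderivM[OF d'(1)])
   show "vcont L P0.M (j ` X.Ov) (%z. j (d' (inv j z)))" by (rule P.vcontM[OF d'(2)])
   show "ext_via L K \<O> d P0.M (j ` X.Ov) (%z. j (d' (inv j z))) (j \<circ> e0)" by (rule P.ext_viaM[OF d'(3)])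
   show "immediate L K \<O> P0.M (j ` X.Ov) (j \<circ> e0)" by (rule P.immediateM[OF X.immediate_e])
   show "strict L K \<O> d P0.M (j ` X.Ov) (%z. j (d' (inv j z))) (j \<circ> e0)" by (rule P.strictM[OF d'(4)])
   show "sph_complete L P0.M (j ` X.Ov)" by (rule P.sphM[OF True])
  qed
  then show ?thesis using ring by blast
 next
  case False
  from X.proper_extension[OF pb False] obtain M' :: "((('c,'a,'f,'r) cur => ('c,'a,'f,'r) cur) set, 'f, 'r) struc" and h where
   M': "struc_ok L M'" "range h <= univ M'" "elementary L N M' h" "~ univ M' <= range h"
   and I: "ALL y:univ M'. y ~= zr L M' --> (EX g:univ K. ALL c:\<O>. ls L M' (ab L M' (ml L M' (h (e0 c)) (sb L M' y (h (e0 g))))) (ab L M' (h (e0 g))))"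
   by (elim exE conjE)
  have im': "imme L K \<O> M' (h \<circ> e0)" using I unfolding imme_def comp_apply .
  \<comment> \<open>Germs are sets of functions on \<open>cur\<close>; they are rewritten as sets of
    functions on the underlying type, so that the conclusion does not mention
    \<open>cur\<close>.\<close>
  define q where "q = (%S. (%f. (Rep_cur :: ('c,'a,'f,'r) cur => _) \<circ> f \<circ> ?A) ` S)"
  have "inj (%f. (Rep_cur :: ('c,'a,'f,'r) cur => _) \<circ> f \<circ> ?A)"
  proof (rule injI, rule ext)
   fix f g :: "('c,'a,'f,'r) cur => ('c,'a,'f,'r) cur" and x :: "('c,'a,'f,'r) cur" assume "(Rep_cur :: ('c,'a,'f,'r) cur => _) \<circ> f \<circ> ?A = Rep_cur \<circ> g \<circ> ?A"
   from fun_cong[OF this, of "Rep_cur x"] show "f x = g x" by (simp add: Rep_cur_inverse Rep_cur_inject)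
  qed
  then have "inj q" unfolding q_def by (intro injI) (simp only: inj_image_eq_iff)
  then have q: "inj_on q (univ M')" by (rule inj_on_subset) simp
  let ?M = "push q M'" and ?h = "q \<circ> (h \<circ> ?A)"
  have 1: "struc_ok L ?M" by (rule push_ok[OF M'(1) q])
  have e1: "elementary L M M' (h \<circ> ?A)" by (rule elementary_trans[OF elN M'(3) Mok])
  have 2: "elementary L M ?M ?h" by (rule elementary_trans[OF e1 push_elementary[OF M'(1) q] Mok])
  have 3: "~ univ ?M <= ?h ` univ M"
  proof
   assume s: "univ ?M <= ?h ` univ M"
   have "univ M' <= range h"
   proof
    fix x assume "x : univ M'"
    then obtain y where "q x = q (h (?A y))" using s unfolding push_simps by auto
    then have "x = h (?A y)" using \<open>inj q\<close> by (rule injD[rotated])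
    then show "x : range h" by blast
   qed
   then show False using M'(4) by blast
  qed
  have "imme L K \<O> ?M (q \<circ> (h \<circ> e0))" by (rule imme_push[OF sd(1) M'(1) q _ sd(8) im']) (use M'(2) in auto)
  then have 4: "imme L K \<O> ?M (?h \<circ> e)" unfolding e0_def by (simp only: o_assoc)
  show ?thesis using ring 1 2 3 4 by blast
 qed
qed

theorem Goal_holds:
 assumes "ordfield (X :: ('c + rat) ops)" shows "Goal X TYPE('a) TYPE('f) TYPE('r)"
proof (rule ccontr)
 assume "~ Goal X TYPE('a) TYPE('f) TYPE('r)"
 then have "~ Goal (cx TYPE('c * 'a * 'f * 'r)) TYPE('a) TYPE('f) TYPE('r)" by (rule cx(2)[OF assms])
 moreover have "Goal (cx TYPE('c * 'a * 'f * 'r)) TYPE('a) TYPE('f) TYPE('r)" unfolding Goal_def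
  by (intro allI impI conjI; (rule Goal_cur(1) Goal_cur(2)[THEN conjunct1] Goal_cur(2)[THEN conjunct2]; assumption))
 ultimately show False by blast
qed

lemma elementary_cong: assumes "!!x. x : univ K ==> e x = e' x" "elementary L K M e" shows "elementary L K M e'"
 unfolding elementary_def
proof (intro allI impI)
 fix ph bt assume *: "wf_fm L ph & (ALL i::nat. bt i : univ K)"
 have "e \<circ> bt = e' \<circ> bt" using * assms(1) by auto
 then show "sat K bt ph <-> sat M (e' \<circ> bt) ph" using assms(2)[unfolded elementary_def, rule_format, OF *] by simp
qed

lemma imme_cong: assumes "!!x. x : univ K ==> e x = e' x" "\<O> <= univ K" "imme L K \<O> M e" shows "imme L K \<O> M e'"
 unfolding imme_def
proof (intro ballI impI)
 fix y assume "y : univ M" "y ~= zr L M"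
 then obtain g where g: "g : univ K" "ALL c:\<O>. ls L M (ab L M (ml L M (e c) (sb L M y (e g)))) (ab L M (e g))" using assms(3) unfolding imme_def by blast
 have "ALL c:\<O>. ls L M (ab L M (ml L M (e' c) (sb L M y (e' g)))) (ab L M (e' g))"
 proof
  fix c assume c: "c : \<O>"
  have "e c = e' c" "e g = e' g" using assms(1,2) c g(1) by blast+
  then show "ls L M (ab L M (ml L M (e' c) (sb L M y (e' g)))) (ab L M (e' g))" using bspec[OF g(2) c] by simp
 qed
 then show "EX g:univ K. ALL c:\<O>. ls L M (ab L M (ml L M (e' c) (sb L M y (e' g)))) (ab L M (e' g))" using g(1) by blast
qed

section \<open>Elementary chains, maximal extensions and the conclusion\<close>

definition elext :: "('f,'r) lang => ('u,'f,'r) struc => ('u,'f,'r) struc => bool" where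
 "elext L M M' <-> univ M <= univ M' & elementary L M M' (%x. x)"

lemma elext_refl: "elext L M M" unfolding elext_def elementary_def by (simp add: comp_def)

lemma elext_trans: "elext L M M' ==> elext L M' M'' ==> struc_ok L M ==> elext L M M''"
 unfolding elext_def using elementary_trans[of L M M' "%x. x" M'' "%x. x"] by (auto simp: comp_def)

lemma elext_fint: "elext L M M' ==> struc_ok L M ==> length xs = fun_ar L f ==> set xs <= univ M ==> fint M' f xs = fint M f xs"
 unfolding elext_def using elementary_fint[of L M M' "%x. x" xs f] by simp

lemma elext_rint: "elext L M M' ==> struc_ok L M ==> length xs = rel_ar L r ==> set xs <= univ M ==> rint M' r xs = rint M r xs"
proof -
 assume *: "elext L M M'" "struc_ok L M" "length xs = rel_ar L r" "set xs <= univ M"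
 obtain x0 where "x0 : univ M" using *(2) unfolding struc_ok_def by blast
 then show ?thesis using elementary_rint[of L M M' "%x. x" x0 xs r] * unfolding elext_def by simp
qed

lemma elext_sat: "elext L M M' ==> wf_fm L ph ==> (!!i. bt i : univ M) ==> sat M' bt ph = sat M bt ph"
 unfolding elext_def elementary_def by (simp add: comp_def)

lemma elext_ops: assumes "elext L M M'" "struc_ok L M" "lang_ok L"
 shows "zr L M' = zr L M" "x : univ M ==> y : univ M ==> ad L M' x y = ad L M x y" "x : univ M ==> ng L M' x = ng L M x"
  "x : univ M ==> y : univ M ==> ml L M' x y = ml L M x y" "x : univ M ==> y : univ M ==> ls L M' x y = ls L M x y"
 using elext_fint[OF assms(1,2)] elext_rint[OF assms(1,2)] assms(3) by (simp_all add: zr_def ad_def ng_def ml_def ls_def lang_ok_def)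

lemma imme_elext_at: assumes "elext L M M'" "struc_ok L M" "lang_ok L" "y : univ M" "c : univ M" "g : univ M"
 shows "ls L M' (ab L M' (ml L M' c (sb L M' y g))) (ab L M' g) <-> ls L M (ab L M (ml L M c (sb L M y g))) (ab L M g)"
proof -
 note o = elext_ops[OF assms(1-3)] and cl = struc_cl[OF assms(3,2)]
 have sb: "sb L M' a b = sb L M a b" if "a : univ M" "b : univ M" for a b using that by (simp add: sb_def o cl)
 have ab: "ab L M' a = ab L M a" if "a : univ M" for a using that by (simp add: ab_def o cl)
 show ?thesis using assms(4-6) by (simp add: sb ab o cl)
qed


locale elchain =
 fixes L :: "('f,'r) lang" and C :: "('u,'f,'r) struc set"
 assumes ne: "C ~= {}" and ok: "!!M. M : C ==> struc_ok L M" and lin: "!!M M'. M : C ==> M' : C ==> elext L M M' | elext L M' M"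
begin

text \<open>The union of the chain. Each operation is evaluated in some member containing the
  arguments; any such member gives the same value, by \<open>pick\<close>.\<close>

definition W :: "('u,'f,'r) struc" where
 "W = \<lparr>univ = (\<Union>M\<in>C. univ M), fint = (%f xs. fint (SOME M. M : C & set xs <= univ M) f xs),
   rint = (%r xs. rint (SOME M. M : C & set xs <= univ M) r xs)\<rparr>"

lemma uW: "univ W = (\<Union>M\<in>C. univ M)" by (simp add: W_def)

lemma cover: "finite F ==> F <= univ W ==> EX M:C. F <= univ M"
proof (induction F rule: finite_induct)
 case empty then show ?case using ne by blast
next
 case (insert x F)
 then obtain M M' where M: "M : C" "F <= univ M" "M' : C" "x : univ M'" unfolding uW by auto
 show ?case using lin[OF M(1,3)] M unfolding elext_def by blast
qed

lemma pick: assumes "M : C" "set xs <= univ M"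
 shows "length xs = fun_ar L f ==> fint W f xs = fint M f xs" "length xs = rel_ar L r ==> rint W r xs = rint M r xs"
proof -
 let ?M = "SOME M. M : C & set xs <= univ M"
 have "?M : C & set xs <= univ ?M" by (rule someI[of "%M. M : C & set xs <= univ M"]) (use assms in blast)
 then have m: "?M : C" "set xs <= univ ?M" by blast+
 show "length xs = fun_ar L f ==> fint W f xs = fint M f xs" "length xs = rel_ar L r ==> rint W r xs = rint M r xs"
  using lin[OF assms(1) m(1)] elext_fint[OF _ ok[OF assms(1)] _ assms(2)] elext_fint[OF _ ok[OF m(1)] _ m(2)]
   elext_rint[OF _ ok[OF assms(1)] _ assms(2)] elext_rint[OF _ ok[OF m(1)] _ m(2)] by (auto simp: W_def)
qed

lemma evalW: assumes "M : C" "!!i. bt i : univ M" shows "wf_trm L t ==> eval_trm W bt t = eval_trm M bt t"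
proof (induction t)
 case (Fn f ts)
 have e: "map (eval_trm W bt) ts = map (eval_trm M bt) ts"
  by (rule map_cong[OF refl], rule Fn.IH) (use Fn.prems in \<open>auto simp: list_all_iff\<close>)
 have "set (map (eval_trm M bt) ts) <= univ M" using Fn.prems eval_univ[OF ok[OF assms(1)] assms(2)] by (auto simp: list_all_iff)
 then show ?case unfolding eval_trm.simps e by (rule pick(1)[OF assms(1)]) (use Fn.prems in simp)
qed simp

text \<open>The elementary chain theorem. The induction covers all members of the chain, since a
  witness found in the union may lie only in a larger member, from which the existential statement
  returns by elementarity.\<close>

lemma satW: "wf_fm L ph ==> M : C ==> (!!i. bt i : univ M) ==> sat W bt ph = sat M bt ph"
proof (induction ph arbitrary: M bt)
 case (Eq s t)
 then show ?case using evalW[OF Eq.prems(2,3)] by simp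
next
 case (Rl r ts)
 have e: "map (eval_trm W bt) ts = map (eval_trm M bt) ts"
  by (rule map_cong[OF refl], rule evalW[OF Rl.prems(2,3)]) (use Rl.prems(1) in \<open>auto simp: list_all_iff\<close>)
 have "set (map (eval_trm M bt) ts) <= univ M" using Rl.prems(1) eval_univ[OF ok[OF Rl.prems(2)] Rl.prems(3)] by (auto simp: list_all_iff)
 then show ?case unfolding sat.simps e by (rule pick(2)[OF Rl.prems(2)]) (use Rl.prems in simp)
next
 case (Neg ph)
 have "sat W bt ph = sat M bt ph" by (rule Neg.IH) (use Neg.prems in simp_all)
 then show ?case by simp
next
 case (Conj ph \<psi>)
 have "sat W bt ph = sat M bt ph" "sat W bt \<psi> = sat M bt \<psi>" by (rule Conj.IH; use Conj.prems in simp)+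
 then show ?case by simp
next
 case (Ex x ph)
 have w: "wf_fm L ph" using Ex.prems(1) by simp
 show ?case
 proof
  assume "sat W bt (Ex x ph)"
  then obtain a where a: "a : univ W" "sat W (bt(x := a)) ph" by auto
  then obtain M' where M': "M' : C" "a : univ M'" unfolding uW by blast
  obtain M'' where M'': "M'' : C" "elext L M M''" "a : univ M''"
   using lin[OF Ex.prems(2) M'(1)] M' Ex.prems(2) elext_refl unfolding elext_def by blast
  have b: "(bt(x := a)) i : univ M''" for i using M''(2,3) Ex.prems(3) unfolding elext_def by auto
  have "sat W (bt(x := a)) ph = sat M'' (bt(x := a)) ph" by (rule Ex.IH[OF w M''(1)]) (rule b)
  then have "sat M'' (bt(x := a)) ph" using a(2) by blast
  then have "sat M'' bt (Ex x ph)" using M''(3) by auto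
  then show "sat M bt (Ex x ph)" using elext_sat[OF M''(2) Ex.prems(1) Ex.prems(3)] by simp
 next
  assume "sat M bt (Ex x ph)"
  then obtain a where a: "a : univ M" "sat M (bt(x := a)) ph" by auto
  have b: "(bt(x := a)) i : univ M" for i using a(1) Ex.prems(3) by auto
  have "sat W (bt(x := a)) ph = sat M (bt(x := a)) ph" by (rule Ex.IH[OF w Ex.prems(2)]) (rule b)
  then have "sat W (bt(x := a)) ph" using a(2) by blast
  moreover have "a : univ W" using a(1) Ex.prems(2) unfolding uW by blast
  ultimately show "sat W bt (Ex x ph)" by auto
 qed
qed

lemma elextW: "M : C ==> elext L M W"
 unfolding elext_def elementary_def using satW by (auto simp: uW comp_def)

lemma okW: "struc_ok L W"
 unfolding struc_ok_def
proof (intro conjI allI impI)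
 obtain M where M: "M : C" using ne by blast
 then show "univ W ~= {}" using ok[OF M] unfolding uW struc_ok_def by blast
 fix f xs assume *: "length xs = fun_ar L f & set xs <= univ W"
 then obtain M where M: "M : C" "set xs <= univ M" using cover[of "set xs"] by auto
 have "fint W f xs = fint M f xs" by (rule pick(1)[OF M]) (use * in blast)
 moreover have "fint M f xs : univ M" using ok[OF M(1)] M(2) * unfolding struc_ok_def by blast
 ultimately show "fint W f xs : univ W" using M(1) unfolding uW by auto
qed

end

lemma ordered_infinite: assumes "ordfield (ops_of L K)" shows "infinite (univ K)"
proof
 assume fin: "finite (univ K)"
 let ?U = "univ K" let ?l = "ls L K" let ?a = "ad L K" let ?z = "zr L K"
 have cl: "?z : ?U" "on L K : ?U" "!!x y. x : ?U ==> y : ?U ==> ?a x y : ?U" "!!x. x : ?U ==> ng L K x : ?U"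
  and ax: "!!x y w. x : ?U ==> y : ?U ==> w : ?U ==> ofax ?U ?z (on L K) ?a (ng L K) (ml L K) ?l x y w"
  using assms unfolding ops_of_def ordfield.simps by blast+
 have irr: "!!x. x : ?U ==> ~ ?l x x" and tr: "!!x y w. x : ?U ==> y : ?U ==> w : ?U ==> ?l x y ==> ?l y w ==> ?l x w"
  and am: "!!x y w. x : ?U ==> y : ?U ==> w : ?U ==> ?l x y ==> ?l (?a x w) (?a y w)" using ax unfolding ofax_def by blast+
 have zu: "?z ~= on L K" "?l ?z (on L K) | ?l (on L K) ?z" and az: "!!x. x : ?U ==> ?a x ?z = x" "!!x. x : ?U ==> ?a x (ng L K x) = ?z"
  and cm: "!!x y. x : ?U ==> y : ?U ==> ?a x y = ?a y x" using ax[OF cl(1) cl(2) cl(1)] ax cl(1) unfolding ofax_def by blast+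
 obtain w where w: "w : ?U" "?l ?z w"
 proof (cases "?l ?z (on L K)")
  case True then show ?thesis using that cl(2) by blast
 next
  case False
  then have "?l (on L K) ?z" using zu by blast
  from am[OF cl(2) cl(1) cl(4)[OF cl(2)] this] have "?l ?z (?a ?z (ng L K (on L K)))" using az(2)[OF cl(2)] by simp
  then show ?thesis using that[OF cl(3)[OF cl(1) cl(4)[OF cl(2)]]] by blast
 qed
 have up: "EX y:?U. ?l x y" if x: "x : ?U" for x
  using am[OF cl(1) w(1) x w(2)] cm[OF cl(1) x] az(1)[OF x] cl(3)[OF w(1) x] by auto
 let ?r = "{(y, x). x : ?U & y : ?U & ?l x y}"
 have "?r <= ?U \<times> ?U" by blast
 then have "finite ?r" using fin by (meson finite_SigmaI finite_subset)
 moreover have "trans ?r" using tr unfolding trans_def by blast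
 then have "acyclic ?r" using irr unfolding acyclic_def by (simp add: trancl_id)
 ultimately have wf: "wf ?r" by (rule finite_acyclic_wf)
 obtain m where "m : ?U" "!!y. (y, m) : ?r ==> y ~: ?U"
 proof (rule wfE_min[OF wf cl(1)])
  fix m assume "m : ?U" "!!y. (y, m) : ?r ==> y ~: ?U"
  then show thesis by (rule that)
 qed
 then show False using up by blast
qed

text \<open>Each element is its own leading term. The computation c * 0 = 0 is made from the axioms,
  because the carrier of \<open>K\<close> is a set and not a type of the field class.\<close>

lemma imme_id: assumes "ordfield (ops_of L K)" "\<O> <= univ K" shows "imme L K \<O> K (%x. x)"
 unfolding imme_def
proof (intro ballI impI)
 let ?U = "univ K" let ?l = "ls L K" let ?a = "ad L K" let ?z = "zr L K" let ?n = "ng L K" let ?m = "ml L K"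
 have cl: "?z : ?U" "!!x y. x : ?U ==> y : ?U ==> ?a x y : ?U" "!!x. x : ?U ==> ?n x : ?U" "!!x y. x : ?U ==> y : ?U ==> ?m x y : ?U"
  and ax: "!!x y w. x : ?U ==> y : ?U ==> w : ?U ==> ofax ?U ?z (on L K) ?a ?n ?m ?l x y w"
  using assms(1) unfolding ops_of_def ordfield.simps by blast+
 have irr: "!!x. x : ?U ==> ~ ?l x x" and tot: "!!x y. x : ?U ==> y : ?U ==> ?l x y | x = y | ?l y x"
  and am: "!!x y w. x : ?U ==> y : ?U ==> w : ?U ==> ?l x y ==> ?l (?a x w) (?a y w)"
  and az: "!!x. x : ?U ==> ?a x ?z = x" "!!x. x : ?U ==> ?a x (?n x) = ?z"
  and cm: "!!x y. x : ?U ==> y : ?U ==> ?a x y = ?a y x"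
  and as: "!!x y w. x : ?U ==> y : ?U ==> w : ?U ==> ?a (?a x y) w = ?a x (?a y w)"
  and di: "!!x y w. x : ?U ==> y : ?U ==> w : ?U ==> ?m x (?a y w) = ?a (?m x y) (?m x w)" using ax cl(1) unfolding ofax_def by blast+
 fix y assume y: "y : ?U" "y ~= ?z"
 have mz: "?m c ?z = ?z" if c: "c : ?U" for c
 proof -
  let ?q = "?m c ?z"
  have q: "?q : ?U" using cl c by blast
  have "?q = ?a ?q ?q" using di[OF c cl(1) cl(1)] az(1)[OF cl(1)] by simp
  then have "?a ?q (?n ?q) = ?a (?a ?q ?q) (?n ?q)" by simp
  then show ?thesis using as[OF q q cl(3)[OF q]] az q by simp
 qed
 have abz: "ab L K ?z = ?z" using irr[OF cl(1)] by (simp add: ab_def)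
 have aby: "?l ?z (ab L K y)"
 proof (cases "?l y ?z")
  case True
  from am[OF y(1) cl(1) cl(3)[OF y(1)] True] have "?l ?z (?n y)" using az(1)[OF cl(3)[OF y(1)]] az(2)[OF y(1)] cm[OF cl(1) cl(3)[OF y(1)]] by simp
  then show ?thesis using True by (simp add: ab_def)
 next
  case False then show ?thesis using tot[OF y(1) cl(1)] y(2) by (simp add: ab_def)
 qed
 have "ALL c:\<O>. ?l (ab L K (?m c (sb L K y y))) (ab L K y)"
 proof
  fix c assume "c : \<O>"
  then have "c : ?U" using assms(2) by blast
  then show "?l (ab L K (?m c (sb L K y y))) (ab L K y)" using az(2)[OF y(1)] mz abz aby by (simp add: sb_def)
 qed
 then show "EX g:?U. ALL c:\<O>. ?l (ab L K (?m c (sb L K y g))) (ab L K g)" using y(1) by blast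
qed

lemma GoalD:
 fixes L :: "('f,'r) lang" and K :: "('a,'f,'r) struc" and M :: "('c + rat,'f,'r) struc"
 assumes "setting L T K \<O> d" "struc_ok L M" "ordfield (ops_of L M)" "elementary L K M e" "imme L K \<O> M e"
 shows "Oring L K \<O> ==> EX bf::'c + rat => 'a => 'a. inj_on bf (univ M)"
  and "inj_on (bp :: 'c + rat => ('a + 'f + 'r + nat) set) (univ M) ==> Oring L K \<O>"
  and "inj_on (bp :: 'c + rat => ('a + 'f + 'r + nat) set) (univ M) ==> ~ final L T K \<O> d ==>
    EX (M'::((('c + rat) => ('c + rat)) set,'f,'r) struc) h. struc_ok L M' & elementary L M M' h & ~ univ M' <= h ` univ M & imme L K \<O> M' (h \<circ> e)"
 using Goal_holds[OF assms(3), where ?'a = 'a and ?'f = 'f and ?'r = 'r, unfolded Goal_def, rule_format, OF assms(1,2) refl assms(4,5)] by blast+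

definition extension :: "('f,'r) lang => ('a,'f,'r) struc => 'a set => ('a => 'u) => ('u,'f,'r) struc => bool" where
 "extension L K \<O> e M <-> struc_ok L M & elementary L K M e & imme L K \<O> M e"

text \<open>The union of a maximal chain of extensions on one type is again an extension. Anything
  elementary above the union could be added to the chain and so already belongs to it.\<close>

lemma maximal_extension:
 fixes L :: "('f,'r) lang" and K :: "('a,'f,'r) struc" and K1 :: "('u,'f,'r) struc"
 assumes K: "struc_ok L K" "lang_ok L" "\<O> <= univ K" and K1: "extension L K \<O> e K1"
 obtains M where "extension L K \<O> e M" "!!M'. extension L K \<O> e M' ==> elext L M M' ==> univ M' <= univ M"
proof -
 define Z where "Z = {M. extension L K \<O> e M}"
 define r where "r M M' <-> elext L M M'" for M M' :: "('u,'f,'r) struc"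
 interpret P: pred_on Z r .
 obtain C where C: "P.maxchain C" using P.Hausdorff by blast
 then have ch: "P.chain C" by (rule P.maxchain_imp_chain)
 have CZ: "C <= Z" using ch unfolding P.chain_def by blast
 have lin: "elext L M M' | elext L M' M" if "M : C" "M' : C" for M M'
 proof (cases "M = M'")
  case True then show ?thesis using elext_refl by blast
 next
  case False then show ?thesis using ch that unfolding P.chain_def r_def by auto
 qed
 have sup: "S = C" if "P.chain S" "C <= S" for S using C that unfolding P.maxchain_def by blast
 have ne: "C ~= {}"
 proof
  assume e: "C = {}"
  have "P.chain {K1}" unfolding P.chain_def using K1 by (simp add: Z_def)
  then show False using sup[of "{K1}"] e by blast
 qed
 interpret E: elchain L C
  by unfold_locales (use ne CZ lin in \<open>auto simp: Z_def extension_def\<close>)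
 obtain M0 where M0: "M0 : C" using ne by blast
 have eM: "e x : univ M" if "M : C" "x : univ K" for M x
  using elementary_maps[of L K M e x] K(1) that CZ by (auto simp: Z_def extension_def)
 have W: "extension L K \<O> e E.W" unfolding extension_def
 proof (intro conjI E.okW)
  have "elementary L K E.W ((%x. x) \<circ> e)"
   by (rule elementary_trans[of L K M0 e]) (use M0 CZ E.elextW[OF M0] K(1) in \<open>auto simp: Z_def extension_def elext_def\<close>)
  then show "elementary L K E.W e" by (simp add: comp_def)
  show "imme L K \<O> E.W e" unfolding imme_def
  proof (intro ballI impI)
   fix y assume y: "y : univ E.W" "y ~= zr L E.W"
   then obtain M where M: "M : C" "y : univ M" unfolding E.uW by blast
   have Mx: "struc_ok L M" "imme L K \<O> M e" using M(1) CZ by (auto simp: Z_def extension_def)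
   note el = E.elextW[OF M(1)]
   have "y ~= zr L M" using y(2) elext_ops(1)[OF el Mx(1) K(2)] by simp
   then obtain g where g: "g : univ K" "ALL c:\<O>. ls L M (ab L M (ml L M (e c) (sb L M y (e g)))) (ab L M (e g))"
    using Mx(2) M(2) unfolding imme_def by blast
   have "ls L E.W (ab L E.W (ml L E.W (e c) (sb L E.W y (e g)))) (ab L E.W (e g))" if c: "c : \<O>" for c
    using imme_elext_at[OF el Mx(1) K(2) M(2) eM[OF M(1)] eM[OF M(1) g(1)], of c] g(2) c K(3) by blast
   then show "EX g:univ K. ALL c:\<O>. ls L E.W (ab L E.W (ml L E.W (e c) (sb L E.W y (e g)))) (ab L E.W (e g))" using g(1) by blast
  qed
 qed
 have "univ M' <= univ E.W" if M': "extension L K \<O> e M'" "elext L E.W M'" for M'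
 proof -
  have up: "elext L M M'" if "M : C" for M using elext_trans[OF E.elextW[OF that] M'(2) E.ok[OF that]] .
  have "P.chain (insert M' C)" unfolding P.chain_def
   using CZ M'(1) lin up by (auto simp: Z_def r_def)
  from sup[OF this] have "M' : C" by blast
  then show ?thesis unfolding E.uW by blast
 qed
 then show thesis using that W by blast
qed

text \<open>An immediate extension injects into \<open>'a => 'a\<close>, while the ambient type
  contains all sets of such functions. A maximal extension there leaves room for its own germ
  extension, which contradicts maximality unless the required extension exists.\<close>

lemma final_exists:
 fixes L :: "('f,'r) lang" and K :: "('a,'f,'r) struc"
 assumes S: "setting L T K \<O> d" and rcf: "extends_rcf TYPE(('a + 'f + 'r + nat) set) L T"
 shows "final L T K \<O> d"
proof (rule ccontr)
 assume nf: "~ final L T K \<O> d"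
 note sd = settingD[OF S]
 define s :: "'a => ('a + 'f + 'r + nat) set" where "s x = {Inl x}" for x
 have s: "inj_on s (univ K)" by (simp add: s_def inj_on_def)
 have "is_model L T (push s K)" by (rule model_transfer[OF push_elementary[OF sd(3) s] sd(2,4) push_ok[OF sd(3) s]])
 then have oKU: "ordfield (ops_of L (push s K))" using rcf ordfield_rcf unfolding extends_rcf_def by blast
 have oK: "ordfield (ops_of L K)"
 proof -
  have "satall (push s K) (axfm L)" using satall_axfm[OF sd(1) push_ok[OF sd(3) s]] oKU by blast
  moreover have "sat K bt (axfm L)" if b: "satall (push s K) (axfm L)" "ALL i. bt i : univ K" for bt
  proof -
   have "sat (push s K) (s \<circ> bt) (axfm L)" using b unfolding satall_def push_simps by simp
   then show ?thesis using sat_push[OF sd(3) s axfm_wf(1)[OF sd(1)], of bt] b(2) by blast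
  qed
  ultimately have "satall K (axfm L)" unfolding satall_def by blast
  then show ?thesis using satall_axfm[OF sd(1,3)] by blast
 qed
 \<comment> \<open>An ordered field is infinite, so pairs from \<open>'a\<close> can be coded by
   single elements. This serves both to store the graph of a function as a set and to tag functions
   in the diagonal argument.\<close>
 have inf: "infinite (UNIV :: 'a set)" by (rule infinite_super[OF subset_UNIV ordered_infinite[OF oK]])
 from card_of_ordIso[THEN iffD2, OF card_of_Times_same_infinite[OF inf]]
 obtain bk :: "'a * 'a => 'a" where "bij_betw bk (UNIV \<times> UNIV) UNIV" by blast
 then have bk: "inj bk" by (simp add: bij_betw_def)
 obtain a b :: 'a where ab: "a ~= b" using ex_new_if_finite[OF inf, of "{undefined}"] by auto
 define bs where "bs c f = (%x. bk (c, f x))" for c and f :: "'a => 'a"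
 have bs: "bs c f = bs c' f' <-> c = c' & f = f'" for c c' f f'
 proof
  assume "bs c f = bs c' f'"
  then have "bk (c, f x) = bk (c', f' x)" for x unfolding bs_def by (rule fun_cong)
  then have "c = c' & f x = f' x" for x using injD[OF bk] by blast
  then show "c = c' & f = f'" by auto
 qed simp
 define t :: "('a => 'a) => ('a + 'f + 'r + nat) set" where "t f = range (%x. Inl (bk (x, f x)))" for f
 have t: "inj t"
 proof (rule injI, rule ext)
  fix f g x assume "t f = t g"
  then have "Inl (bk (x, f x)) : t g" unfolding t_def by blast
  then obtain y where "bk (x, f x) = bk (y, g y)" unfolding t_def by blast
  then show "f x = g x" using injD[OF bk] by blast
 qed
 \<comment> \<open>The ambient type must be larger than \<open>'a => 'a\<close>, hence sets of
   functions; \<open>rat\<close> is added because the results on \<open>Goal\<close> are stated for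
   such sums.\<close>
 define e :: "'a => ('a => 'a) set + rat" where "e x = Inl {%_. x}" for x
 have e: "inj_on e (univ K)" by (auto simp: e_def inj_on_def fun_eq_iff)
 have K1: "extension L K \<O> e (push e K)" unfolding extension_def
  using push_ok[OF sd(3) e] push_elementary[OF sd(3) e] imme_push[OF sd(1,3) e _ sd(8) imme_id[OF oK sd(8)]] by (simp add: comp_def)
 \<comment> \<open>The ring property is derived from the copy of \<open>K\<close>, which certainly
   injects into the type of the hypotheses. It is needed before any bound on the size of a larger
   extension.\<close>
 have R: "Oring L K \<O>"
 proof (rule GoalD(2)[OF S])
  show "struc_ok L (push e K)" "elementary L K (push e K) e" "imme L K \<O> (push e K) e" using K1 unfolding extension_def by blast+
  then show "ordfield (ops_of L (push e K))" by (intro ordfield_transfer[OF _ sd(1,3) _ oK])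
  show "inj_on (s \<circ> inv_into (univ K) e) (univ (push e K))" unfolding push_simps
   using e s by (auto intro!: inj_onI dest!: inj_onD[OF s] simp: inv_into_f_f)
 qed
 obtain M where M: "extension L K \<O> e M" and max: "!!M'. extension L K \<O> e M' ==> elext L M M' ==> univ M' <= univ M"
  using maximal_extension[OF sd(3,1,8) K1] by blast
 have Mx: "struc_ok L M" "elementary L K M e" "imme L K \<O> M e" using M unfolding extension_def by blast+
 have oM: "ordfield (ops_of L M)" by (rule ordfield_transfer[OF Mx(2) sd(1,3) Mx(1) oK])
 obtain bf :: "('a => 'a) set + rat => 'a => 'a" where bf: "inj_on bf (univ M)" using GoalD(1)[OF S Mx(1) oM Mx(2,3) R] by blast
 have "inj_on (t \<circ> bf) (univ M)" using bf t by (simp add: comp_inj_on inj_on_subset)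
 from GoalD(3)[OF S Mx(1) oM Mx(2,3) this nf]
 obtain M' :: "((('a => 'a) set + rat => ('a => 'a) set + rat) set, 'f, 'r) struc" and h where
  M': "struc_ok L M'" "elementary L M M' h" "~ univ M' <= h ` univ M" "imme L K \<O> M' (h \<circ> e)" by blast
 have elKM': "elementary L K M' (h \<circ> e)" by (rule elementary_trans[OF Mx(2) M'(2) sd(3)])
 have eM: "e x : univ M" if "x : univ K" for x by (rule elementary_maps[OF Mx(2) sd(3) that])
 have hM: "h x : univ M'" if "x : univ M" for x by (rule elementary_maps[OF M'(2) Mx(1) that])
 have hi: "inj_on h (univ M)" by (rule elementary_inj[OF M'(2)])
 \<comment> \<open>The germ extension lives on yet another type; embedded into a sum with
   \<open>rat\<close>, it is subject to the same size bound and injects into \<open>'a => 'a\<close>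
   as well.\<close>
 let ?I = "Inl :: _ => (('a => 'a) set + rat => ('a => 'a) set + rat) set + rat"
 have I: "inj_on ?I (univ M')" by (simp add: inj_on_def)
 have MI: "struc_ok L (push ?I M')" "elementary L K (push ?I M') (?I \<circ> (h \<circ> e))"
  by (rule push_ok[OF M'(1) I], rule elementary_trans[OF elKM' push_elementary[OF M'(1) I] sd(3)])
 have "imme L K \<O> (push ?I M') (?I \<circ> (h \<circ> e))" by (rule imme_push[OF sd(1) M'(1) I _ sd(8) M'(4)]) (use eM hM in auto)
 from GoalD(1)[OF S MI(1) ordfield_transfer[OF MI(2) sd(1,3) MI(1) oK] MI(2) this R]
 obtain bf' :: "(('a => 'a) set + rat => ('a => 'a) set + rat) set + rat => 'a => 'a" where bf': "inj_on bf' (univ (push ?I M'))" by blast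
  txt \<open>A diagonal argument finds room for \<open>M'\<close> outside \<open>M\<close> in the ambient type.\<close>
  define k where "k f = {bs a g | g. bs a g ~: projl (inv_into (univ M) bf g)} Un {bs b f}" for f
 have kout: "Inl (k f) ~: univ M" for f
 proof
  assume m: "Inl (k f) : univ M"
  define g where "g = bf (Inl (k f))"
  have "inv_into (univ M) bf g = Inl (k f)" unfolding g_def by (rule inv_into_f_f[OF bf m])
  then have p: "projl (inv_into (univ M) bf g) = k f" by simp
  have "bs a g : k f <-> bs a g ~: projl (inv_into (univ M) bf g)" unfolding k_def using bs ab by auto
  then show False unfolding p by blast
 qed
 have kinj: "f = f'" if "k f = k f'" for f f'
 proof -
  have "bs b f : k f'" using that unfolding k_def by blast
  then show ?thesis unfolding k_def using bs ab by auto
 qed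
 \<comment> \<open>Points from \<open>M\<close> return to their old places, and all new points go to
   the fresh places given by \<open>k\<close>, so the copy literally contains
   \<open>M\<close>.\<close>
 define m where "m y = (if y : h ` univ M then inv_into (univ M) h y else Inl (k (bf' (?I y))))" for y
 have mh: "m (h x) = x" if "x : univ M" for x using that hi by (simp add: m_def)
 have mi: "inj_on m (univ M')"
 proof (rule inj_onI)
  fix y y' assume y: "y : univ M'" "y' : univ M'" and eq: "m y = m y'"
  have inM: "m z : univ M <-> z : h ` univ M" for z using kout mh by (auto simp: m_def)
  show "y = y'"
  proof (cases "y : h ` univ M")
   case True
   then have "y' : h ` univ M" using inM eq by metis
   then show ?thesis using True eq mh by auto
  next
   case False
   then have "y' ~: h ` univ M" using inM eq by metis
   then have "k (bf' (?I y)) = k (bf' (?I y'))" using False eq by (simp add: m_def)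
   then have "bf' (?I y) = bf' (?I y')" by (rule kinj)
   then have "?I y = ?I y'" by (rule inj_onD[OF bf']) (use y in \<open>auto simp: push_simps\<close>)
   then show ?thesis by simp
  qed
 qed
 let ?M2 = "push m M'"
 have me: "(m \<circ> (h \<circ> e)) x = e x" if "x : univ K" for x using mh eM[OF that] by simp
 have "elementary L K ?M2 e"
  by (rule elementary_cong[where e = "m \<circ> (h \<circ> e)", OF me elementary_trans[OF elKM' push_elementary[OF M'(1) mi] sd(3)]])
 moreover have "imme L K \<O> ?M2 (m \<circ> (h \<circ> e))" by (rule imme_push[OF sd(1) M'(1) mi _ sd(8) M'(4)]) (use eM hM in auto)
 from imme_cong[where e = "m \<circ> (h \<circ> e)" and e' = e, OF me sd(8) this] have "imme L K \<O> ?M2 e" .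
 ultimately have X2: "extension L K \<O> e ?M2" unfolding extension_def using push_ok[OF M'(1) mi] by blast
 have "elementary L M ?M2 (%x. x)"
  by (rule elementary_cong[OF _ elementary_trans[OF M'(2) push_elementary[OF M'(1) mi] Mx(1)]]) (simp add: mh)
 moreover have "univ M <= univ ?M2"
 proof
  fix x assume x: "x : univ M"
  have "m (h x) : m ` univ M'" using hM[OF x] by blast
  then show "x : univ ?M2" unfolding push_simps mh[OF x] .
 qed
 ultimately have "elext L M ?M2" unfolding elext_def by blast
 from max[OF X2 this] have sub: "univ ?M2 <= univ M" .
 obtain y where y: "y : univ M'" "y ~: h ` univ M" using M'(3) by blast
 then have "m y : univ M" using sub unfolding push_simps by blast
 then show False using y(2) kout by (simp add: m_def)
qed

theorem theorem6p3:
  fixes L :: "('f,'r) lang" and T :: "('f,'r) fm set"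
    and K :: "('a,'f,'r) struc" and Ov :: "'a set" and d :: "'a \<Rightarrow> 'a"
  assumes "lang_ok L"
    and "\<forall>\<phi>\<in>T. sentence L \<phi>"
    and "complete_th TYPE(('a + 'f + 'r + nat) set) L T"
    and "model_complete TYPE(('a + 'f + 'r + nat) set) L T"
    and "ominimal_th TYPE(('a + 'f + 'r + nat) set) L T"
    and "extends_rcf TYPE(('a + 'f + 'r + nat) set) L T"
    and "power_bounded TYPE(('a + 'f + 'r + nat) set) L T"
    and "tdiff L T K Ov d"
    and "\<exists>x\<in>univ K. d x \<noteq> zr L K"
    and "Ov \<noteq> univ K"
    and "S_der L K Ov d = {val L K Ov (on L K)}"
  shows "\<exists>(M :: (('a + 'f + 'r + nat) set, 'f, 'r) struc) OvM dM e.
           tdiff L T M OvM dM \<and> ext_via L K Ov d M OvM dM e \<and>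
           immediate L K Ov M OvM e \<and> strict L K Ov d M OvM dM e \<and> sph_complete L M OvM"
proof -
  have "setting L T K Ov d" unfolding setting_def using assms(1,2,5,7,8) by blast
  from final_exists[OF this assms(6)] show ?thesis unfolding final_def .
qed

end
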